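(* Let $\alpha>-1$, $r\in\mathbb{N}$, and $0<\theta<1$ be fixed. For $n\in\mathbb{N}$ let $m_n$ be the largest integer such that $j(m_n)\le n$. Then there are constants $C_1,C_2>0$ independent of $n$ such that for all $n\in\mathbb{N}$ \[ C_1 n^{-3r/4}\;\le\;\mathrm{Int}_n\big(\mathbf{W}^r_{1,w_r}(\mathbb{R}_+)\big)\;\le\;\sup_{f\in \mathbf{W}^r_{1,w_r}(\mathbb{R}_+)}\Big|\int_{\mathbb{R}_+} f(x)w(x)\,dx-Q^{\mathrm{TL}}_{j(m_n)}f\Big|\;\le\; C_2\, n^{-r/2}. \]
   Context: Here $\mathbb{R}_+=(0,\infty)$ (or $[0,\infty)$). For $r\in\mathbb{N}_0$ let $w_r(x)=x^{\alpha+r/2}e^{-x}$ on $\mathbb{R}_+$, and $w:=w_0$, i.e. $w(x)=x^{\alpha}e^{-x}$. The space $L_{1,w_r}(\mathbb{R}_+)$ consists of measurable $f$ with $\|f\|_{L_{1,w_r}}=\int_{\mathbb{R}_+}|f(x)w_r(x)|\,dx<\infty$. The weighted Sobolev space $W^r_{1,w_r}(\mathbb{R}_+)$ consists of $f\in L_{1,w_r}(\mathbb{R}_+)$ whose weak derivatives $f^{(k)}$, $0\le k\le r$, lie in $L_{1,w_r}(\mathbb{R}_+)$, with norm $\|f\|_{W^r_{1,w_r}}=\sum_{k=0}^r\|f^{(k)}\|_{L_{1,w_r}}$; its elements are identified with their continuous representatives. $\mathbf{W}^r_{1,w_r}(\mathbb{R}_+)$ denotes its closed unit ball. For a set $\mathbf{F}$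 of continuous functions, $\mathrm{Int}_n(\mathbf{F})=\inf_{Q}\sup_{f\in\mathbf{F}}\big|\int_{\mathbb{R}_+}f(x)w(x)\,dx-Qf\big|$, where the infimum is over all quadratures $Qf=\sum_{i=1}^k\lambda_i f(x_i)$ with $k\le n$, arbitrary nodes $x_i\in\mathbb{R}_+$ (possibly repeated) and arbitrary real weights $\lambda_i$. Let $(p_m(w))_{m\in\mathbb{N}}$ be the orthonormal polynomials for the weight $w$ on $\mathbb{R}_+$, let $x_{m,1}<\dots<x_{m,m}$ be the zeros of $p_m(w)$, and let $\lambda_{m,k}(w)=\int_{\mathbb{R}_+}\ell_k(x)w(x)\,dx$ with $\ell_k(x)=\prod_{i\ne k}\frac{x-x_{m,i}}{x_{m,k}-x_{m,i}}$ be the Cotes numbers. For the fixed $\theta\in(0,1)$, $j(m)$ denotes the largest integer with $x_{m,j(m)}\le 4\theta m$, and the truncated Gauss–Laguerre quadrature is $Q^{\mathrm{TL}}_{j(m)}f=\sum_{k=1}^{j(m)}\lambda_{m,k}(w)f(x_{m,k})$. *)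

theory Defs
  imports "HOL-Analysis.Analysis" "HOL-Computational_Algebra.Polynomial"
begin

definition lag_w :: "real \<Rightarrow> nat \<Rightarrow> real \<Rightarrow> real" where
  "lag_w \<alpha> r x = x powr (\<alpha> + real r / 2) * exp (- x)"

definition smooth_real :: "(real \<Rightarrow> real) \<Rightarrow> bool" where
  "smooth_real \<phi> \<longleftrightarrow>
     (\<forall>k x. ((deriv ^^ k) \<phi> has_real_derivative (deriv ^^ Suc k) \<phi> x) (at x))"

definition test_fn_pos :: "(real \<Rightarrow> real) \<Rightarrow> bool" where
  "test_fn_pos \<phi> \<longleftrightarrow> smooth_real \<phi> \<and>
     (\<exists>a b. 0 < a \<and> a \<le> b \<and> (\<forall>x. x \<notin> {a..b} \<longrightarrow> \<phi> x = 0))"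

definition loc_int_pos :: "(real \<Rightarrow> real) \<Rightarrow> bool" where
  "loc_int_pos f \<longleftrightarrow> (\<forall>a b. 0 < a \<longrightarrow> set_integrable lborel {a..b} f)"

definition weak_deriv_pos :: "nat \<Rightarrow> (real \<Rightarrow> real) \<Rightarrow> (real \<Rightarrow> real) \<Rightarrow> bool" where
  "weak_deriv_pos k f g \<longleftrightarrow> loc_int_pos f \<and> loc_int_pos g \<and>
     (\<forall>\<phi>. test_fn_pos \<phi> \<longrightarrow>
        (LINT x:{0<..}|lborel. f x * (deriv ^^ k) \<phi> x)
          = (-1) ^ k * (LINT x:{0<..}|lborel. g x * \<phi> x))"

text \<open>Closed unit ball of W^r_{1,w_r}(R_+) (continuous representatives on (0,inf)).
  g k is the k-th weak derivative of f.\<close>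
definition sob_ball :: "real \<Rightarrow> nat \<Rightarrow> (real \<Rightarrow> real) set" where
  "sob_ball \<alpha> r = {f. continuous_on {0<..} f \<and>
     (\<exists>g :: nat \<Rightarrow> real \<Rightarrow> real.
        (\<forall>k\<le>r. weak_deriv_pos k f (g k) \<and>
               set_integrable lborel {0<..} (\<lambda>x. g k x * lag_w \<alpha> r x)) \<and>
        (\<Sum>k\<le>r. LINT x:{0<..}|lborel. \<bar>g k x * lag_w \<alpha> r x\<bar>) \<le> 1)}"

definition wint :: "real \<Rightarrow> (real \<Rightarrow> real) \<Rightarrow> real" where
  "wint \<alpha> f = (LINT x:{0<..}|lborel. f x * lag_w \<alpha> 0 x)"

definition Int_n :: "real \<Rightarrow> nat \<Rightarrow> (real \<Rightarrow> real) set \<Rightarrow> ereal" where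
  "Int_n \<alpha> n F =
    (INF k \<in> {..n}. INF xs \<in> {xs :: nat \<Rightarrow> real. \<forall>i<k. 0 < xs i}.
       INF ls \<in> (UNIV :: (nat \<Rightarrow> real) set).
         SUP f \<in> F. ereal \<bar>wint \<alpha> f - (\<Sum>i<k. ls i * f (xs i))\<bar>)"

definition zero_pm :: "(nat \<Rightarrow> real poly) \<Rightarrow> nat \<Rightarrow> nat \<Rightarrow> real" where
  "zero_pm p m k = sorted_list_of_set {x. poly (p m) x = 0} ! (k - 1)"

definition cotes :: "real \<Rightarrow> (nat \<Rightarrow> real poly) \<Rightarrow> nat \<Rightarrow> nat \<Rightarrow> real" where
  "cotes \<alpha> p m k = (LINT x:{0<..}|lborel.
     (\<Prod>i\<in>{1..m} - {k}. (x - zero_pm p m i) / (zero_pm p m k - zero_pm p m i))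
       * lag_w \<alpha> 0 x)"

definition jm :: "real \<Rightarrow> (nat \<Rightarrow> real poly) \<Rightarrow> nat \<Rightarrow> nat" where
  "jm \<theta> p m = Max ({0} \<union> {j \<in> {1..m}. zero_pm p m j \<le> 4 * \<theta> * real m})"

definition mn :: "real \<Rightarrow> (nat \<Rightarrow> real poly) \<Rightarrow> nat \<Rightarrow> nat" where
  "mn \<theta> p n = (GREATEST m. jm \<theta> p m \<le> n)"

definition QTL :: "real \<Rightarrow> real \<Rightarrow> (nat \<Rightarrow> real poly) \<Rightarrow> nat \<Rightarrow> (real \<Rightarrow> real) \<Rightarrow> real" where
  "QTL \<alpha> \<theta> p m f = (\<Sum>k = 1..jm \<theta> p m. cotes \<alpha> p m k * f (zero_pm p m k))"

end

theory Submission
  imports Defs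
begin

text \<open>Lower bound: one of the \<open>n + 1\<close> disjoint unit intervals starting at \<open>n, \<dots>, 2n\<close> contains no node,
  and a smooth bump on it, normalised in the Sobolev norm, has integral of order \<open>n\<close> to the power \<open>-r/2\<close>.
  This is even larger than the required \<open>n\<close> to the power \<open>-3r/4\<close>.

  Upper bound: since \<open>j(m) \<le> m\<close> we have \<open>m\<^sub>n \<ge> n\<close>, so it is enough to bound the error of the truncated
  rule by a multiple of \<open>m\<close> to the power \<open>-r/2\<close>. Fix a point \<open>b\<close> of order \<open>m\<close>, chosen by averaging so
  that the derivatives of \<open>f\<close> are controlled there. To the left of \<open>b\<close>, Taylor's formula at \<open>b\<close> writes the
  error as a superposition of Gauss-Laguerre errors of truncated powers \<open>(t - x)\<close> to the power \<open>s - 1\<close> on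
  \<open>x \<le> t\<close>. Each of these is approximated by a polynomial of degree below \<open>2m\<close> with a nonnegative
  polynomial error majorant; exactness of the Gauss rule then bounds its error by the integral of the
  majorant, which is of order \<open>(t/m)\<close> to the power \<open>s/2\<close> times \<open>w(t)\<close>. The polynomials come from an
  antiderivative of a Chebyshev peak at \<open>t\<close> multiplied by \<open>(1 + (z - t)/L)\<close> to the power \<open>L\<close>, a polynomial
  substitute for \<open>exp (z - t)\<close> that compensates the decay of the weight. To the right of \<open>b\<close>
  the weight \<open>w\<^sub>r\<close> itself gains the factor, and the nodes up to \<open>4\<theta>m\<close> are treated by comparing the sum
  with an integral: Sonin's energy argument for the Laguerre equation bounds the Cotes numbers by the weight
  and separates the nodes.\<close>

section \<open>The Laguerre weight\<close>

text \<open>The exponent of the Sobolev weight matches the local scale of the nodes: near t it is h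
  = sqrt (t/m) up to constants, a truncated power of order s is resolved up to h^s, and h^r w(t)
  equals m^(-r/2) times the Sobolev weight at t. The obstacle is that the error must be small
  relative to w(t) for every t at once: a polynomial imitating a truncated power is wrong also far
  to the left of t, where w exceeds w(t) by an exponential factor. The substitute for exp (z - t)
  repairs this only if it stays below the exponential on the whole half line, and it uses m of the
  2m available degrees; about half of the rest goes to the peak. The peak is built in the variable
  sqrt z, because a width of order 1/sqrt m there is one of order sqrt (t/m) in z. The restriction t
  \<le> c m makes h at most 1, so exp changes only by a bounded factor across a peak. The cut-off 4
  \<theta> m with \<theta> < 1 stays away from the turning point near 4m of the Laguerre equation in
  normal form; its coefficient is then bounded below, which gives Sonin's argument uniform
  constants.\<close>

lemma set_integrable_powr_exp:
  fixes a c :: real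
  assumes "a > -1" "c > 0"
  shows "set_integrable lborel {0<..} (\<lambda>x. x powr a * exp (- c * x))"
proof -
  have "(\<lambda>t. complex_of_real t powr (of_real (a + 1) - 1) / of_real (exp (c * t))) absolutely_integrable_on {0<..}"
    by (rule absolutely_integrable_Gamma_integral) (use assms in auto)
  then have "(\<lambda>t. norm (complex_of_real t powr (of_real (a + 1) - 1) / of_real (exp (c * t)))) absolutely_integrable_on {0<..}"
    by (rule absolutely_integrable_norm[unfolded o_def])
  then have "(\<lambda>t. t powr a * exp (- c * t)) absolutely_integrable_on {0<..}"
    by (rule absolutely_integrable_spike[of _ _ "{}"])
       (auto simp: norm_divide norm_mult norm_inverse norm_powr_real_powr exp_minus divide_inverse simp flip: of_real_exp)
  then show ?thesis
    unfolding set_integrable_def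
    by (subst (asm) integrable_completion) auto
qed

lemma set_integral_powr_exp:
  fixes a :: real
  assumes "a > -1"
  shows "(LINT x:{0<..}|lborel. x powr a * exp (- x)) = Gamma (a + 1)"
proof -
  have int: "set_integrable lborel {0<..} (\<lambda>x. x powr a * exp (- x))"
    using set_integrable_powr_exp[OF assms, of 1] by simp
  have "((\<lambda>t. t powr a / exp t) has_integral Gamma (a + 1)) {0..}"
    using Gamma_integral_real[of "a + 1"] assms by simp
  then have "((\<lambda>t. if t \<in> {0<..} then t powr a * exp (- t) else 0) has_integral Gamma (a + 1)) {0..}"
    by (rule has_integral_spike[of "{0}", rotated 2]) (auto simp: exp_minus divide_inverse)
  then have "((\<lambda>t. t powr a * exp (- t)) has_integral Gamma (a + 1)) {0<..}"
    by (subst (asm) has_integral_restrict) auto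
  moreover have "((\<lambda>x. x powr a * exp (- x)) has_integral (LINT x:{0<..}|lborel. x powr a * exp (- x))) {0<..}"
    using set_borel_integral_eq_integral[OF int] by (metis has_integral_integral)
  ultimately show ?thesis by (rule has_integral_unique[symmetric])
qed

locale laguerre_weight =
  fixes \<alpha> :: real
  assumes alpha: "\<alpha> > -1"
begin

lemma lag_w_pos: "x > 0 \<Longrightarrow> lag_w \<alpha> r x > 0"
  by (simp add: lag_w_def)

lemma lag_w_nonneg: "lag_w \<alpha> r x \<ge> 0"
  by (simp add: lag_w_def)

lemma lag_w_measurable [measurable]: "lag_w \<alpha> r \<in> borel_measurable borel"
  unfolding lag_w_def by measurable

lemma set_integrable_monom_lag_w:
  "set_integrable lborel {0<..} (\<lambda>x. x ^ n * lag_w \<alpha> 0 x)"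
proof -
  have "set_integrable lborel {0<..} (\<lambda>x. x powr (\<alpha> + n) * exp (- 1 * x))"
    by (rule set_integrable_powr_exp) (use alpha in auto)
  then show ?thesis
    by (rule set_integrable_cong[THEN iffD1, rotated -1])
       (auto simp: lag_w_def powr_add powr_realpow)
qed

lemma set_integrable_poly_lag_w:
  "set_integrable lborel {0<..} (\<lambda>x. poly P x * lag_w \<alpha> 0 x)"
proof -
  have "(\<lambda>x. poly P x * lag_w \<alpha> 0 x) = (\<lambda>x. \<Sum>i\<le>degree P. coeff P i * (x ^ i * lag_w \<alpha> 0 x))"
    by (auto simp: poly_altdef sum_distrib_right mult.assoc)
  moreover have "set_integrable lborel {0<..} (\<lambda>x. \<Sum>i\<le>degree P. coeff P i * (x ^ i * lag_w \<alpha> 0 x))"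
    unfolding set_integrable_def scaleR_sum_right
    by (intro Bochner_Integration.integrable_sum)
       (use set_integrable_monom_lag_w in \<open>auto simp: set_integrable_def mult.left_commute
          intro!: Bochner_Integration.integrable_mult_right\<close>)
  ultimately show ?thesis by simp
qed

text \<open>Integration against \<open>w\<close> restricted to polynomials: every such integral
  converges, so linearity and monotonicity hold without integrability side conditions.\<close>

definition LI :: "real poly \<Rightarrow> real" where
  "LI P = wint \<alpha> (poly P)"

lemma LI_add: "LI (P + Q) = LI P + LI Q"
  unfolding LI_def wint_def poly_add distrib_right
  by (rule set_integral_add) (rule set_integrable_poly_lag_w)+

lemma LI_smult: "LI (smult c P) = c * LI P"
  unfolding LI_def wint_def poly_smult mult.assoc
  by (rule set_integral_mult_right)

lemma LI_0 [simp]: "LI 0 = 0"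
  using LI_smult[of 0 0] by simp

lemma LI_minus: "LI (- P) = - LI P"
  using LI_smult[of "-1" P] by simp

lemma LI_diff: "LI (P - Q) = LI P - LI Q"
  using LI_add[of P "- Q"] by (simp add: LI_minus)

lemma LI_sum: "LI (\<Sum>i\<in>A. f i) = (\<Sum>i\<in>A. LI (f i))"
  by (induction A rule: infinite_finite_induct) (auto simp: LI_add)

lemma LI_mono:
  assumes "\<And>x. x > 0 \<Longrightarrow> poly P x \<le> poly Q x"
  shows "LI P \<le> LI Q"
  unfolding LI_def wint_def
  by (rule set_integral_mono) (auto intro!: mult_right_mono lag_w_nonneg assms set_integrable_poly_lag_w)

lemma LI_nonneg:
  assumes "\<And>x. x > 0 \<Longrightarrow> 0 \<le> poly P x"
  shows "0 \<le> LI P"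
  using LI_mono[of 0 P] assms by simp

text \<open>If the integral vanished, the nonnegative integrand would be zero almost everywhere. It
  is positive off the finitely many roots of \<open>P\<close>, so the interval from 0 to 1 would be
  a null set.\<close>

lemma LI_pos:
  assumes "\<And>x. x > 0 \<Longrightarrow> 0 \<le> poly P x" "P \<noteq> 0"
  shows "LI P > 0"
proof (rule ccontr)
  assume "\<not> LI P > 0"
  with LI_nonneg[OF assms(1)] have "LI P = 0" by simp
  then have "(\<integral>x. indicator {0<..} x *\<^sub>R (poly P x * lag_w \<alpha> 0 x) \<partial>lborel) = 0"
    by (simp add: LI_def wint_def set_lebesgue_integral_def)
  moreover have "AE x in lborel. 0 \<le> indicator {0<..} x *\<^sub>R (poly P x * lag_w \<alpha> 0 x)"
    by (auto simp: indicator_def lag_w_nonneg assms)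
  ultimately have "AE x in lborel. indicator {0<..} x *\<^sub>R (poly P x * lag_w \<alpha> 0 x) = 0"
    using set_integrable_poly_lag_w[of P] integral_nonneg_eq_0_iff_AE
    unfolding set_integrable_def by blast
  moreover have "AE x in lborel. x \<notin> {x. poly P x = 0}"
    by (rule AE_not_in, rule finite_imp_null_set_lborel) (simp add: assms poly_roots_finite)
  ultimately have "AE x in lborel. x \<notin> {0<..<1::real}"
  proof eventually_elim
    case (elim x)
    then show ?case using lag_w_pos[of x 0] by auto
  qed
  then have "{0<..<1::real} \<in> null_sets lborel"
    by (subst (asm) AE_iff_null_sets[symmetric]) auto
  then show False by (auto simp: null_sets_def)
qed

lemma LI_monom: "LI (monom 1 n) = Gamma (\<alpha> + n + 1)"
proof -
  have "LI (monom 1 n) = (LINT x:{0<..}|lborel. x powr (\<alpha> + n) * exp (- x))"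
    unfolding LI_def wint_def
    by (rule set_lebesgue_integral_cong) (auto simp: lag_w_def poly_monom powr_add powr_realpow)
  then show ?thesis
    using set_integral_powr_exp[of "\<alpha> + n"] alpha by simp
qed

text \<open>Since (x w)' = (\<alpha> + 1 - x) w and x w vanishes at both ends of the half line, this
  is integration by parts. On monomials it reduces to the functional equation of
  \<open>Gamma\<close>, so no boundary terms have to be handled.\<close>

lemma LI_by_parts_monom:
  "LI ([:0, 1:] * pderiv (monom c n)) = LI ([:- (\<alpha> + 1), 1:] * monom c n)"
proof -
  have 1: "[:- (\<alpha> + 1), 1:] * monom c n = smult (c * - (\<alpha> + 1)) (monom 1 n) + smult c (monom 1 (Suc n))"
    by (simp add: smult_monom monom_Suc)
  have 2: "[:0, 1:] * pderiv (monom c n) = smult (c * n) (monom 1 n)"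
    by (rule poly_eqI) (auto simp: coeff_pderiv coeff_pCons split: nat.splits)
  have "Gamma (\<alpha> + n + 1 + 1) = (\<alpha> + n + 1) * Gamma (\<alpha> + n + 1)"
    using alpha by (intro Gamma_plus1) (auto elim!: nonpos_Ints_cases)
  then show ?thesis
    unfolding 1 2 LI_add LI_smult LI_monom by (simp add: algebra_simps)
qed

lemma pderiv_sum: "pderiv (\<Sum>i\<in>A. f i) = (\<Sum>i\<in>A. pderiv (f i))"
  by (induction A rule: infinite_finite_induct) (simp_all add: pderiv_add)

lemma LI_by_parts: "LI ([:0, 1:] * pderiv P) = LI ([:- (\<alpha> + 1), 1:] * P)"
proof -
  have P: "P = (\<Sum>i\<le>degree P. monom (coeff P i) i)"
    by (simp add: poly_as_sum_of_monoms)
  show ?thesis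
    by (subst (1 2) P) (simp only: pderiv_sum sum_distrib_left LI_sum LI_by_parts_monom)
qed

end

section \<open>Gauss-Laguerre quadrature\<close>

lemma poly_ext:
  fixes P Q :: "real poly"
  shows "(\<And>x. poly P x = poly Q x) \<Longrightarrow> P = Q"
  using poly_eq_poly_eq_iff[of P Q] by auto

text \<open>\<open>Z\<close> is the set of positive roots of odd multiplicity; one extra linear
  factor for each makes all multiplicities even. Splitting off a root \<open>a\<close> toggles its
  membership in \<open>Z\<close>, which is the case distinction of the induction.\<close>

lemma sign_changes_removable:
  fixes P :: "real poly"
  assumes "P \<noteq> 0"
  shows "\<exists>Z. finite Z \<and> Z \<subseteq> {x. x > 0 \<and> poly P x = 0} \<and>
    ((\<forall>x>0. 0 \<le> poly (P * (\<Prod>z\<in>Z. [:-z, 1:])) x) \<or> (\<forall>x>0. poly (P * (\<Prod>z\<in>Z. [:-z, 1:])) x \<le> 0))"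
  using assms
proof (induction "degree P" arbitrary: P rule: less_induct)
  case less
  show ?case
  proof (cases "\<exists>a>0. poly P a = 0")
    case False
    have "(\<forall>x>0. 0 \<le> poly P x) \<or> (\<forall>x>0. poly P x \<le> 0)"
    proof (rule ccontr)
      assume "\<not> ?thesis"
      then obtain x y where xy: "x > 0" "y > 0" "poly P x < 0" "poly P y > 0" by (auto simp: not_le)
      show False
      proof (cases "x < y")
        case True
        then obtain c where "x < c" "poly P c = 0" using poly_IVT_pos[of x y P] xy by auto
        with xy False show False by auto
      next
        case False
        then have "y < x" using xy by (cases "x = y") auto
        then obtain c where "y < c" "poly P c = 0" using poly_IVT_neg[of y x P] xy by auto
        with xy \<open>\<not> (\<exists>a>0. poly P a = 0)\<close> show False by auto
      qed
    qed
    then show ?thesis by (intro exI[of _ "{}"]) auto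
  next
    case True
    then obtain a where a: "a > 0" "poly P a = 0" by auto
    then have "[:-a, 1:] dvd P" by (simp add: poly_eq_0_iff_dvd)
    then obtain P1 where P1: "P = [:-a, 1:] * P1" by (elim dvdE)
    with less.prems have P1_0: "P1 \<noteq> 0" by auto
    have "degree P1 < degree P" using P1_0 unfolding P1 by (simp add: degree_mult_eq del: mult_pCons_left)
    from less.hyps[OF this P1_0] obtain Z where Z: "finite Z" "Z \<subseteq> {x. x > 0 \<and> poly P1 x = 0}"
      "(\<forall>x>0. 0 \<le> poly (P1 * (\<Prod>z\<in>Z. [:-z, 1:])) x) \<or> (\<forall>x>0. poly (P1 * (\<Prod>z\<in>Z. [:-z, 1:])) x \<le> 0)"
      by blast
    show ?thesis
    proof (cases "a \<in> Z")
      case True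
      have "(\<Prod>z\<in>Z. [:-z, 1:]) = [:-a, 1:] * (\<Prod>z\<in>Z - {a}. [:-z, 1:])"
        using Z(1) True by (subst prod.remove) auto
      then have eq: "P * (\<Prod>z\<in>Z - {a}. [:-z, 1:]) = P1 * (\<Prod>z\<in>Z. [:-z, 1:])"
        by (simp add: P1 mult_ac del: mult_pCons_left mult_pCons_right)
      show ?thesis
        by (rule exI[of _ "Z - {a}"], unfold eq) (use Z in \<open>auto simp: P1\<close>)
    next
      case False
      then have "(\<Prod>z\<in>insert a Z. [:-z, 1:]) = [:-a, 1:] * (\<Prod>z\<in>Z. [:-z, 1:])"
        using Z(1) by (subst prod.insert) auto
      then have eq: "P * (\<Prod>z\<in>insert a Z. [:-z, 1:]) = [:-a, 1:] ^ 2 * (P1 * (\<Prod>z\<in>Z. [:-z, 1:]))"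
        by (simp add: P1 power2_eq_square mult_ac del: mult_pCons_left mult_pCons_right)
      have "poly ([:-a, 1:] ^ 2 * R) x = (x - a)\<^sup>2 * poly R x" for R x
        by (simp add: power2_eq_square algebra_simps)
      then have "(\<forall>x>0. 0 \<le> poly ([:-a, 1:] ^ 2 * (P1 * (\<Prod>z\<in>Z. [:-z, 1:]))) x) \<or>
          (\<forall>x>0. poly ([:-a, 1:] ^ 2 * (P1 * (\<Prod>z\<in>Z. [:-z, 1:]))) x \<le> 0)"
        using Z(3) by (simp only:) (metis mult_nonneg_nonneg mult_nonneg_nonpos zero_le_power2)
      then show ?thesis
        by (intro exI[of _ "insert a Z"]) (use Z a eq in \<open>auto simp: P1\<close>)
    qed
  qed
qed

lemma degree_prod_linear: "degree (\<Prod>z\<in>Z. [:-z, 1:]) = card (Z :: real set)"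
  by (induction Z rule: infinite_finite_induct) (auto simp: degree_mult_eq simp del: mult_pCons_left)

lemma prod_linear_monic: "lead_coeff (\<Prod>z\<in>Z. [:-z, 1:]) = (1::real)"
  by (induction Z rule: infinite_finite_induct) (auto simp: lead_coeff_mult simp del: mult_pCons_left)

locale gauss_laguerre = laguerre_weight +
  fixes p :: "nat \<Rightarrow> real poly"
  assumes degree_p [simp]: "degree (p m) = m"
    and orthonormal: "LI (p m * p k) = (if m = k then 1 else 0)"
begin

lemma p_nonzero [simp]: "p m \<noteq> 0"
  using orthonormal[of m m] by auto

definition lc :: "nat \<Rightarrow> real" where
  "lc m = coeff (p m) m"

lemma lc_nonzero [simp]: "lc m \<noteq> 0"
  unfolding lc_def using p_nonzero[of m] degree_p[of m] leading_coeff_neq_0[of "p m"] by simp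

text \<open>Each \<open>p k\<close> has exact degree \<open>k\<close>, so subtracting a multiple of
  the orthonormal polynomial of the same degree lowers the degree of \<open>Q\<close>. The induction
  carries orthogonality to all later \<open>p k\<close> at once.\<close>

lemma orthogonal_lower:
  assumes "degree Q < m"
  shows "LI (p m * Q) = 0"
proof -
  have "\<forall>k>n. LI (p k * Q) = 0" if "degree Q \<le> n" for n Q
    using that
  proof (induction n arbitrary: Q)
    case 0
    obtain c where c: "Q = [:c:]" using degree_eq_zeroE[of Q] 0 by auto
    obtain d where d: "p 0 = [:d:]" using degree_eq_zeroE[of "p 0"] by auto
    then have "d \<noteq> 0" using p_nonzero[of 0] by auto
    then have "Q = smult (c / d) (p 0)" using c d by simp
    then show ?case using orthonormal by (auto simp: LI_smult)
  next
    case (Suc n)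
    define c where "c = coeff Q (Suc n) / lc (Suc n)"
    define R where "R = Q - smult c (p (Suc n))"
    have "degree R \<le> n"
    proof (rule degree_le, intro allI impI)
      fix i assume "n < i"
      show "coeff R i = 0"
      proof (cases "i = Suc n")
        case True
        then show ?thesis using lc_nonzero[of "Suc n"] by (simp add: R_def c_def lc_def)
      next
        case False
        then have "degree Q < i" "degree (p (Suc n)) < i" using \<open>n < i\<close> Suc.prems by auto
        then show ?thesis by (simp add: R_def coeff_eq_0)
      qed
    qed
    moreover have Q: "Q = smult c (p (Suc n)) + R" by (simp add: R_def)
    ultimately show ?case
      using Suc.IH orthonormal by (auto simp: Q distrib_left LI_add LI_smult)
  qed
  from this[of Q "degree Q"] assms show ?thesis by auto
qed

text \<open>Subtracting the right multiple of \<open>p m\<close> leaves a polynomial of lower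
  degree, which is orthogonal to \<open>p m\<close>. The moments and the Cotes numbers are evaluated
  this way.\<close>

lemma LI_p_mult:
  assumes "degree Q \<le> m"
  shows "LI (p m * Q) = coeff Q m / lc m"
proof -
  define c where "c = coeff Q m / lc m"
  define R where "R = Q - smult c (p m)"
  have Q: "Q = smult c (p m) + R" by (simp add: R_def)
  have cR: "coeff R m = 0" by (simp add: R_def c_def lc_def[symmetric])
  have dR: "degree R \<le> m" unfolding R_def
    using assms by (intro degree_diff_le) (auto intro: order.trans[OF degree_smult_le])
  have "LI (p m * R) = 0"
  proof (cases "R = 0")
    case False
    with cR dR have "degree R < m" by (metis leading_coeff_neq_0 le_neq_implies_less)
    then show ?thesis by (rule orthogonal_lower)
  qed auto
  then show ?thesis by (subst Q) (simp add: distrib_left LI_add LI_smult orthonormal c_def)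
qed

section \<open>Zeros, Lagrange interpolation and exactness of the Gauss rule\<close>

definition zs :: "nat \<Rightarrow> real set" where
  "zs m = {x. poly (p m) x = 0}"

lemma finite_zs [simp, intro]: "finite (zs m)"
  unfolding zs_def by (rule poly_roots_finite) simp

text \<open>With fewer than \<open>m\<close> sign changes on the half line, the product of the
  linear factors at the sign changes would have degree below \<open>m\<close>, yet its product with
  \<open>p m\<close> has one sign and hence a nonzero integral, against orthogonality.\<close>

lemma zs_aux: "card (zs m) = m \<and> zs m \<subseteq> {0<..}"
proof -
  obtain Z where Z: "finite Z" "Z \<subseteq> {x. x > 0 \<and> poly (p m) x = 0}"
    "(\<forall>x>0. 0 \<le> poly (p m * (\<Prod>z\<in>Z. [:-z, 1:])) x) \<or> (\<forall>x>0. poly (p m * (\<Prod>z\<in>Z. [:-z, 1:])) x \<le> 0)"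
    using sign_changes_removable[of "p m"] by auto
  define q where "q = (\<Prod>z\<in>Z. [:-z, 1:])"
  have q0: "q \<noteq> 0" unfolding q_def using Z(1) by auto
  have "LI (p m * q) \<noteq> 0"
  proof -
    have "p m * q \<noteq> 0" using q0 by auto
    then show ?thesis
      using Z(3) LI_pos[of "p m * q"] LI_pos[of "- (p m * q)"]
      unfolding q_def[symmetric] by (auto simp: LI_minus)
  qed
  then have "\<not> degree q < m" using orthogonal_lower by auto
  then have "m \<le> card Z" unfolding q_def by (simp add: degree_prod_linear)
  moreover have sub: "Z \<subseteq> zs m" using Z by (auto simp: zs_def)
  moreover have "card (zs m) \<le> m"
    using card_poly_roots_bound[of "p m"] by (simp add: zs_def)
  ultimately have "Z = zs m \<and> card (zs m) = m"
    using card_mono[OF finite_zs sub] card_subset_eq[OF finite_zs sub] by auto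
  then show ?thesis using Z by auto
qed

lemma card_zs [simp]: "card (zs m) = m"
  using zs_aux by auto

lemma zs_index_pos: "z \<in> zs m \<Longrightarrow> m > 0"
  using card_zs[of m] card_gt_0_iff[of "zs m"] by auto

lemma zs_pos: "z \<in> zs m \<Longrightarrow> z > 0"
  using zs_aux by auto

lemma p_factorization: "p m = smult (lc m) (\<Prod>z\<in>zs m. [:-z, 1:])"
proof -
  define R where "R = p m - smult (lc m) (\<Prod>z\<in>zs m. [:-z, 1:])"
  have d: "degree (\<Prod>z\<in>zs m. [:-z, 1:]) = m" by (simp add: degree_prod_linear)
  have "R = 0"
  proof (rule ccontr)
    assume R0: "R \<noteq> 0"
    have "coeff R m = 0"
      using prod_linear_monic[of "zs m"] by (simp add: R_def lc_def d)
    moreover have "degree R \<le> m" unfolding R_def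
      using d by (intro degree_diff_le) (auto intro: order.trans[OF degree_smult_le])
    ultimately have "degree R < m" using R0 by (metis leading_coeff_neq_0 le_neq_implies_less)
    moreover have "zs m \<subseteq> {x. poly R x = 0}"
    proof safe
      fix x assume x: "x \<in> zs m"
      have "(\<Prod>z\<in>zs m. x - z) = 0"
        using x by (intro prod_zero) auto
      then show "poly R x = 0" using x by (simp add: R_def poly_prod zs_def)
    qed
    then have "m \<le> degree R"
      using card_mono[OF poly_roots_finite[OF R0]] card_poly_roots_bound[OF R0] by (metis card_zs order.trans)
    ultimately show False by simp
  qed
  then show ?thesis by (simp add: R_def)
qed

text \<open>The Lagrange polynomials are indexed by the node itself rather than by its position in
  the sorted list; \<open>cotes_eq_lam\<close> translates at the end.\<close>

definition ell :: "nat \<Rightarrow> real \<Rightarrow> real poly" where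
  "ell m z = (\<Prod>y\<in>zs m - {z}. smult (1 / (z - y)) [:-y, 1:])"

definition lam :: "nat \<Rightarrow> real \<Rightarrow> real" where
  "lam m z = LI (ell m z)"

lemma degree_ell: "z \<in> zs m \<Longrightarrow> degree (ell m z) < m"
proof -
  assume z: "z \<in> zs m"
  have "degree (ell m z) \<le> (\<Sum>y\<in>zs m - {z}. degree (smult (1 / (z - y)) [:-y, 1:]))"
    unfolding ell_def using degree_prod_sum_le[of "zs m - {z}" "\<lambda>y. smult (1 / (z - y)) [:-y, 1:]"]
    by (simp add: o_def)
  also have "\<dots> = (\<Sum>y\<in>zs m - {z}. 1)" by (rule sum.cong) auto
  also have "\<dots> = m - 1" using z by simp
  finally show ?thesis using zs_index_pos[OF z] by simp
qed

lemma poly_ell: "z \<in> zs m \<Longrightarrow> y \<in> zs m \<Longrightarrow> poly (ell m z) y = (if y = z then 1 else 0)"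
proof (cases "y = z")
  case True
  then show ?thesis
    unfolding ell_def poly_prod by (auto intro!: prod.neutral simp flip: diff_divide_distrib)
next
  case False
  moreover assume "z \<in> zs m" "y \<in> zs m"
  ultimately show ?thesis
    unfolding ell_def poly_prod by (auto intro!: prod_zero bexI[of _ y])
qed

lemma lagrange_interpolation:
  assumes "degree Q < m"
  shows "Q = (\<Sum>z\<in>zs m. smult (poly Q z) (ell m z))"
proof (rule poly_eqI_degree[of "zs m"])
  fix x assume x: "x \<in> zs m"
  have "poly (\<Sum>z\<in>zs m. smult (poly Q z) (ell m z)) x = (\<Sum>z\<in>zs m. if x = z then poly Q z else 0)"
    unfolding poly_sum by (rule sum.cong) (auto simp: poly_ell x)
  then show "poly Q x = poly (\<Sum>z\<in>zs m. smult (poly Q z) (ell m z)) x"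
    using x by simp
next
  have "degree (\<Sum>z\<in>zs m. smult (poly Q z) (ell m z)) < m"
    using assms by (intro degree_sum_less) (auto intro: le_less_trans[OF degree_smult_le] degree_ell)
  then show "degree (\<Sum>z\<in>zs m. smult (poly Q z) (ell m z)) < card (zs m)" by simp
qed (use assms in simp)

text \<open>In the division by \<open>p m\<close> the quotient has degree below \<open>m\<close>, so
  its product with \<open>p m\<close> integrates to 0. At the nodes only the remainder is seen, and
  interpolation integrates it exactly.\<close>

lemma gauss_exact:
  assumes "degree P < 2 * m"
  shows "LI P = (\<Sum>z\<in>zs m. lam m z * poly P z)"
proof -
  define A where "A = P div p m"
  define B where "B = P mod p m"
  have P: "P = p m * A + B" by (simp add: A_def B_def)
  have m: "m > 0" using assms by simp
  have "degree B < m" using m degree_mod_less[of "p m" P] unfolding B_def by auto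
  moreover have "degree A < m"
  proof (cases "A = 0")
    case False
    have "degree (p m * A) < 2 * m"
      using P assms \<open>degree B < m\<close> degree_diff_less[of P "2 * m" B] by (metis add_diff_cancel_right' less_trans mult_2 trans_less_add1)
    then show ?thesis using False by (simp add: degree_mult_eq)
  qed (use m in auto)
  ultimately have "LI P = LI B" by (subst P) (simp add: LI_add orthogonal_lower)
  also have "\<dots> = (\<Sum>z\<in>zs m. lam m z * poly B z)"
    by (subst lagrange_interpolation[OF \<open>degree B < m\<close>]) (simp add: LI_sum LI_smult lam_def mult.commute)
  also have "\<dots> = (\<Sum>z\<in>zs m. lam m z * poly P z)"
    by (rule sum.cong) (auto simp: P zs_def)
  finally show ?thesis .
qed

text \<open>The square of \<open>ell m z\<close> still has degree below \<open>2 * m\<close>, so the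
  rule is exact for it and only the node \<open>z\<close> contributes: the Cotes number is the
  integral of a square.\<close>

lemma lam_pos: assumes "z \<in> zs m" shows "lam m z > 0"
proof -
  have nz: "ell m z \<noteq> 0" using poly_ell[OF assms assms] by auto
  have "degree (ell m z ^ 2) < 2 * m"
    using degree_ell[OF assms] by (intro le_less_trans[OF degree_power_le]) auto
  from gauss_exact[OF this] have "LI (ell m z ^ 2) = (\<Sum>y\<in>zs m. lam m y * (if y = z then 1 else 0))"
    by (auto simp: poly_ell assms intro!: sum.cong)
  also have "\<dots> = lam m z" using assms by (simp add: if_distrib cong: if_cong)
  finally have "lam m z = LI (ell m z ^ 2)" ..
  then show ?thesis using LI_pos[of "ell m z ^ 2"] nz by simp
qed

section \<open>Differential equation, Cotes numbers and moments of the orthonormal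
  polynomials\<close>

lemma laguerre_ode:
  "[:0, 1:] * pderiv (pderiv (p m)) + [:\<alpha> + 1, -1:] * pderiv (p m) + smult (real m) (p m) = 0"
proof -
  \<comment> \<open>\<open>L\<close> is symmetric for the inner product \<open>LI (y * q)\<close>
    and does not raise degrees. In \<open>e\<close> the coefficient at \<open>m\<close> cancels, so
    \<open>e\<close> has degree below \<open>m\<close> and is orthogonal to all such polynomials, in
    particular to itself.\<close>
  define L where "L = (\<lambda>y. [:0, 1:] * pderiv (pderiv y) + [:\<alpha> + 1, -1:] * pderiv y)"
  have LL: "LI (L y * q) = - LI ([:0, 1:] * pderiv y * pderiv q)" for y q
  proof -
    have "LI ([:0, 1:] * pderiv (pderiv y * q)) = LI ([:- (\<alpha> + 1), 1:] * (pderiv y * q))"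
      by (rule LI_by_parts)
    moreover have "[:0, 1:] * pderiv (pderiv y * q) =
        [:0, 1:] * pderiv (pderiv y) * q + [:0, 1:] * pderiv y * pderiv q"
      by (simp only: pderiv_mult distrib_left) (simp only: mult_ac add_ac)
    moreover have "L y * q = [:0, 1:] * pderiv (pderiv y) * q - [:- (\<alpha> + 1), 1:] * (pderiv y * q)"
    proof -
      have "[:\<alpha> + 1, -1:] = - [:- (\<alpha> + 1), 1:]" by simp
      then show ?thesis unfolding L_def by (simp only: algebra_simps)
    qed
    ultimately show ?thesis by (simp only: LI_add LI_diff)
  qed
  have sym: "LI (L y * q) = LI (y * L q)" for y q
  proof -
    have "LI (L y * q) = LI (L q * y)"
      unfolding LL by (simp only: mult_ac)
    then show ?thesis by (simp only: mult.commute)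
  qed
  define e where "e = L (p m) + smult (real m) (p m)"
  have coeffL: "coeff (L y) i = real (i + 1) * (real i + \<alpha> + 1) * coeff y (i + 1) - real i * coeff y i" for y i
    unfolding L_def by (cases i) (auto simp: coeff_pderiv coeff_pCons algebra_simps)
  have degL: "degree (L q) \<le> degree q" for q
    by (rule degree_le) (auto simp: coeffL coeff_eq_0)
  have coeff_e: "coeff e i = 0" if "i \<ge> m" for i
    using that by (cases "i = m") (auto simp: e_def coeffL coeff_eq_0)
  have e_orth: "LI (e * q) = 0" if "degree q < m" for q
    using orthogonal_lower[of "L q" m] orthogonal_lower[of q m] that degL[of q]
    by (simp add: e_def distrib_right LI_add LI_smult sym)
  have "e = 0"
  proof (rule ccontr)
    assume "e \<noteq> 0"
    then have "degree e < m" using coeff_e[of "degree e"] by (metis leading_coeff_neq_0 not_le)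
    then have "LI (e * e) = 0" by (rule e_orth)
    moreover have "LI (e * e) > 0" using \<open>e \<noteq> 0\<close> by (intro LI_pos) auto
    ultimately show False by simp
  qed
  then show ?thesis by (simp add: e_def L_def)
qed

lemma laguerre_ode_poly:
  "x * poly (pderiv (pderiv (p m))) x + (\<alpha> + 1 - x) * poly (pderiv (p m)) x + m * poly (p m) x = 0"
  using arg_cong[OF laguerre_ode[of m], of "\<lambda>q. poly q x"] by (simp add: algebra_simps)

lemma pderiv_prod_linear_at_0:
  assumes "finite Z" "0 \<notin> Z"
  shows "poly (pderiv (\<Prod>z\<in>Z. [:-z, 1:])) 0 = - (\<Sum>z\<in>Z. 1 / z) * poly (\<Prod>z\<in>Z. [:-z, 1:]) (0::real)"
  using assms by (induction Z) (auto simp: pderiv_mult pderiv_pCons field_simps simp del: mult_pCons_left)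

text \<open>At 0 the differential equation relates value and derivative of \<open>p m\<close>, which
  says that the reciprocals of the zeros add up to m / (\<alpha> + 1); no single reciprocal exceeds
  the sum. A truncated power that ends below this bound meets no node.\<close>

lemma zs_lower_bound:
  assumes "z \<in> zs m"
  shows "(\<alpha> + 1) / m \<le> z"
proof -
  have m: "m > 0" using assms by (rule zs_index_pos)
  have 0: "0 \<notin> zs m" using zs_pos by auto
  have "poly (pderiv (p m)) 0 = - (\<Sum>z\<in>zs m. 1 / z) * poly (p m) 0"
    by (subst (1 2) p_factorization) (simp add: pderiv_smult pderiv_prod_linear_at_0[OF finite_zs 0])
  then have "((\<alpha> + 1) * (\<Sum>z\<in>zs m. 1 / z) - m) * poly (p m) 0 = 0"
    using laguerre_ode_poly[of 0 m] by (simp add: algebra_simps)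
  moreover have "poly (p m) 0 \<noteq> 0" using 0 by (auto simp: zs_def)
  ultimately have s: "(\<alpha> + 1) * (\<Sum>z\<in>zs m. 1 / z) = m" by simp
  have "1 / z \<le> (\<Sum>z\<in>zs m. 1 / z)"
    using assms by (intro member_le_sum) (auto dest!: zs_pos)
  then have "(\<alpha> + 1) * (1 / z) \<le> m" unfolding s[symmetric] using alpha by (intro mult_left_mono) auto
  then show ?thesis using m zs_pos[OF assms] by (simp add: field_simps)
qed

text \<open>Integration by parts is applied to \<open>g * p m\<close> with \<open>g\<close> the
  quotient of \<open>p m\<close> by its linear factor at \<open>z\<close>. One side is 1, read off
  from the leading coefficient. On the other side the term with the derivative of \<open>g\<close>
  is orthogonal to \<open>p m\<close>; the remaining one has degree \<open>2 * m - 1\<close>, so the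
  Gauss rule is exact, and \<open>g\<close> vanishes at all nodes but \<open>z\<close>.\<close>

lemma lam_formula:
  assumes "z \<in> zs m"
  shows "lam m z * z * (poly (pderiv (p m)) z)\<^sup>2 = 1"
proof -
  have m: "m > 0" using assms by (rule zs_index_pos)
  obtain g where g: "p m = [:-z, 1:] * g"
    using assms poly_eq_0_iff_dvd[of "p m" z] by (auto simp: zs_def elim!: dvdE)
  have g0: "g \<noteq> 0" using p_nonzero[of m] unfolding g by auto
  have dg: "degree g = m - 1" using degree_p[of m] g0 unfolding g by (simp add: degree_mult_eq del: mult_pCons_left)
  have lg: "coeff g (m - 1) = lc m"
    using m dg coeff_eq_0[of g m] unfolding lc_def g by (cases m) auto
  have g_z: "poly g z = poly (pderiv (p m)) z"
    by (simp add: g pderiv_mult pderiv_pCons del: mult_pCons_left)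
  have g_y: "poly g y = 0" if "y \<in> zs m" "y \<noteq> z" for y
    using that unfolding zs_def by (simp add: g del: mult_pCons_left)
  have "LI ([:0, 1:] * pderiv (g * p m)) = LI ([:- (\<alpha> + 1), 1:] * (g * p m))" by (rule LI_by_parts)
  also have "[:- (\<alpha> + 1), 1:] * (g * p m) = p m * (pCons 0 g) + smult (- (\<alpha> + 1)) (p m * g)"
    by (simp add: algebra_simps)
  also have "LI \<dots> = LI (p m * (pCons 0 g))"
    using m dg by (simp only: LI_add LI_smult) (simp add: orthogonal_lower)
  also have "\<dots> = 1"
    using m dg lg by (subst LI_p_mult) (auto simp: coeff_pCons split: nat.splits)
  also have "[:0, 1:] * pderiv (g * p m) = p m * ([:0, 1:] * pderiv g) + g * ([:0, 1:] * pderiv (p m))"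
    by (simp only: pderiv_mult distrib_left) (simp only: mult_ac add_ac)
  also have "LI \<dots> = LI (g * ([:0, 1:] * pderiv (p m)))"
  proof -
    have "degree ([:0, 1:] * pderiv g) < m"
    proof (cases "pderiv g = 0")
      case False
      then have "degree g \<noteq> 0" by (simp add: pderiv_eq_0_iff)
      then show ?thesis using dg False by (simp add: degree_pderiv)
    qed (use m in auto)
    then show ?thesis unfolding LI_add by (simp only: orthogonal_lower add_0)
  qed
  also have "\<dots> = (\<Sum>y\<in>zs m. lam m y * poly (g * ([:0, 1:] * pderiv (p m))) y)"
  proof (rule gauss_exact)
    have "degree (g * ([:0, 1:] * pderiv (p m))) \<le> degree g + (1 + degree (pderiv (p m)))"
      by (intro order.trans[OF degree_mult_le] add_mono order.refl) (auto intro: degree_pCons_le)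
    also have "\<dots> < 2 * m" using m by (simp add: dg degree_pderiv)
    finally show "degree (g * ([:0, 1:] * pderiv (p m))) < 2 * m" .
  qed
  also have "\<dots> = (\<Sum>y\<in>zs m. if y = z then lam m z * z * (poly (pderiv (p m)) z)\<^sup>2 else 0)"
    by (rule sum.cong) (auto simp: g_y g_z power2_eq_square)
  also have "\<dots> = lam m z * z * (poly (pderiv (p m)) z)\<^sup>2" using assms by simp
  finally show ?thesis by simp
qed

text \<open>Integration by parts for the square of \<open>p m\<close>: in the product of
  \<open>p m\<close> with x times its derivative only the leading coefficient counts, and that is
  \<open>m\<close> times the one of \<open>p m\<close>.\<close>

lemma first_moment: "LI ([:0, 1:] * p m ^ 2) = 2 * m + \<alpha> + 1"
proof -
  have "LI ([:0, 1:] * pderiv (p m ^ 2)) = LI ([:- (\<alpha> + 1), 1:] * p m ^ 2)" by (rule LI_by_parts)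
  also have "[:- (\<alpha> + 1), 1:] * p m ^ 2 = [:0, 1:] * p m ^ 2 + smult (- (\<alpha> + 1)) (p m * p m)"
    by (simp add: power2_eq_square)
  also have "LI \<dots> = LI ([:0, 1:] * p m ^ 2) - (\<alpha> + 1)"
    by (simp only: LI_add LI_smult orthonormal) simp
  also have "[:0, 1:] * pderiv (p m ^ 2) = smult 2 (p m * ([:0, 1:] * pderiv (p m)))"
    by (rule poly_ext) (simp add: power2_eq_square pderiv_mult)
  also have "LI \<dots> = 2 * m"
  proof -
    have "degree ([:0, 1:] * pderiv (p m)) \<le> m"
      by (rule degree_le) (auto simp: coeff_pderiv coeff_pCons coeff_eq_0 split: nat.splits)
    then show ?thesis
      by (simp only: LI_smult LI_p_mult) (cases m; simp add: coeff_pderiv lc_def[symmetric])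
  qed
  finally show ?thesis by simp
qed

lemma second_moment:
  "LI ([:0, 0, 1:] * p m ^ 2) = (\<alpha> + 2) * (2 * m + \<alpha> + 1) + 2 * (m * (2 * m + \<alpha> + 1) + m * (m + \<alpha>))"
proof -
  \<comment> \<open>The combination in parentheses cancels the term of degree \<open>m\<close>, so
    after the extra factor x the degree is still at most \<open>m\<close> and
    \<open>LI_p_mult\<close> applies.\<close>
  define q where "q = [:0, 1:] * ([:0, 1:] * pderiv (p m) - smult m (p m))"
  have q_coeff: "coeff q i = (if i = 0 then 0 else (real i - 1 - m) * coeff (p m) (i - 1))" for i
    by (auto simp: q_def coeff_pCons coeff_pderiv algebra_simps split: nat.splits)
  have dq: "degree q \<le> m"
  proof (rule degree_le, intro allI impI)
    fix i assume "m < i"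
    then show "coeff q i = 0"
      by (cases "i = Suc m") (auto simp: q_coeff coeff_eq_0)
  qed
  have key: "LI (p m * q) = m * (m + \<alpha>)"
  proof (cases m)
    case 0
    then have "coeff q m = 0" by (simp add: q_coeff)
    then show ?thesis using LI_p_mult[OF dq] 0 by simp
  next
    case (Suc k)
    \<comment> \<open>The coefficient of degree m - 1 in the differential equation determines the
      second highest coefficient of \<open>p m\<close>.\<close>
    have "coeff ([:0, 1:] * pderiv (pderiv (p m)) + [:\<alpha> + 1, -1:] * pderiv (p m) + smult (real m) (p m)) k = 0"
      by (simp only: laguerre_ode coeff_0)
    then have "real m * (m + \<alpha>) * lc m + coeff (p m) k = 0"
      unfolding lc_def using Suc by (cases k) (auto simp: coeff_pderiv coeff_pCons algebra_simps)
    then have "coeff q m = m * (m + \<alpha>) * lc m" using Suc by (simp add: q_coeff)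
    then show ?thesis using LI_p_mult[OF dq] by simp
  qed
  have "LI ([:0, 1:] * pderiv ([:0, 1:] * p m ^ 2)) = LI ([:- (\<alpha> + 1), 1:] * ([:0, 1:] * p m ^ 2))"
    by (rule LI_by_parts)
  also have "[:- (\<alpha> + 1), 1:] * ([:0, 1:] * p m ^ 2) = [:0, 0, 1:] * p m ^ 2 + smult (- (\<alpha> + 1)) ([:0, 1:] * p m ^ 2)"
    by simp
  also have "[:0, 1:] * pderiv ([:0, 1:] * p m ^ 2) =
      [:0, 1:] * p m ^ 2 + smult 2 (p m * q) + smult (2 * m) ([:0, 1:] * p m ^ 2)"
    by (rule poly_ext) (simp add: q_def power2_eq_square pderiv_mult pderiv_pCons algebra_simps)
  finally show ?thesis by (simp only: LI_add LI_smult key first_moment) (simp add: algebra_simps)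
qed

section \<open>Sonin's energy argument\<close>

text \<open>Liouville normal form: multiplying the Laguerre polynomial by the square root of x w
  removes the first-order term, and the function \<open>u\<close> below satisfies u'' = -
  \<open>potential\<close> * u. \<open>u'\<close> is the explicit derivative of
  \<open>u\<close>.\<close>

definition potential :: "nat \<Rightarrow> real \<Rightarrow> real" where
  "potential m x = (m + (\<alpha> + 1) / 2) / x - 1 / 4 + (1 - \<alpha>\<^sup>2) / (4 * x\<^sup>2)"

definition u :: "nat \<Rightarrow> real \<Rightarrow> real" where
  "u m x = x powr ((\<alpha> + 1) / 2) * exp (- x / 2) * poly (p m) x"

definition u' :: "nat \<Rightarrow> real \<Rightarrow> real" where
  "u' m x = x powr ((\<alpha> + 1) / 2) * exp (- x / 2) *
     (poly (pderiv (p m)) x + ((\<alpha> + 1) / (2 * x) - 1 / 2) * poly (p m) x)"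

lemma factor_deriv:
  assumes "x > 0"
  shows "((\<lambda>x. x powr ((\<alpha> + 1) / 2) * exp (- x / 2)) has_real_derivative
     x powr ((\<alpha> + 1) / 2) * exp (- x / 2) * ((\<alpha> + 1) / (2 * x) - 1 / 2)) (at x)"
proof -
  have e: "x powr ((\<alpha> + 1) / 2 - 1) = x powr ((\<alpha> + 1) / 2) / x"
    using assms by (simp only: powr_diff) simp
  have d: "((\<lambda>x. exp (- x / 2)) has_real_derivative - (1 / 2) * exp (- x / 2)) (at x)"
    by (auto intro!: derivative_eq_intros)
  show ?thesis
    by (rule DERIV_cong[OF DERIV_mult[OF has_real_derivative_powr[OF assms] d]])
       (simp only: e, use assms in \<open>simp add: field_simps\<close>)
qed

lemma u_deriv:
  assumes "x > 0"
  shows "(u m has_real_derivative u' m x) (at x)"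
  unfolding u_def[abs_def] u'_def
  by (rule derivative_eq_intros factor_deriv[OF assms] poly_DERIV refl)+ (simp add: algebra_simps)

lemma u'_deriv:
  assumes "x > 0"
  shows "(u' m has_real_derivative - potential m x * u m x) (at x)"
proof -
  define P P' P'' where "P = poly (p m) x" and "P' = poly (pderiv (p m)) x" and "P'' = poly (pderiv (pderiv (p m))) x"
  define g where "g = x powr ((\<alpha> + 1) / 2) * exp (- x / 2)"
  define k where "k = (\<alpha> + 1) / (2 * x) - 1 / 2"
  define c where "c = (\<alpha> + 1) / (2 * x\<^sup>2)"
  have 1: "((\<lambda>x. (\<alpha> + 1) / (2 * x) - 1 / 2) has_real_derivative - c) (at x)"
    using assms unfolding c_def
    by (auto intro!: derivative_eq_intros simp: power2_eq_square; simp add: divide_simps)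
  have ode: "x * P'' = - (\<alpha> + 1 - x) * P' - m * P"
    using laguerre_ode_poly[of x m] by (simp add: algebra_simps P_def P'_def P''_def)
  have xk: "x * k = (\<alpha> + 1 - x) / 2" and xc: "x\<^sup>2 * c = (\<alpha> + 1) / 2"
    using assms by (simp_all add: field_simps k_def c_def)
  have "x\<^sup>2 * (k * (P' + k * P) + (P'' - c * P + k * P')) =
    x * (x * P'') + 2 * (x * k) * (x * P') + ((x * k)\<^sup>2 - x\<^sup>2 * c) * P"
    by (simp add: algebra_simps power2_eq_square)
  also have "\<dots> = - (x\<^sup>2 * potential m x) * P"
    unfolding ode xk xc potential_def using assms by (simp add: field_simps power2_eq_square)
  finally have "k * (P' + k * P) + (P'' - c * P + k * P') = - potential m x * P"
    using assms by (subst mult_left_cancel[of "x\<^sup>2", symmetric]) (simp_all add: mult.assoc)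
  then have "g * (k * (P' + k * P) + (P'' - c * P + k * P')) = - potential m x * u m x"
    by (simp add: u_def g_def P_def)
  then have "g * k * (P' + k * P) + (P'' + (- c * P + k * P')) * g = - potential m x * u m x"
    by (simp add: algebra_simps)
  moreover have "(u' m has_real_derivative g * k * (P' + k * P) + (P'' + (- c * P + k * P')) * g) (at x)"
    unfolding u'_def[abs_def] g_def k_def P_def P'_def P''_def
    by (intro DERIV_cong[OF DERIV_mult[OF factor_deriv[OF assms] DERIV_add[OF poly_DERIV DERIV_mult[OF 1 poly_DERIV]]]])
       (simp add: algebra_simps)
  ultimately show ?thesis by (simp only:)
qed

lemma factor_square:
  assumes "x > 0"
  shows "(x powr ((\<alpha> + 1) / 2) * exp (- x / 2))\<^sup>2 = x * lag_w \<alpha> 0 x"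
proof -
  have "(x powr ((\<alpha> + 1) / 2) * exp (- x / 2))\<^sup>2 = (x powr ((\<alpha> + 1) / 2) * x powr ((\<alpha> + 1) / 2)) * (exp (- x / 2) * exp (- x / 2))"
    by (simp add: power2_eq_square)
  also have "\<dots> = x powr (\<alpha> + 1) * exp (- x)"
    unfolding powr_add[symmetric] exp_add[symmetric] field_sum_of_halves by simp
  finally show ?thesis using assms by (simp add: lag_w_def powr_add)
qed

text \<open>At a node only the derivative of \<open>p m\<close> survives in \<open>u'\<close>, so
  \<open>lam_formula\<close> takes this form: an upper bound for the Cotes number is a lower bound
  for the slope of \<open>u\<close>.\<close>

lemma lam_u':
  assumes "z \<in> zs m"
  shows "lam m z * (u' m z)\<^sup>2 = lag_w \<alpha> 0 z"
proof -
  have z: "z > 0" using assms by (rule zs_pos)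
  have "(u' m z)\<^sup>2 = (z powr ((\<alpha> + 1) / 2) * exp (- z / 2))\<^sup>2 * (poly (pderiv (p m)) z)\<^sup>2"
    using assms z by (simp add: u'_def zs_def flip: power_mult_distrib)
  also have "\<dots> = lag_w \<alpha> 0 z * (z * (poly (pderiv (p m)) z)\<^sup>2)"
    unfolding factor_square[OF z] by simp
  finally show ?thesis using lam_formula[OF assms] by (simp add: algebra_simps)
qed

lemma u_square:
  assumes "x > 0"
  shows "(u m x)\<^sup>2 = x * (poly (p m) x)\<^sup>2 * lag_w \<alpha> 0 x"
  using factor_square[OF assms] unfolding u_def by (subst power_mult_distrib) simp

lemma potential_deriv:
  assumes "x > 0"
  shows "(potential m has_real_derivative - (m + (\<alpha> + 1) / 2) / x\<^sup>2 - (1 - \<alpha>\<^sup>2) / (2 * x ^ 3)) (at x)"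
  unfolding potential_def[abs_def] using assms
  by (auto intro!: derivative_eq_intros simp: field_simps power2_eq_square power3_eq_cube power4_eq_xxxx)

lemma potential_deriv_nonpos:
  assumes "x \<ge> 1" "m \<ge> \<alpha>\<^sup>2"
  shows "- (m + (\<alpha> + 1) / 2) / x\<^sup>2 - (1 - \<alpha>\<^sup>2) / (2 * x ^ 3) \<le> (0::real)"
proof -
  have "\<alpha>\<^sup>2 - 1 \<le> 2 * x * (m + (\<alpha> + 1) / 2)"
  proof -
    have "\<alpha>\<^sup>2 \<le> 1 * (m + (\<alpha> + 1) / 2)" using assms(2) alpha by (simp add: add_increasing2)
    also have "\<dots> \<le> 2 * x * (m + (\<alpha> + 1) / 2)"
      using assms alpha order.trans[OF zero_le_power2 assms(2)] by (intro mult_right_mono) auto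
    finally show ?thesis by simp
  qed
  then have "(\<alpha>\<^sup>2 - 1) / (2 * x ^ 3) \<le> 2 * x * (m + (\<alpha> + 1) / 2) / (2 * x ^ 3)"
    using assms by (intro divide_right_mono) auto
  also have "\<dots> = (m + (\<alpha> + 1) / 2) / x\<^sup>2" using assms by (simp add: power2_eq_square power3_eq_cube)
  finally have "(\<alpha>\<^sup>2 - 1) / (2 * x ^ 3) \<le> (m + (\<alpha> + 1) / 2) / x\<^sup>2" .
  moreover have "(1 - \<alpha>\<^sup>2) / (2 * x ^ 3) = - ((\<alpha>\<^sup>2 - 1) / (2 * x ^ 3))"
    unfolding minus_divide_left by simp
  ultimately show ?thesis unfolding minus_divide_left[symmetric] by linarith
qed

text \<open>Sonin's argument: while the potential is positive and decreasing, the energy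
  \<open>u'\<^sup>2 + potential * u\<^sup>2\<close> decreases and its quotient by the potential increases.\<close>

lemma u_bound_energy:
  assumes m: "real m \<ge> \<alpha>\<^sup>2" and A: "potential m A \<ge> q0" "q0 > 0"
    and z: "1 \<le> z" "z \<le> A" and x: "1 \<le> x" "x \<le> A"
  shows "(u m x)\<^sup>2 \<le> ((u' m z)\<^sup>2 + potential m z * (u m z)\<^sup>2) / q0"
proof -
  define Q' where "Q' = (\<lambda>x. - (m + (\<alpha> + 1) / 2) / x\<^sup>2 - (1 - \<alpha>\<^sup>2) / (2 * x ^ 3))"
  define \<Phi> where "\<Phi> = (\<lambda>x. (u' m x)\<^sup>2 + potential m x * (u m x)\<^sup>2)"
  have Q': "Q' y \<le> 0" if "y \<ge> 1" for y
    unfolding Q'_def using potential_deriv_nonpos[OF that m] .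
  have dQ: "(potential m has_real_derivative Q' y) (at y)" if "y \<ge> 1" for y
    unfolding Q'_def using potential_deriv[of y m] that by simp
  have potential_ge: "potential m y \<ge> q0" if "1 \<le> y" "y \<le> A" for y
  proof -
    have "potential m A \<le> potential m y"
      by (rule DERIV_nonpos_imp_nonincreasing[OF that(2)]) (use that dQ Q' in \<open>meson order.trans\<close>)
    with A show ?thesis by simp
  qed
  have d\<Phi>: "(\<Phi> has_real_derivative Q' y * (u m y)\<^sup>2) (at y)" if "1 \<le> y" for y
    unfolding \<Phi>_def using that
    by (intro DERIV_cong[OF DERIV_add[OF DERIV_power[OF u'_deriv] DERIV_mult[OF dQ DERIV_power[OF u_deriv]]]])
       (auto simp: algebra_simps power2_eq_square)
  have \<Phi>_dec: "\<Phi> y2 \<le> \<Phi> y1" if "1 \<le> y1" "y1 \<le> y2" for y1 y2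
  proof (rule DERIV_nonpos_imp_nonincreasing[OF that(2)])
    fix y assume "y1 \<le> y"
    then show "\<exists>d. (\<Phi> has_real_derivative d) (at y) \<and> d \<le> 0"
      using that(1) by (intro exI[of _ "Q' y * (u m y)\<^sup>2"] conjI d\<Phi> mult_nonpos_nonneg Q') auto
  qed
  have \<Psi>_inc: "\<Phi> y1 / potential m y1 \<le> \<Phi> y2 / potential m y2" if "1 \<le> y1" "y1 \<le> y2" "y2 \<le> A" for y1 y2
  proof (rule DERIV_nonneg_imp_nondecreasing[OF that(2)])
    fix y assume y: "y1 \<le> y" "y \<le> y2"
    have pos: "potential m y > 0" using potential_ge[of y] y that A by simp
    have "((\<lambda>y. \<Phi> y / potential m y) has_real_derivative - Q' y * (u' m y)\<^sup>2 / (potential m y)\<^sup>2) (at y)"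
      using pos y that
      by (intro DERIV_cong[OF DERIV_divide[OF d\<Phi> dQ]])
         (simp_all add: \<Phi>_def algebra_simps power2_eq_square)
    moreover have "- Q' y * (u' m y)\<^sup>2 / (potential m y)\<^sup>2 \<ge> 0" using Q'[of y] y that
      by (intro divide_nonneg_nonneg mult_nonneg_nonneg) auto
    ultimately show "\<exists>d. ((\<lambda>y. \<Phi> y / potential m y) has_real_derivative d) (at y) \<and> 0 \<le> d" by blast
  qed
  have nonneg: "\<Phi> y \<ge> 0" if "1 \<le> y" "y \<le> A" for y
    using potential_ge[OF that] A unfolding \<Phi>_def by simp
  have le: "(u m y)\<^sup>2 \<le> \<Phi> y / potential m y" if "1 \<le> y" "y \<le> A" for y
    using potential_ge[OF that] A unfolding \<Phi>_def by (simp add: field_simps)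
  have le2: "\<Phi> y / potential m y \<le> \<Phi> y / q0" if "1 \<le> y" "y \<le> A" for y
    using potential_ge[OF that] A nonneg[OF that] by (intro divide_left_mono mult_pos_pos) auto
  show ?thesis
  \<comment> \<open>To the left of \<open>z\<close> the increasing quotient transports the bound to
    \<open>z\<close>; to the right the decreasing energy does.\<close>
  proof (cases "x \<le> z")
    case True
    have "(u m x)\<^sup>2 \<le> \<Phi> x / potential m x" by (rule le[OF x])
    also have "\<dots> \<le> \<Phi> z / potential m z" by (rule \<Psi>_inc) (use x z True in auto)
    also have "\<dots> \<le> \<Phi> z / q0" by (rule le2[OF z])
    finally show ?thesis unfolding \<Phi>_def .
  next
    case False
    have "(u m x)\<^sup>2 \<le> \<Phi> x / potential m x" by (rule le[OF x])
    also have "\<dots> \<le> \<Phi> x / q0" by (rule le2[OF x])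
    also have "\<dots> \<le> \<Phi> z / q0" using \<Phi>_dec[of z x] z False A by (intro divide_right_mono) auto
    finally show ?thesis unfolding \<Phi>_def .
  qed
qed

text \<open>The left side is the integral of x (A - x) (p m)^2 w. On [1, A] this integrand is (A -
  x) u^2, at most A * M; elsewhere x (A - x) is at most A and the normalisation of
  \<open>p m\<close> gives the term \<open>A\<close>. If \<open>u\<close> were small on [1, A], the
  first two moments would be incompatible.\<close>

lemma moment_bound:
  assumes M: "\<And>x. 1 \<le> x \<Longrightarrow> x \<le> A \<Longrightarrow> (u m x)\<^sup>2 \<le> M" and "A \<ge> 1"
  shows "A * LI ([:0, 1:] * p m ^ 2) - LI ([:0, 0, 1:] * p m ^ 2) \<le> A + M * A\<^sup>2"
proof -
  have M0: "M \<ge> 0" using M[of 1] \<open>A \<ge> 1\<close> by (simp add: order.trans[OF zero_le_power2])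
  define R where "R = smult A ([:0, 1:] * p m ^ 2) - [:0, 0, 1:] * p m ^ 2"
  have R: "poly R x = x * (A - x) * (poly (p m) x)\<^sup>2" for x
    by (simp add: R_def algebra_simps power2_eq_square)
  have int1: "set_integrable lborel {0<..} (\<lambda>x. poly (smult A (p m * p m)) x * lag_w \<alpha> 0 x)"
    by (rule set_integrable_poly_lag_w)
  have "integrable lborel (\<lambda>x. indicator {1..A} x * (A * M))"
    by (intro integrable_mult_left integrable_real_indicator) (auto simp: emeasure_lborel_Icc_eq)
  then have int2: "set_integrable lborel {0<..} (\<lambda>x. indicator {1..A} x * (A * M))"
    unfolding set_integrable_def
    by (rule Bochner_Integration.integrable_bound) (auto simp: indicator_def)
  have "LI R \<le> (LINT x:{0<..}|lborel. poly (smult A (p m * p m)) x * lag_w \<alpha> 0 x + indicator {1..A} x * (A * M))"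
    unfolding LI_def wint_def
  proof (rule set_integral_mono)
    fix x :: real assume "x \<in> {0<..}"
    then have x: "x > 0" by simp
    have w: "lag_w \<alpha> 0 x \<ge> 0" by (rule lag_w_nonneg)
    show "poly R x * lag_w \<alpha> 0 x \<le> poly (smult A (p m * p m)) x * lag_w \<alpha> 0 x + indicator {1..A} x * (A * M)"
    proof (cases "x \<in> {1..A}")
      case True
      have "poly R x * lag_w \<alpha> 0 x = (A - x) * (u m x)\<^sup>2" by (simp add: R u_square x algebra_simps)
      also have "\<dots> \<le> A * M" using True M[of x] x by (intro mult_mono) auto
      finally show ?thesis using True w \<open>A \<ge> 1\<close> by (simp add: add_increasing)
    next
      case False
      then have "x \<le> 1 \<or> x > A" by auto
      then have "x * (A - x) \<le> A"
      proof
        assume "x \<le> 1" then have "x * (A - x) \<le> 1 * A" using x \<open>A \<ge> 1\<close> by (intro mult_mono) auto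
        then show ?thesis by simp
      next
        assume "x > A" then have "x * (A - x) \<le> 0" using x by (intro mult_nonneg_nonpos) auto
        then show ?thesis using \<open>A \<ge> 1\<close> by simp
      qed
      then show ?thesis using False w
        by (auto simp: R power2_eq_square intro!: mult_right_mono)
    qed
  qed (use int1 int2 set_integrable_poly_lag_w in \<open>auto intro!: set_integral_add(1)\<close>)
  also have "\<dots> = A * LI (p m * p m) + (LINT x:{0<..}|lborel. indicator {1..A} x * (A * M))"
    unfolding set_integral_add(2)[OF int1 int2]
    by (subst LI_smult[symmetric]) (simp only: LI_def wint_def)
  also have "(LINT x:{0<..}|lborel. indicator {1..A} x * (A * M)) = (\<integral>x. indicator {1..A} x * (A * M) \<partial>lborel)"
    unfolding set_lebesgue_integral_def by (rule Bochner_Integration.integral_cong) (auto simp: indicator_def)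
  also have "\<dots> = (A - 1) * (A * M)" using \<open>A \<ge> 1\<close> by simp
  also have "\<dots> \<le> A * (A * M)" using M0 \<open>A \<ge> 1\<close> by (intro mult_right_mono) auto
  finally show ?thesis unfolding R_def LI_diff LI_smult orthonormal by (simp add: power2_eq_square mult_ac)
qed

lemma potential_lower:
  assumes "0 < \<theta>" "\<theta> < 1"
  shows "\<exists>q0>0. \<exists>m0. \<forall>m\<ge>m0. potential m (4 * \<theta> * real m) \<ge> q0"
proof -
  \<comment> \<open>At x = 4 \<theta> m the main terms of \<open>potential\<close> amount to at
    least 1/(4 \<theta>) - 1/4 = 2 * \<open>q0\<close>; \<open>m0\<close> is chosen so that the term
    with 1/x^2 takes away at most one \<open>q0\<close>.\<close>
  define q0 where "q0 = (1 / \<theta> - 1) / 8"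
  have q0: "q0 > 0" using assms by (simp add: q0_def field_simps)
  define m0 where "m0 = nat \<lceil>\<alpha>\<^sup>2 / (64 * \<theta>\<^sup>2 * q0)\<rceil> + 1"
  have "potential m (4 * \<theta> * real m) \<ge> q0" if "m \<ge> m0" for m
  proof -
    have m1: "real m \<ge> 1" using that by (simp add: m0_def)
    have m: "real m \<ge> \<alpha>\<^sup>2 / (64 * \<theta>\<^sup>2 * q0)" using that unfolding m0_def by linarith
    have "\<alpha>\<^sup>2 \<le> 64 * \<theta>\<^sup>2 * q0 * m" using m q0 assms by (simp add: field_simps)
    also have "\<dots> \<le> 64 * \<theta>\<^sup>2 * q0 * (m * m)" using m1 q0 by (intro mult_left_mono) auto
    finally have "\<alpha>\<^sup>2 / (4 * (4 * \<theta> * real m)\<^sup>2) \<le> q0"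
      using m1 assms by (simp add: field_simps power2_eq_square)
    moreover have "(1 - \<alpha>\<^sup>2) / (4 * (4 * \<theta> * real m)\<^sup>2) \<ge> - (\<alpha>\<^sup>2 / (4 * (4 * \<theta> * real m)\<^sup>2))"
      unfolding minus_divide_left by (intro divide_right_mono) auto
    moreover have "(m + (\<alpha> + 1) / 2) / (4 * \<theta> * m) \<ge> m / (4 * \<theta> * m)"
      using alpha assms by (intro divide_right_mono) auto
    moreover have "m / (4 * \<theta> * m) = 2 * q0 + 1 / 4" using m1 assms by (simp add: q0_def field_simps)
    ultimately show ?thesis unfolding potential_def by linarith
  qed
  with q0 show ?thesis by blast
qed

text \<open>At a node the energy is the square of \<open>u'\<close> alone, and by Sonin's argument
  it bounds \<open>u\<close> on all of [1, A]. Since the moments forbid \<open>u\<close> to be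
  uniformly small there, the slope at the node is bounded below, and \<open>lam_u'\<close> turns
  this into the bound for the Cotes number.\<close>

lemma lam_upper_bound:
  assumes "0 < \<theta>" "\<theta> < 1"
  shows "\<exists>C>0. \<exists>m0. \<forall>m\<ge>m0. \<forall>z\<in>zs m. 1 \<le> z \<longrightarrow> z \<le> 4 * \<theta> * real m \<longrightarrow> lam m z \<le> C * lag_w \<alpha> 0 z"
proof -
  \<comment> \<open>The first moment is about 2m and the second about 6m^2, so
    \<open>moment_bound\<close> has content only for A > 3m. With 7/8 one has A \<ge> 7m/2, leaving
    a surplus of m^2 up to lower-order terms.\<close>
  define \<theta>' where "\<theta>' = max \<theta> (7 / 8)"
  have \<theta>': "\<theta> \<le> \<theta>'" "7 / 8 \<le> \<theta>'" "\<theta>' < 1" "0 < \<theta>'" using assms by (auto simp: \<theta>'_def)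
  obtain q0 m0 where q0: "q0 > 0" "\<And>m. m \<ge> m0 \<Longrightarrow> potential m (4 * \<theta>' * real m) \<ge> q0"
    using potential_lower[of \<theta>'] \<theta>' by blast
  define m1 where "m1 = max m0 (nat \<lceil>\<alpha>\<^sup>2 + 10 * (\<alpha> + 2)\<^sup>2 + 20\<rceil>)"
  have "lam m z \<le> 32 / q0 * lag_w \<alpha> 0 z"
    if "m \<ge> m1" and z: "z \<in> zs m" "1 \<le> z" "z \<le> 4 * \<theta> * real m" for m z
  proof -
    have mge: "m \<ge> m0" and mK: "real m \<ge> \<alpha>\<^sup>2 + 10 * (\<alpha> + 2)\<^sup>2 + 20"
      using that(1) unfolding m1_def by linarith+
    have m\<alpha>: "real m \<ge> \<alpha>\<^sup>2" and m10: "real m \<ge> 10 * (\<alpha> + 2)\<^sup>2 + 20" using mK by (auto intro: order.trans[rotated])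
    define A where "A = 4 * \<theta>' * real m"
    have zA: "z \<le> A" using z(3) \<theta>' mult_right_mono[OF \<theta>'(1), of "real m"] by (simp add: A_def)
    have A: "7 / 2 * m \<le> A" "A \<le> 4 * m"
      using \<theta>' mult_right_mono[OF \<theta>'(2), of "real m"] mult_right_mono[OF less_imp_le[OF \<theta>'(3)], of "real m"]
      by (auto simp: A_def)
    have mpos: "real m \<ge> 20" using m10 zero_le_power2[of "\<alpha> + 2"] by linarith
    define M where "M = (u' m z)\<^sup>2 / q0"
    have A1: "A \<ge> 1" using A(1) mpos by linarith
    have "(u m x)\<^sup>2 \<le> M" if "1 \<le> x" "x \<le> A" for x
      using u_bound_energy[OF m\<alpha> _ q0(1) z(2) zA that] q0(2)[OF mge] z(1)
      by (simp add: A_def M_def u_def zs_def)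
    from moment_bound[OF this A1] have "A * (2 * m + \<alpha> + 1) - A \<le>
       (\<alpha> + 2) * (2 * m + \<alpha> + 1) + 2 * (m * (2 * m + \<alpha> + 1) + m * (m + \<alpha>)) + M * A\<^sup>2"
      unfolding first_moment second_moment by simp
    moreover have "7 / 2 * m * (2 * m + \<alpha> + 1) \<le> A * (2 * m + \<alpha> + 1)"
      using A alpha by (intro mult_right_mono) auto
    moreover have "M * A\<^sup>2 \<le> M * (4 * m)\<^sup>2"
      using power_mono[OF A(2), of 2] A1 q0(1) by (intro mult_left_mono) (auto simp: M_def)
    ultimately have 1: "m * m - m * (5 / 2 * (\<alpha> + 1) + 4) - (\<alpha> + 1) * (\<alpha> + 2) \<le> 16 * M * (m * m)"
      using A(2) by (simp add: field_simps power2_eq_square)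
    have 2: "(10 * (\<alpha> + 2)\<^sup>2 + 20) * real m \<le> real m * real m" using m10 by (intro mult_right_mono) auto
    have 3: "(\<alpha> + 1) * (\<alpha> + 2) \<le> (\<alpha> + 2)\<^sup>2 * m"
    proof -
      have "(\<alpha> + 1) * (\<alpha> + 2) \<le> (\<alpha> + 2)\<^sup>2 * 1" using alpha by (simp add: power2_eq_square mult_right_mono)
      also have "\<dots> \<le> (\<alpha> + 2)\<^sup>2 * m" using mpos by (intro mult_left_mono) auto
      finally show ?thesis .
    qed
    have 4: "m * (5 / 2 * (\<alpha> + 1) + 4) \<le> m * (4 * (\<alpha> + 2)\<^sup>2 + 10)"
    proof (rule mult_left_mono)
      have "0 \<le> (2 * (\<alpha> + 2) - 1)\<^sup>2" by simp
      then show "5 / 2 * (\<alpha> + 1) + 4 \<le> 4 * (\<alpha> + 2)\<^sup>2 + 10"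
        using alpha by (simp add: power2_eq_square algebra_simps)
    qed simp
    have "m * m / 2 \<le> 16 * M * (m * m)"
    proof -
      \<comment> \<open>The threshold on \<open>m\<close> makes all lower-order terms together at
        most half of m^2; the other half gives M \<ge> 1/32.\<close>
      define Y where "Y = (\<alpha> + 2)\<^sup>2 * m"
      have "10 * Y + 20 * m \<le> real m * real m" using 2 by (simp add: Y_def algebra_simps)
      moreover have "m * (5 / 2 * (\<alpha> + 1) + 4) \<le> 4 * Y + 10 * m" using 4 by (simp add: Y_def algebra_simps)
      ultimately show ?thesis using 1 3[folded Y_def] by (simp only: of_nat_mult)
    qed
    then have "1 / 32 \<le> M" using mpos by (simp add: field_simps)
    then have "q0 / 32 \<le> (u' m z)\<^sup>2" using q0 by (simp add: M_def field_simps)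
    then have "lam m z * (q0 / 32) \<le> lag_w \<alpha> 0 z"
      unfolding lam_u'[OF z(1), symmetric] using lam_pos[OF z(1)] by (intro mult_left_mono) auto
    then show ?thesis using q0 by (simp add: field_simps)
  qed
  then show ?thesis using q0(1) by (intro exI[of _ "32 / q0"] conjI exI[of _ m1]) auto
qed

text \<open>Between two zeros |u| has a maximum at some \<open>s\<close> where the slope vanishes.
  As \<open>K\<close> bounds the potential, integrating u'' twice from \<open>s\<close> back to the
  zero \<open>y\<close> yields |u(s)| \<le> K |u(s)| (s - y)^2, so the distance is at least 1 / sqrt
  K.\<close>

lemma zs_spacing:
  assumes "c > 0"
  shows "\<exists>\<delta>>0. \<forall>m\<ge>1. \<forall>y\<in>zs m. \<forall>z\<in>zs m. y < z \<longrightarrow> c * real m \<le> y \<longrightarrow> \<delta> \<le> z - y"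
proof -
  define K where "K = (\<bar>\<alpha>\<bar> + 2) / c + 1 / 4 + (1 + \<alpha>\<^sup>2) / (4 * c\<^sup>2)"
  have K: "K > 0" unfolding K_def using assms by (intro add_pos_nonneg) auto
  have potential_le: "\<bar>potential m x\<bar> \<le> K" if m: "m \<ge> 1" and x: "c * real m \<le> x" for m x
  proof -
    have m1: "real m \<ge> 1" using m by simp
    have xpos: "x > 0" using x assms m1 by (smt (verit) mult_pos_pos)
    have cx: "c \<le> x" using x assms mult_left_mono[OF m1, of c] by linarith
    have "\<bar>(m + (\<alpha> + 1) / 2) / x\<bar> \<le> (\<bar>\<alpha>\<bar> + 2) / c"
    proof -
      have "\<bar>m + (\<alpha> + 1) / 2\<bar> \<le> m + (\<bar>\<alpha>\<bar> + 1)" using alpha m1 by (auto simp: abs_if field_simps)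
      also have "\<dots> \<le> m * (\<bar>\<alpha>\<bar> + 2)" using mult_right_mono[OF m1, of "\<bar>\<alpha>\<bar> + 1"] by (simp add: algebra_simps)
      finally have "\<bar>(m + (\<alpha> + 1) / 2) / x\<bar> \<le> m * (\<bar>\<alpha>\<bar> + 2) / x" using xpos by (simp add: divide_right_mono)
      also have "\<dots> \<le> m * (\<bar>\<alpha>\<bar> + 2) / (c * m)" using x xpos assms m1 by (intro divide_left_mono) auto
      finally show ?thesis using m1 by simp
    qed
    moreover have "\<bar>(1 - \<alpha>\<^sup>2) / (4 * x\<^sup>2)\<bar> \<le> (1 + \<alpha>\<^sup>2) / (4 * c\<^sup>2)"
    proof -
      have "\<bar>(1 - \<alpha>\<^sup>2) / (4 * x\<^sup>2)\<bar> = \<bar>1 - \<alpha>\<^sup>2\<bar> / (4 * x\<^sup>2)" by simp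
      also have "\<dots> \<le> (1 + \<alpha>\<^sup>2) / (4 * c\<^sup>2)"
        using cx assms abs_triangle_ineq4[of 1 "\<alpha>\<^sup>2"] by (intro frac_le mult_left_mono power_mono) simp_all
      finally show ?thesis .
    qed
    ultimately show ?thesis unfolding potential_def K_def by linarith
  qed
  have "1 / sqrt K \<le> z - y"
    if m: "m \<ge> 1" and yz: "y \<in> zs m" "z \<in> zs m" "y < z" "c * real m \<le> y" for m y z
  proof -
    have ypos: "y > 0" using zs_pos yz by auto
    have uy: "u m y = 0" "u m z = 0" using yz by (auto simp: u_def zs_def)
    have cont: "continuous_on {y..z} (\<lambda>x. (u m x)\<^sup>2)"
      using ypos by (intro continuous_on_power, intro DERIV_continuous_on[where D="u' m"])
        (rule has_field_derivative_at_within[OF u_deriv], simp)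
    obtain s where s: "s \<in> {y..z}" "\<And>x. x \<in> {y..z} \<Longrightarrow> (u m x)\<^sup>2 \<le> (u m s)\<^sup>2"
      using continuous_attains_sup[OF compact_Icc _ cont] yz by auto
    have us: "u m s \<noteq> 0"
    proof
      assume "u m s = 0"
      then have "u m x = 0" if "x \<in> {y..z}" for x using s(2)[OF that] by simp
      moreover have "x powr ((\<alpha> + 1) / 2) * exp (- x / 2) \<noteq> 0" if "x \<in> {y..z}" for x
        using that ypos by auto
      ultimately have "{y..z} \<subseteq> zs m" by (auto simp: u_def zs_def)
      then have "finite {y..z}" using finite_subset[OF _ finite_zs] by blast
      then show False using yz infinite_Icc[of y z] by simp
    qed
    then have sI: "y < s" "s < z" using s(1) uy by (auto simp: less_le)
    have "((\<lambda>x. (u m x)\<^sup>2) has_real_derivative 2 * u m s * u' m s) (at s)"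
      using sI ypos by (auto intro!: derivative_eq_intros u_deriv)
    then have "2 * u m s * u' m s = 0"
      by (rule DERIV_local_max[of _ _ _ "min (s - y) (z - s)"]) (use sI in \<open>auto intro!: s(2) simp: abs_less_iff\<close>)
    then have u's: "u' m s = 0" using us by simp
    have u_le: "\<bar>u m x\<bar> \<le> \<bar>u m s\<bar>" if "x \<in> {y..z}" for x
      using s(2)[OF that] by (simp add: abs_le_square_iff)
    have u'_le: "\<bar>u' m x\<bar> \<le> K * \<bar>u m s\<bar> * (s - y)" if "y \<le> x" "x \<le> s" for x
    proof (cases "x = s")
      case False
      then have "x < s" using that by simp
      then have "\<exists>v>x. v < s \<and> u' m s - u' m x = (s - x) * (- potential m v * u m v)"
        by (rule MVT2) (use that ypos in \<open>intro u'_deriv, simp\<close>)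
      then obtain v where v: "v > x" "v < s" "u' m s - u' m x = (s - x) * (- potential m v * u m v)"
        by blast
      have "\<bar>u' m x\<bar> = (s - x) * (\<bar>potential m v\<bar> * \<bar>u m v\<bar>)"
        using v u's \<open>x < s\<close> by (simp add: abs_mult flip: abs_minus_cancel[of "u' m x"])
      also have "\<dots> \<le> (s - y) * (K * \<bar>u m s\<bar>)"
        using v that sI yz potential_le[OF m, of v] K
        by (intro mult_mono u_le) auto
      finally show ?thesis by (simp add: mult_ac)
    qed (use u's K sI in auto)
    have "\<exists>v>y. v < s \<and> u m s - u m y = (s - y) * u' m v"
      by (rule MVT2[OF sI(1)]) (use ypos in \<open>intro u_deriv, simp\<close>)
    then obtain v where v: "v > y" "v < s" "u m s - u m y = (s - y) * u' m v"
      by blast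
    have "\<bar>u m s\<bar> = (s - y) * \<bar>u' m v\<bar>" using v uy sI by (simp add: abs_mult)
    also have "\<dots> \<le> (s - y) * (K * \<bar>u m s\<bar> * (s - y))" using sI v by (intro mult_left_mono u'_le) auto
    finally have "\<bar>u m s\<bar> * 1 \<le> \<bar>u m s\<bar> * (K * (s - y)\<^sup>2)" by (simp add: power2_eq_square mult_ac)
    then have "1 \<le> K * (s - y)\<^sup>2" using us by (subst (asm) mult_le_cancel_left_pos) auto
    then have "sqrt 1 \<le> sqrt (K * (s - y)\<^sup>2)" by (rule real_sqrt_le_mono)
    then have "1 \<le> sqrt K * (s - y)" using sI by (simp add: real_sqrt_mult)
    then have "1 / sqrt K \<le> s - y" using K by (simp add: field_simps)
    then show ?thesis using sI by simp
  qed
  then show ?thesis using K by (intro exI[of _ "1 / sqrt K"]) auto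
qed

end

section \<open>Chebyshev polynomials and polynomial peaks\<close>

fun cheb :: "nat \<Rightarrow> real poly" where
  "cheb 0 = 1"
| "cheb (Suc 0) = [:0, 1:]"
| "cheb (Suc (Suc n)) = [:0, 2:] * cheb (Suc n) - cheb n"

lemma poly_cheb_rec: "poly (cheb (Suc (Suc n))) x = 2 * x * poly (cheb (Suc n)) x - poly (cheb n) x"
  by simp

lemma degree_cheb: "degree (cheb n) \<le> n"
proof (induction n rule: cheb.induct)
  case (3 n)
  have "degree ([:0, 2:] * cheb (Suc n)) \<le> 1 + Suc n"
    by (rule order.trans[OF degree_mult_le]) (use 3 in auto)
  then show ?case unfolding cheb.simps
    by (intro degree_diff_le) (use 3 in auto)
qed auto

lemma cheb_cos: "poly (cheb n) (cos x) = cos (n * x)"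
proof (induction n rule: cheb.induct)
  case (3 n)
  have "cos (Suc (Suc n) * x) + cos (n * x) = 2 * cos x * cos (Suc n * x)"
    using cos_plus_cos[of "Suc (Suc n) * x" "n * x"] by (simp add: algebra_simps add_divide_distrib)
  then show ?case using 3 unfolding poly_cheb_rec by simp
qed auto

lemma cheb_bounded:
  assumes "\<bar>y\<bar> \<le> 1"
  shows "\<bar>poly (cheb n) y\<bar> \<le> 1"
  using cheb_cos[of n "arccos y"] assms by (simp add: abs_le_iff cos_arccos)

text \<open>The square of \<open>n\<close> is the derivative of the Chebyshev polynomial at 1. The
  bound for consecutive differences is carried along because the recursion increases the difference
  by twice \<delta> times a value that is at least 1.\<close>

lemma cheb_growth:
  assumes "\<delta> \<ge> 0"
  shows "poly (cheb n) (1 + \<delta>) \<ge> 1 + (real n)\<^sup>2 * \<delta> \<and>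
    poly (cheb (Suc n)) (1 + \<delta>) - poly (cheb n) (1 + \<delta>) \<ge> (2 * n + 1) * \<delta>"
proof (induction n)
  case (Suc n)
  let ?T = "\<lambda>n. poly (cheb n) (1 + \<delta>)"
  have 1: "?T (Suc n) \<ge> 1 + (real (Suc n))\<^sup>2 * \<delta>"
    using Suc by (simp add: power2_eq_square algebra_simps)
  then have "?T (Suc n) \<ge> 1" using assms by (simp add: order.trans[rotated])
  then have "\<delta> \<le> \<delta> * ?T (Suc n)" using assms mult_left_mono[of 1 "?T (Suc n)" \<delta>] by simp
  moreover have "?T (Suc (Suc n)) - ?T (Suc n) = ?T (Suc n) - ?T n + 2 * (\<delta> * ?T (Suc n))"
    unfolding poly_cheb_rec by (simp add: algebra_simps)
  ultimately have "?T (Suc (Suc n)) - ?T (Suc n) \<ge> (2 * real (Suc n) + 1) * \<delta>"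
    using Suc by (simp add: algebra_simps)
  with 1 show ?case by blast
qed auto

lemma cheb_ge_1:
  assumes "y \<ge> 1"
  shows "poly (cheb n) y \<ge> 1"
proof -
  have "0 \<le> (real n)\<^sup>2 * (y - 1)" using assms by simp
  moreover have "1 + (real n)\<^sup>2 * (y - 1) \<le> poly (cheb n) (1 + (y - 1))"
    using cheb_growth[of "y - 1" n] assms by simp
  ultimately show ?thesis by simp
qed

lemma cheb_upper:
  assumes "y \<ge> 1"
  shows "poly (cheb n) y \<le> (2 * y) ^ n"
proof (induction n rule: cheb.induct)
  case (3 n)
  have "poly (cheb (Suc (Suc n))) y \<le> 2 * y * poly (cheb (Suc n)) y"
    unfolding poly_cheb_rec using cheb_ge_1[OF assms, of n] by simp
  also have "\<dots> \<le> 2 * y * (2 * y) ^ Suc n" using assms 3 by (intro mult_left_mono) auto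
  finally show ?case by simp
qed (use assms in auto)

lemma cheb_minus: "poly (cheb n) (- y) = (-1) ^ n * poly (cheb n) y"
  by (induction n rule: cheb.induct) (auto simp: algebra_simps)

text \<open>The polynomial \<open>1 - T\<^sub>N(2w - 1) / T\<^sub>N(-1 - 2/N\<^sup>2)\<close> vanishes at \<open>w = -1/N\<^sup>2\<close>; dividing out this
  zero leaves a polynomial comparable to \<open>1 / (N\<^sup>2 w + 1)\<close> on the unit interval.\<close>

lemma resolvent_poly:
  assumes "N \<ge> 1"
  obtains k :: "real poly" where "degree k \<le> N"
    "\<And>w. 0 \<le> w \<Longrightarrow> w \<le> 1 \<Longrightarrow> 2 / 3 * (1 / ((real N)\<^sup>2 * w + 1)) \<le> poly k w"
    "\<And>w. 0 \<le> w \<Longrightarrow> w \<le> 1 \<Longrightarrow> poly k w \<le> 4 / 3 * (1 / ((real N)\<^sup>2 * w + 1))"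
    "\<And>w W. 0 \<le> w \<Longrightarrow> w \<le> W \<Longrightarrow> 1 \<le> W \<Longrightarrow> \<bar>poly k w\<bar> \<le> (4 * W) ^ N"
proof -
  define T0 where "T0 = poly (cheb N) (-1 - 2 / (real N)\<^sup>2)"
  have N: "real N \<ge> 1" using assms by simp
  have "poly (cheb N) (1 + 2 / (real N)\<^sup>2) \<ge> 1 + (real N)\<^sup>2 * (2 / (real N)\<^sup>2)"
    using cheb_growth[of "2 / (real N)\<^sup>2" N] by simp
  then have "poly (cheb N) (1 + 2 / (real N)\<^sup>2) \<ge> 3" using N by simp
  moreover have "\<bar>T0\<bar> = \<bar>poly (cheb N) (1 + 2 / (real N)\<^sup>2)\<bar>"
    unfolding T0_def using cheb_minus[of N "1 + 2 / (real N)\<^sup>2"] by (simp add: abs_mult)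
  \<comment> \<open>The value 3 makes the perturbation by the Chebyshev quotient at most 1/3 on the
    unit interval; this is the origin of the constants 2/3 and 4/3.\<close>
  ultimately have T0: "\<bar>T0\<bar> \<ge> 3" by linarith
  define num where "num = 1 - smult (1 / T0) (pcompose (cheb N) [:-1, 2:])"
  have num: "poly num w = 1 - poly (cheb N) (2 * w - 1) / T0" for w
    by (simp add: num_def poly_pcompose algebra_simps)
  have "poly num (- 1 / (real N)\<^sup>2) = 0"
  proof -
    have "2 * (- 1 / (real N)\<^sup>2) - 1 = -1 - 2 / (real N)\<^sup>2" by simp
    then show ?thesis unfolding num using T0 by (simp only: T0_def[symmetric]) simp
  qed
  then have "[:- (- 1 / (real N)\<^sup>2), 1:] dvd num" by (simp only: poly_eq_0_iff_dvd)
  then obtain k0 where k0: "num = [:1 / (real N)\<^sup>2, 1:] * k0" by (auto elim!: dvdE)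
  define k where "k = smult (1 / (real N)\<^sup>2) k0"
  have k: "poly k w = (1 - poly (cheb N) (2 * w - 1) / T0) * (1 / ((real N)\<^sup>2 * w + 1))" if "w \<ge> 0" for w
  proof -
    have pos: "(real N)\<^sup>2 * w + 1 > 0" using that by (intro add_nonneg_pos) auto
    have "poly num w = (1 / (real N)\<^sup>2 + w) * poly k0 w" by (simp add: k0 algebra_simps)
    also have "\<dots> = ((real N)\<^sup>2 * w + 1) * poly k w" using N by (simp add: k_def field_simps)
    finally show ?thesis using pos by (simp add: num field_simps)
  qed
  have "degree num \<le> N"
    unfolding num_def using degree_cheb[of N]
    by (intro degree_diff_le) (auto intro!: order.trans[OF degree_smult_le] simp: degree_pcompose)
  moreover have "num \<noteq> 0"
  proof
    assume "num = 0"
    then have "poly (cheb N) (2 * 1 - 1) = T0" using num[of 1] T0 by auto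
    then show False using cheb_bounded[of 1 N] T0 by simp
  qed
  ultimately have "degree k \<le> N"
    using k0 by (auto simp: k_def degree_mult_eq simp del: mult_pCons_left)
  moreover have "2 / 3 * (1 / ((real N)\<^sup>2 * w + 1)) \<le> poly k w \<and> poly k w \<le> 4 / 3 * (1 / ((real N)\<^sup>2 * w + 1))"
    if "0 \<le> w" "w \<le> 1" for w
  proof -
    have "\<bar>poly (cheb N) (2 * w - 1) / T0\<bar> \<le> 1 / 3"
      unfolding abs_divide using cheb_bounded[of "2 * w - 1" N] that T0 by (intro frac_le) auto
    then have "2 / 3 \<le> 1 - poly (cheb N) (2 * w - 1) / T0" "1 - poly (cheb N) (2 * w - 1) / T0 \<le> 4 / 3"
      by linarith+
    then show ?thesis unfolding k[OF that(1)] using that by (intro conjI mult_right_mono) auto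
  qed
  moreover have "\<bar>poly k w\<bar> \<le> (4 * W) ^ N" if "0 \<le> w" "w \<le> W" "1 \<le> W" for w W
  proof -
    have W: "4 \<le> (4 * W) ^ N"
      using that N self_le_power[of "4 * W" N] by auto
    have "\<bar>poly (cheb N) (2 * w - 1)\<bar> \<le> (4 * W) ^ N"
    proof (cases "w \<le> 1")
      case True
      then have "\<bar>2 * w - 1\<bar> \<le> 1" using that by (simp add: abs_le_iff)
      from cheb_bounded[OF this, of N] W show ?thesis by linarith
    next
      case False
      then have "\<bar>poly (cheb N) (2 * w - 1)\<bar> \<le> (2 * (2 * w - 1)) ^ N"
        using cheb_upper[of "2 * w - 1" N] cheb_ge_1[of "2 * w - 1" N] by simp
      also have "\<dots> \<le> (4 * W) ^ N" using that False by (intro power_mono) auto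
      finally show ?thesis .
    qed
    then have "\<bar>poly (cheb N) (2 * w - 1) / T0\<bar> \<le> (4 * W) ^ N / 3"
      unfolding abs_divide using T0 by (intro frac_le) auto
    then have *: "\<bar>1 - poly (cheb N) (2 * w - 1) / T0\<bar> \<le> (4 * W) ^ N" using W by linarith
    have "\<bar>poly k w\<bar> = \<bar>1 - poly (cheb N) (2 * w - 1) / T0\<bar> * (1 / ((real N)\<^sup>2 * w + 1))"
      unfolding k[OF that(1)] abs_mult using that by simp
    also have "\<dots> \<le> (4 * W) ^ N * 1"
      using * that by (intro mult_mono) (auto simp: divide_le_eq)
    finally show ?thesis by simp
  qed
  ultimately show ?thesis using that by blast
qed

text \<open>Symmetrising a polynomial in y = sqrt z leaves only even powers, hence a polynomial in z
  of half the degree.\<close>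

lemma even_part_poly:
  fixes g :: "real poly"
  obtains e where "2 * degree e \<le> degree g" "\<And>y. poly e (y\<^sup>2) = poly g y + poly g (- y)"
proof -
  define e where "e = (\<Sum>i\<le>degree g div 2. monom (2 * coeff g (2 * i)) i)"
  have "degree e \<le> degree g div 2"
    unfolding e_def by (intro degree_sum_le) (auto intro: order.trans[OF degree_monom_le])
  moreover have "poly e (y\<^sup>2) = poly g y + poly g (- y)" for y
  proof -
    have "poly g y + poly g (- y) = (\<Sum>i\<le>degree g. coeff g i * (y ^ i + (- y) ^ i))"
      by (simp add: poly_altdef sum.distrib distrib_left)
    also have "\<dots> = (\<Sum>i\<in>{i. i \<le> degree g \<and> even i}. coeff g i * (y ^ i + (- y) ^ i))"
      by (rule sum.mono_neutral_right) auto
    also have "\<dots> = (\<Sum>i\<le>degree g div 2. coeff g (2 * i) * (2 * (y\<^sup>2) ^ i))"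
      by (rule sum.reindex_bij_witness[of _ "\<lambda>i. 2 * i" "\<lambda>i. i div 2"]) (auto simp: power_mult)
    finally show ?thesis by (simp add: e_def poly_sum poly_monom mult.assoc mult.left_commute)
  qed
  ultimately show ?thesis using that[of e] by fastforce
qed

text \<open>A Lorentz profile in sqrt z with centre \<tau> and width \<eta>. In the variable z it is
  centred at \<tau>^2 and its width is of order \<tau> \<eta>.\<close>

definition peak :: "real \<Rightarrow> real \<Rightarrow> real \<Rightarrow> real" where
  "peak \<tau> \<eta> z = \<eta>\<^sup>2 / ((sqrt z - \<tau>)\<^sup>2 + \<eta>\<^sup>2)"

text \<open>Powers of the resolvent polynomial at \<open>\<surd>z - \<tau>\<close> and \<open>\<surd>z + \<tau>\<close> are added, so that only even powers
  of \<open>\<surd>z\<close> survive.\<close>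

lemma peak_poly:
  assumes "N \<ge> 1" "B > 0" "\<tau> \<ge> 0" "even q"
  obtains Q :: "real poly" where "degree Q \<le> N * q"
    "\<And>z. 0 \<le> z \<Longrightarrow> (sqrt z + \<tau>)\<^sup>2 \<le> B\<^sup>2 \<Longrightarrow> (2 / 3) ^ q * peak \<tau> (B / N) z ^ q \<le> poly Q z"
    "\<And>z. 0 \<le> z \<Longrightarrow> (sqrt z + \<tau>)\<^sup>2 \<le> B\<^sup>2 \<Longrightarrow> poly Q z \<le> 2 * (4 / 3) ^ q * peak \<tau> (B / N) z ^ q"
    "\<And>z. 0 \<le> z \<Longrightarrow> 0 \<le> poly Q z"
    "\<And>z W. 0 \<le> z \<Longrightarrow> 1 \<le> W \<Longrightarrow> (sqrt z + \<tau>)\<^sup>2 \<le> B\<^sup>2 * W \<Longrightarrow> poly Q z \<le> 2 * (4 * W) ^ (N * q)"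
proof -
  obtain k where k: "degree k \<le> N"
    "\<And>w. 0 \<le> w \<Longrightarrow> w \<le> 1 \<Longrightarrow> 2 / 3 * (1 / ((real N)\<^sup>2 * w + 1)) \<le> poly k w"
    "\<And>w. 0 \<le> w \<Longrightarrow> w \<le> 1 \<Longrightarrow> poly k w \<le> 4 / 3 * (1 / ((real N)\<^sup>2 * w + 1))"
    "\<And>w W. 0 \<le> w \<Longrightarrow> w \<le> W \<Longrightarrow> 1 \<le> W \<Longrightarrow> \<bar>poly k w\<bar> \<le> (4 * W) ^ N"
    using resolvent_poly[OF assms(1)] by blast
  define \<kappa> where "\<kappa> = (\<lambda>v. poly k (v\<^sup>2 / B\<^sup>2))"
  define g where "g = pcompose (k ^ q) [:\<tau>\<^sup>2 / B\<^sup>2, - 2 * \<tau> / B\<^sup>2, 1 / B\<^sup>2:]"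
  have g: "poly g y = \<kappa> (y - \<tau>) ^ q" for y
  proof -
    have "\<tau>\<^sup>2 / B\<^sup>2 + y * (- 2 * \<tau> / B\<^sup>2 + y * (1 / B\<^sup>2)) = (y - \<tau>)\<^sup>2 / B\<^sup>2"
      by (simp add: power2_eq_square add_divide_distrib diff_divide_distrib algebra_simps)
    then show ?thesis by (simp add: g_def \<kappa>_def poly_pcompose)
  qed
  obtain Q where Q: "2 * degree Q \<le> degree g" "\<And>y. poly Q (y\<^sup>2) = poly g y + poly g (- y)"
    using even_part_poly[of g] by blast
  have Qz: "poly Q z = \<kappa> (sqrt z - \<tau>) ^ q + \<kappa> (sqrt z + \<tau>) ^ q" if "z \<ge> 0" for z
  proof -
    have "(- sqrt z - \<tau>)\<^sup>2 = (sqrt z + \<tau>)\<^sup>2" by (simp add: power2_eq_square algebra_simps)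
    then have "\<kappa> (- sqrt z - \<tau>) = \<kappa> (sqrt z + \<tau>)" by (simp add: \<kappa>_def)
    then show ?thesis using Q(2)[of "sqrt z"] that by (simp add: g)
  qed
  have le: "(sqrt z - \<tau>)\<^sup>2 \<le> (sqrt z + \<tau>)\<^sup>2" if "z \<ge> 0" for z
    using that assms by (simp add: power2_eq_square algebra_simps)
  \<comment> \<open>An even exponent gives nonnegativity even where the resolvent polynomial is not
    controlled.\<close>
  have \<kappa>_nonneg: "\<kappa> v ^ q \<ge> 0" for v using assms(4) by (simp add: zero_le_even_power)
  have \<kappa>_bd: "2 / 3 * ((B / N)\<^sup>2 / (v\<^sup>2 + (B / N)\<^sup>2)) \<le> \<kappa> v \<and> \<kappa> v \<le> 4 / 3 * ((B / N)\<^sup>2 / (v\<^sup>2 + (B / N)\<^sup>2))"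
    if "v\<^sup>2 \<le> B\<^sup>2" for v
  proof -
    have "1 / ((real N)\<^sup>2 * (v\<^sup>2 / B\<^sup>2) + 1) = (B / N)\<^sup>2 / (v\<^sup>2 + (B / N)\<^sup>2)"
    proof -
      have "(B / N)\<^sup>2 > 0" using assms by simp
      then have "(B / N)\<^sup>2 / (v\<^sup>2 + (B / N)\<^sup>2) = 1 / ((v\<^sup>2 + (B / N)\<^sup>2) / (B / N)\<^sup>2)" by simp
      also have "(v\<^sup>2 + (B / N)\<^sup>2) / (B / N)\<^sup>2 = v\<^sup>2 / (B / N)\<^sup>2 + 1"
        using assms by (simp add: add_divide_distrib)
      also have "v\<^sup>2 / (B / N)\<^sup>2 = (real N)\<^sup>2 * (v\<^sup>2 / B\<^sup>2)" by (simp add: power_divide)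
      finally show ?thesis by simp
    qed
    then show ?thesis
      unfolding \<kappa>_def using k(2)[of "v\<^sup>2 / B\<^sup>2"] k(3)[of "v\<^sup>2 / B\<^sup>2"] that assms by simp
  qed
  show ?thesis
  proof (rule that[of Q])
    have "degree g \<le> degree (k ^ q) * degree [:\<tau>\<^sup>2 / B\<^sup>2, - 2 * \<tau> / B\<^sup>2, 1 / B\<^sup>2:]"
      unfolding g_def by (simp only: degree_pcompose)
    also have "\<dots> \<le> (N * q) * 2"
    proof (rule mult_mono)
      show "degree (k ^ q) \<le> N * q"
        using k(1) by (intro order.trans[OF degree_power_le]) auto
    qed auto
    finally show "degree Q \<le> N * q" using Q(1) by linarith
  next
    fix z :: real assume z: "0 \<le> z" "(sqrt z + \<tau>)\<^sup>2 \<le> B\<^sup>2"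
    have z2: "(sqrt z - \<tau>)\<^sup>2 \<le> B\<^sup>2" using le[OF z(1)] z(2) by simp
    have peak0: "peak \<tau> (B / N) z \<ge> 0" by (simp add: peak_def)
    have "(2 / 3) ^ q * peak \<tau> (B / N) z ^ q \<le> \<kappa> (sqrt z - \<tau>) ^ q"
      unfolding power_mult_distrib[symmetric] using \<kappa>_bd[OF z2] peak0
      by (intro power_mono) (auto simp: peak_def)
    then show "(2 / 3) ^ q * peak \<tau> (B / N) z ^ q \<le> poly Q z"
      unfolding Qz[OF z(1)] using \<kappa>_nonneg[of "sqrt z + \<tau>"] by linarith
    have 1: "\<kappa> (sqrt z - \<tau>) ^ q \<le> (4 / 3 * peak \<tau> (B / N) z) ^ q"
      using \<kappa>_bd[OF z2] by (intro power_mono order.trans[OF _ conjunct1[OF \<kappa>_bd[OF z2]]]) (auto simp: peak_def)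
    \<comment> \<open>The second summand is centred at -\<tau>, farther away than \<tau> because
      sqrt z and \<tau> are nonnegative. The same peak dominates it, at the cost of a factor
      2.\<close>
    have "\<kappa> (sqrt z + \<tau>) \<le> 4 / 3 * ((B / N)\<^sup>2 / ((sqrt z + \<tau>)\<^sup>2 + (B / N)\<^sup>2))" using \<kappa>_bd[OF z(2)] by simp
    also have "\<dots> \<le> 4 / 3 * peak \<tau> (B / N) z"
      unfolding peak_def using le[OF z(1)] assms
      by (intro mult_left_mono divide_left_mono mult_pos_pos add_nonneg_pos) auto
    finally have 2: "\<kappa> (sqrt z + \<tau>) ^ q \<le> (4 / 3 * peak \<tau> (B / N) z) ^ q"
      by (intro power_mono order.trans[OF _ conjunct1[OF \<kappa>_bd[OF z(2)]]]) auto
    show "poly Q z \<le> 2 * (4 / 3) ^ q * peak \<tau> (B / N) z ^ q"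
      unfolding Qz[OF z(1)] using add_mono[OF 1 2] unfolding power_mult_distrib by (simp add: mult_ac)
  next
    fix z :: real assume "0 \<le> z"
    then show "0 \<le> poly Q z" by (simp add: Qz \<kappa>_nonneg)
  next
    fix z W :: real assume z: "0 \<le> z" "1 \<le> W" "(sqrt z + \<tau>)\<^sup>2 \<le> B\<^sup>2 * W"
    have *: "\<kappa> v ^ q \<le> (4 * W) ^ (N * q)" if "v\<^sup>2 \<le> B\<^sup>2 * W" for v
    proof -
      have "\<kappa> v ^ q = \<bar>\<kappa> v\<bar> ^ q" using assms(4) by (simp add: power_even_abs)
      also have "\<dots> \<le> ((4 * W) ^ N) ^ q"
        unfolding \<kappa>_def using that z(2) assms by (intro power_mono k(4)) (auto simp: field_simps)
      finally show ?thesis by (simp add: power_mult)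
    qed
    show "poly Q z \<le> 2 * (4 * W) ^ (N * q)"
      unfolding Qz[OF z(1)] using *[of "sqrt z - \<tau>"] *[of "sqrt z + \<tau>"] z le[OF z(1)] by linarith
  qed
qed

lemma poly_antiderivative:
  fixes D :: "real poly"
  obtains F where "pderiv F = D" "poly F 0 = 0" "degree F \<le> degree D + 1"
proof -
  define F where "F = (\<Sum>i\<le>degree D. monom (coeff D i / (i + 1)) (i + 1))"
  have "coeff F (Suc i) = coeff D i / (i + 1)" for i
    by (auto simp: F_def coeff_sum coeff_monom coeff_eq_0 if_distrib cong: if_cong)
  then have "pderiv F = D"
    by (intro poly_eqI) (auto simp: coeff_pderiv add.commute)
  moreover have "poly F 0 = 0" by (simp add: F_def poly_sum poly_monom)
  moreover have "degree F \<le> degree D + 1"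
    unfolding F_def by (intro degree_sum_le) (auto intro: order.trans[OF degree_monom_le])
  ultimately show ?thesis using that by blast
qed

text \<open>Stands for integrating an inequality between derivatives: below, \<open>F\<close> is a
  polynomial antiderivative and \<open>G\<close> an explicit antiderivative of a majorant.\<close>

lemma deriv_le_imp_diff_le:
  fixes F G :: "real \<Rightarrow> real"
  assumes "a \<le> b"
    and "\<And>x. a \<le> x \<Longrightarrow> x \<le> b \<Longrightarrow> (F has_real_derivative F' x) (at x)"
    and "\<And>x. a \<le> x \<Longrightarrow> x \<le> b \<Longrightarrow> (G has_real_derivative G' x) (at x)"
    and "\<And>x. a \<le> x \<Longrightarrow> x \<le> b \<Longrightarrow> F' x \<le> G' x"
  shows "F b - F a \<le> G b - G a"
proof -
  have "G a - F a \<le> G b - F b"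
  proof (rule DERIV_nonneg_imp_nondecreasing[OF assms(1)])
    fix x assume "a \<le> x" "x \<le> b"
    then show "\<exists>y. ((\<lambda>x. G x - F x) has_real_derivative y) (at x) \<and> 0 \<le> y"
      using assms(2-4)[of x] by (intro exI[of _ "G' x - F' x"]) (auto intro!: DERIV_diff)
  qed
  then show ?thesis by simp
qed

section \<open>Polynomial approximation of truncated powers\<close>

text \<open>The peak sits at \<open>t\<close>, the square of \<tau>, and \<open>h\<close> is its
  width in the variable z. The bound of \<eta> by \<open>C1\<close> times \<tau> keeps
  \<open>h\<close> below a multiple of \<open>t\<close>, that is, the peak does not reach far beyond
  the origin.\<close>

locale peak_setup =
  fixes \<tau> \<eta> C1 :: real
  assumes \<tau>: "\<tau> > 0" and \<eta>: "\<eta> > 0" and C1: "C1 \<ge> 1" and \<eta>_le: "\<eta> \<le> C1 * \<tau>"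
begin

definition t :: real where "t = \<tau>\<^sup>2"
definition h :: real where "h = \<tau> * \<eta>"
definition K :: real where "K = 4 * C1 + 8"
abbreviation \<theta> :: "real \<Rightarrow> real" where "\<theta> \<equiv> peak \<tau> \<eta>"

lemma t_pos: "t > 0" and h_pos: "h > 0" and K_pos: "K > 0"
  using \<tau> \<eta> C1 by (auto simp: t_def h_def K_def)

lemma h_le_t: "h \<le> C1 * t"
  using \<eta>_le \<tau> by (simp add: h_def t_def power2_eq_square)

lemma sqrt_t: "sqrt t = \<tau>"
  using \<tau> by (simp add: t_def)

lemma peak_pos: "\<theta> z > 0"
  unfolding peak_def using \<eta> by (intro divide_pos_pos add_nonneg_pos) auto

lemma peak_le_1: "\<theta> z \<le> 1"
  unfolding peak_def using \<eta> by (simp add: divide_le_eq add_nonneg_pos)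

lemma sqrt_diff:
  assumes "z \<ge> 0"
  shows "(sqrt z - \<tau>) * (sqrt z + \<tau>) = z - t"
  using assms by (simp add: t_def algebra_simps power2_eq_square)

text \<open>With v = |z - t| one has v^2 = (sqrt z - \<tau>)^2 (sqrt z + \<tau>)^2, and the last
  factor is at most 2v + 4t. So for v > h the peak times v^2 is at most \<eta>^2 (2v + 4t), which is
  of order h v. In z the decay is therefore of first order only, and higher powers of the peak are
  needed for integrability.\<close>

lemma peak_le:
  assumes "z \<ge> 0"
  shows "\<theta> z \<le> K * h / (\<bar>z - t\<bar> + h)"
proof -
  define v where "v = \<bar>z - t\<bar>"
  show ?thesis
  proof (cases "v \<le> h")
    case True
    have "2 * h \<le> K * h" using h_pos C1 by (intro mult_right_mono) (auto simp: K_def)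
    then have "v + h \<le> K * h" using True by simp
    then have "1 \<le> K * h / (v + h)" using h_pos by (simp add: v_def le_divide_eq add_nonneg_pos)
    then show ?thesis using peak_le_1[of z] unfolding v_def by linarith
  next
    case False
    then have v: "v > h" "v > 0" using h_pos by auto
    have sq: "(sqrt z + \<tau>)\<^sup>2 \<le> 2 * v + 4 * t"
    proof -
      have "(sqrt z + \<tau>)\<^sup>2 \<le> 2 * (sqrt z)\<^sup>2 + 2 * \<tau>\<^sup>2"
        using zero_le_power2[of "sqrt z - \<tau>"] by (simp add: power2_eq_square algebra_simps)
      also have "\<dots> \<le> 2 * v + 4 * t"
      proof -
        have "z \<le> v + t" by (simp add: v_def)
        then show ?thesis using assms by (simp add: t_def)
      qed
      finally show ?thesis .
    qed
    have "v\<^sup>2 = (sqrt z - \<tau>)\<^sup>2 * (sqrt z + \<tau>)\<^sup>2"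
      unfolding v_def power2_abs sqrt_diff[OF assms, symmetric] by (rule power_mult_distrib)
    then have v2: "v\<^sup>2 \<le> (sqrt z - \<tau>)\<^sup>2 * (2 * v + 4 * t)"
      using sq by (simp add: mult_left_mono)
    have d0: "2 * v + 4 * t > 0" using v t_pos by simp
    have "\<theta> z * v\<^sup>2 \<le> \<theta> z * ((sqrt z - \<tau>)\<^sup>2 * (2 * v + 4 * t))"
      using v2 peak_pos[of z] by (intro mult_left_mono) auto
    also have "\<dots> = (\<theta> z * (sqrt z - \<tau>)\<^sup>2) * (2 * v + 4 * t)" by simp
    also have "\<theta> z * (sqrt z - \<tau>)\<^sup>2 \<le> \<eta>\<^sup>2"
      unfolding peak_def using \<eta> by (simp add: divide_le_eq add_nonneg_pos mult_left_mono)
    also have "\<eta>\<^sup>2 * (2 * v + 4 * t) = 2 * \<eta>\<^sup>2 * v + 4 * h\<^sup>2"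
      by (simp add: h_def t_def power2_eq_square algebra_simps)
    also have "\<dots> \<le> 2 * (C1 * h) * v + 4 * (h * v)"
    proof (intro add_mono mult_mono mult_right_mono mult_left_mono)
      show "\<eta>\<^sup>2 \<le> C1 * h" using \<eta>_le \<eta> mult_left_mono[of \<eta> "C1 * \<tau>" \<eta>] by (simp add: h_def power2_eq_square mult_ac)
      show "h\<^sup>2 \<le> h * v" using v h_pos by (simp add: power2_eq_square)
    qed (use v C1 h_pos in auto)
    also have "\<dots> = (2 * C1 + 4) * h * v" by (simp add: algebra_simps)
    finally have "\<theta> z * v * v \<le> ((2 * C1 + 4) * h) * v" using d0 by (simp add: power2_eq_square mult.assoc mult_right_mono)
    then have "\<theta> z * v \<le> (2 * C1 + 4) * h" using v by (simp only: mult_le_cancel_right_pos)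
    moreover have "\<theta> z * (v + h) \<le> \<theta> z * (2 * v)" using v peak_pos[of z] by (intro mult_left_mono) auto
    ultimately have "\<theta> z * (v + h) \<le> K * h" by (simp add: K_def algebra_simps)
    then show ?thesis using v h_pos unfolding v_def by (simp add: le_divide_eq add_nonneg_pos)
  qed
qed

lemma peak_sq_le:
  assumes "z \<ge> 0"
  shows "\<theta> z ^ 2 \<le> K\<^sup>2 * (h\<^sup>2 / (\<bar>z - t\<bar> + h)\<^sup>2)"
  using power_mono[OF peak_le[OF assms], of 2] peak_pos[of z] by (simp add: power_divide power_mult_distrib)

lemma abs_diff_le_peak:
  assumes "z \<ge> 0"
  shows "\<bar>t - z\<bar> \<le> K * h / \<theta> z"
proof -
  have "\<theta> z * (\<bar>z - t\<bar> + h) \<le> K * h"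
    using peak_le[OF assms] h_pos by (simp add: le_divide_eq add_nonneg_pos)
  moreover have "\<theta> z * \<bar>z - t\<bar> \<le> \<theta> z * (\<bar>z - t\<bar> + h)"
    using peak_pos[of z] h_pos by (intro mult_left_mono) auto
  ultimately have "\<theta> z * \<bar>t - z\<bar> \<le> K * h" by (simp add: abs_minus_commute)
  then show ?thesis using peak_pos[of z] by (simp add: le_divide_eq mult.commute)
qed

lemma peak_antimono_denom:
  assumes "(sqrt y - \<tau>)\<^sup>2 \<le> (sqrt z - \<tau>)\<^sup>2"
  shows "\<theta> z \<le> \<theta> y"
  unfolding peak_def using assms \<eta> by (intro divide_left_mono mult_pos_pos add_nonneg_pos) auto

lemma peak_mono_left:
  assumes "0 \<le> z" "z \<le> y" "y \<le> t"
  shows "\<theta> z \<le> \<theta> y"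
proof (rule peak_antimono_denom)
  have "sqrt z \<le> sqrt y" "sqrt y \<le> sqrt t" using assms by auto
  then have "(\<tau> - sqrt y)\<^sup>2 \<le> (\<tau> - sqrt z)\<^sup>2" unfolding sqrt_t by (intro power_mono) auto
  then show "(sqrt y - \<tau>)\<^sup>2 \<le> (sqrt z - \<tau>)\<^sup>2" by (simp only: power2_commute)
qed

lemma peak_mono_right:
  assumes "t \<le> y" "y \<le> z"
  shows "\<theta> z \<le> \<theta> y"
proof (rule peak_antimono_denom)
  have "sqrt t \<le> sqrt y" "sqrt y \<le> sqrt z" using assms by auto
  then show "(sqrt y - \<tau>)\<^sup>2 \<le> (sqrt z - \<tau>)\<^sup>2" unfolding sqrt_t by (intro power_mono) auto
qed

text \<open>At distance at least 1 from \<open>t\<close>, moving right by v increases sqrt z -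
  \<tau> at most by the factor 1 + v. The peak thus decays polynomially in v, which the exponential
  gain of \<open>R\<close> will outweigh.\<close>

lemma peak_decay:
  assumes "t + 1 \<le> z" "z \<le> y"
  shows "\<theta> z \<le> \<theta> y * (1 + (y - z))\<^sup>2"
proof -
  define a b where "a = sqrt z" and "b = sqrt y"
  have z0: "z \<ge> 0" "y \<ge> 0" using assms t_pos by auto
  have ab: "\<tau> < a" "a \<le> b"
  proof -
    have "sqrt t < sqrt z" "sqrt z \<le> sqrt y" using assms by auto
    then show "\<tau> < a" "a \<le> b" by (simp_all add: a_def b_def sqrt_t)
  qed
  have za: "z = a\<^sup>2" "y = b\<^sup>2" using z0 by (auto simp: a_def b_def)
  have "(a - \<tau>) * (a + \<tau>) \<ge> 1" using sqrt_diff[OF z0(1)] assms by (simp add: a_def)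
  also have "(a - \<tau>) * (a + \<tau>) \<le> (a - \<tau>) * (b + a)" using ab by (intro mult_left_mono) auto
  finally have "1 \<le> (a - \<tau>) * (b + a)" .
  then have "(b - a) * 1 \<le> (b - a) * ((a - \<tau>) * (b + a))" using ab by (intro mult_left_mono) auto
  also have "\<dots> = (a - \<tau>) * (y - z)" by (simp add: za power2_eq_square algebra_simps)
  finally have "b - \<tau> \<le> (a - \<tau>) * (1 + (y - z))" by (simp add: algebra_simps)
  then have "(b - \<tau>)\<^sup>2 \<le> (a - \<tau>)\<^sup>2 * (1 + (y - z))\<^sup>2"
    using power_mono[of "b - \<tau>" "(a - \<tau>) * (1 + (y - z))" 2] ab by (simp add: power_mult_distrib)
  moreover have "\<eta>\<^sup>2 * 1 \<le> \<eta>\<^sup>2 * (1 + (y - z))\<^sup>2"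
    using assms by (intro mult_left_mono) auto
  ultimately have "(b - \<tau>)\<^sup>2 + \<eta>\<^sup>2 \<le> ((a - \<tau>)\<^sup>2 + \<eta>\<^sup>2) * (1 + (y - z))\<^sup>2"
    by (simp add: distrib_right)
  then have "\<eta>\<^sup>2 * ((b - \<tau>)\<^sup>2 + \<eta>\<^sup>2) \<le> \<eta>\<^sup>2 * (((a - \<tau>)\<^sup>2 + \<eta>\<^sup>2) * (1 + (y - z))\<^sup>2)"
    by (intro mult_left_mono) auto
  moreover have "(a - \<tau>)\<^sup>2 + \<eta>\<^sup>2 > 0" "(b - \<tau>)\<^sup>2 + \<eta>\<^sup>2 > 0" using \<eta> by (auto intro!: add_nonneg_pos)
  ultimately show ?thesis
    unfolding peak_def a_def[symmetric] b_def[symmetric] by (simp add: field_simps)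
qed

text \<open>Within distance \<open>h\<close> to the right of \<open>t\<close>, sqrt z differs from
  \<tau> by at most \<eta>/2, and 1 / (1/4 + 1) = 4/5.\<close>

lemma peak_near:
  assumes "t \<le> z" "z \<le> t + h"
  shows "4 / 5 \<le> \<theta> z"
proof -
  have z0: "z \<ge> 0" using assms t_pos by auto
  have "\<tau> \<le> sqrt z" using assms by (metis real_sqrt_le_mono sqrt_t)
  then have "(sqrt z - \<tau>) * (2 * \<tau>) \<le> (sqrt z - \<tau>) * (sqrt z + \<tau>)"
    by (intro mult_left_mono) auto
  also have "\<dots> \<le> \<eta> * \<tau>" using assms unfolding sqrt_diff[OF z0] by (simp add: h_def mult.commute)
  finally have "(2 * (sqrt z - \<tau>)) * \<tau> \<le> \<eta> * \<tau>" by (simp add: algebra_simps)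
  then have "2 * (sqrt z - \<tau>) \<le> \<eta>" using \<tau> by (simp only: mult_le_cancel_right_pos)
  then have "(2 * (sqrt z - \<tau>))\<^sup>2 \<le> \<eta>\<^sup>2" using \<open>\<tau> \<le> sqrt z\<close> by (intro power_mono) auto
  then have "4 * ((sqrt z - \<tau>)\<^sup>2 + \<eta>\<^sup>2) \<le> 5 * \<eta>\<^sup>2" unfolding power_mult_distrib by simp
  moreover have "(sqrt z - \<tau>)\<^sup>2 + \<eta>\<^sup>2 > 0" using \<eta> by (auto intro!: add_nonneg_pos)
  ultimately show ?thesis unfolding peak_def by (simp add: field_simps)
qed

end

text \<open>With c the maximum of 1 and n/k one has 1 + v \<le> c (1 + k v / n) \<le> c exp (k v /
  n), and the n-th power is the claim; the constant does not depend on \<open>v\<close>.\<close>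

lemma one_plus_power_le_exp:
  fixes k v :: real
  assumes "k > 0" "v \<ge> 0"
  shows "(1 + v) ^ n \<le> (max 1 (n / k)) ^ n * exp (k * v)"
proof (cases "n = 0")
  case True
  then show ?thesis using assms by simp
next
  case False
  then have n: "real n > 0" by simp
  define c where "c = max 1 (n / k)"
  have c: "c \<ge> 1" "c \<ge> n / k" by (auto simp: c_def)
  have "v = (n / k) * (k * v / n)" using n assms by simp
  also have "\<dots> \<le> c * (k * v / n)" using c assms n by (intro mult_right_mono) auto
  finally have "1 + v \<le> c * (1 + k * v / n)" using c by (simp add: distrib_left)
  also have "\<dots> \<le> c * exp (k * v / n)" using c exp_ge_add_one_self by (intro mult_left_mono) auto
  finally have "(1 + v) ^ n \<le> (c * exp (k * v / n)) ^ n" using assms by (intro power_mono) auto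
  also have "\<dots> = c ^ n * exp (k * v)"
    using n by (simp add: power_mult_distrib flip: exp_of_nat_mult)
  finally show ?thesis by (simp add: c_def)
qed

text \<open>Data for a polynomial step at \<open>t\<close>. \<open>Q\<close> copies the
  \<open>q\<close>-th power of the peak up to constants on [0, X]; beyond \<open>X\<close> only its
  growth of order \<open>J\<close> is known. \<open>L\<close> is the degree of the exponential
  substitute, and X \<le> Ar * L keeps the relative growth of that substitute bounded below on
  [0, X].\<close>

locale step_approx = peak_setup +
  fixes L q J :: nat and X Ar cQ cq :: real and Q :: "real poly"
  assumes tL: "t < L" and X: "t + 1 \<le> X" "X \<le> Ar * L" and h1: "h \<le> 1" and q: "q \<ge> 2"
    and cQ: "cQ > 0" "cq > 0"
    and Q_upper: "\<And>z. 0 \<le> z \<Longrightarrow> z \<le> X \<Longrightarrow> poly Q z \<le> cQ * \<theta> z ^ q"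
    and Q_lower: "\<And>z. 0 \<le> z \<Longrightarrow> z \<le> X \<Longrightarrow> cq * \<theta> z ^ q \<le> poly Q z"
    and Q_nonneg: "\<And>z. 0 \<le> z \<Longrightarrow> 0 \<le> poly Q z"
    and Q_tail: "\<And>z y. 0 \<le> z \<Longrightarrow> z \<le> y \<Longrightarrow> X \<le> y \<Longrightarrow> poly Q z \<le> 2 * (4 * (y / X)) ^ J"
begin

text \<open>A polynomial substitute for \<open>exp (z - t)\<close>: it never exceeds the exponential on the half line.\<close>

definition R :: "real poly" where
  "R = [:1 - t / L, 1 / L:] ^ L"

lemma L_pos: "real L > 0"
  using tL t_pos by simp

lemma poly_R: "poly R z = (1 + (z - t) / L) ^ L"
  by (simp add: R_def diff_divide_distrib algebra_simps)

lemma R_base_pos: "z \<ge> 0 \<Longrightarrow> 0 < 1 + (z - t) / L"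
  using tL L_pos by (simp add: field_simps)

lemma R_pos: "z \<ge> 0 \<Longrightarrow> poly R z > 0"
  unfolding poly_R using R_base_pos by simp

lemma R_mono: "0 \<le> z \<Longrightarrow> z \<le> y \<Longrightarrow> poly R z \<le> poly R y"
  unfolding poly_R using R_base_pos[of z] L_pos by (intro power_mono) (auto simp: divide_right_mono)

lemma R_le_exp: "0 \<le> z \<Longrightarrow> poly R z \<le> exp (z - t)"
proof -
  assume z: "0 \<le> z"
  have "poly R z \<le> exp ((z - t) / L) ^ L"
    unfolding poly_R using R_base_pos[OF z] exp_ge_add_one_self by (intro power_mono) auto
  then show ?thesis using L_pos by (simp flip: exp_of_nat_mult)
qed

lemma R_ge_1: "t \<le> z \<Longrightarrow> 1 \<le> poly R z"
  unfolding poly_R using L_pos by (intro one_le_power) auto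

text \<open>A lower bound on [0, X] for the logarithmic derivative L / (L + z - t) of
  \<open>R\<close>. It is the rate at which \<open>R\<close> decreases to the left in
  \<open>R_decay\<close>.\<close>

definition \<kappa> :: real where "\<kappa> = 1 / (1 + Ar)"

lemma Ar_pos: "Ar > 0"
proof -
  have "Ar * L > 0" using X t_pos by linarith
  then show ?thesis using L_pos by (simp add: zero_less_mult_iff)
qed

lemma \<kappa>_pos: "\<kappa> > 0"
  using Ar_pos by (simp add: \<kappa>_def)

lemma R_decay:
  assumes "0 \<le> z" "z \<le> y" "y \<le> X"
  shows "poly R z \<le> poly R y * exp (- \<kappa> * (y - z))"
proof -
  have d: "L + y - t > 0" using assms tL by simp
  have "1 + (z - t) / L = (1 + (y - t) / L) * (1 - (y - z) / (L + y - t))"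
  proof -
    have "1 + (z - t) / L = (L + z - t) / L" "1 + (y - t) / L = (L + y - t) / L"
      "1 - (y - z) / (L + y - t) = (L + z - t) / (L + y - t)"
      using d L_pos by (simp_all add: field_simps)
    then show ?thesis using d by simp
  qed
  then have "poly R z = poly R y * (1 - (y - z) / (L + y - t)) ^ L"
    unfolding poly_R by (simp only: power_mult_distrib)
  also have "\<dots> \<le> poly R y * exp (- ((y - z) / (L + y - t))) ^ L"
  proof (intro mult_left_mono power_mono)
    show "1 - (y - z) / (L + y - t) \<le> exp (- ((y - z) / (L + y - t)))"
      using exp_ge_add_one_self[of "- ((y - z) / (L + y - t))"] by simp
    show "0 \<le> 1 - (y - z) / (L + y - t)" using d assms tL by (simp add: field_simps)
    show "0 \<le> poly R y" using R_pos[of y] assms by simp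
  qed
  also have "exp (- ((y - z) / (L + y - t))) ^ L = exp (- (L / (L + y - t) * (y - z)))"
    by (simp add: algebra_simps flip: exp_of_nat_mult)
  also have "poly R y * exp (- (L / (L + y - t) * (y - z))) \<le> poly R y * exp (- \<kappa> * (y - z))"
  proof -
    have "\<kappa> = L / (L * (1 + Ar))" using L_pos by (simp add: \<kappa>_def)
    also have "L * (1 + Ar) = L + Ar * L" by (simp add: algebra_simps)
    also have "L / (L + Ar * L) \<le> L / (L + y - t)"
      using d L_pos assms X t_pos Ar_pos by (intro divide_left_mono mult_pos_pos) auto
    finally have "\<kappa> * (y - z) \<le> L / (L + y - t) * (y - z)" using assms by (intro mult_right_mono) auto
    then show ?thesis using R_pos[of y] assms by (intro mult_left_mono) auto
  qed
  finally show ?thesis .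
qed

text \<open>\<open>R * Q\<close> is nonnegative on the half line with most of its mass up to t + 1
  within order \<open>h\<close> of \<open>t\<close>, so 1 - F / F (t + 1) is a polynomial step from
  1 to 0 at \<open>t\<close>. The normalisation is taken at t + 1 because \<open>F\<close> keeps
  growing further right; there the error is measured against \<open>R\<close>.\<close>

definition F :: "real poly" where
  "F = (SOME F. pderiv F = R * Q \<and> poly F 0 = 0 \<and> degree F \<le> degree (R * Q) + 1)"

lemma F: "pderiv F = R * Q" "poly F 0 = 0" "degree F \<le> degree (R * Q) + 1"
proof -
  have "\<exists>F. pderiv F = R * Q \<and> poly F 0 = 0 \<and> degree F \<le> degree (R * Q) + 1"
    using poly_antiderivative[of "R * Q"] by metis
  from someI_ex[OF this] show "pderiv F = R * Q" "poly F 0 = 0" "degree F \<le> degree (R * Q) + 1"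
    by (auto simp: F_def)
qed

lemma F_deriv: "(poly F has_real_derivative poly R z * poly Q z) (at z)"
  using poly_DERIV[of F z] by (simp add: F(1))

lemma F_mono:
  assumes "0 \<le> z" "z \<le> y"
  shows "poly F z \<le> poly F y"
proof (rule DERIV_nonneg_imp_nondecreasing[OF assms(2)])
  fix x assume "z \<le> x"
  then show "\<exists>d. (poly F has_real_derivative d) (at x) \<and> 0 \<le> d"
    using assms R_pos[of x] Q_nonneg[of x] by (intro exI[of _ "poly R x * poly Q x"] conjI F_deriv mult_nonneg_nonneg) auto
qed

lemma peak_power_split: "\<theta> z ^ q = \<theta> z ^ (q - 2) * \<theta> z ^ 2"
  using q by (metis power_add le_add_diff_inverse2)

text \<open>Two of the \<open>q\<close> powers of the peak are spent on the kernel h^2 / (t - z +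
  h)^2, whose integral is at most \<open>h\<close>. The other q - 2 powers, and \<open>R\<close>,
  increase towards \<open>t\<close> and are replaced by their values at \<open>y\<close>.\<close>

lemma F_left:
  assumes "0 \<le> y" "y \<le> t"
  shows "poly F y \<le> cQ * K\<^sup>2 * h * poly R y * \<theta> y ^ (q - 2)"
proof -
  define c where "c = cQ * K\<^sup>2 * poly R y * \<theta> y ^ (q - 2)"
  have c: "c \<ge> 0" unfolding c_def using cQ R_pos[OF assms(1)] peak_pos[of y] by simp
  have "poly F y - poly F 0 \<le> c * (h\<^sup>2 / (t - y + h)) - c * (h\<^sup>2 / (t - 0 + h))"
  proof (rule deriv_le_imp_diff_le[OF assms(1)])
    fix z assume z: "0 \<le> z" "z \<le> y"
    have p: "t - z + h > 0" using z assms h_pos by simp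
    show "((\<lambda>z. c * (h\<^sup>2 / (t - z + h))) has_real_derivative c * (h\<^sup>2 / (t - z + h)\<^sup>2)) (at z)"
      using p by (auto intro!: derivative_eq_intros simp: power2_eq_square)
    have "poly R z * poly Q z \<le> poly R y * (cQ * (\<theta> z ^ (q - 2) * \<theta> z ^ 2))"
      using R_mono[OF z] Q_upper[of z] z assms X R_pos[of y] Q_nonneg[of z]
      unfolding peak_power_split[symmetric] by (intro mult_mono) auto
    also have "\<dots> \<le> poly R y * (cQ * (\<theta> y ^ (q - 2) * (K\<^sup>2 * (h\<^sup>2 / (\<bar>z - t\<bar> + h)\<^sup>2))))"
      using peak_pos[of z] peak_pos[of y] cQ R_pos[of y] assms z peak_mono_left[OF z assms(2)]
      by (intro mult_left_mono mult_mono power_mono peak_sq_le) auto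
    also have "\<bar>z - t\<bar> = t - z" using z assms by simp
    finally show "poly R z * poly Q z \<le> c * (h\<^sup>2 / (t - z + h)\<^sup>2)"
      by (simp add: c_def mult_ac)
  qed (rule F_deriv)
  also have "\<dots> \<le> c * (h\<^sup>2 / (t - y + h))" using c t_pos h_pos by simp
  also have "\<dots> \<le> c * h"
    using c h_pos assms by (intro mult_left_mono) (auto simp: divide_le_eq power2_eq_square)
  finally show ?thesis by (simp add: F(2) c_def mult_ac)
qed

text \<open>The same splitting of the powers works to the right of \<open>t\<close>, where the peak
  decreases. \<open>R\<close> now increases, but over a unit interval by at most a factor e.\<close>

lemma F_mid:
  assumes "t \<le> y" "y \<le> t + 1"
  shows "poly F (t + 1) - poly F y \<le> cQ * K\<^sup>2 * h * exp 1 * poly R y * \<theta> y ^ (q - 2)"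
proof -
  define c where "c = cQ * K\<^sup>2 * exp 1 * poly R y * \<theta> y ^ (q - 2)"
  have y0: "y \<ge> 0" using assms t_pos by simp
  have c: "c \<ge> 0" unfolding c_def using cQ R_pos[OF y0] peak_pos[of y] by simp
  have "poly F (t + 1) - poly F y \<le> - c * (h\<^sup>2 / (t + 1 - t + h)) - - c * (h\<^sup>2 / (y - t + h))"
  proof (rule deriv_le_imp_diff_le[OF assms(2)])
    fix z assume z: "y \<le> z" "z \<le> t + 1"
    have p: "z - t + h > 0" using z assms h_pos by simp
    show "((\<lambda>z. - c * (h\<^sup>2 / (z - t + h))) has_real_derivative c * (h\<^sup>2 / (z - t + h)\<^sup>2)) (at z)"
      using p by (auto intro!: derivative_eq_intros simp: power2_eq_square)
    have Rz: "poly R z \<le> exp 1 * poly R y"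
    proof -
      have "poly R z \<le> exp (z - t)" using z y0 by (intro R_le_exp) auto
      also have "\<dots> \<le> exp 1" using z by simp
      also have "\<dots> \<le> exp 1 * poly R y" using R_ge_1[OF assms(1)] by simp
      finally show ?thesis .
    qed
    have "poly R z * poly Q z \<le> (exp 1 * poly R y) * (cQ * (\<theta> z ^ (q - 2) * \<theta> z ^ 2))"
      using Rz Q_upper[of z] z assms y0 X R_pos[of y] Q_nonneg[of z]
      unfolding peak_power_split[symmetric] by (intro mult_mono) auto
    also have "\<dots> \<le> (exp 1 * poly R y) * (cQ * (\<theta> y ^ (q - 2) * (K\<^sup>2 * (h\<^sup>2 / (\<bar>z - t\<bar> + h)\<^sup>2))))"
      using peak_pos[of z] peak_pos[of y] cQ R_pos[of y] assms y0 z peak_mono_right[OF assms(1) z(1)]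
      by (intro mult_left_mono mult_mono power_mono peak_sq_le) auto
    also have "\<bar>z - t\<bar> = z - t" using z assms by simp
    finally show "poly R z * poly Q z \<le> c * (h\<^sup>2 / (z - t + h)\<^sup>2)"
      by (simp add: c_def mult_ac)
  qed (rule F_deriv)
  also have "\<dots> \<le> c * (h\<^sup>2 / (y - t + h))" using c t_pos h_pos by simp
  also have "\<dots> \<le> c * h"
    using c h_pos assms by (intro mult_left_mono) (auto simp: divide_le_eq power2_eq_square)
  finally show ?thesis by (simp add: c_def mult_ac)
qed

definition C\<kappa> :: real where
  "C\<kappa> = (max 1 (real (2 * q) / (\<kappa> / 2))) ^ (2 * q) * (2 / \<kappa>)"

lemma C\<kappa>_pos: "C\<kappa> > 0"
  unfolding C\<kappa>_def using \<kappa>_pos by (intro mult_pos_pos zero_less_power) auto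

text \<open>Going back from \<open>y\<close> by v, \<open>R\<close> loses exp (- \<kappa> v) while
  the power of the peak grows at most like (1 + v)^(2q). Half of the exponential rate absorbs this
  growth; the other half integrates to 2 / \<kappa>. Both constants are collected in
  \<open>C\<kappa>\<close>.\<close>

lemma F_right:
  assumes "t + 1 \<le> y" "y \<le> X"
  shows "poly F y - poly F (t + 1) \<le> cQ * C\<kappa> * poly R y * \<theta> y ^ q"
proof -
  define m where "m = (max 1 (real (2 * q) / (\<kappa> / 2))) ^ (2 * q)"
  define c where "c = cQ * poly R y * \<theta> y ^ q * m"
  have y0: "y \<ge> 0" using assms t_pos by simp
  have m: "m \<ge> 0" unfolding m_def by (intro zero_le_power) auto
  then have c: "c \<ge> 0" unfolding c_def using cQ R_pos[OF y0] peak_pos[of y] by simp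
  have "poly F y - poly F (t + 1) \<le> c * (2 / \<kappa> * exp (- (\<kappa> / 2) * (y - y))) - c * (2 / \<kappa> * exp (- (\<kappa> / 2) * (y - (t + 1))))"
  proof (rule deriv_le_imp_diff_le[OF assms(1)])
    fix z assume z: "t + 1 \<le> z" "z \<le> y"
    have z0: "z \<ge> 0" using z t_pos by simp
    show "((\<lambda>z. c * (2 / \<kappa> * exp (- (\<kappa> / 2) * (y - z)))) has_real_derivative c * exp (- (\<kappa> / 2) * (y - z))) (at z)"
      using \<kappa>_pos by (auto intro!: derivative_eq_intros)
    have "poly R z * poly Q z \<le> (poly R y * exp (- \<kappa> * (y - z))) * (cQ * (\<theta> y * (1 + (y - z))\<^sup>2) ^ q)"
    proof (intro mult_mono R_decay)
      have "poly Q z \<le> cQ * \<theta> z ^ q" using z0 z assms by (intro Q_upper) auto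
      also have "\<dots> \<le> cQ * (\<theta> y * (1 + (y - z))\<^sup>2) ^ q"
        using cQ peak_pos[of z] peak_decay[OF z] by (intro mult_left_mono power_mono) auto
      finally show "poly Q z \<le> cQ * (\<theta> y * (1 + (y - z))\<^sup>2) ^ q" .
    qed (use z0 z assms R_pos[OF y0] Q_nonneg[OF z0] in auto)
    also have "\<dots> = cQ * poly R y * \<theta> y ^ q * exp (- \<kappa> * (y - z)) * (1 + (y - z)) ^ (2 * q)"
      by (simp add: power_mult_distrib mult_ac flip: power_mult)
    also have "\<dots> \<le> cQ * poly R y * \<theta> y ^ q * exp (- \<kappa> * (y - z)) * (m * exp (\<kappa> / 2 * (y - z)))"
      unfolding m_def using \<kappa>_pos z cQ R_pos[OF y0] peak_pos[of y]
      by (intro mult_left_mono one_plus_power_le_exp) auto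
    also have "\<dots> = c * (exp (- \<kappa> * (y - z)) * exp (\<kappa> / 2 * (y - z)))"
      by (simp add: c_def)
    also have "exp (- \<kappa> * (y - z)) * exp (\<kappa> / 2 * (y - z)) = exp (- (\<kappa> / 2) * (y - z))"
      by (simp add: field_simps flip: exp_add)
    finally show "poly R z * poly Q z \<le> c * exp (- (\<kappa> / 2) * (y - z))" .
  qed (rule F_deriv)
  also have "\<dots> \<le> c * (2 / \<kappa>)" using c \<kappa>_pos by simp
  finally show ?thesis by (simp add: c_def C\<kappa>_def m_def mult_ac)
qed

definition c0 :: real where "c0 = cq * (4 / 5) ^ q"

lemma c0_pos: "c0 > 0" using cQ by (simp add: c0_def)

text \<open>The interval from \<open>t\<close> to \<open>t + h\<close> alone suffices: there
  \<open>R\<close> is at least 1 and the peak at least 4/5.\<close>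

lemma F_lower: "c0 * h \<le> poly F (t + 1)"
proof -
  have "c0 * (t + h) - c0 * t \<le> poly F (t + h) - poly F t"
  proof (rule deriv_le_imp_diff_le)
    fix z assume z: "t \<le> z" "z \<le> t + h"
    show "((\<lambda>z. c0 * z) has_real_derivative c0) (at z)" by (auto intro!: derivative_eq_intros)
    have "c0 \<le> cq * \<theta> z ^ q"
      unfolding c0_def using peak_near[OF z] cQ by (intro mult_left_mono power_mono) auto
    also have "\<dots> \<le> poly Q z" using z t_pos X h1 by (intro Q_lower) auto
    also have "\<dots> \<le> poly R z * poly Q z"
      using R_ge_1[OF z(1)] Q_nonneg[of z] z t_pos by (simp add: mult_le_cancel_right1)
    finally show "c0 \<le> poly R z * poly Q z" .
  qed (use h_pos F_deriv in auto)
  moreover have "poly F t \<ge> 0" using F_mono[of 0 t] t_pos F(2) by simp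
  moreover have "poly F (t + h) \<le> poly F (t + 1)" using F_mono[of "t + h" "t + 1"] t_pos h_pos h1 by simp
  ultimately show ?thesis by (simp add: algebra_simps)
qed

definition Cerr :: real where
  "Cerr = cQ * (K\<^sup>2 * exp 1 + C\<kappa> * K) / c0"

lemma step_error:
  assumes "0 \<le> y" "y \<le> X"
  shows "\<bar>(if y \<le> t then 1 else 0) - (1 - poly F y / poly F (t + 1))\<bar> \<le> Cerr * poly R y * \<theta> y ^ (q - 2)"
proof -
  define N where "N = poly F (t + 1)"
  have N: "N \<ge> c0 * h" "N > 0" using F_lower c0_pos h_pos unfolding N_def by (auto intro: less_le_trans[OF mult_pos_pos])
  have R: "poly R y > 0" using R_pos assms by simp
  have div: "a / N \<le> a / (c0 * h)" if "a \<ge> 0" for a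
    using N c0_pos h_pos that by (intro divide_left_mono) auto
  have step: "E / N \<le> Cerr * poly R y * \<theta> y ^ (q - 2)"
    if "E \<le> cQ * K\<^sup>2 * h * exp 1 * poly R y * \<theta> y ^ (q - 2)" for E
  proof -
    have "E / N \<le> (cQ * K\<^sup>2 * h * exp 1 * poly R y * \<theta> y ^ (q - 2)) / N" using that N by (intro divide_right_mono) auto
    also have "\<dots> \<le> (cQ * K\<^sup>2 * h * exp 1 * poly R y * \<theta> y ^ (q - 2)) / (c0 * h)"
      using cQ h_pos R peak_pos[of y] by (intro div) auto
    also have "\<dots> = (cQ * (K\<^sup>2 * exp 1) / c0) * poly R y * \<theta> y ^ (q - 2)" using h_pos by simp
    also have "\<dots> \<le> Cerr * poly R y * \<theta> y ^ (q - 2)"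
      unfolding Cerr_def using cQ c0_pos C\<kappa>_pos K_pos R peak_pos[of y]
      by (intro mult_right_mono divide_right_mono mult_left_mono) auto
    finally show ?thesis .
  qed
  consider "y \<le> t" | "t < y" "y \<le> t + 1" | "t + 1 < y" by linarith
  then show ?thesis
  proof cases
    case 1
    have F0: "poly F y \<ge> 0" using F_mono[of 0 y] assms F(2) by simp
    have "poly F y \<le> cQ * K\<^sup>2 * h * 1 * poly R y * \<theta> y ^ (q - 2)" using F_left[OF assms(1) 1] by simp
    also have "\<dots> \<le> cQ * K\<^sup>2 * h * exp 1 * poly R y * \<theta> y ^ (q - 2)"
      using cQ h_pos R peak_pos[of y] by (intro mult_right_mono mult_left_mono) auto
    finally show ?thesis using step 1 F0 N by (simp add: N_def[symmetric])
  next
    case 2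
    have "1 - poly F y / N = (N - poly F y) / N" using N by (simp add: field_simps)
    moreover have "N - poly F y \<ge> 0" using F_mono[of y "t + 1"] assms 2 by (simp add: N_def)
    ultimately show ?thesis using step[of "N - poly F y"] F_mid[of y] 2 N by (simp add: N_def[symmetric])
  next
    case 3
    have "1 - poly F y / N = - ((poly F y - N) / N)" using N by (simp add: field_simps)
    moreover have F0: "poly F y - N \<ge> 0" using F_mono[of "t + 1" y] assms 3 t_pos by (simp add: N_def)
    ultimately have "\<bar>(if y \<le> t then 1 else 0) - (1 - poly F y / N)\<bar> = (poly F y - N) / N"
      using 3 t_pos N by simp
    also have "\<dots> \<le> (cQ * C\<kappa> * poly R y * \<theta> y ^ q) / N"
      using F_right[of y] 3 assms N by (intro divide_right_mono) (auto simp: N_def)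
    also have "\<dots> \<le> (cQ * C\<kappa> * poly R y * \<theta> y ^ q) / (c0 * h)"
      using cQ C\<kappa>_pos R peak_pos[of y] by (intro div) auto
    also have "\<theta> y ^ q = \<theta> y ^ (q - 2) * \<theta> y ^ 2" by (rule peak_power_split)
    \<comment> \<open>\<open>F_right\<close> carries no factor \<open>h\<close> to cancel the one in
      the denominator. Since \<open>y\<close> has distance at least 1 from \<open>t\<close>, two
      powers of the peak are at most K * h and supply it.\<close>
    also have "cQ * C\<kappa> * poly R y * (\<theta> y ^ (q - 2) * \<theta> y ^ 2) / (c0 * h) \<le>
        cQ * C\<kappa> * poly R y * (\<theta> y ^ (q - 2) * (K * h)) / (c0 * h)"
    proof (intro divide_right_mono mult_left_mono)
      have "\<theta> y ^ 2 \<le> \<theta> y" using peak_pos[of y] peak_le_1[of y] by (simp add: power2_eq_square mult_le_cancel_left1)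
      also have "\<dots> \<le> K * h / (\<bar>y - t\<bar> + h)" by (rule peak_le[OF assms(1)])
      also have "\<dots> \<le> K * h / 1" using 3 h_pos K_pos by (intro divide_left_mono) auto
      finally show "\<theta> y ^ 2 \<le> K * h" by simp
    qed (use cQ C\<kappa>_pos R peak_pos[of y] c0_pos h_pos in auto)
    also have "\<dots> = (cQ * (C\<kappa> * K) / c0) * poly R y * \<theta> y ^ (q - 2)" using h_pos by simp
    also have "\<dots> \<le> Cerr * poly R y * \<theta> y ^ (q - 2)"
      unfolding Cerr_def using cQ c0_pos C\<kappa>_pos K_pos R peak_pos[of y]
      by (intro mult_right_mono divide_right_mono mult_left_mono) auto
    finally show ?thesis by (simp only: N_def)
  qed
qed

text \<open>A crude bound, interval length times the largest derivative, is enough beyond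
  \<open>X\<close>: the weight there is exponentially small compared with the powers that
  appear.\<close>

lemma step_tail:
  assumes "X \<le> y"
  shows "\<bar>1 - poly F y / poly F (t + 1)\<bar> \<le> y * poly R y * (2 * (4 * (y / X)) ^ J) / (c0 * h)"
proof -
  define N where "N = poly F (t + 1)"
  have N: "N \<ge> c0 * h" "N > 0" using F_lower c0_pos h_pos unfolding N_def by (auto intro: less_le_trans[OF mult_pos_pos])
  have y: "t + 1 \<le> y" "0 \<le> y" using assms X t_pos by auto
  define c where "c = poly R y * (2 * (4 * (y / X)) ^ J)"
  have c0: "c \<ge> 0" unfolding c_def using R_pos[OF y(2)] X t_pos y by (intro mult_nonneg_nonneg zero_le_power) auto
  have "poly F y - poly F (t + 1) \<le> c * y - c * (t + 1)"
  proof (rule deriv_le_imp_diff_le[OF y(1)])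
    fix z assume z: "t + 1 \<le> z" "z \<le> y"
    then have z0: "z \<ge> 0" using t_pos by simp
    show "((\<lambda>z. c * z) has_real_derivative c) (at z)" by (auto intro!: derivative_eq_intros)
    show "poly R z * poly Q z \<le> c"
      unfolding c_def using z z0 R_mono[OF z0 z(2)] R_pos[OF y(2)] Q_nonneg[OF z0] Q_tail[OF z0 z(2) assms]
      by (intro mult_mono) auto
  qed (rule F_deriv)
  also have "\<dots> \<le> c * y" using c0 t_pos by (simp add: mult_left_mono)
  finally have le: "poly F y - N \<le> c * y" by (simp add: N_def)
  have "1 - poly F y / N = - ((poly F y - N) / N)" using N by (simp add: field_simps)
  moreover have F0: "poly F y - N \<ge> 0" using F_mono[of "t + 1" y] y t_pos by (simp add: N_def)
  ultimately have "\<bar>1 - poly F y / N\<bar> = (poly F y - N) / N" using N by simp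
  also have "\<dots> \<le> (c * y) / N" using le N by (intro divide_right_mono) auto
  also have "\<dots> \<le> (c * y) / (c0 * h)"
    using N c0_pos h_pos c0 y by (intro divide_left_mono) auto
  finally show ?thesis by (simp add: N_def c_def mult_ac)
qed

text \<open>The truncated power is (t - y)^(s - 1) times the step, so the step error is multiplied
  by |t - y|^(s - 1). Each factor |t - y| is at most K * h over the peak and so costs one power of
  the peak, whence the condition on \<open>q\<close>. The first summand of \<open>S\<close>
  dominates on [0, X] and the second beyond; both are nonnegative on the half line, so their sum
  dominates everywhere.\<close>

lemma truncated_power_error:
  assumes s: "s \<ge> 1" "q' + s + 1 \<le> q" and cq': "cq' > 0"
    and Q'_lower: "\<And>z. 0 \<le> z \<Longrightarrow> z \<le> X \<Longrightarrow> cq' * \<theta> z ^ q' \<le> poly Q' z"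
    and Q'_nonneg: "\<And>z. 0 \<le> z \<Longrightarrow> 0 \<le> poly Q' z"
  defines "P \<equiv> [:t, -1:] ^ (s - 1) * (1 - smult (1 / poly F (t + 1)) F)"
    and "S \<equiv> smult (Cerr * (K * h) ^ (s - 1) / cq') (R * Q') +
      smult (2 / (c0 * h)) ([:0, 1:] ^ s * R * [:0, 4 / X:] ^ J)"
  assumes y: "y > 0"
  shows "\<bar>(if y \<le> t then (t - y) ^ (s - 1) else 0) - poly P y\<bar> \<le> poly S y"
proof -
  define e where "e = (if y \<le> t then 1 else 0) - (1 - poly F y / poly F (t + 1))"
  have "(if y \<le> t then (t - y) ^ (s - 1) else 0) - poly P y = (t - y) ^ (s - 1) * e"
    by (simp add: P_def e_def algebra_simps)
  then have abs: "\<bar>(if y \<le> t then (t - y) ^ (s - 1) else 0) - poly P y\<bar> = \<bar>t - y\<bar> ^ (s - 1) * \<bar>e\<bar>"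
    by (simp add: abs_mult power_abs)
  have R: "poly R y > 0" using R_pos y by simp
  have Cerr: "Cerr > 0" unfolding Cerr_def using cQ K_pos C\<kappa>_pos c0_pos by (intro divide_pos_pos mult_pos_pos add_pos_pos) auto
  define S1 where "S1 = Cerr * (K * h) ^ (s - 1) / cq' * (poly R y * poly Q' y)"
  define S2 where "S2 = 2 / (c0 * h) * (y ^ s * poly R y * (4 / X * y) ^ J)"
  have S: "poly S y = S1 + S2" by (simp add: S_def S1_def S2_def mult.commute)
  have S1: "S1 \<ge> 0" unfolding S1_def using Cerr K_pos h_pos cq' R Q'_nonneg[of y] y by simp
  have S2: "S2 \<ge> 0" unfolding S2_def using c0_pos h_pos R X t_pos y by simp
  show ?thesis
  proof (cases "y \<le> X")
    case True
    have "\<bar>t - y\<bar> ^ (s - 1) * \<bar>e\<bar> \<le> (K * h / \<theta> y) ^ (s - 1) * (Cerr * poly R y * \<theta> y ^ (q - 2))"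
      unfolding e_def using y True K_pos h_pos peak_pos[of y]
      by (intro mult_mono power_mono abs_diff_le_peak step_error) auto
    also have "\<theta> y ^ (q - 2) \<le> \<theta> y ^ (s - 1 + q')"
      using s peak_pos[of y] peak_le_1[of y] by (intro power_decreasing) auto
    also have "(K * h / \<theta> y) ^ (s - 1) * (Cerr * poly R y * \<theta> y ^ (s - 1 + q')) =
        Cerr * (K * h) ^ (s - 1) * (poly R y * \<theta> y ^ q')"
      using peak_pos[of y] by (simp add: power_divide power_add)
    also have "\<theta> y ^ q' \<le> poly Q' y / cq'"
      using Q'_lower[of y] y True cq' by (simp add: field_simps)
    also have "Cerr * (K * h) ^ (s - 1) * (poly R y * (poly Q' y / cq')) = S1"
      by (simp add: S1_def)
    finally have "\<bar>t - y\<bar> ^ (s - 1) * \<bar>e\<bar> \<le> S1"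
      using Cerr K_pos h_pos R peak_pos[of y] by (simp add: mult_left_mono)
    then show ?thesis unfolding abs S using S2 by simp
  next
    case False
    have yt: "y > t" using False X by simp
    have "\<bar>t - y\<bar> ^ (s - 1) * \<bar>e\<bar> \<le> y ^ (s - 1) * (y * poly R y * (2 * (4 * (y / X)) ^ J) / (c0 * h))"
    proof (intro mult_mono power_mono)
      show "\<bar>e\<bar> \<le> y * poly R y * (2 * (4 * (y / X)) ^ J) / (c0 * h)"
        using step_tail[of y] False yt by (simp add: e_def)
    qed (use yt t_pos in auto)
    also have "\<dots> = 2 / (c0 * h) * ((y ^ (s - 1) * y) * poly R y * (4 * (y / X)) ^ J)"
      by simp
    also have "y ^ (s - 1) * y = y ^ s" using s by (cases s) auto
    finally show ?thesis unfolding abs S using S1 by (simp add: S2_def mult_ac)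
  qed
qed

end

section \<open>Integrals of the peak and of the error majorant\<close>

lemma powr_integral_Ioc:
  fixes a b :: real
  assumes "a > -1" "b \<ge> 0"
  shows "integrable lborel (\<lambda>x. indicator {0<..b} x * x powr a)"
    and "(\<integral>x. indicator {0<..b} x * x powr a \<partial>lborel) = b powr (a + 1) / (a + 1)"
proof -
  have "((\<lambda>x. x powr a) has_integral b powr (a + 1) / (a + 1)) {0..b}"
    using has_integral_powr_from_0[OF assms] .
  then have "((\<lambda>x. if x \<in> {0<..b} then x powr a else 0) has_integral b powr (a + 1) / (a + 1)) {0..b}"
    by (rule has_integral_eq[rotated]) auto
  then have hi': "((\<lambda>x. x powr a) has_integral b powr (a + 1) / (a + 1)) {0<..b}"
    by (subst (asm) has_integral_restrict) auto
  then have "(\<lambda>x. x powr a) absolutely_integrable_on {0<..b}"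
    by (intro nonnegative_absolutely_integrable_1) (auto simp: integrable_on_def)
  then have int: "set_integrable lborel {0<..b} (\<lambda>x. x powr a)"
    unfolding set_integrable_def by (subst (asm) integrable_completion) auto
  then show "integrable lborel (\<lambda>x. indicator {0<..b} x * x powr a)"
    by (simp add: set_integrable_def)
  have "((\<lambda>x. x powr a) has_integral (LINT x:{0<..b}|lborel. x powr a)) {0<..b}"
    using set_borel_integral_eq_integral[OF int] by (metis has_integral_integral)
  from has_integral_unique[OF this hi'] show "(\<integral>x. indicator {0<..b} x * x powr a \<partial>lborel) = b powr (a + 1) / (a + 1)"
    by (simp add: set_lebesgue_integral_def)
qed

lemma integral_lincomb3:
  fixes f g k :: "'a \<Rightarrow> real"
  assumes "integrable M f" "integrable M g" "integrable M k"
  shows "(\<integral>x. a * f x + (b * g x + c * k x) \<partial>M) = a * integral\<^sup>L M f + (b * integral\<^sup>L M g + c * integral\<^sup>L M k)"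
  using assms by simp

context peak_setup
begin

lemma kernel_integrals:
  assumes "t \<le> X"
  shows "integrable lborel (\<lambda>y. h\<^sup>2 / (t - y + h)\<^sup>2 * indicator {0..t} y)"
    "(\<integral>y. h\<^sup>2 / (t - y + h)\<^sup>2 * indicator {0..t} y \<partial>lborel) \<le> h"
    "integrable lborel (\<lambda>y. h\<^sup>2 / (y - t + h)\<^sup>2 * indicator {t..X} y)"
    "(\<integral>y. h\<^sup>2 / (y - t + h)\<^sup>2 * indicator {t..X} y \<partial>lborel) \<le> h"
proof -
  have 1: "has_bochner_integral lborel (\<lambda>y. h\<^sup>2 / (t - y + h)\<^sup>2 * indicator {0..t} y) (h\<^sup>2 / (t - t + h) - h\<^sup>2 / (t - 0 + h))"
  proof (rule has_bochner_integral_FTC_Icc_nonneg[where F = "\<lambda>y. h\<^sup>2 / (t - y + h)"])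
    fix y assume "y \<in> {0..t}"
    then have "t - y + h > 0" using h_pos by simp
    then show "((\<lambda>y. h\<^sup>2 / (t - y + h)) has_real_derivative h\<^sup>2 / (t - y + h)\<^sup>2) (at y)"
      by (auto intro!: derivative_eq_intros simp: power2_eq_square)
  qed (use t_pos in auto)
  have 2: "has_bochner_integral lborel (\<lambda>y. h\<^sup>2 / (y - t + h)\<^sup>2 * indicator {t..X} y) (- (h\<^sup>2 / (X - t + h)) - - (h\<^sup>2 / (t - t + h)))"
  proof (rule has_bochner_integral_FTC_Icc_nonneg[where F = "\<lambda>y. - (h\<^sup>2 / (y - t + h))"])
    fix y assume "y \<in> {t..X}"
    then have "y - t + h > 0" using h_pos by simp
    then show "((\<lambda>y. - (h\<^sup>2 / (y - t + h))) has_real_derivative h\<^sup>2 / (y - t + h)\<^sup>2) (at y)"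
      by (auto intro!: derivative_eq_intros simp: power2_eq_square)
  qed (use assms in auto)
  have hh: "h\<^sup>2 / h = h" using h_pos by (simp add: power2_eq_square)
  show "integrable lborel (\<lambda>y. h\<^sup>2 / (t - y + h)\<^sup>2 * indicator {0..t} y)"
    "integrable lborel (\<lambda>y. h\<^sup>2 / (y - t + h)\<^sup>2 * indicator {t..X} y)"
    using 1 2 by (auto simp: has_bochner_integral_iff)
  show "(\<integral>y. h\<^sup>2 / (t - y + h)\<^sup>2 * indicator {0..t} y \<partial>lborel) \<le> h"
    using has_bochner_integral_integral_eq[OF 1] t_pos h_pos hh by simp
  show "(\<integral>y. h\<^sup>2 / (y - t + h)\<^sup>2 * indicator {t..X} y \<partial>lborel) \<le> h"
    using has_bochner_integral_integral_eq[OF 2] assms h_pos hh by simp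
qed

text \<open>Up to t/2 the peak is at most 2 K h / t, and the power of y is integrable since a > -1.
  Beyond t/2, with v = |y - t| + h, the power of y exceeds that of \<open>t\<close> at most by a
  multiple of (v/h)^|a|. This uses up |a| powers of the peak, and two more give kernels with
  integral at most \<open>h\<close>.\<close>

lemma peak_integral:
  fixes a :: real and n :: nat
  assumes a: "a > -1" and n: "real n \<ge> \<bar>a\<bar> + 2" and X: "t \<le> X"
  defines "Cp \<equiv> 2 * K / (a + 1) + 2 * (2 powr \<bar>a\<bar> * C1 powr \<bar>a\<bar> * K ^ n)"
  obtains G where "integrable lborel G" "\<And>y. 0 \<le> G y"
    "\<And>y. 0 < y \<Longrightarrow> y \<le> X \<Longrightarrow> \<theta> y ^ n * y powr a \<le> G y"
    "(\<integral>y. G y \<partial>lborel) \<le> Cp * h * t powr a"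
proof -
  define c1 where "c1 = 2 * K * h / t"
  define c2 where "c2 = 2 powr \<bar>a\<bar> * C1 powr \<bar>a\<bar> * K ^ n * t powr a"
  define G where "G = (\<lambda>y. c1 * (indicator {0<..t / 2} y * y powr a) +
    (c2 * (h\<^sup>2 / (t - y + h)\<^sup>2 * indicator {0..t} y) + c2 * (h\<^sup>2 / (y - t + h)\<^sup>2 * indicator {t..X} y)))"
  have c: "c1 \<ge> 0" "c2 \<ge> 0" using K_pos h_pos t_pos C1 by (auto simp: c1_def c2_def)
  note ints = kernel_integrals[OF X] powr_integral_Ioc[OF a, of "t / 2"]
  have G0: "0 \<le> G y" for y
    unfolding G_def using c by (intro add_nonneg_nonneg mult_nonneg_nonneg) auto
  have int: "integrable lborel G"
    unfolding G_def using ints t_pos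
    by (intro Bochner_Integration.integrable_add Bochner_Integration.integrable_mult_right) auto
  have n1: "n \<ge> 1" using n by linarith
  have bound: "\<theta> y ^ n * y powr a \<le> G y" if y: "0 < y" "y \<le> X" for y
  proof (cases "y \<le> t / 2")
    case True
    have "\<theta> y ^ n \<le> \<theta> y ^ 1"
      using n1 peak_pos[of y] peak_le_1[of y] by (intro power_decreasing) auto
    also have "\<dots> \<le> K * h / (\<bar>y - t\<bar> + h)" using peak_le[of y] y by simp
    also have "\<dots> \<le> K * h / (t / 2)"
      using True y t_pos h_pos K_pos by (intro divide_left_mono mult_pos_pos) auto
    also have "\<dots> = c1" by (simp add: c1_def)
    finally have "\<theta> y ^ n * y powr a \<le> c1 * (indicator {0<..t / 2} y * y powr a)"
      using True y by (simp add: mult_right_mono)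
    also have "\<dots> \<le> G y" unfolding G_def using c by simp
    finally show ?thesis .
  next
    case False
    define v where "v = \<bar>y - t\<bar> + h"
    have v: "v \<ge> h" "v > 0" using h_pos by (auto simp: v_def)
    have ya: "y powr a \<le> 2 powr \<bar>a\<bar> * C1 powr \<bar>a\<bar> * t powr a * (v / h) powr \<bar>a\<bar>"
    proof (cases "a \<ge> 0")
      case True
      have "y \<le> t * (1 + \<bar>y - t\<bar> / t)" using t_pos by (simp add: distrib_left)
      also have "\<dots> \<le> t * (C1 * (v / h))"
      proof -
        have "\<bar>y - t\<bar> / t \<le> \<bar>y - t\<bar> / (h / C1)"
          using h_le_t C1 h_pos t_pos by (intro divide_left_mono) (auto simp: field_simps)
        moreover have "1 \<le> C1 * (h / h)" using C1 h_pos by simp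
        ultimately have "1 + \<bar>y - t\<bar> / t \<le> C1 * (v / h)"
          unfolding v_def add_divide_distrib distrib_left using C1 h_pos by (simp add: mult.commute)
        then show ?thesis using t_pos by (intro mult_left_mono) auto
      qed
      finally have "y powr a \<le> (t * (C1 * (v / h))) powr a" using y True by (intro powr_mono2) auto
      also have "\<dots> = 1 * C1 powr \<bar>a\<bar> * t powr a * (v / h) powr \<bar>a\<bar>"
      proof -
        have "(t * (C1 * r)) powr a = C1 powr a * t powr a * r powr a" if "r \<ge> 0" for r
          using that t_pos C1 by (simp add: powr_mult mult_ac)
        from this[of "v / h"] show ?thesis using v h_pos True by (simp only: abs_of_nonneg) simp
      qed
      also have "\<dots> \<le> 2 powr \<bar>a\<bar> * C1 powr \<bar>a\<bar> * t powr a * (v / h) powr \<bar>a\<bar>"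
        by (intro mult_right_mono) (auto simp: ge_one_powr_ge_zero)
      finally show ?thesis .
    next
      case neg: False
      have "y powr a \<le> (t / 2) powr a" using False neg t_pos by (intro powr_mono2') auto
      also have "\<dots> = 2 powr \<bar>a\<bar> * 1 * t powr a * 1" using neg t_pos by (simp add: powr_divide powr_minus_divide)
      also have "\<dots> \<le> 2 powr \<bar>a\<bar> * C1 powr \<bar>a\<bar> * t powr a * (v / h) powr \<bar>a\<bar>"
        using C1 v h_pos by (intro mult_mono ge_one_powr_ge_zero) (auto simp: ge_one_powr_ge_zero)
      finally show ?thesis .
    qed
    have "\<theta> y ^ n \<le> (K * h / v) ^ n"
      unfolding v_def using peak_le[of y] y peak_pos[of y] by (intro power_mono) auto
    also have "\<dots> = K ^ n * (h / v) ^ n" by (simp add: power_divide power_mult_distrib)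
    also have "(h / v) ^ n = (h / v) powr n" using h_pos v by (simp add: powr_realpow)
    also have "\<dots> \<le> (h / v) powr (\<bar>a\<bar> + 2)" using h_pos v n by (intro powr_mono') auto
    finally have "\<theta> y ^ n * y powr a \<le> (K ^ n * (h / v) powr (\<bar>a\<bar> + 2)) *
        (2 powr \<bar>a\<bar> * C1 powr \<bar>a\<bar> * t powr a * (v / h) powr \<bar>a\<bar>)"
      using ya K_pos by (intro mult_mono) (auto simp: mult_left_mono)
    also have "\<dots> = c2 * ((h / v) powr (\<bar>a\<bar> + 2) * (v / h) powr \<bar>a\<bar>)" by (simp add: c2_def)
    also have "(h / v) powr (\<bar>a\<bar> + 2) * (v / h) powr \<bar>a\<bar> = h\<^sup>2 / v\<^sup>2"
    proof -
      have "(v / h) powr \<bar>a\<bar> = (h / v) powr (- \<bar>a\<bar>)"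
        using h_pos v by (simp add: powr_minus powr_divide)
      then have "(h / v) powr (\<bar>a\<bar> + 2) * (v / h) powr \<bar>a\<bar> = (h / v) powr 2"
        by (simp flip: powr_add)
      also have "\<dots> = (h / v) ^ 2" using h_pos v by (simp add: powr_numeral)
      finally show ?thesis by (simp add: power_divide)
    qed
    also have "c2 * (h\<^sup>2 / v\<^sup>2) \<le> c2 * (h\<^sup>2 / (t - y + h)\<^sup>2 * indicator {0..t} y) + c2 * (h\<^sup>2 / (y - t + h)\<^sup>2 * indicator {t..X} y)"
    proof (cases "y \<le> t")
      case True
      then have "v = t - y + h" by (simp add: v_def)
      then have "c2 * (h\<^sup>2 / v\<^sup>2) = c2 * (h\<^sup>2 / (t - y + h)\<^sup>2 * indicator {0..t} y)" using True y by simp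
      then show ?thesis using c by simp
    next
      case False
      then have "v = y - t + h" by (simp add: v_def)
      then have "c2 * (h\<^sup>2 / v\<^sup>2) = c2 * (h\<^sup>2 / (y - t + h)\<^sup>2 * indicator {t..X} y)" using False y by simp
      then show ?thesis using c by simp
    qed
    also have "\<dots> \<le> G y" unfolding G_def using c by simp
    finally show ?thesis .
  qed
  have "(\<integral>y. G y \<partial>lborel) = c1 * (\<integral>y. indicator {0<..t / 2} y * y powr a \<partial>lborel) +
      (c2 * (\<integral>y. h\<^sup>2 / (t - y + h)\<^sup>2 * indicator {0..t} y \<partial>lborel) +
       c2 * (\<integral>y. h\<^sup>2 / (y - t + h)\<^sup>2 * indicator {t..X} y \<partial>lborel))"
    unfolding G_def using ints t_pos by (intro integral_lincomb3) auto
  also have "\<dots> \<le> c1 * ((t / 2) powr (a + 1) / (a + 1)) + (c2 * h + c2 * h)"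
    using ints c t_pos by (intro add_mono mult_left_mono) auto
  also have "c1 * ((t / 2) powr (a + 1) / (a + 1)) \<le> 2 * K / (a + 1) * h * t powr a"
  proof -
    have "(t / 2) powr (a + 1) \<le> t powr (a + 1)" using t_pos a by (intro powr_mono2) auto
    also have "\<dots> = t powr a * t" using t_pos by (simp add: powr_add)
    finally have "c1 * ((t / 2) powr (a + 1) / (a + 1)) \<le> c1 * (t powr a * t / (a + 1))"
      using c a by (intro mult_left_mono divide_right_mono) auto
    also have "\<dots> = 2 * K / (a + 1) * h * t powr a" using t_pos by (simp add: c1_def)
    finally show ?thesis .
  qed
  finally have "(\<integral>y. G y \<partial>lborel) \<le> Cp * h * t powr a"
    by (simp add: Cp_def c2_def algebra_simps)
  then show ?thesis using that int G0 bound by blast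
qed

end

context step_approx
begin

text \<open>Of the decay exp (- y), \<open>R\<close> consumes one half and the \<open>J\<close>-th
  power one quarter; the last quarter keeps integrability. The factor 2^L from \<open>R\<close> and
  another one from exp (t / 2) are beaten by 16^(-L) from the power.\<close>

lemma tail_pointwise:
  assumes XL: "X = 524288 * L" and J: "L \<le> 4 * J" "2 * J \<le> L" and y: "y \<ge> 0"
  shows "poly R y * (4 / X * y) ^ J * exp (- y) \<le> exp (- t) * (1 / 2) ^ L * exp (- y / 4)"
proof -
  have J0: "real J > 0" using J(1) L_pos by simp
  have "poly R y \<le> 2 ^ L * exp ((y - t) / 2)"
  proof -
    define v where "v = 1 + (y - t) / L"
    have v: "v > 0" unfolding v_def by (rule R_base_pos[OF y])
    have "v / 2 \<le> exp (v / 2 - 1)" using exp_ge_add_one_self[of "v / 2 - 1"] by simp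
    then have "v \<le> 2 * exp (v / 2 - 1)" by simp
    then have "v ^ L \<le> (2 * exp (v / 2 - 1)) ^ L" using v by (intro power_mono) auto
    also have "\<dots> = 2 ^ L * exp (L * (v / 2 - 1))" by (simp add: power_mult_distrib exp_of_nat_mult)
    also have "L * (v / 2 - 1) \<le> (y - t) / 2" using L_pos by (simp add: v_def field_simps)
    finally show ?thesis by (simp add: poly_R v_def)
  qed
  moreover have "(4 / X * y) ^ J \<le> (1 / 16) ^ L * exp (y / 4)"
  proof -
    have "4 / X * y = (16 * J / X) * (y / (4 * J))" using J0 by simp
    also have "\<dots> \<le> (1 / 16) ^ 4 * exp (y / (4 * J))"
    proof (intro mult_mono)
      \<comment> \<open>Here the constant is fixed: 16 J \<le> 8 L, and 524288 is 8 times
        16^4.\<close>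
      show "16 * J / X \<le> (1 / 16) ^ 4" using J L_pos by (simp add: XL field_simps)
      show "y / (4 * J) \<le> exp (y / (4 * J))" using exp_ge_add_one_self[of "y / (4 * J)"] by linarith
    qed (use y in auto)
    finally have "(4 / X * y) ^ J \<le> ((1 / 16) ^ 4 * exp (y / (4 * J))) ^ J"
      using y X t_pos by (intro power_mono) auto
    also have "\<dots> = (1 / 16) ^ (4 * J) * exp (y / 4)"
      using J0 by (simp add: power_mult_distrib power_mult flip: exp_of_nat_mult)
    also have "\<dots> \<le> (1 / 16) ^ L * exp (y / 4)" using J by (intro mult_right_mono power_decreasing) auto
    finally show ?thesis .
  qed
  ultimately have "poly R y * (4 / X * y) ^ J * exp (- y) \<le>
      (2 ^ L * exp ((y - t) / 2)) * ((1 / 16) ^ L * exp (y / 4)) * exp (- y)"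
    using R_pos[OF y] y X t_pos by (intro mult_right_mono mult_mono) auto
  also have "\<dots> = (2 ^ L * (1 / 16) ^ L) * (exp ((y - t) / 2) * exp (y / 4) * exp (- y))" by simp
  also have "2 ^ L * (1 / 16) ^ L = (1 / 8 :: real) ^ L" by (simp flip: power_mult_distrib)
  also have "exp ((y - t) / 2) * exp (y / 4) * exp (- y) = exp (t / 2) * (exp (- t) * exp (- y / 4))"
    by (simp add: field_simps flip: exp_add)
  also have "exp (t / 2) \<le> 2 ^ L"
  proof -
    have "exp (t / 2) \<le> exp (L * (1 / 2))" using tL by simp
    also have "\<dots> = exp (1 / 2) ^ L" by (rule exp_of_nat_mult)
    also have "\<dots> \<le> 2 ^ L"
    proof (intro power_mono)
      show "exp (1 / 2 :: real) \<le> 2" using exp_bound[of "1 / 2"] by (simp add: power2_eq_square)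
    qed auto
    finally show ?thesis .
  qed
  also have "(1 / 8) ^ L * (2 ^ L * (exp (- t) * exp (- y / 4))) = ((1 / 8) ^ L * 2 ^ L) * (exp (- t) * exp (- y / 4))"
    by simp
  also have "(1 / 8) ^ L * 2 ^ L = (1 / 4 :: real) ^ L" by (simp flip: power_mult_distrib)
  also have "(1 / 4 :: real) ^ L \<le> (1 / 2) ^ L" by (intro power_mono) auto
  finally show ?thesis by (simp add: mult_ac mult_left_mono)
qed

end

context laguerre_weight
begin

definition tail_const :: "nat \<Rightarrow> real" where
  "tail_const j = (LINT x:{0<..}|lborel. x powr (\<alpha> + j) * exp (- (1 / 4) * x))"

lemma tail_integrable: "set_integrable lborel {0<..} (\<lambda>x. x powr (\<alpha> + real j) * exp (- (1 / 4) * x))"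
  by (rule set_integrable_powr_exp) (use alpha in auto)

lemma tail_const_nonneg: "tail_const j \<ge> 0"
  unfolding tail_const_def set_lebesgue_integral_def by (rule Bochner_Integration.integral_nonneg) (auto simp: indicator_def)

lemma LI_le:
  assumes "set_integrable lborel {0<..} g" "\<And>y. y > 0 \<Longrightarrow> poly P y * lag_w \<alpha> 0 y \<le> g y"
  shows "LI P \<le> (LINT y:{0<..}|lborel. g y)"
  unfolding LI_def wint_def by (rule set_integral_mono) (use assms set_integrable_poly_lag_w in auto)

text \<open>On [0, X] the bound of \<open>R\<close> by exp (y - t) cancels the exponential of the
  weight exactly. What remains is exp (- t) times the integral of a power of the peak against the
  power part of \<open>w\<close>, of order h * t powr \<alpha>. The part beyond \<open>X\<close>
  contributes only with the factor 2^(-L).\<close>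

lemma LI_majorant_bound:
  assumes "step_approx \<tau> \<eta> C1 L q J X Ar cQ cq Q"
  defines "t \<equiv> peak_setup.t \<tau>" and "h \<equiv> peak_setup.h \<tau> \<eta>" and "R \<equiv> step_approx.R \<tau> L" and "K \<equiv> peak_setup.K C1"
  assumes XL: "X = 524288 * L" and J: "L \<le> 4 * J" "2 * J \<le> L"
    and n: "real n \<ge> \<bar>\<alpha>\<bar> + 2" and cn: "cn \<ge> 0"
    and Q'_upper: "\<And>z. 0 \<le> z \<Longrightarrow> z \<le> X \<Longrightarrow> poly Q' z \<le> cn * peak \<tau> \<eta> z ^ n"
    and Q'_tail: "\<And>z. X \<le> z \<Longrightarrow> poly Q' z \<le> 2 * (4 / X * z) ^ J"
    and d: "d1 \<ge> 0" "d2 \<ge> 0"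
  shows "LI (smult d1 (R * Q') + smult d2 ([:0, 1:] ^ s * R * [:0, 4 / X:] ^ J)) \<le>
    exp (- t) * (d1 * (cn * (2 * K / (\<alpha> + 1) + 2 * (2 powr \<bar>\<alpha>\<bar> * C1 powr \<bar>\<alpha>\<bar> * K ^ n)) * h * t powr \<alpha>)
      + (1 / 2) ^ L * (2 * d1 * tail_const 0 + d2 * tail_const s))"
proof -
  interpret S: step_approx \<tau> \<eta> C1 L q J X Ar cQ cq Q by fact
  note t_def[simp] h_def[simp] R_def[simp] K_def[simp]
  have tX: "S.t \<le> X" using S.X by simp
  define Cp where "Cp = 2 * K / (\<alpha> + 1) + 2 * (2 powr \<bar>\<alpha>\<bar> * C1 powr \<bar>\<alpha>\<bar> * K ^ n)"
  obtain G where G: "integrable lborel G" "\<And>y. 0 \<le> G y"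
    "\<And>y. 0 < y \<Longrightarrow> y \<le> X \<Longrightarrow> S.\<theta> y ^ n * y powr \<alpha> \<le> G y"
    "(\<integral>y. G y \<partial>lborel) \<le> Cp * S.h * S.t powr \<alpha>"
    using S.peak_integral[OF alpha n tX] unfolding Cp_def K_def by blast
  define T where "T = (\<lambda>j::nat. \<lambda>y. (1 / 2) ^ L * (y powr (\<alpha> + j) * exp (- (1 / 4) * y)))"
  have T0: "T j y \<ge> 0" for j y by (simp add: T_def)
  have tail: "y ^ j * (poly S.R y * (4 / X * y) ^ J * lag_w \<alpha> 0 y) \<le> exp (- S.t) * T j y" if y: "y > 0" for y j
  proof -
    have "y ^ j * (poly S.R y * (4 / X * y) ^ J * lag_w \<alpha> 0 y) = y powr (\<alpha> + j) * (poly S.R y * (4 / X * y) ^ J * exp (- y))"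
      using y by (simp add: lag_w_def powr_add powr_realpow)
    also have "\<dots> \<le> y powr (\<alpha> + j) * (exp (- S.t) * (1 / 2) ^ L * exp (- y / 4))"
      using S.tail_pointwise[OF XL J, of y] y by (intro mult_left_mono) auto
    finally show ?thesis by (simp add: T_def mult_ac)
  qed
  define g where "g = (\<lambda>y. exp (- S.t) * (d1 * (cn * G y + 2 * T 0 y) + d2 * T s y))"
  have intT: "set_integrable lborel {0<..} (T j)" for j
    unfolding T_def using tail_integrable[of j] by (intro set_integrable_mult_right) auto
  have intG: "set_integrable lborel {0<..} G"
    unfolding set_integrable_def using G(1) by (intro integrable_mult_indicator) auto
  have intg: "set_integrable lborel {0<..} g"
    unfolding g_def using intT intG by (intro set_integrable_mult_right set_integral_add(1)) auto
  have "LI (smult d1 (R * Q') + smult d2 ([:0, 1:] ^ s * R * [:0, 4 / X:] ^ J)) \<le> (LINT y:{0<..}|lborel. g y)"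
  proof (rule LI_le[OF intg])
    fix y :: real assume y: "y > 0"
    have w0: "lag_w \<alpha> 0 y \<ge> 0" by (rule lag_w_nonneg)
    have Ry: "poly S.R y > 0" using S.R_pos y by simp
    have 1: "poly S.R y * poly Q' y * lag_w \<alpha> 0 y \<le> exp (- S.t) * (cn * G y + 2 * T 0 y)"
    proof (cases "y \<le> X")
      case True
      have Q'y: "poly S.R y * poly Q' y \<le> poly S.R y * (cn * S.\<theta> y ^ n)"
        using True y Q'_upper[of y] Ry by (intro mult_left_mono) auto
      have "poly S.R y * poly Q' y * lag_w \<alpha> 0 y \<le> (poly S.R y * (cn * S.\<theta> y ^ n)) * lag_w \<alpha> 0 y"
        using Q'y w0 by (rule mult_right_mono)
      also have "\<dots> \<le> (exp (y - S.t) * (cn * S.\<theta> y ^ n)) * lag_w \<alpha> 0 y"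
        using S.R_le_exp[of y] y w0 cn S.peak_pos[of y] by (intro mult_right_mono) auto
      also have "\<dots> = exp (- S.t) * cn * (S.\<theta> y ^ n * y powr \<alpha>)"
        by (simp add: lag_w_def exp_diff exp_minus field_simps)
      also have "\<dots> \<le> exp (- S.t) * cn * G y" using G(3)[OF y True] cn by (intro mult_left_mono) auto
      also have "\<dots> \<le> exp (- S.t) * (cn * G y + 2 * T 0 y)" using T0[of 0 y] by (simp add: algebra_simps)
      finally show ?thesis .
    next
      case False
      have "poly S.R y * poly Q' y * lag_w \<alpha> 0 y \<le> poly S.R y * (2 * (4 / X * y) ^ J) * lag_w \<alpha> 0 y"
        using False Q'_tail[of y] Ry w0 by (intro mult_right_mono mult_left_mono) auto
      also have "\<dots> \<le> 2 * (exp (- S.t) * T 0 y)" using tail[OF y, of 0] by simp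
      also have "\<dots> \<le> exp (- S.t) * (cn * G y + 2 * T 0 y)" using G(2)[of y] cn by (simp add: algebra_simps)
      finally show ?thesis .
    qed
    have "poly (smult d1 (R * Q') + smult d2 ([:0, 1:] ^ s * R * [:0, 4 / X:] ^ J)) y * lag_w \<alpha> 0 y =
        d1 * (poly S.R y * poly Q' y * lag_w \<alpha> 0 y) + d2 * (y ^ s * (poly S.R y * (4 / X * y) ^ J * lag_w \<alpha> 0 y))"
      by (simp add: algebra_simps)
    also have "\<dots> \<le> d1 * (exp (- S.t) * (cn * G y + 2 * T 0 y)) + d2 * (exp (- S.t) * T s y)"
      using 1 tail[OF y, of s] d by (intro add_mono mult_left_mono) auto
    also have "\<dots> = g y" by (simp add: g_def algebra_simps)
    finally show "poly (smult d1 (R * Q') + smult d2 ([:0, 1:] ^ s * R * [:0, 4 / X:] ^ J)) y * lag_w \<alpha> 0 y \<le> g y" .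
  qed
  also have "(LINT y:{0<..}|lborel. g y) =
      exp (- S.t) * (d1 * (cn * (LINT y:{0<..}|lborel. G y) + 2 * (LINT y:{0<..}|lborel. T 0 y)) + d2 * (LINT y:{0<..}|lborel. T s y))"
    unfolding g_def using intT intG by (simp add: set_integral_add set_integrable_mult_right)
  also have "\<dots> = exp (- S.t) * (d1 * (cn * (LINT y:{0<..}|lborel. G y) + 2 * ((1 / 2) ^ L * tail_const 0)) + d2 * ((1 / 2) ^ L * tail_const s))"
  proof -
    have "(LINT y:{0<..}|lborel. T j y) = (1 / 2) ^ L * tail_const j" for j
      unfolding T_def tail_const_def by (rule set_integral_mult_right)
    then show ?thesis by simp
  qed
  also have "exp (- S.t) * (d1 * (cn * (LINT y:{0<..}|lborel. G y) + 2 * ((1 / 2) ^ L * tail_const 0)) + d2 * ((1 / 2) ^ L * tail_const s)) \<le>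
    exp (- S.t) * (d1 * (cn * (Cp * S.h * S.t powr \<alpha>) + 2 * ((1 / 2) ^ L * tail_const 0)) + d2 * ((1 / 2) ^ L * tail_const s))"
  proof -
    have "(LINT y:{0<..}|lborel. G y) \<le> (\<integral>y. G y \<partial>lborel)"
      unfolding set_lebesgue_integral_def using G intG[unfolded set_integrable_def]
      by (intro integral_mono) (auto simp: indicator_def)
    with G(4) have "(LINT y:{0<..}|lborel. G y) \<le> Cp * S.h * S.t powr \<alpha>" by simp
    then show ?thesis using d cn by (intro mult_left_mono add_mono) auto
  qed
  also have "\<dots> = exp (- S.t) * (d1 * (cn * Cp * S.h * S.t powr \<alpha>) + (1 / 2) ^ L * (2 * d1 * tail_const 0 + d2 * tail_const s))"
    by (simp add: algebra_simps)
  finally show ?thesis by (simp add: Cp_def)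
qed

end

section \<open>Choice of the parameters for the approximating polynomials\<close>

lemma power_le_const_mult_2_power:
  "\<exists>C>0. \<forall>m\<ge>1. real m ^ k \<le> C * 2 ^ m"
proof -
  define C where "C = (max 1 (k / ln 2)) ^ k"
  have "real m ^ k \<le> C * 2 ^ m" for m
  proof -
    have "real m ^ k \<le> (1 + real m) ^ k" by (intro power_mono) auto
    also have "\<dots> \<le> C * exp (ln 2 * m)" unfolding C_def by (rule one_plus_power_le_exp) auto
    also have "exp (ln 2 * m) = (2::real) ^ m" by (simp add: mult.commute exp_of_nat_mult)
    finally show ?thesis .
  qed
  moreover have "C > 0" unfolding C_def by (intro zero_less_power) auto
  ultimately show ?thesis by blast
qed

context laguerre_weight
begin

text \<open>The constants depend on \<alpha>, \<open>s\<close> and \<open>a0\<close> only. The lower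
  end a0 / m of the range of \<open>t\<close> keeps \<eta> below a multiple of \<tau>, the upper end
  c m keeps \<open>h\<close> below 1.\<close>

lemma truncated_power_approximation:
  assumes s: "s \<ge> 1" and a0: "0 < a0" "a0 \<le> 1"
  shows "\<exists>C>0. \<exists>c>0. \<exists>m0. \<forall>m\<ge>m0. \<forall>t. a0 / real m \<le> t \<longrightarrow> t \<le> c * real m \<longrightarrow>
    (\<exists>P S. degree P < 2 * m \<and> degree S < 2 * m \<and>
      (\<forall>y>0. \<bar>(if y \<le> t then (t - y) ^ (s - 1) else 0) - poly P y\<bar> \<le> poly S y) \<and>
      LI S \<le> C * (t / m) powr (s / 2) * lag_w \<alpha> 0 t)"
proof -
  define n where "n = 2 * nat \<lceil>\<bar>\<alpha>\<bar> + 2\<rceil>"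
  \<comment> \<open>\<open>n\<close> is even and large enough for \<open>peak_integral\<close>.
    \<open>q\<close> is then even too, exceeds n + s + 1 as the truncated power requires, and q
    \<ge> 2 s + 2 lets m \<ge> 2 q absorb \<open>s\<close> in the degree count.\<close>
  define q where "q = n + 2 * s + 2"
  define A :: real where "A = 524288"
  define D where "D = 8 * q * sqrt A"
  \<comment> \<open>From \<eta> \<le> D / sqrt m and \<tau> \<ge> sqrt a0 / sqrt m.\<close>
  define C1 where "C1 = max 1 (D / sqrt a0)"
  define K where "K = 4 * C1 + 8"
  define cQ :: real where "cQ = 2 * (4 / 3) ^ q"
  define cq :: real where "cq = (2 / 3) ^ q"
  define cn :: real where "cn = 2 * (4 / 3) ^ n"
  define cn' :: real where "cn' = (2 / 3) ^ n"
  define \<kappa> where "\<kappa> = 1 / (1 + A)"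
  define C\<kappa> where "C\<kappa> = (max 1 (real (2 * q) / (\<kappa> / 2))) ^ (2 * q) * (2 / \<kappa>)"
  define c0 where "c0 = cq * (4 / 5) ^ q"
  define Cerr where "Cerr = cQ * (K\<^sup>2 * exp 1 + C\<kappa> * K) / c0"
  define Cp where "Cp = 2 * K / (\<alpha> + 1) + 2 * (2 powr \<bar>\<alpha>\<bar> * C1 powr \<bar>\<alpha>\<bar> * K ^ n)"
  define E1 where "E1 = Cerr * K ^ (s - 1) / cn'"
  define k where "k = nat \<lceil>real s + 1 + \<bar>\<alpha>\<bar>\<rceil>"
  define ch where "ch = 4 * q * sqrt A * sqrt a0"
  obtain Ck where Ck: "Ck > 0" "\<And>m. m \<ge> 1 \<Longrightarrow> real m ^ k \<le> Ck * 2 ^ m"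
    using power_le_const_mult_2_power[of k] by blast
  define Ct where "Ct = Ck / (ch ^ (s + 1) * a0 powr \<bar>\<alpha>\<bar>)"
  define C where "C = (E1 * (cn * Cp) + Ct * (2 * E1 * tail_const 0 + 2 / c0 * tail_const s)) * D ^ s + 1"
  \<comment> \<open>For t \<le> c m the bound D * sqrt (t / m) for \<open>h\<close> is at most
    1.\<close>
  define c where "c = 1 / D\<^sup>2"
  have q2: "q \<ge> 2" "real q \<ge> 2" by (auto simp: q_def)
  have n_ge: "real n \<ge> \<bar>\<alpha>\<bar> + 2" unfolding n_def by (simp, linarith)
  have sA: "sqrt A \<ge> 1" by (simp add: A_def)
  have D16: "D \<ge> 16"
    unfolding D_def using mult_mono[of 16 "8 * real q" 1 "sqrt A"] q2 sA by simp
  have C1: "C1 \<ge> 1" "C1 \<ge> D / sqrt a0" by (auto simp: C1_def)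
  have pos: "K > 0" "cQ > 0" "cq > 0" "cn > 0" "cn' > 0" "\<kappa> > 0" "c0 > 0" "ch > 0"
    using C1 q2 sA a0 by (auto simp: K_def cQ_def cq_def cn_def cn'_def \<kappa>_def A_def c0_def ch_def)
  have C\<kappa>: "C\<kappa> > 0" unfolding C\<kappa>_def using pos by (intro mult_pos_pos zero_less_power) auto
  have Cerr: "Cerr > 0" unfolding Cerr_def using pos C\<kappa> by (intro divide_pos_pos mult_pos_pos add_pos_pos) auto
  have E1: "E1 > 0" unfolding E1_def using pos Cerr by (intro divide_pos_pos mult_pos_pos zero_less_power) auto
  have "2 * K / (\<alpha> + 1) \<ge> 0" using pos alpha by simp
  then have Cp: "Cp \<ge> 0" unfolding Cp_def using pos by simp
  have Ct: "Ct > 0" unfolding Ct_def using Ck pos a0 by (intro divide_pos_pos mult_pos_pos zero_less_power) auto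
  have Cbr: "E1 * (cn * Cp) + Ct * (2 * E1 * tail_const 0 + 2 / c0 * tail_const s) \<ge> 0"
    using E1 Cp Ct pos tail_const_nonneg
    by (intro add_nonneg_nonneg mult_nonneg_nonneg) auto
  have C0: "C > 0" unfolding C_def using Cbr D16 by (intro add_nonneg_pos mult_nonneg_nonneg) auto
  have c: "c > 0" "c \<le> 1 / 2" unfolding c_def using D16 power_mono[of 16 D 2] by (auto simp: divide_le_eq)
  have main: "\<exists>P S. degree P < 2 * m \<and> degree S < 2 * m \<and>
      (\<forall>y>0. \<bar>(if y \<le> t then (t - y) ^ (s - 1) else 0) - poly P y\<bar> \<le> poly S y) \<and>
      LI S \<le> C * (t / m) powr (s / 2) * lag_w \<alpha> 0 t"
    if m: "m \<ge> 2 * q" and t: "a0 / real m \<le> t" "t \<le> c * real m" for m t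
  proof -
    have m1: "real m \<ge> 2 * real q" "real m \<ge> 1" "m \<ge> 1" using m q2 by auto
    \<comment> \<open>\<open>R\<close> takes m of the available degrees. \<open>J\<close>, the
      product of \<open>N\<close> and \<open>q\<close>, lies between m/4 and m/2, so P and S stay
      below degree 2m with room for the power of order \<open>s\<close>.\<close>
    define N where "N = m div (2 * q)"
    define X where "X = A * m"
    \<comment> \<open>sqrt z + \<tau> is at most 2 sqrt X as long as z and t do not exceed
      \<open>X\<close>. As \<open>B\<close> is of order sqrt m and \<open>N\<close> of order m,
      \<eta> = B / N is of order 1/sqrt m.\<close>
    define B where "B = 2 * sqrt X"
    define J where "J = N * q"
    define \<tau> where "\<tau> = sqrt t"
    define \<eta> where "\<eta> = B / N"
    have N1: "N \<ge> 1" using m q2 by (simp add: N_def div_greater_zero_iff Suc_le_eq)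
    have N_le: "2 * J \<le> m" unfolding J_def N_def by (metis div_times_less_eq_dividend mult.assoc mult.commute)
    have N_ge: "m \<le> 4 * J"
    proof -
      have "m = N * (2 * q) + m mod (2 * q)" unfolding N_def by (rule div_mult_mod_eq[symmetric])
      also have "m mod (2 * q) \<le> 1 * (2 * q)" using q2 by (simp add: less_imp_le)
      also have "1 * (2 * q) \<le> N * (2 * q)" using N1 by (intro mult_right_mono) auto
      finally show ?thesis by (simp add: J_def)
    qed
    have Nr: "real m \<le> 4 * q * real N" "2 * q * real N \<le> m"
      using of_nat_mono[OF N_ge, where 'a = real] of_nat_mono[OF N_le, where 'a = real] by (simp_all add: J_def mult_ac)
    have X0: "X > 0" using m1 by (simp add: X_def A_def)
    have B0: "B > 0" using X0 by (simp add: B_def)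
    have t0: "t > 0" using t(1) a0 m1 by (smt (verit) divide_pos_pos)
    have \<tau>0: "\<tau> > 0" "\<tau>\<^sup>2 = t" using t0 by (auto simp: \<tau>_def)
    have \<eta>0: "\<eta> > 0" using B0 N1 by (simp add: \<eta>_def)
    define \<sigma> where "\<sigma> = sqrt (real m)"
    have sm: "\<sigma> > 0" "\<sigma> * \<sigma> = m" using m1 by (auto simp: \<sigma>_def)
    have B_eq: "B = 2 * sqrt A * \<sigma>" by (simp add: B_def X_def real_sqrt_mult \<sigma>_def)
    have \<eta>_up: "\<eta> \<le> D / \<sigma>"
    proof -
      have "\<eta> = 2 * sqrt A * (\<sigma> * \<sigma>) / (N * \<sigma>)"
        unfolding \<eta>_def B_eq using sm(1) by simp
      also have "\<dots> = 2 * sqrt A * m / (N * \<sigma>)" by (simp only: sm(2))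
      also have "\<dots> \<le> 2 * sqrt A * (4 * q * real N) / (N * \<sigma>)"
        using Nr sA sm by (intro divide_right_mono mult_left_mono) auto
      also have "\<dots> = D / \<sigma>" using N1 by (simp add: D_def)
      finally show ?thesis .
    qed
    have \<eta>_low: "4 * q * sqrt A / \<sigma> \<le> \<eta>"
    proof -
      have "4 * q * sqrt A / \<sigma> = 2 * sqrt A * (2 * q * real N) / (N * \<sigma>)" using N1 by simp
      also have "\<dots> \<le> 2 * sqrt A * m / (N * \<sigma>)"
        using Nr sA sm by (intro divide_right_mono mult_left_mono) auto
      also have "\<dots> = 2 * sqrt A * (\<sigma> * \<sigma>) / (N * \<sigma>)" by (simp only: sm(2))
      also have "\<dots> = \<eta>" unfolding \<eta>_def B_eq using sm(1) by simp
      finally show ?thesis .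
    qed
    have \<tau>_low: "sqrt a0 / \<sigma> \<le> \<tau>"
      using t(1) by (simp add: \<tau>_def \<sigma>_def flip: real_sqrt_divide)
    have \<eta>_le: "\<eta> \<le> C1 * \<tau>"
    proof -
      have "\<eta> \<le> D / sqrt a0 * (sqrt a0 / \<sigma>)" using \<eta>_up a0 by simp
      also have "\<dots> \<le> C1 * \<tau>" using C1 \<tau>_low a0 D16 sm by (intro mult_mono) auto
      finally show ?thesis .
    qed
    define h where "h = \<tau> * \<eta>"
    have h0: "h > 0" using \<tau>0 \<eta>0 by (simp add: h_def)
    have h_up: "h \<le> D * sqrt (t / m)"
      using \<eta>_up \<tau>0 mult_left_mono[OF \<eta>_up, of \<tau>] by (simp add: h_def \<tau>_def \<sigma>_def real_sqrt_divide mult.commute)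
    have h1: "h \<le> 1"
    proof -
      have "sqrt (t / m) \<le> sqrt c" using t(2) m1 by (intro real_sqrt_le_mono) (simp add: divide_le_eq)
      also have "sqrt c = 1 / D" unfolding c_def using D16 by (simp add: real_sqrt_divide)
      finally have "D * sqrt (t / m) \<le> D * (1 / D)" using D16 by (intro mult_left_mono) auto
      then show ?thesis using h_up D16 by simp
    qed
    have h_low: "ch / m \<le> h"
    proof -
      have "(sqrt a0 / \<sigma>) * (4 * q * sqrt A / \<sigma>) \<le> h"
        unfolding h_def using \<tau>_low \<eta>_low a0 sA \<tau>0 sm by (intro mult_mono) auto
      moreover have "(sqrt a0 / \<sigma>) * (4 * q * sqrt A / \<sigma>) = ch / m" by (simp add: ch_def mult_ac flip: sm(2))
      ultimately show ?thesis by simp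
    qed
    have tm: "t \<le> m / 2" using t(2) mult_right_mono[OF c(2), of "real m"] by simp
    have tX: "t + 1 \<le> X" using tm m1 by (simp add: X_def A_def)
    have sq_le: "(sqrt z + \<tau>)\<^sup>2 \<le> B\<^sup>2 * (y / X)" if "0 \<le> z" "z \<le> y" "t \<le> y" for z y
    proof -
      have "(sqrt z + \<tau>)\<^sup>2 \<le> (sqrt y + sqrt y)\<^sup>2"
        using that \<tau>0 unfolding \<tau>_def by (intro power_mono add_mono) auto
      also have "\<dots> = B\<^sup>2 * (y / X)" using that X0 by (simp add: B_def power_mult_distrib flip: mult_2)
      finally show ?thesis .
    qed
    have sq_le_X: "(sqrt z + \<tau>)\<^sup>2 \<le> B\<^sup>2" if "0 \<le> z" "z \<le> X" for z
      using sq_le[OF that] tX X0 by simp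
    obtain Q where Q: "degree Q \<le> N * q"
      "\<And>z. 0 \<le> z \<Longrightarrow> (sqrt z + \<tau>)\<^sup>2 \<le> B\<^sup>2 \<Longrightarrow> (2 / 3) ^ q * peak \<tau> (B / N) z ^ q \<le> poly Q z"
      "\<And>z. 0 \<le> z \<Longrightarrow> (sqrt z + \<tau>)\<^sup>2 \<le> B\<^sup>2 \<Longrightarrow> poly Q z \<le> 2 * (4 / 3) ^ q * peak \<tau> (B / N) z ^ q"
      "\<And>z. 0 \<le> z \<Longrightarrow> 0 \<le> poly Q z"
      "\<And>z W. 0 \<le> z \<Longrightarrow> 1 \<le> W \<Longrightarrow> (sqrt z + \<tau>)\<^sup>2 \<le> B\<^sup>2 * W \<Longrightarrow> poly Q z \<le> 2 * (4 * W) ^ (N * q)"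
      using peak_poly[of N B \<tau> q] N1 B0 \<tau>0 by (auto simp: q_def n_def)
    obtain Q' where Q': "degree Q' \<le> N * n"
      "\<And>z. 0 \<le> z \<Longrightarrow> (sqrt z + \<tau>)\<^sup>2 \<le> B\<^sup>2 \<Longrightarrow> (2 / 3) ^ n * peak \<tau> (B / N) z ^ n \<le> poly Q' z"
      "\<And>z. 0 \<le> z \<Longrightarrow> (sqrt z + \<tau>)\<^sup>2 \<le> B\<^sup>2 \<Longrightarrow> poly Q' z \<le> 2 * (4 / 3) ^ n * peak \<tau> (B / N) z ^ n"
      "\<And>z. 0 \<le> z \<Longrightarrow> 0 \<le> poly Q' z"
      "\<And>z W. 0 \<le> z \<Longrightarrow> 1 \<le> W \<Longrightarrow> (sqrt z + \<tau>)\<^sup>2 \<le> B\<^sup>2 * W \<Longrightarrow> poly Q' z \<le> 2 * (4 * W) ^ (N * n)"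
      using peak_poly[of N B \<tau> n] N1 B0 \<tau>0 by (auto simp: n_def)
    interpret Ps: peak_setup \<tau> \<eta> C1
      by unfold_locales (use \<tau>0 \<eta>0 C1 \<eta>_le in auto)
    have tt: "Ps.t = t" using \<tau>0 by (simp add: Ps.t_def)
    have hh: "Ps.h = h" by (simp add: Ps.h_def h_def)
    have KK: "Ps.K = K" by (simp add: Ps.K_def K_def)
    have step: "step_approx \<tau> \<eta> C1 m q J X A cQ cq Q"
    proof unfold_locales
      show "Ps.t < real m" unfolding tt using tm m1 by simp
      show "Ps.t + 1 \<le> X" unfolding tt by (rule tX)
      show "X \<le> A * real m" by (simp add: X_def)
      show "Ps.h \<le> 1" unfolding hh by (rule h1)
      show "poly Q z \<le> cQ * Ps.\<theta> z ^ q" if "0 \<le> z" "z \<le> X" for z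
        using Q(3)[OF that(1) sq_le_X[OF that]] by (simp add: cQ_def \<eta>_def)
      show "cq * Ps.\<theta> z ^ q \<le> poly Q z" if "0 \<le> z" "z \<le> X" for z
        using Q(2)[OF that(1) sq_le_X[OF that]] by (simp add: cq_def \<eta>_def)
      show "poly Q z \<le> 2 * (4 * (y / X)) ^ J" if "0 \<le> z" "z \<le> y" "X \<le> y" for z y
        unfolding J_def using Q(5)[OF that(1) _ sq_le[OF that(1,2)]] that tX X0 by simp
    qed (use q2 pos Q(4) in auto)
    interpret S: step_approx \<tau> \<eta> C1 m q J X A cQ cq Q by (rule step)
    define P where "P = [:t, -1:] ^ (s - 1) * (1 - smult (1 / poly S.F (t + 1)) S.F)"
    define d1 where "d1 = Cerr * (K * h) ^ (s - 1) / cn'"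
    define d2 where "d2 = 2 / (c0 * h)"
    define S where "S = smult d1 (S.R * Q') + smult d2 ([:0, 1:] ^ s * S.R * [:0, 4 / X:] ^ J)"
    have const_eqs: "S.\<kappa> = \<kappa>" "S.C\<kappa> = C\<kappa>" "S.c0 = c0" "S.Cerr = Cerr"
      by (simp_all add: S.\<kappa>_def \<kappa>_def S.C\<kappa>_def C\<kappa>_def S.c0_def c0_def S.Cerr_def Cerr_def KK)
    have degR: "degree S.R \<le> m"
      unfolding S.R_def by (intro order.trans[OF degree_power_le]) auto
    have degF: "degree S.F \<le> m + J + 1"
      using S.F(3) degR Q(1) degree_mult_le[of S.R Q] by (simp add: J_def)
    have sJ: "2 * s + 2 \<le> q" by (simp add: q_def)
    have "degree P \<le> (s - 1) + (m + J + 1)"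
    proof -
      have "degree ([:t, -1:] ^ (s - 1)) \<le> s - 1" by (intro order.trans[OF degree_power_le]) auto
      moreover have "degree (1 - smult (1 / poly S.F (t + 1)) S.F) \<le> m + J + 1"
        using degF by (intro degree_diff_le) (auto intro: order.trans[OF degree_smult_le])
      ultimately show ?thesis unfolding P_def by (intro order.trans[OF degree_mult_le] add_mono)
    qed
    then have degP: "degree P < 2 * m" using s N_le m sJ by linarith
    have "N * n \<le> J" unfolding J_def by (intro mult_left_mono) (simp_all add: q_def)
    then have "degree (S.R * Q') \<le> m + J"
      using degree_mult_le[of S.R Q'] degR Q'(1) by linarith
    moreover have "degree ([:0, 1:] ^ s * S.R * [:0, 4 / X:] ^ J) \<le> (s + m) + J"
    proof (intro order.trans[OF degree_mult_le] add_mono degR)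
      show "degree ([:0, 1::real:] ^ s) \<le> s" by (intro order.trans[OF degree_power_le]) auto
      show "degree ([:0, 4 / X:] ^ J) \<le> J" by (intro order.trans[OF degree_power_le]) auto
    qed
    ultimately have "degree S \<le> s + m + J"
      unfolding S_def by (intro degree_add_le order.trans[OF degree_smult_le]) auto
    then have degS: "degree S < 2 * m" using s N_le m sJ by linarith
    have bound: "\<bar>(if y \<le> t then (t - y) ^ (s - 1) else 0) - poly P y\<bar> \<le> poly S y" if "y > 0" for y
      using S.truncated_power_error[of s n cn' Q' y] s pos that Q'(2) Q'(4) sq_le_X
      unfolding P_def S_def d1_def d2_def tt hh KK const_eqs by (simp add: cn'_def \<eta>_def q_def)
    have "LI S \<le> exp (- t) * (d1 * (cn * Cp) * h * t powr \<alpha> + (1 / 2) ^ m * (2 * d1 * tail_const 0 + d2 * tail_const s))"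
    proof -
      have Q'up: "poly Q' z \<le> cn * peak \<tau> \<eta> z ^ n" if "0 \<le> z" "z \<le> X" for z
        using Q'(3)[OF that(1) sq_le_X[OF that]] by (simp add: cn_def \<eta>_def)
      have Q'tail: "poly Q' z \<le> 2 * (4 / X * z) ^ J" if "X \<le> z" for z
      proof -
        have "poly Q' z \<le> 2 * (4 * (z / X)) ^ (N * n)"
          using Q'(5)[of z "z / X"] sq_le[of z z] that X0 tX by simp
        also have "\<dots> \<le> 2 * (4 * (z / X)) ^ J"
          using that X0 \<open>N * n \<le> J\<close> by (intro mult_left_mono power_increasing) (auto simp: le_divide_eq)
        finally show ?thesis by simp
      qed
      have "X = 524288 * m" by (simp add: X_def A_def)
      moreover have "0 \<le> d1" "0 \<le> d2" using Cerr pos h0 by (auto simp: d1_def d2_def)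
      ultimately show ?thesis
        using LI_majorant_bound[OF step _ N_ge N_le n_ge _ Q'up Q'tail, of d1 d2 s] pos
        unfolding S_def tt hh KK Cp_def by (simp add: mult.assoc)
    qed
    also have "\<dots> \<le> exp (- t) * ((E1 * (cn * Cp) + Ct * (2 * E1 * tail_const 0 + 2 / c0 * tail_const s)) * h ^ s * t powr \<alpha>)"
    proof (intro mult_left_mono)
      have d1: "d1 = E1 * h ^ (s - 1)" by (simp add: d1_def E1_def power_mult_distrib)
      have hs: "h ^ (s - 1) * h = h ^ s" using s by (cases s) auto
      \<comment> \<open>The lower bound for \<open>h\<close> and the two-sided bounds for
        \<open>t\<close> make the right side at least a fixed negative power of m; \<open>Ct\<close>
        is chosen so that 2^(-m) lies below it. This hides the exponentially small tails in the main
        term.\<close>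
      have key: "(1 / 2) ^ m \<le> Ct * h ^ (s + 1) * t powr \<alpha>"
      proof -
        have "(a0 / m) powr \<bar>\<alpha>\<bar> \<le> t powr \<alpha>"
        proof (cases "\<alpha> \<ge> 0")
          case True
          then show ?thesis using t(1) a0 by (simp add: powr_mono2)
        next
          case False
          have "t \<le> m / a0"
          proof -
            have "t \<le> m / 1" using tm m1 by simp
            also have "\<dots> \<le> m / a0" using a0 by (intro divide_left_mono) auto
            finally show ?thesis .
          qed
          then have "(m / a0) powr \<alpha> \<le> t powr \<alpha>" using False t0 by (intro powr_mono2') auto
          moreover have "(a0 / m) powr \<bar>\<alpha>\<bar> = (m / a0) powr \<alpha>"
            using False a0 m1 by (simp add: powr_divide powr_minus_divide)
          ultimately show ?thesis by simp
        qed
        moreover have "(ch / m) ^ (s + 1) \<le> h ^ (s + 1)" using h_low pos by (intro power_mono) auto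
        ultimately have "(ch / m) ^ (s + 1) * (a0 / m) powr \<bar>\<alpha>\<bar> \<le> h ^ (s + 1) * t powr \<alpha>"
          using h0 by (intro mult_mono) auto
        moreover have "(ch / m) ^ (s + 1) * (a0 / m) powr \<bar>\<alpha>\<bar> = (ch ^ (s + 1) * a0 powr \<bar>\<alpha>\<bar>) / (real m ^ (s + 1) * m powr \<bar>\<alpha>\<bar>)"
          using a0 m1 by (simp add: power_divide powr_divide)
        moreover have "(ch ^ (s + 1) * a0 powr \<bar>\<alpha>\<bar>) / (Ck * 2 ^ m) \<le> (ch ^ (s + 1) * a0 powr \<bar>\<alpha>\<bar>) / (real m ^ (s + 1) * m powr \<bar>\<alpha>\<bar>)"
        proof (rule divide_left_mono)
          have "real m ^ (s + 1) * m powr \<bar>\<alpha>\<bar> = m powr (real s + 1 + \<bar>\<alpha>\<bar>)"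
            using m1 by (simp add: powr_add powr_realpow)
          also have "\<dots> \<le> m powr k" unfolding k_def using m1 by (intro powr_mono) (linarith, auto)
          also have "\<dots> = real m ^ k" using m1 by (simp add: powr_realpow)
          also have "\<dots> \<le> Ck * 2 ^ m" using Ck(2) m1 by simp
          finally show "real m ^ (s + 1) * m powr \<bar>\<alpha>\<bar> \<le> Ck * 2 ^ m" .
        qed (use pos a0 m1 Ck in auto)
        ultimately have "(ch ^ (s + 1) * a0 powr \<bar>\<alpha>\<bar>) / (Ck * 2 ^ m) \<le> h ^ (s + 1) * t powr \<alpha>" by linarith
        then have "Ct * ((ch ^ (s + 1) * a0 powr \<bar>\<alpha>\<bar>) / (Ck * 2 ^ m)) \<le> Ct * (h ^ (s + 1) * t powr \<alpha>)"
          using Ct by (intro mult_left_mono) auto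
        moreover have "Ct * ((ch ^ (s + 1) * a0 powr \<bar>\<alpha>\<bar>) / (Ck * 2 ^ m)) = (1 / 2) ^ m"
          using pos a0 Ck by (simp add: Ct_def power_divide)
        ultimately show ?thesis by (simp add: mult.assoc)
      qed
      have "(1 / 2) ^ m * (2 * d1 * tail_const 0) \<le> Ct * h ^ s * t powr \<alpha> * (2 * E1 * tail_const 0)"
      proof -
        have "(1 / 2) ^ m * h ^ (s - 1) \<le> (Ct * h ^ (s + 1) * t powr \<alpha>) * 1"
          using key h0 h1 Ct by (intro mult_mono power_le_one) auto
        also have "\<dots> \<le> Ct * h ^ s * t powr \<alpha>"
          using Ct h0 h1 by (simp add: mult_right_mono mult_left_mono mult_left_le_one_le)
        finally have "((1 / 2) ^ m * h ^ (s - 1)) * (2 * E1 * tail_const 0) \<le> Ct * h ^ s * t powr \<alpha> * (2 * E1 * tail_const 0)"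
          using E1 tail_const_nonneg[of 0] by (intro mult_right_mono) auto
        then show ?thesis by (simp add: d1 mult_ac)
      qed
      moreover have "(1 / 2) ^ m * (d2 * tail_const s) \<le> Ct * h ^ s * t powr \<alpha> * (2 / c0 * tail_const s)"
      proof -
        have "(1 / 2) ^ m * (1 / h) \<le> (Ct * h ^ (s + 1) * t powr \<alpha>) * (1 / h)"
          using key h0 by (intro mult_right_mono) auto
        also have "\<dots> = Ct * h ^ s * t powr \<alpha>" using h0 by simp
        finally have "((1 / 2) ^ m * (1 / h)) * (2 / c0 * tail_const s) \<le> Ct * h ^ s * t powr \<alpha> * (2 / c0 * tail_const s)"
          using pos tail_const_nonneg[of s] by (intro mult_right_mono) auto
        then show ?thesis by (simp add: d2_def mult_ac)
      qed
      ultimately have tails: "(1 / 2) ^ m * (2 * d1 * tail_const 0) + (1 / 2) ^ m * (d2 * tail_const s) \<le>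
          Ct * h ^ s * t powr \<alpha> * (2 * E1 * tail_const 0) + Ct * h ^ s * t powr \<alpha> * (2 / c0 * tail_const s)"
        by (rule add_mono)
      have "d1 * (cn * Cp) * h * t powr \<alpha> = E1 * (cn * Cp) * (h ^ (s - 1) * h) * t powr \<alpha>"
        by (simp only: d1 mult_ac)
      then have "d1 * (cn * Cp) * h * t powr \<alpha> + (1 / 2) ^ m * (2 * d1 * tail_const 0 + d2 * tail_const s) =
          E1 * (cn * Cp) * h ^ s * t powr \<alpha> + ((1 / 2) ^ m * (2 * d1 * tail_const 0) + (1 / 2) ^ m * (d2 * tail_const s))"
        by (simp only: hs distrib_left)
      also have "\<dots> \<le> E1 * (cn * Cp) * h ^ s * t powr \<alpha> +
          (Ct * h ^ s * t powr \<alpha> * (2 * E1 * tail_const 0) + Ct * h ^ s * t powr \<alpha> * (2 / c0 * tail_const s))"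
        using tails by (rule add_left_mono)
      also have "\<dots> = (E1 * (cn * Cp) + Ct * (2 * E1 * tail_const 0 + 2 / c0 * tail_const s)) * h ^ s * t powr \<alpha>"
        by (simp only: distrib_left distrib_right mult_ac)
      finally show "d1 * (cn * Cp) * h * t powr \<alpha> + (1 / 2) ^ m * (2 * d1 * tail_const 0 + d2 * tail_const s)
        \<le> (E1 * (cn * Cp) + Ct * (2 * E1 * tail_const 0 + 2 / c0 * tail_const s)) * h ^ s * t powr \<alpha>" .
    qed auto
    also have "\<dots> \<le> exp (- t) * (C * (t / m) powr (s / 2) * t powr \<alpha>)"
    proof (intro mult_left_mono mult_right_mono)
      have "h ^ s \<le> (D * sqrt (t / m)) ^ s" using h_up h0 by (intro power_mono) auto
      also have "\<dots> = D ^ s * (t / m) powr (s / 2)"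
        using t0 m1 by (simp add: power_mult_distrib powr_half_sqrt[symmetric] powr_powr flip: powr_realpow)
      finally have "(E1 * (cn * Cp) + Ct * (2 * E1 * tail_const 0 + 2 / c0 * tail_const s)) * h ^ s \<le>
          (E1 * (cn * Cp) + Ct * (2 * E1 * tail_const 0 + 2 / c0 * tail_const s)) * (D ^ s * (t / m) powr (s / 2))"
        using Cbr by (intro mult_left_mono) auto
      also have "\<dots> \<le> C * (t / m) powr (s / 2)" by (simp add: C_def algebra_simps)
      finally show "(E1 * (cn * Cp) + Ct * (2 * E1 * tail_const 0 + 2 / c0 * tail_const s)) * h ^ s \<le> C * (t / m) powr (s / 2)" .
    qed auto
    also have "\<dots> = C * (t / m) powr (s / 2) * lag_w \<alpha> 0 t" by (simp add: lag_w_def)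
    finally show ?thesis using degP degS bound by blast
  qed
  show ?thesis
    using main C0 c(1) by blast
qed

end

section \<open>Smooth functions and weak derivatives\<close>

text \<open>\<open>smooth_real\<close> speaks of iterated \<open>deriv\<close>, awkward for products
  and substitutions. Here the derivatives are existentially quantified, which makes the closure
  rules easy; \<open>smooth_realI\<close> converts back, since a derivative is unique.\<close>

primrec n_times_diff :: "nat \<Rightarrow> (real \<Rightarrow> real) \<Rightarrow> bool" where
  "n_times_diff 0 f \<longleftrightarrow> True"
| "n_times_diff (Suc n) f \<longleftrightarrow> (\<exists>f'. (\<forall>x. (f has_real_derivative f' x) (at x)) \<and> n_times_diff n f')"

lemma n_times_diff_Suc: "n_times_diff (Suc n) f \<Longrightarrow> n_times_diff n f"
proof (induction n arbitrary: f)
  case (Suc n)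
  obtain f' where f': "\<forall>x. (f has_real_derivative f' x) (at x)" "n_times_diff (Suc n) f'"
    using Suc.prems n_times_diff.simps(2)[of "Suc n" f] by blast
  from f'(1) Suc.IH[OF f'(2)] show ?case unfolding n_times_diff.simps(2) by blast
qed simp

lemma n_times_diff_add: "n_times_diff n f \<Longrightarrow> n_times_diff n g \<Longrightarrow> n_times_diff n (\<lambda>x. f x + g x)"
proof (induction n arbitrary: f g)
  case (Suc n)
  then obtain f' g' where "\<And>x. (f has_real_derivative f' x) (at x)" "n_times_diff n f'"
    "\<And>x. (g has_real_derivative g' x) (at x)" "n_times_diff n g'" by auto
  then show ?case using Suc.IH[of f' g'] by (auto intro!: exI[of _ "\<lambda>x. f' x + g' x"] DERIV_add)
qed auto

lemma n_times_diff_mult: "n_times_diff n f \<Longrightarrow> n_times_diff n g \<Longrightarrow> n_times_diff n (\<lambda>x. f x * g x)"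
proof (induction n arbitrary: f g)
  case (Suc n)
  then obtain f' g' where fg: "\<And>x. (f has_real_derivative f' x) (at x)" "n_times_diff n f'"
    "\<And>x. (g has_real_derivative g' x) (at x)" "n_times_diff n g'" by auto
  have "n_times_diff n (\<lambda>x. f' x * g x + f x * g' x)"
    by (intro n_times_diff_add Suc.IH fg n_times_diff_Suc[OF Suc.prems(1)] n_times_diff_Suc[OF Suc.prems(2)])
  moreover have "((\<lambda>x. f x * g x) has_real_derivative f' x * g x + f x * g' x) (at x)" for x
    using DERIV_mult[OF fg(1)[of x] fg(3)[of x]] by (simp add: algebra_simps)
  ultimately show ?case by (auto intro!: exI[of _ "\<lambda>x. f' x * g x + f x * g' x"])
qed auto

lemma n_times_diff_const: "n_times_diff n (\<lambda>x. c)"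
  by (induction n arbitrary: c) (auto intro!: exI[of _ "\<lambda>x. 0"])

lemma n_times_diff_affine: "n_times_diff n f \<Longrightarrow> n_times_diff n (\<lambda>x. f (a * x + b))"
proof (induction n arbitrary: f)
  case (Suc n)
  then obtain f' where f: "\<And>x. (f has_real_derivative f' x) (at x)" "n_times_diff n f'" by auto
  have "n_times_diff n (\<lambda>x. a * f' (a * x + b))"
    using Suc.IH[OF f(2)] by (intro n_times_diff_mult n_times_diff_const)
  moreover have "((\<lambda>x. f (a * x + b)) has_real_derivative a * f' (a * x + b)) (at x)" for x
  proof -
    have "((\<lambda>x. a * x + b) has_real_derivative a) (at x)" by (auto intro!: derivative_eq_intros)
    from DERIV_chain2[OF f(1) this] show ?thesis by (simp add: mult.commute)
  qed
  ultimately show ?case by (auto intro!: exI[of _ "\<lambda>x. a * f' (a * x + b)"])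
qed auto

lemma smooth_realI:
  assumes "\<And>n. n_times_diff n f"
  shows "smooth_real f"
proof -
  have deriv: "(\<forall>x. (g has_real_derivative deriv g x) (at x)) \<and> (\<forall>n. n_times_diff n (deriv g))"
    if g: "\<And>n. n_times_diff n g" for g
  proof -
    have "\<exists>g'. (\<forall>x. (g has_real_derivative g' x) (at x)) \<and> n_times_diff n g'" for n
      using g[of "Suc n"] by simp
    moreover have "g' = deriv g" if "\<forall>x. (g has_real_derivative g' x) (at x)" for g'
      using that by (intro ext DERIV_imp_deriv[symmetric]) auto
    ultimately show ?thesis by metis
  qed
  have "\<forall>n. n_times_diff n ((deriv ^^ k) f)" for k
    by (induction k) (use assms deriv in auto)
  then show ?thesis unfolding smooth_real_def using deriv by simp
qed

lemma smooth_real_deriv: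
  assumes "smooth_real f"
  shows "smooth_real (deriv f)"
  unfolding smooth_real_def
proof (intro allI)
  fix k x
  have "(deriv ^^ i) (deriv f) = (deriv ^^ Suc i) f" for i
    by (simp add: funpow_Suc_right del: funpow.simps)
  then show "((deriv ^^ k) (deriv f) has_real_derivative (deriv ^^ Suc k) (deriv f) x) (at x)"
    using assms unfolding smooth_real_def by metis
qed

lemma smooth_real_DERIV: "smooth_real f \<Longrightarrow> (f has_real_derivative deriv f x) (at x)"
  unfolding smooth_real_def by (drule spec[of _ 0]) simp

lemma smooth_real_antideriv:
  assumes "\<And>x. (F has_real_derivative f x) (at x)" "smooth_real f"
  shows "smooth_real F"
proof -
  have d: "deriv F = f" using assms(1) by (intro ext DERIV_imp_deriv)
  show ?thesis unfolding smooth_real_def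
  proof (intro allI)
    fix k x
    show "((deriv ^^ k) F has_real_derivative (deriv ^^ Suc k) F x) (at x)"
    proof (cases k)
      case (Suc j)
      have "(deriv ^^ Suc i) F = (deriv ^^ i) f" for i by (simp add: funpow_Suc_right d del: funpow.simps)
      then show ?thesis using assms(2) Suc unfolding smooth_real_def by (simp del: funpow.simps)
    qed (use assms(1) d in simp)
  qed
qed

lemma smooth_real_lincomb:
  assumes "smooth_real f" "smooth_real g"
  shows "smooth_real (\<lambda>x. f x - c * g x)"
proof -
  have "(deriv ^^ k) (\<lambda>x. f x - c * g x) = (\<lambda>x. (deriv ^^ k) f x - c * (deriv ^^ k) g x)" for k
  proof (induction k)
    case (Suc k)
    have "deriv (\<lambda>x. (deriv ^^ k) f x - c * (deriv ^^ k) g x) x = (deriv ^^ Suc k) f x - c * (deriv ^^ Suc k) g x" for x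
      using assms unfolding smooth_real_def
      by (intro DERIV_imp_deriv DERIV_diff DERIV_cmult) auto
    then show ?case using Suc by auto
  qed simp
  then show ?thesis using assms unfolding smooth_real_def
    by (auto intro!: DERIV_diff DERIV_cmult simp del: funpow.simps)
qed

lemma smooth_real_continuous: "smooth_real f \<Longrightarrow> continuous_on A f"
  by (intro continuous_at_imp_continuous_on ballI DERIV_isCont[OF smooth_real_DERIV])

text \<open>The polynomial factor makes this family closed under differentiation.\<close>

definition flat_exp :: "real \<Rightarrow> real poly \<Rightarrow> real \<Rightarrow> real" where
  "flat_exp c p x = (if x > 0 then poly p (1 / x) * exp (- c / x) else 0)"

lemma poly_exp_tendsto_0:
  fixes c :: real
  assumes "c > 0"
  shows "((\<lambda>y. poly p y * exp (- c * y)) \<longlongrightarrow> 0) at_top"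
proof -
  have mono: "((\<lambda>y. y ^ k * exp (- c * y)) \<longlongrightarrow> 0) at_top" for k
  proof -
    have "filterlim (\<lambda>y. c * y) at_top at_top"
      by (rule filterlim_tendsto_pos_mult_at_top[OF tendsto_const assms filterlim_ident])
    from filterlim_compose[OF tendsto_power_div_exp_0[of k] this]
    have "((\<lambda>y. (c * y) ^ k / exp (c * y)) \<longlongrightarrow> 0) at_top" .
    from tendsto_mult_right[OF this, of "1 / c ^ k"] show ?thesis
      using assms by (simp add: power_mult_distrib exp_minus field_simps)
  qed
  have "((\<lambda>y. \<Sum>i\<le>degree p. coeff p i * (y ^ i * exp (- c * y))) \<longlongrightarrow> (\<Sum>i\<le>degree p. coeff p i * 0)) at_top"
    by (intro tendsto_sum tendsto_mult_left mono)
  then show ?thesis by (simp add: poly_altdef sum_distrib_right mult.assoc)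
qed

lemma flat_exp_tendsto_0:
  assumes "c > 0"
  shows "(flat_exp c p \<longlongrightarrow> 0) (at 0)"
proof (rule filterlim_split_at)
  have "((\<lambda>x::real. poly p (inverse x) * exp (- c * inverse x)) \<longlongrightarrow> 0) (at_right 0)"
    by (rule filterlim_compose[OF poly_exp_tendsto_0[OF assms] filterlim_inverse_at_top_right])
  then show "(flat_exp c p \<longlongrightarrow> 0) (at_right 0)"
    by (rule Lim_transform_eventually) (auto simp: flat_exp_def eventually_at_filter divide_inverse)
  show "(flat_exp c p \<longlongrightarrow> 0) (at_left 0)"
    by (rule Lim_transform_eventually[OF tendsto_const])
       (auto simp: flat_exp_def eventually_at_filter)
qed

lemma flat_exp_deriv:
  assumes c: "c > 0"
  shows "(flat_exp c p has_real_derivative flat_exp c ([:0, 0, 1:] * (smult c p - pderiv p)) x) (at x)"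
proof -
  consider "x > 0" | "x < 0" | "x = 0" by linarith
  then show ?thesis
  proof cases
    case 1
    have "((\<lambda>x. poly p (1 / x) * exp (- c / x)) has_real_derivative
        flat_exp c ([:0, 0, 1:] * (smult c p - pderiv p)) x) (at x)"
    proof -
      have d1: "((\<lambda>x. 1 / x) has_real_derivative - (1 / x\<^sup>2)) (at x)"
        using 1 by (auto intro!: derivative_eq_intros simp: power2_eq_square)
      have d2: "((\<lambda>x. exp (- c / x)) has_real_derivative exp (- c / x) * (c / x\<^sup>2)) (at x)"
        using 1 by (auto intro!: derivative_eq_intros simp: power2_eq_square)
      show ?thesis
        by (rule DERIV_cong[OF DERIV_mult[OF DERIV_chain2[OF poly_DERIV d1] d2]])
           (use 1 in \<open>simp add: flat_exp_def field_simps power2_eq_square\<close>)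
    qed
    then show ?thesis
      by (rule has_field_derivative_transform_within_open[of _ _ _ "{0<..}"]) (use 1 in \<open>auto simp: flat_exp_def\<close>)
  next
    case 2
    have "((\<lambda>x. 0) has_real_derivative flat_exp c ([:0, 0, 1:] * (smult c p - pderiv p)) x) (at x)"
      using 2 by (simp add: flat_exp_def)
    then show ?thesis
      by (rule has_field_derivative_transform_within_open[of _ _ _ "{..<0}"]) (use 2 in \<open>auto simp: flat_exp_def\<close>)
  next
    case 3
    \<comment> \<open>Dividing by y multiplies the polynomial in 1/y by its variable, so the
      difference quotient at 0 is again a function of the family and tends to 0.\<close>
    have "((\<lambda>y. (flat_exp c p y - flat_exp c p 0) / (y - 0)) \<longlongrightarrow> 0) (at 0)"
      by (rule Lim_transform_eventually[OF flat_exp_tendsto_0[OF c, of "[:0, 1:] * p"]])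
         (auto simp: flat_exp_def eventually_at_filter)
    then show ?thesis using 3 by (simp add: has_field_derivative_iff flat_exp_def)
  qed
qed

lemma flat_exp_n_times_diff: "c > 0 \<Longrightarrow> n_times_diff n (flat_exp c p)"
proof (induction n arbitrary: p)
  case (Suc n)
  then show ?case
    by (auto intro!: exI[of _ "flat_exp c ([:0, 0, 1:] * (smult c p - pderiv p))"] flat_exp_deriv
        simp del: mult_pCons_left)
qed simp

text \<open>The parameter \<open>c\<close> controls the flatness: as it tends to 0, the bump tends
  to the indicator of the open interval. With fixed \<open>c\<close> it is the test function of the
  lower bound.\<close>

definition bump :: "real \<Rightarrow> real \<Rightarrow> real \<Rightarrow> real \<Rightarrow> real" where
  "bump a b c x = flat_exp c 1 (x - a) * flat_exp c 1 (b - x)"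

lemma bump_smooth:
  assumes "c > 0"
  shows "smooth_real (bump a b c)"
proof (rule smooth_realI)
  fix n
  have "n_times_diff n (\<lambda>x. flat_exp c 1 (1 * x + - a) * flat_exp c 1 (-1 * x + b))"
    by (intro n_times_diff_mult n_times_diff_affine flat_exp_n_times_diff assms)
  then show "n_times_diff n (bump a b c)" by (simp add: bump_def[abs_def])
qed

lemma bump_eq: "bump a b c x = (if a < x \<and> x < b then exp (- c / (x - a)) * exp (- c / (b - x)) else 0)"
  by (simp add: bump_def flat_exp_def)

lemma bump_nonneg: "bump a b c x \<ge> 0"
  by (simp add: bump_eq)

lemma bump_le_1: "c > 0 \<Longrightarrow> bump a b c x \<le> 1"
  by (auto simp: bump_eq intro!: mult_le_one)

lemma bump_test_fn: "0 < a \<Longrightarrow> a \<le> b \<Longrightarrow> c > 0 \<Longrightarrow> test_fn_pos (bump a b c)"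
  unfolding test_fn_pos_def by (intro conjI bump_smooth exI[of _ a] exI[of _ b]) (auto simp: bump_eq)

lemma bump_tendsto: "(\<lambda>n. bump a b (1 / real (Suc n)) x) \<longlonglongrightarrow> indicator {a<..<b} x"
proof (cases "a < x \<and> x < b")
  case True
  have "(\<lambda>n. - (1 / real (Suc n)) / v) \<longlonglongrightarrow> - 0 / v" if "v \<noteq> 0" for v
    using that LIMSEQ_inverse_real_of_nat
    by (intro tendsto_divide tendsto_minus tendsto_const) (simp_all add: divide_inverse)
  then have "(\<lambda>n. exp (- (1 / real (Suc n)) / v)) \<longlonglongrightarrow> exp (- 0 / v)" if "v \<noteq> 0" for v
    using that by (intro tendsto_exp)
  from tendsto_mult[OF this[of "x - a"] this[of "b - x"]] show ?thesis
    using True by (simp add: bump_eq)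
qed (auto simp: bump_eq)

section \<open>The fundamental lemma of the calculus of variations\<close>

lemma integrable_zero_on_intervals_AE:
  fixes d :: "real \<Rightarrow> real"
  assumes d: "integrable lborel d" and z: "\<And>x. (LINT t:{..x}|lborel. d t) = 0" and u: "(\<integral>t. d t \<partial>lborel) = 0"
  shows "AE x in lborel. d x = 0"
proof (rule sigma_finite_measure.density_zero[OF sigma_finite_lborel d])
  fix A :: "real set" assume "A \<in> sets lborel"
  have int: "set_integrable lborel B d" if "B \<in> sets borel" for B
    unfolding set_integrable_def using that by (intro integrable_mult_indicator d) auto
  have A: "A \<in> sigma_sets UNIV (range atMost)"
    using \<open>A \<in> sets lborel\<close> by (simp add: borel_eq_atMost)
  have borel: "B \<in> sets borel" if "B \<in> sigma_sets UNIV (range atMost)" for B :: "real set"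
    using that by (simp add: borel_eq_atMost)
  have stable: "Int_stable (range (atMost :: real \<Rightarrow> _))" "range (atMost :: real \<Rightarrow> _) \<subseteq> Pow UNIV"
    by (auto simp: Int_stable_def)
  \<comment> \<open>The half lines form an intersection-stable generator, and sets of zero integral
    are closed under complements and disjoint countable unions; complements use that the total
    integral is 0.\<close>
  have "A \<in> sets borel \<and> (LINT t:A|lborel. d t) = 0"
    using stable A
  proof (induction rule: sigma_sets_induct_disjoint)
    case (basic B)
    then show ?case using z by auto
  next
    case empty
    then show ?case by (simp add: set_lebesgue_integral_def)
  next
    case (compl B)
    have "(LINT t:(UNIV - B) \<union> B|lborel. d t) = (LINT t:UNIV - B|lborel. d t) + (LINT t:B|lborel. d t)"
      using compl by (intro set_integral_Un int) auto
    then show ?case using compl u by (auto simp: set_lebesgue_integral_def)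
  next
    case (union B)
    have "(LINT t:(\<Union>i. B i)|lborel. d t) = (\<Sum>i. (LINT t:B i|lborel. d t))"
      using union by (intro lebesgue_integral_countable_add int) (auto simp: disjoint_family_on_def)
    then show ?case using union by auto
  qed
  then show "(LINT t:A|lborel. d t) = 0" by simp
qed

text \<open>Dominated convergence along bumps that tend to an indicator shows that the integral over
  every open interval away from 0 vanishes. Countably many such intervals exhaust the half
  line.\<close>

lemma fundamental_lemma:
  assumes d: "loc_int_pos d" and z: "\<And>\<phi>. test_fn_pos \<phi> \<Longrightarrow> (LINT x:{0<..}|lborel. d x * \<phi> x) = 0"
  shows "AE x in lborel. x > 0 \<longrightarrow> d x = 0"
proof -
  have int: "set_integrable lborel {a..b} d" if "0 < a" for a b
    using d that by (auto simp: loc_int_pos_def)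
  have zero: "(LINT x:{a<..<b}|lborel. d x) = 0" if "0 < a" for a b
  proof (cases "a < b")
    case True
    define k where "k = (\<lambda>x. indicator {a..b} x * d x)"
    have k: "integrable lborel k" using int[OF that] by (simp add: set_integrable_def k_def)
    have meas: "bump a b c \<in> borel_measurable borel" if "c > 0" for c
      by (intro borel_measurable_continuous_onI smooth_real_continuous bump_smooth that)
    have "(\<lambda>n. \<integral>x. k x * bump a b (1 / real (Suc n)) x \<partial>lborel) \<longlonglongrightarrow> (\<integral>x. k x * indicator {a<..<b} x \<partial>lborel)"
    proof (rule integral_dominated_convergence[where w = "\<lambda>x. norm (k x)"])
      show "AE x in lborel. norm (k x * bump a b (1 / real (Suc n)) x) \<le> norm (k x)" for n
        using bump_nonneg[of a b "1 / real (Suc n)"] bump_le_1[of "1 / real (Suc n)" a b]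
        by (auto simp: abs_mult mult_left_le)
      have km: "k \<in> borel_measurable lborel" using k by auto
      show "(\<lambda>x. k x * bump a b (1 / real (Suc n)) x) \<in> borel_measurable lborel" for n
        using km meas[of "1 / real (Suc n)"] by (intro borel_measurable_times) auto
      show "(\<lambda>x. k x * indicator {a<..<b} x) \<in> borel_measurable lborel"
        using km by (intro borel_measurable_times) auto
      show "AE x in lborel. (\<lambda>n. k x * bump a b (1 / real (Suc n)) x) \<longlonglongrightarrow> k x * indicator {a<..<b} x"
        by (intro AE_I2 tendsto_mult_left bump_tendsto)
      show "integrable lborel (\<lambda>x. norm (k x))" using k by (rule integrable_norm)
    qed
    moreover have "(\<integral>x. k x * bump a b (1 / real (Suc n)) x \<partial>lborel) = 0" for n
    proof -
      have "(LINT x:{0<..}|lborel. d x * bump a b (1 / real (Suc n)) x) = 0"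
        using True that by (intro z bump_test_fn) auto
      also have "(LINT x:{0<..}|lborel. d x * bump a b (1 / real (Suc n)) x) = (\<integral>x. k x * bump a b (1 / real (Suc n)) x \<partial>lborel)"
        unfolding set_lebesgue_integral_def k_def using that
        by (intro Bochner_Integration.integral_cong) (auto simp: indicator_def bump_eq)
      finally show ?thesis .
    qed
    ultimately have "(\<integral>x. k x * indicator {a<..<b} x \<partial>lborel) = 0"
      by (simp add: LIMSEQ_const_iff)
    moreover have "(\<integral>x. k x * indicator {a<..<b} x \<partial>lborel) = (LINT x:{a<..<b}|lborel. d x)"
      unfolding set_lebesgue_integral_def k_def by (intro Bochner_Integration.integral_cong) (auto simp: indicator_def)
    ultimately show ?thesis by simp
  qed (simp add: set_lebesgue_integral_def)
  have AE1: "AE x in lborel. indicator {a<..<b} x * d x = 0" if "0 < a" for a b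
  proof (rule integrable_zero_on_intervals_AE)
    have "set_integrable lborel {a<..<b} d"
      by (rule set_integrable_subset[OF int[OF that, of b]]) auto
    then show "integrable lborel (\<lambda>x. indicator {a<..<b} x * d x)" by (simp add: set_integrable_def)
    show "(\<integral>x. indicator {a<..<b} x * d x \<partial>lborel) = 0"
      using zero[OF that, of b] by (simp add: set_lebesgue_integral_def)
    fix y
    have "(LINT t:{..y}|lborel. indicator {a<..<b} t * d t) = (LINT t:{a<..<min b y}|lborel. d t)"
      unfolding set_lebesgue_integral_def
    proof (rule integral_cong_AE)
      have "AE x in lborel. x \<noteq> y" by (rule AE_lborel_singleton)
      then show "AE x in lborel. indicator {..y} x *\<^sub>R (indicator {a<..<b} x * d x) = indicator {a<..<min b y} x *\<^sub>R d x"
        by eventually_elim (auto simp: indicator_def)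
      have "(\<lambda>x. indicator {a<..<b} x * d x) \<in> borel_measurable lborel"
        using \<open>integrable lborel (\<lambda>x. indicator {a<..<b} x * d x)\<close> by auto
      then show "(\<lambda>x. indicator {..y} x *\<^sub>R (indicator {a<..<b} x * d x)) \<in> borel_measurable lborel"
        by (intro borel_measurable_scaleR) auto
      have "set_integrable lborel {a<..<min b y} d"
        by (rule set_integrable_subset[OF int[OF that, of b]]) auto
      then show "(\<lambda>x. indicator {a<..<min b y} x *\<^sub>R d x) \<in> borel_measurable lborel"
        by (simp add: set_integrable_def)
    qed
    then show "(LINT t:{..y}|lborel. indicator {a<..<b} t * d t) = 0" using zero[OF that] by simp
  qed
  have "AE x in lborel. \<forall>n::nat. indicator {1 / real (Suc n)<..<real n} x * d x = 0"
    unfolding AE_all_countable by (intro allI AE1) simp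
  then show ?thesis
  proof eventually_elim
    case (elim x)
    show ?case
    proof
      assume x: "x > 0"
      obtain n1 where n1: "1 / x < real n1" using reals_Archimedean2 by blast
      obtain n2 where n2: "x < real n2" using reals_Archimedean2 by blast
      define n where "n = max n1 n2"
      have "1 / x < real (Suc n)" "x < real n" using n1 n2 unfolding n_def by linarith+
      then have "x \<in> {1 / real (Suc n)<..<real n}" using x by (simp add: field_simps)
      then show "d x = 0" using elim[rule_format, of n] by simp
    qed
  qed
qed

lemma triangle_fubini:
  fixes W g :: "real \<Rightarrow> real"
  assumes [measurable]: "W \<in> borel_measurable borel" "g \<in> borel_measurable borel"
    and i1: "\<And>t. integrable lborel (\<lambda>x. if x \<le> t then W x * (t - x) ^ j else 0)"
    and i2: "integrable lborel (\<lambda>t. \<bar>g t\<bar> * (\<integral>x. (if x \<le> t then \<bar>W x\<bar> * (t - x) ^ j else 0) \<partial>lborel))"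
  shows "integrable lborel (\<lambda>x. W x * (\<integral>t. (if x \<le> t then (t - x) ^ j * g t else 0) \<partial>lborel))"
    and "(\<integral>x. W x * (\<integral>t. (if x \<le> t then (t - x) ^ j * g t else 0) \<partial>lborel) \<partial>lborel) =
      (\<integral>t. g t * (\<integral>x. (if x \<le> t then W x * (t - x) ^ j else 0) \<partial>lborel) \<partial>lborel)"
proof -
  define f where "f = (\<lambda>t x. if x \<le> t then W x * (t - x) ^ j * g t else 0)"
  have f_t: "f t x = g t * (if x \<le> t then W x * (t - x) ^ j else 0)" for t x by (simp add: f_def)
  have f_x: "f t x = W x * (if x \<le> t then (t - x) ^ j * g t else 0)" for t x by (simp add: f_def)
  have int: "integrable (lborel \<Otimes>\<^sub>M lborel) (case_prod f)"
  proof (rule lborel_pair.Fubini_integrable)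
    show "case_prod f \<in> borel_measurable (lborel \<Otimes>\<^sub>M lborel)" unfolding f_def by measurable
    have "(\<integral>x. norm (case (t, x) of (t, x) \<Rightarrow> f t x) \<partial>lborel) =
        \<bar>g t\<bar> * (\<integral>x. (if x \<le> t then \<bar>W x\<bar> * (t - x) ^ j else 0) \<partial>lborel)" for t
      unfolding integral_mult_right_zero[symmetric]
      by (intro Bochner_Integration.integral_cong) (auto simp: f_def abs_mult power_abs)
    then show "integrable lborel (\<lambda>t. \<integral>x. norm (case (t, x) of (t, x) \<Rightarrow> f t x) \<partial>lborel)"
      using i2 by simp
    show "AE t in lborel. integrable lborel (\<lambda>x. case (t, x) of (t, x) \<Rightarrow> f t x)"
      using i1 by (simp add: f_t)
  qed
  have "integrable lborel (\<lambda>x. \<integral>t. f t x \<partial>lborel)"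
    using lborel_pair.integrable_snd[OF int] by simp
  then show "integrable lborel (\<lambda>x. W x * (\<integral>t. (if x \<le> t then (t - x) ^ j * g t else 0) \<partial>lborel))"
    by (simp add: f_x)
  show "(\<integral>x. W x * (\<integral>t. (if x \<le> t then (t - x) ^ j * g t else 0) \<partial>lborel) \<partial>lborel) =
      (\<integral>t. g t * (\<integral>x. (if x \<le> t then W x * (t - x) ^ j else 0) \<partial>lborel) \<partial>lborel)"
  proof -
    have "(\<integral>t. f t x \<partial>lborel) = W x * (\<integral>t. (if x \<le> t then (t - x) ^ j * g t else 0) \<partial>lborel)" for x
      unfolding f_x by (rule integral_mult_right_zero)
    moreover have "(\<integral>x. f t x \<partial>lborel) = g t * (\<integral>x. (if x \<le> t then W x * (t - x) ^ j else 0) \<partial>lborel)" for t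
      unfolding f_t by (rule integral_mult_right_zero)
    ultimately show ?thesis using lborel_pair.Fubini_integral[OF int] by simp
  qed
qed

lemma triangle_fubini_integrable:
  fixes W g :: "real \<Rightarrow> real"
  assumes Wi: "integrable lborel W" and gi: "integrable lborel g"
  shows "(\<integral>x. W x * (\<integral>t. (if x \<le> t then g t else 0) \<partial>lborel) \<partial>lborel) =
      (\<integral>t. g t * (\<integral>x. (if x \<le> t then W x else 0) \<partial>lborel) \<partial>lborel)"
proof -
  have Wm: "W \<in> borel_measurable borel" using Wi by auto
  have gm: "g \<in> borel_measurable borel" using gi by auto
  have le_int: "integrable lborel (\<lambda>x. if x \<le> t then F x else 0)" if "integrable lborel F" for t and F :: "real \<Rightarrow> real"
  proof -
    have "(\<lambda>x. if x \<le> t then F x else 0) = (\<lambda>x. indicator {..t} x *\<^sub>R F x)"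
      by (auto simp: indicator_def fun_eq_iff)
    then show ?thesis using integrable_mult_indicator[of "{..t}" lborel F] that by simp
  qed
  have inner: "(\<integral>x. (if x \<le> t then \<bar>W x\<bar> else 0) \<partial>lborel) \<le> (\<integral>x. \<bar>W x\<bar> \<partial>lborel)" for t
    using Wi by (intro integral_mono le_int) auto
  have inner_nonneg: "0 \<le> (\<integral>x. (if x \<le> t then \<bar>W x\<bar> else 0) \<partial>lborel)" for t
    by (intro Bochner_Integration.integral_nonneg) auto
  have "(\<integral>x. W x * (\<integral>t. (if x \<le> t then (t - x) ^ 0 * g t else 0) \<partial>lborel) \<partial>lborel) =
      (\<integral>t. g t * (\<integral>x. (if x \<le> t then W x * (t - x) ^ 0 else 0) \<partial>lborel) \<partial>lborel)"
  proof (rule triangle_fubini(2)[OF Wm gm])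
    show "integrable lborel (\<lambda>x. if x \<le> t then W x * (t - x) ^ 0 else 0)" for t
      using le_int[OF Wi, of t] by (simp only: power_0 mult_1_right)
    show "integrable lborel (\<lambda>t. \<bar>g t\<bar> * (\<integral>x. (if x \<le> t then \<bar>W x\<bar> * (t - x) ^ 0 else 0) \<partial>lborel))"
    proof (rule Bochner_Integration.integrable_bound)
      show "integrable lborel (\<lambda>t. (\<integral>x. \<bar>W x\<bar> \<partial>lborel) * \<bar>g t\<bar>)"
        using gi by (intro integrable_mult_right integrable_abs)
      note [measurable] = Wm gm
      show "(\<lambda>t. \<bar>g t\<bar> * (\<integral>x. (if x \<le> t then \<bar>W x\<bar> * (t - x) ^ 0 else 0) \<partial>lborel)) \<in> borel_measurable lborel"
        by measurable
      show "AE t in lborel. norm (\<bar>g t\<bar> * (\<integral>x. (if x \<le> t then \<bar>W x\<bar> * (t - x) ^ 0 else 0) \<partial>lborel))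
          \<le> norm ((\<integral>x. \<bar>W x\<bar> \<partial>lborel) * \<bar>g t\<bar>)"
      proof (intro AE_I2)
        fix t
        have "\<bar>g t\<bar> * (\<integral>x. (if x \<le> t then \<bar>W x\<bar> else 0) \<partial>lborel) \<le> \<bar>g t\<bar> * (\<integral>x. \<bar>W x\<bar> \<partial>lborel)"
          by (intro mult_left_mono inner) auto
        then show "norm (\<bar>g t\<bar> * (\<integral>x. (if x \<le> t then \<bar>W x\<bar> * (t - x) ^ 0 else 0) \<partial>lborel))
          \<le> norm ((\<integral>x. \<bar>W x\<bar> \<partial>lborel) * \<bar>g t\<bar>)"
          using inner_nonneg[of t] order.trans[OF inner_nonneg inner] by (simp add: abs_mult mult.commute cong: if_cong)
      qed
    qed
  qed
  then show ?thesis by (simp cong: if_cong)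
qed

section \<open>Primitives and continuous representatives of weak derivatives\<close>

lemma set_integral_Icc_split:
  fixes h :: "real \<Rightarrow> real"
  assumes "set_integrable lborel {a..c} h" "a \<le> b" "b \<le> c"
  shows "(LINT t:{a..c}|lborel. h t) = (LINT t:{a..b}|lborel. h t) + (LINT t:{b..c}|lborel. h t)"
proof -
  have "{a..c} = {a..b} \<union> {b..c}" using assms by auto
  moreover have "AE x in lborel. \<not> (x \<in> {a..b} \<and> x \<in> {b..c})"
    using AE_lborel_singleton[of b] by eventually_elim auto
  moreover have "set_integrable lborel {a..b} h" "set_integrable lborel {b..c} h"
    using assms by (auto intro: set_integrable_subset)
  ultimately show ?thesis by (simp add: set_integral_Un_AE)
qed

lemma set_integral_Icc_continuous:
  fixes h :: "real \<Rightarrow> real"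
  assumes "set_integrable lborel {a..b} h"
  shows "continuous_on {a..b} (\<lambda>x. LINT t:{a..x}|lborel. h t)"
proof -
  have "continuous_on {a..b} (\<lambda>x. integral {a..x} h)"
    using set_borel_integral_eq_integral(1)[OF assms] by (rule indefinite_integral_continuous_1)
  moreover have "integral {a..x} h = (LINT t:{a..x}|lborel. h t)" if "x \<in> {a..b}" for x
    using set_integrable_subset[OF assms, of "{a..x}"] that
    by (intro set_borel_integral_eq_integral(2)[symmetric]) auto
  ultimately show ?thesis by (rule continuous_on_eq)
qed

text \<open>The base point is 1 because a locally integrable function on the open half line need not
  be integrable near 0.\<close>

definition primitive :: "(real \<Rightarrow> real) \<Rightarrow> real \<Rightarrow> real" where
  "primitive h x = (if 1 \<le> x then LINT t:{1..x}|lborel. h t else - (LINT t:{x..1}|lborel. h t))"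

lemma loc_int_posD: "loc_int_pos h \<Longrightarrow> 0 < a \<Longrightarrow> set_integrable lborel {a..b} h"
  by (simp add: loc_int_pos_def)

lemma primitive_diff:
  assumes "loc_int_pos h" "0 < x" "x \<le> y"
  shows "primitive h y - primitive h x = (LINT t:{x..y}|lborel. h t)"
proof -
  note i = loc_int_posD[OF assms(1)]
  consider "1 \<le> x" | "x < 1" "1 \<le> y" | "y < 1" by linarith
  then show ?thesis
  proof cases
    case 1
    then show ?thesis using set_integral_Icc_split[OF i, of 1 x y] assms by (simp add: primitive_def)
  next
    case 2
    then show ?thesis using set_integral_Icc_split[OF i, of x 1 y] assms by (simp add: primitive_def)
  next
    case 3
    then show ?thesis using set_integral_Icc_split[OF i, of x y 1] assms by (simp add: primitive_def)
  qed
qed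

lemma continuous_on_primitive_like:
  assumes h: "loc_int_pos h" and G: "\<And>x y. 0 < x \<Longrightarrow> x \<le> y \<Longrightarrow> G y - G x = (LINT t:{x..y}|lborel. h t)"
  shows "continuous_on {0<..} G"
proof (rule continuous_at_imp_continuous_on, rule ballI)
  fix x :: real assume "x \<in> {0<..}"
  then have x: "x > 0" by simp
  have "continuous_on {x / 2..x + 1} (\<lambda>y. G (x / 2) + (LINT t:{x / 2..y}|lborel. h t))"
    using x by (intro continuous_on_add continuous_on_const set_integral_Icc_continuous loc_int_posD[OF h]) auto
  then have "continuous_on {x / 2..x + 1} G"
  proof (rule continuous_on_eq)
    fix y assume "y \<in> {x / 2..x + 1}"
    then show "G (x / 2) + (LINT t:{x / 2..y}|lborel. h t) = G y" using G[of "x / 2" y] x by simp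
  qed
  then show "isCont G x"
    by (rule continuous_on_interior) (use x in auto)
qed

lemma set_integrable_continuous_Icc:
  fixes f :: "real \<Rightarrow> real"
  shows "continuous_on {a..b} f \<Longrightarrow> set_integrable lborel {a..b} f"
  by (rule borel_integrable_atLeastAtMost'[folded set_integrable_def])

lemma loc_int_pos_continuous: "continuous_on {0<..} f \<Longrightarrow> loc_int_pos f"
  unfolding loc_int_pos_def by (auto intro!: set_integrable_continuous_Icc elim!: continuous_on_subset)

lemma test_fn_pos_deriv: "test_fn_pos \<phi> \<Longrightarrow> test_fn_pos (deriv \<phi>)"
proof -
  assume t: "test_fn_pos \<phi>"
  then obtain a b where ab: "0 < a" "a \<le> b" "\<And>x. x \<notin> {a..b} \<Longrightarrow> \<phi> x = 0" and s: "smooth_real \<phi>"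
    unfolding test_fn_pos_def by blast
  have "deriv \<phi> x = 0" if "x \<notin> {a..b}" for x
  proof -
    have "((\<lambda>_. 0) has_real_derivative deriv \<phi> x) (at x)"
      by (rule has_field_derivative_transform_within_open[OF smooth_real_DERIV[OF s], of "- {a..b}"])
         (use that ab in auto)
    then show ?thesis using DERIV_const DERIV_unique by blast
  qed
  then show ?thesis using ab smooth_real_deriv[OF s] unfolding test_fn_pos_def by blast
qed

lemma test_fn_integral_cong:
  fixes g :: "real \<Rightarrow> real"
  assumes "0 < a" "\<And>x. x \<notin> {a..b} \<Longrightarrow> \<phi> x = (0::real)"
  shows "(LINT x:{0<..}|lborel. g x * \<phi> x) = (LINT x:{a..b}|lborel. g x * \<phi> x)"
  unfolding set_lebesgue_integral_def
  by (rule Bochner_Integration.integral_cong) (use assms in \<open>auto simp: indicator_def\<close>)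

lemma set_integrable_mult_bounded:
  fixes g \<phi> :: "real \<Rightarrow> real"
  assumes "set_integrable lborel {a..b} g" "continuous_on UNIV \<phi>"
  shows "set_integrable lborel {a..b} (\<lambda>x. g x * \<phi> x)"
proof -
  have "compact (\<phi> ` {a..b})" using assms(2) by (intro compact_continuous_image) (auto elim: continuous_on_subset)
  then obtain M where M: "\<And>x. x \<in> {a..b} \<Longrightarrow> \<bar>\<phi> x\<bar> \<le> M"
    using compact_imp_bounded bounded_iff by (metis imageI real_norm_def)
  have g: "(\<lambda>x. indicator {a..b} x * g x) \<in> borel_measurable lborel"
    using assms(1) by (simp add: set_integrable_def)
  have \<phi>: "\<phi> \<in> borel_measurable borel" using assms(2) by (rule borel_measurable_continuous_onI)
  have "integrable lborel (\<lambda>x. (indicator {a..b} x * g x) * \<phi> x)"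
  proof (rule Bochner_Integration.integrable_bound)
    show "integrable lborel (\<lambda>x. M * (indicator {a..b} x * g x))"
      using assms(1) by (intro integrable_mult_right) (simp add: set_integrable_def)
    show "(\<lambda>x. (indicator {a..b} x * g x) * \<phi> x) \<in> borel_measurable lborel"
      by (rule borel_measurable_times[OF g]) (use \<phi> in simp)
    show "AE x in lborel. norm (indicator {a..b} x * g x * \<phi> x) \<le> norm (M * (indicator {a..b} x * g x))"
      using M by (intro AE_I2) (auto simp: abs_mult indicator_def mult.commute intro!: mult_right_mono order.trans[OF M abs_ge_self])
  qed
  then show ?thesis by (simp add: set_integrable_def mult.assoc)
qed

lemma set_integral_deriv_Icc:
  fixes \<phi> :: "real \<Rightarrow> real"
  assumes "smooth_real \<phi>" "a \<le> b"
  shows "(LINT x:{a..b}|lborel. deriv \<phi> x) = \<phi> b - \<phi> a"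
proof -
  have i: "set_integrable lborel {a..b} (deriv \<phi>)"
    by (intro set_integrable_continuous_Icc smooth_real_continuous smooth_real_deriv assms)
  have "(deriv \<phi> has_integral \<phi> b - \<phi> a) {a..b}"
    by (rule fundamental_theorem_of_calculus[OF assms(2)],
        rule has_vector_derivative_at_within,
        rule smooth_real_DERIV[OF assms(1), unfolded has_real_derivative_iff_has_vector_derivative])
  then show ?thesis using set_borel_integral_eq_integral(2)[OF i] by (simp add: integral_unique)
qed

text \<open>The primitive need not be differentiable everywhere, so the product rule is replaced by
  Fubini on the triangle x \<le> t for h(x) and the derivative of \<phi> at t.\<close>

lemma primitive_by_parts:
  assumes h: "loc_int_pos h" and \<phi>: "test_fn_pos \<phi>"
  shows "(LINT x:{0<..}|lborel. primitive h x * deriv \<phi> x) = - (LINT x:{0<..}|lborel. h x * \<phi> x)"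
proof -
  obtain a0 b0 where ab0: "0 < a0" "a0 \<le> b0" "\<And>x. x \<notin> {a0..b0} \<Longrightarrow> \<phi> x = 0" and s: "smooth_real \<phi>"
    using \<phi> unfolding test_fn_pos_def by blast
  \<comment> \<open>The enlarged interval makes \<phi> vanish at the end points by
    construction.\<close>
  define a b where "a = a0 / 2" and "b = b0 + 1"
  have ab: "0 < a" "a \<le> b" "\<phi> a = 0" "\<phi> b = 0" and out: "\<And>x. x \<notin> {a..b} \<Longrightarrow> \<phi> x = 0"
    using ab0 by (auto simp: a_def b_def)
  have out': "deriv \<phi> x = 0" if "x \<notin> {a..b}" for x
  proof -
    have "((\<lambda>_. 0) has_real_derivative deriv \<phi> x) (at x)"
      by (rule has_field_derivative_transform_within_open[OF smooth_real_DERIV[OF s], of "- {a..b}"])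
         (use that out in auto)
    then show ?thesis using DERIV_const DERIV_unique by blast
  qed
  have cont: "continuous_on A (deriv \<phi>)" for A
    by (intro smooth_real_continuous smooth_real_deriv s)
  have hi: "set_integrable lborel {a..b} h" by (rule loc_int_posD[OF h ab(1)])
  have i': "set_integrable lborel {a..b} (deriv \<phi>)" by (intro set_integrable_continuous_Icc cont)
  define W where "W = (\<lambda>x. indicator {a..b} x * h x)"
  define g where "g = (\<lambda>x. indicator {a..b} x * deriv \<phi> x)"
  have Wi: "integrable lborel W" using hi by (simp add: W_def set_integrable_def)
  have gi: "integrable lborel g" using i' by (simp add: g_def set_integrable_def)
  have fub: "(\<integral>x. W x * (\<integral>t. (if x \<le> t then g t else 0) \<partial>lborel) \<partial>lborel) =
      (\<integral>t. g t * (\<integral>x. (if x \<le> t then W x else 0) \<partial>lborel) \<partial>lborel)"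
    by (rule triangle_fubini_integrable[OF Wi gi])
  have lhs: "W x * (\<integral>t. (if x \<le> t then g t else 0) \<partial>lborel) = indicator {a..b} x * (h x * - \<phi> x)" for x
  proof (cases "x \<in> {a..b}")
    case True
    have "(\<integral>t. (if x \<le> t then g t else 0) \<partial>lborel) = (LINT t:{x..b}|lborel. deriv \<phi> t)"
      unfolding set_lebesgue_integral_def g_def
      by (rule Bochner_Integration.integral_cong) (use True in \<open>auto simp: indicator_def\<close>)
    also have "\<dots> = - \<phi> x" using set_integral_deriv_Icc[OF s, of x b] True ab by simp
    finally show ?thesis by (simp add: W_def)
  qed (simp add: W_def)
  have rhs: "g t * (\<integral>x. (if x \<le> t then W x else 0) \<partial>lborel) = indicator {a..b} t * (primitive h t * deriv \<phi> t) - primitive h a * (indicator {a..b} t * deriv \<phi> t)" for t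
  proof (cases "t \<in> {a..b}")
    case True
    have "(\<integral>x. (if x \<le> t then W x else 0) \<partial>lborel) = (LINT x:{a..t}|lborel. h x)"
      unfolding set_lebesgue_integral_def W_def
      by (rule Bochner_Integration.integral_cong) (use True in \<open>auto simp: indicator_def\<close>)
    also have "\<dots> = primitive h t - primitive h a"
      using primitive_diff[OF h ab(1), of t] True by simp
    finally have "(\<integral>x. (if x \<le> t then W x else 0) \<partial>lborel) = primitive h t - primitive h a" .
    then show ?thesis by (simp only: g_def) (simp add: algebra_simps)
  qed (simp add: g_def)
  have contP: "continuous_on {a..b} (primitive h)"
    using continuous_on_primitive_like[OF h primitive_diff[OF h]] ab by (auto elim: continuous_on_subset)
  have iP: "set_integrable lborel {a..b} (\<lambda>t. primitive h t * deriv \<phi> t)"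
    by (intro set_integrable_mult_bounded set_integrable_continuous_Icc contP cont)
  have "(\<integral>t. g t * (\<integral>x. (if x \<le> t then W x else 0) \<partial>lborel) \<partial>lborel) =
      (LINT t:{a..b}|lborel. primitive h t * deriv \<phi> t) - primitive h a * (LINT t:{a..b}|lborel. deriv \<phi> t)"
    unfolding rhs using iP i' by (simp add: set_integrable_def set_lebesgue_integral_def)
  also have "(LINT t:{a..b}|lborel. deriv \<phi> t) = 0" using set_integral_deriv_Icc[OF s ab(2)] ab by simp
  finally have "(\<integral>t. g t * (\<integral>x. (if x \<le> t then W x else 0) \<partial>lborel) \<partial>lborel) = (LINT x:{0<..}|lborel. primitive h x * deriv \<phi> x)"
    using test_fn_integral_cong[OF ab(1), of b "deriv \<phi>" "primitive h"] out' by simp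
  moreover have "(\<integral>x. W x * (\<integral>t. (if x \<le> t then g t else 0) \<partial>lborel) \<partial>lborel) = - (LINT x:{0<..}|lborel. h x * \<phi> x)"
    unfolding lhs using test_fn_integral_cong[OF ab(1), of b \<phi> h] out by (simp add: set_lebesgue_integral_def)
  ultimately show ?thesis using fub by simp
qed

text \<open>The primitive started to the left of the support is 0 there. To the right it equals the
  total integral, so mean zero is what keeps the support compact.\<close>

lemma test_fn_primitive:
  assumes \<psi>: "test_fn_pos \<psi>" and zero: "(LINT x:{0<..}|lborel. \<psi> x) = 0"
  obtains \<phi> where "test_fn_pos \<phi>" "deriv \<phi> = \<psi>"
proof -
  obtain a b where ab: "0 < a" "a \<le> b" "\<And>x. x \<notin> {a..b} \<Longrightarrow> \<psi> x = 0" and s: "smooth_real \<psi>"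
    using \<psi> unfolding test_fn_pos_def by blast
  define \<phi> where "\<phi> = (\<lambda>x. integral {a - 1..x} \<psi>)"
  have cont: "continuous_on A \<psi>" for A by (rule smooth_real_continuous[OF s])
  have left: "\<phi> x = 0" if "x < a" for x
    unfolding \<phi>_def by (intro integral_unique has_integral_is_0) (use that ab in auto)
  have d: "(\<phi> has_real_derivative \<psi> x) (at x)" for x
  proof (cases "x < a")
    case True
    have "((\<lambda>_. 0) has_real_derivative \<psi> x) (at x)" using ab(3)[of x] True by simp
    then show ?thesis
      by (rule has_field_derivative_transform_within_open[of _ _ _ "{..<a}"]) (use True left in auto)
  next
    case False
    have "((\<lambda>x. integral {a - 1..x} \<psi>) has_real_derivative \<psi> x) (at x within {a - 1..x + 1})"
      by (rule integral_has_real_derivative[OF cont]) (use False in auto)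
    moreover have "at x within {a - 1..x + 1} = at x"
      by (rule at_within_interior) (use False in auto)
    ultimately show ?thesis by (simp add: \<phi>_def)
  qed
  have right: "\<phi> x = 0" if "b < x" for x
  proof -
    have "\<phi> x = (LINT t:{a - 1..x}|lborel. \<psi> t)"
      unfolding \<phi>_def by (intro set_borel_integral_eq_integral(2)[symmetric] set_integrable_continuous_Icc cont)
    also have "\<dots> = (LINT t:{0<..}|lborel. \<psi> t)"
      unfolding set_lebesgue_integral_def
    proof (rule Bochner_Integration.integral_cong)
      fix y
      show "indicator {a - 1..x} y *\<^sub>R \<psi> y = indicator {0<..} y *\<^sub>R \<psi> y"
        by (cases "y \<in> {a..b}") (use ab that in \<open>auto simp: indicator_def\<close>)
    qed simp
    finally show ?thesis using zero by simp
  qed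
  have "smooth_real \<phi>" by (rule smooth_real_antideriv[OF d s])
  moreover have "\<phi> x = 0" if "x \<notin> {a..b}" for x using left right that by force
  ultimately have "test_fn_pos \<phi>" using ab unfolding test_fn_pos_def by blast
  moreover have "deriv \<phi> = \<psi>" using d by (intro ext DERIV_imp_deriv)
  ultimately show ?thesis using that by blast
qed

lemma test_fn_integrable:
  assumes "loc_int_pos g" "test_fn_pos \<phi>"
  shows "set_integrable lborel {0<..} (\<lambda>x. g x * \<phi> x)"
proof -
  obtain a b where ab: "0 < a" "\<And>x. x \<notin> {a..b} \<Longrightarrow> \<phi> x = 0" and s: "smooth_real \<phi>"
    using assms unfolding test_fn_pos_def by blast
  have "set_integrable lborel {a..b} (\<lambda>x. g x * \<phi> x)"
    by (intro set_integrable_mult_bounded loc_int_posD assms ab smooth_real_continuous s)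
  then show ?thesis unfolding set_integrable_def
    by (rule Bochner_Integration.integrable_cong[THEN iffD1, rotated -1]) (use ab in \<open>auto simp: indicator_def\<close>)
qed

text \<open>The argument of du Bois-Reymond: g minus the primitive of h annihilates all derivatives
  of test functions. Every test function is a multiple of a fixed one plus such a derivative, so the
  difference acts like a constant, and the fundamental lemma makes it one.\<close>

lemma weak_deriv_imp_primitive:
  assumes g: "loc_int_pos g" and h: "loc_int_pos h"
    and weak: "\<And>\<phi>. test_fn_pos \<phi> \<Longrightarrow> (LINT x:{0<..}|lborel. g x * deriv \<phi> x) = - (LINT x:{0<..}|lborel. h x * \<phi> x)"
  obtains G where "continuous_on {0<..} G" "AE x in lborel. x > 0 \<longrightarrow> g x = G x"
    "\<And>x y. 0 < x \<Longrightarrow> x \<le> y \<Longrightarrow> G y - G x = (LINT t:{x..y}|lborel. h t)"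
proof -
  have contP: "continuous_on {0<..} (primitive h)"
    by (rule continuous_on_primitive_like[OF h primitive_diff[OF h]])
  have P: "loc_int_pos (primitive h)" by (rule loc_int_pos_continuous[OF contP])
  have one: "loc_int_pos (\<lambda>_. 1)" by (intro loc_int_pos_continuous continuous_intros)
  \<comment> \<open>The fixed test function, with nonzero integral; subtracting a multiple of it
    makes any test function have mean zero.\<close>
  define \<psi>0 where "\<psi>0 = bump 1 2 1"
  have \<psi>0: "test_fn_pos \<psi>0" "smooth_real \<psi>0" unfolding \<psi>0_def by (auto intro: bump_test_fn bump_smooth)
  define I where "I = (\<lambda>(f :: real \<Rightarrow> real) (\<psi> :: real \<Rightarrow> real). LINT x:{0<..}|lborel. f x * \<psi> x)"
  have I_lin: "I f (\<lambda>x. \<psi> x - c * \<psi>' x) = I f \<psi> - c * I f \<psi>'"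
    if "loc_int_pos f" "test_fn_pos \<psi>" "test_fn_pos \<psi>'" for f \<psi> \<psi>' c
  proof -
    have "I f (\<lambda>x. \<psi> x - c * \<psi>' x) = (LINT x:{0<..}|lborel. f x * \<psi> x - c * (f x * \<psi>' x))"
      by (simp add: I_def algebra_simps)
    also have "\<dots> = I f \<psi> - c * I f \<psi>'"
      unfolding I_def using test_fn_integrable[OF that(1)] that(2,3) by (simp add: set_integral_diff(2))
    finally show ?thesis .
  qed
  have I0: "I (\<lambda>_. 1) \<psi>0 \<noteq> 0"
  proof
    assume z: "I (\<lambda>_. 1) \<psi>0 = 0"
    have "integrable lborel (\<lambda>x. indicator {0<..} x *\<^sub>R (1 * \<psi>0 x))"
      using test_fn_integrable[OF one \<psi>0(1)] by (simp add: set_integrable_def)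
    moreover have "AE x in lborel. 0 \<le> indicator {0<..} x *\<^sub>R (1 * \<psi>0 x)"
      by (simp add: \<psi>0_def bump_nonneg)
    moreover have "(\<integral>x. indicator {0<..} x *\<^sub>R (1 * \<psi>0 x) \<partial>lborel) = 0"
      using z by (simp add: I_def set_lebesgue_integral_def)
    ultimately have "AE x in lborel. indicator {0<..} x *\<^sub>R (1 * \<psi>0 x) = 0"
      using integral_nonneg_eq_0_iff_AE by blast
    then have "AE x in lborel. x \<notin> {1<..<2::real}"
      by eventually_elim (auto simp: \<psi>0_def bump_eq)
    then have "{1<..<2::real} \<in> null_sets lborel" by (subst (asm) AE_iff_null_sets[symmetric]) auto
    then show False by (auto simp: null_sets_def)
  qed
  define d where "d = (\<lambda>x. g x - primitive h x)"
  have d: "loc_int_pos d"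
    unfolding d_def using g P by (simp add: loc_int_pos_def set_integral_diff(1))
  have d0: "I d (deriv \<phi>) = 0" if "test_fn_pos \<phi>" for \<phi>
  proof -
    have "I d (deriv \<phi>) = (LINT x:{0<..}|lborel. g x * deriv \<phi> x - primitive h x * deriv \<phi> x)"
      by (simp add: I_def d_def algebra_simps)
    also have "\<dots> = 0"
      using weak[OF that] primitive_by_parts[OF h that]
        test_fn_integrable[OF g test_fn_pos_deriv[OF that]] test_fn_integrable[OF P test_fn_pos_deriv[OF that]]
      by (simp add: set_integral_diff(2))
    finally show ?thesis .
  qed
  define c where "c = I d \<psi>0 / I (\<lambda>_. 1) \<psi>0"
  have key: "I d \<psi> = c * I (\<lambda>_. 1) \<psi>" if \<psi>: "test_fn_pos \<psi>" for \<psi>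
  proof -
    define k where "k = I (\<lambda>_. 1) \<psi> / I (\<lambda>_. 1) \<psi>0"
    define \<psi>1 where "\<psi>1 = (\<lambda>x. \<psi> x - k * \<psi>0 x)"
    obtain a b where ab: "0 < a" "a \<le> b" "\<And>x. x \<notin> {a..b} \<Longrightarrow> \<psi> x = 0" and s: "smooth_real \<psi>"
      using \<psi> unfolding test_fn_pos_def by blast
    have "smooth_real \<psi>1" unfolding \<psi>1_def by (rule smooth_real_lincomb[OF s \<psi>0(2)])
    moreover have "\<psi>1 x = 0" if "x \<notin> {min a 1..max b 2}" for x
    proof -
      have "x \<notin> {a..b}" "x \<notin> {1..2}" using that by auto
      then show ?thesis using ab(3)[of x] by (auto simp: \<psi>1_def \<psi>0_def bump_eq)
    qed
    ultimately have t1: "test_fn_pos \<psi>1"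
      using ab unfolding test_fn_pos_def by (intro conjI exI[of _ "min a 1"] exI[of _ "max b 2"]) auto
    have "I (\<lambda>_. 1) \<psi>1 = 0" unfolding \<psi>1_def I_lin[OF one \<psi> \<psi>0(1)] using I0 by (simp add: k_def)
    then have "(LINT x:{0<..}|lborel. \<psi>1 x) = 0" by (simp add: I_def)
    from test_fn_primitive[OF t1 this] obtain \<phi> where "test_fn_pos \<phi>" "deriv \<phi> = \<psi>1" by blast
    with d0[of \<phi>] have "I d \<psi>1 = 0" by simp
    then have "I d \<psi> = k * I d \<psi>0" unfolding \<psi>1_def I_lin[OF d \<psi> \<psi>0(1)] by simp
    then show ?thesis by (simp add: k_def c_def)
  qed
  have "AE x in lborel. x > 0 \<longrightarrow> d x - c = 0"
  proof (rule fundamental_lemma)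
    have "loc_int_pos (\<lambda>_. c)" by (intro loc_int_pos_continuous continuous_intros)
    then show "loc_int_pos (\<lambda>x. d x - c)" using d by (simp add: loc_int_pos_def set_integral_diff(1))
    fix \<psi> assume \<psi>: "test_fn_pos \<psi>"
    have "(LINT x:{0<..}|lborel. (d x - c) * \<psi> x) = (LINT x:{0<..}|lborel. d x * \<psi> x - c * (1 * \<psi> x))"
      by (simp add: algebra_simps)
    also have "\<dots> = I d \<psi> - c * I (\<lambda>_. 1) \<psi>"
      unfolding I_def
      using set_integral_diff(2)[OF test_fn_integrable[OF d \<psi>] set_integrable_mult_right[of c, OF test_fn_integrable[OF one \<psi>]]]
      by simp
    finally show "(LINT x:{0<..}|lborel. (d x - c) * \<psi> x) = 0" using key[OF \<psi>] by simp
  qed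
  then have "AE x in lborel. x > 0 \<longrightarrow> g x = c + primitive h x"
    by eventually_elim (auto simp: d_def)
  moreover have "continuous_on {0<..} (\<lambda>x. c + primitive h x)" by (intro continuous_intros contP)
  moreover have "(c + primitive h y) - (c + primitive h x) = (LINT t:{x..y}|lborel. h t)" if "0 < x" "x \<le> y" for x y
    using primitive_diff[OF h that] by simp
  ultimately show ?thesis using that[of "\<lambda>x. c + primitive h x"] by blast
qed

lemma continuous_AE_eq_imp_eq:
  fixes f g :: "real \<Rightarrow> real"
  assumes f: "continuous_on {0<..} f" and g: "continuous_on {0<..} g"
    and ae: "AE x in lborel. x > 0 \<longrightarrow> f x = g x" and x: "x > 0"
  shows "f x = g x"
proof (rule ccontr)
  assume ne: "f x \<noteq> g x"
  have "continuous_on {0<..} (\<lambda>y. f y - g y)" using f g by (rule continuous_on_diff)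
  then have "open ((\<lambda>y. f y - g y) -` (- {0}) \<inter> {0<..})"
    by (rule continuous_on_open_vimage[THEN iffD1, rule_format, rotated]) auto
  moreover have "x \<in> (\<lambda>y. f y - g y) -` (- {0}) \<inter> {0<..}" using ne x by auto
  ultimately obtain e where e: "e > 0" "ball x e \<subseteq> (\<lambda>y. f y - g y) -` (- {0}) \<inter> {0<..}"
    using open_contains_ball by blast
  have ball: "{x - e<..<x + e} \<subseteq> ball x e" by (auto simp: dist_real_def)
  have bad: "y > 0 \<and> f y \<noteq> g y" if "y \<in> {x - e<..<x + e}" for y
    using subsetD[OF e(2) subsetD[OF ball that]] by auto
  from ae have "AE y in lborel. y \<notin> {x - e<..<x + e}"
    by eventually_elim (use bad in blast)
  then have "{x - e<..<x + e} \<in> null_sets lborel" by (subst (asm) AE_iff_null_sets[symmetric]) auto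
  then show False using e(1) by (auto simp: null_sets_def)
qed

section \<open>Absolutely continuous representatives and Taylor's formula\<close>

locale derivative_chain =
  fixes r :: nat and fk :: "nat \<Rightarrow> real \<Rightarrow> real"
  assumes r_pos: "r \<ge> 1"
    and cont: "\<And>k. k < r \<Longrightarrow> continuous_on {0<..} (fk k)"
    and loc: "\<And>k. k \<le> r \<Longrightarrow> loc_int_pos (fk k)"
    and diff: "\<And>k x y. k < r \<Longrightarrow> 0 < x \<Longrightarrow> x \<le> y \<Longrightarrow> fk k y - fk k x = (LINT t:{x..y}|lborel. fk (Suc k) t)"
begin

lemma remainder_integrable:
  assumes "k \<le> r" "0 < x"
  shows "set_integrable lborel {x..b} (\<lambda>t. fk k t * (t - x) ^ n)"
  by (intro set_integrable_mult_bounded loc_int_posD loc assms continuous_intros)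

text \<open>The expansion point is the right end \<open>b\<close> and the value is taken to its
  left, hence the alternating sign. Since the top derivative is only locally integrable, the
  induction step rewrites the remainder by exchanging integrals over a triangle.\<close>

lemma taylor:
  assumes "0 < x" "x \<le> b" "1 \<le> n" "n \<le> r"
  shows "fk 0 x = (\<Sum>k<n. fk k b * (x - b) ^ k / fact k) +
    (-1) ^ n / fact (n - 1) * (LINT t:{x..b}|lborel. fk n t * (t - x) ^ (n - 1))"
  using assms(3,4)
proof (induction n rule: nat_induct_at_least)
  case base
  then show ?case using diff[of 0 x b] r_pos assms by simp
next
  case (Suc n)
  then have n: "n \<ge> 1" "n < r" by auto
  define W where "W = (\<lambda>t. indicator {x..b} t * (t - x) ^ (n - 1))"
  define g where "g = (\<lambda>s. indicator {x..b} s * fk (Suc n) s)"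
  have Wi: "integrable lborel W"
    unfolding W_def using set_integrable_continuous_Icc[of x b "\<lambda>t. (t - x) ^ (n - 1)"]
    by (simp add: set_integrable_def continuous_intros)
  have gi: "integrable lborel g"
    unfolding g_def using loc_int_posD[OF loc assms(1), of "Suc n" b] n by (simp add: set_integrable_def)
  have "W t * (\<integral>s. (if t \<le> s then g s else 0) \<partial>lborel) =
      indicator {x..b} t * (fk n b * (t - x) ^ (n - 1)) - indicator {x..b} t * (fk n t * (t - x) ^ (n - 1))" for t
  proof (cases "t \<in> {x..b}")
    case True
    have "(\<integral>s. (if t \<le> s then g s else 0) \<partial>lborel) = (LINT s:{t..b}|lborel. fk (Suc n) s)"
      unfolding set_lebesgue_integral_def g_def
      by (rule Bochner_Integration.integral_cong) (use True in \<open>auto simp: indicator_def\<close>)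
    also have "\<dots> = fk n b - fk n t" using diff[of n t b] n True assms by simp
    finally have "(\<integral>s. (if t \<le> s then g s else 0) \<partial>lborel) = fk n b - fk n t" .
    then show ?thesis using True by (simp only: W_def) (simp add: algebra_simps)
  qed (simp add: W_def)
  moreover have "integrable lborel (\<lambda>t. indicator {x..b} t * (fk n t * (t - x) ^ (n - 1)))"
    using remainder_integrable[OF less_imp_le[OF n(2)] assms(1), of b "n - 1"] by (simp only: set_integrable_def real_scaleR_def)
  moreover have "set_integrable lborel {x..b} (\<lambda>t. fk n b * (t - x) ^ (n - 1))"
    by (intro set_integrable_continuous_Icc continuous_intros)
  ultimately have "(\<integral>t. W t * (\<integral>s. (if t \<le> s then g s else 0) \<partial>lborel) \<partial>lborel) =
      (LINT t:{x..b}|lborel. fk n b * (t - x) ^ (n - 1)) - (LINT t:{x..b}|lborel. fk n t * (t - x) ^ (n - 1))"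
    by (simp only: set_integrable_def set_lebesgue_integral_def real_scaleR_def Bochner_Integration.integral_diff)
  moreover have "g s * (\<integral>t. (if t \<le> s then W t else 0) \<partial>lborel) =
      1 / n * (indicator {x..b} s * (fk (Suc n) s * (s - x) ^ n))" for s
  proof (cases "s \<in> {x..b}")
    case True
    have "(\<integral>t. (if t \<le> s then W t else 0) \<partial>lborel) = (LINT t:{x..s}|lborel. (t - x) ^ (n - 1))"
      unfolding set_lebesgue_integral_def W_def
      by (rule Bochner_Integration.integral_cong) (use True in \<open>auto simp: indicator_def\<close>)
    also have "\<dots> = (s - x) ^ n / n - (x - x) ^ n / n"
      unfolding set_lebesgue_integral_def real_scaleR_def mult.commute[of "indicator _ _"]
    proof (rule integral_FTC_Icc_real)
      fix t assume "x \<le> t" "t \<le> s"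
      show "((\<lambda>t. (t - x) ^ n / n) has_real_derivative (t - x) ^ (n - 1)) (at t)"
        using n by (auto intro!: derivative_eq_intros)
    qed (use True in \<open>auto intro!: continuous_intros\<close>)
    finally have "(\<integral>t. (if t \<le> s then W t else 0) \<partial>lborel) = (s - x) ^ n / n" using n by (simp add: power_0_left)
    then show ?thesis using True by (simp only: g_def) simp
  qed (simp add: g_def)
  then have "(\<integral>s. g s * (\<integral>t. (if t \<le> s then W t else 0) \<partial>lborel) \<partial>lborel) =
      1 / n * (LINT s:{x..b}|lborel. fk (Suc n) s * (s - x) ^ n)"
    by (simp only: set_lebesgue_integral_def real_scaleR_def integral_mult_right_zero)
  moreover have "(LINT t:{x..b}|lborel. fk n b * (t - x) ^ (n - 1)) = fk n b * ((b - x) ^ n / n)"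
  proof -
    have "(LINT t:{x..b}|lborel. (t - x) ^ (n - 1)) = (b - x) ^ n / n - (x - x) ^ n / n"
      unfolding set_lebesgue_integral_def real_scaleR_def mult.commute[of "indicator _ _"]
    proof (rule integral_FTC_Icc_real)
      fix t assume "x \<le> t" "t \<le> b"
      show "((\<lambda>t. (t - x) ^ n / n) has_real_derivative (t - x) ^ (n - 1)) (at t)"
        using n by (auto intro!: derivative_eq_intros)
    qed (use assms in \<open>auto intro!: continuous_intros\<close>)
    then show ?thesis using n by (simp add: power_0_left)
  qed
  ultimately have R: "(LINT t:{x..b}|lborel. fk n t * (t - x) ^ (n - 1)) =
      fk n b * ((b - x) ^ n / n) - 1 / n * (LINT s:{x..b}|lborel. fk (Suc n) s * (s - x) ^ n)"
    using triangle_fubini_integrable[OF Wi gi] by simp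
  have fact_n: "fact n = real n * fact (n - 1)" using n by (cases n) auto
  have "(-1) ^ n / fact (n - 1) * (fk n b * ((b - x) ^ n / n)) = fk n b * (x - b) ^ n / fact n"
  proof -
    have "(x - b) ^ n = (-1) ^ n * (b - x) ^ n" by (simp flip: power_mult_distrib)
    then show ?thesis using n by (simp add: fact_n mult_ac)
  qed
  then have "(-1) ^ n / fact (n - 1) * (LINT t:{x..b}|lborel. fk n t * (t - x) ^ (n - 1)) =
      fk n b * (x - b) ^ n / fact n + (-1) ^ Suc n / fact n * (LINT s:{x..b}|lborel. fk (Suc n) s * (s - x) ^ n)"
    unfolding R right_diff_distrib using n by (simp add: fact_n)
  then show ?case using Suc.IH n by simp
qed

end

context laguerre_weight
begin

text \<open>In the Sobolev ball every \<open>g k\<close> is a weak derivative of \<open>f\<close>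
  itself. Testing with the derivative of a test function shows that \<open>g (Suc k)\<close> is the
  first weak derivative of \<open>g k\<close>, so all but the last have continuous representatives.
  The norms do not change, as only null sets are affected.\<close>

lemma sob_ball_derivatives:
  assumes f: "f \<in> sob_ball \<alpha> r" and r: "r \<ge> 1"
  obtains fk where "derivative_chain r fk" "\<And>x. fk 0 x = f x"
    "\<And>k. k \<le> r \<Longrightarrow> set_integrable lborel {0<..} (\<lambda>x. fk k x * lag_w \<alpha> r x)"
    "(\<Sum>k\<le>r. LINT x:{0<..}|lborel. \<bar>fk k x * lag_w \<alpha> r x\<bar>) \<le> 1"
proof -
  from f obtain g where contf: "continuous_on {0<..} f"
    and weak: "\<And>k. k \<le> r \<Longrightarrow> weak_deriv_pos k f (g k)"
    and int: "\<And>k. k \<le> r \<Longrightarrow> set_integrable lborel {0<..} (\<lambda>x. g k x * lag_w \<alpha> r x)"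
    and sum: "(\<Sum>k\<le>r. LINT x:{0<..}|lborel. \<bar>g k x * lag_w \<alpha> r x\<bar>) \<le> 1"
    unfolding sob_ball_def by blast
  have locg: "loc_int_pos (g k)" if "k \<le> r" for k using weak[OF that] by (simp add: weak_deriv_pos_def)
  have step: "(LINT x:{0<..}|lborel. g k x * deriv \<phi> x) = - (LINT x:{0<..}|lborel. g (Suc k) x * \<phi> x)"
    if k: "k < r" and \<phi>: "test_fn_pos \<phi>" for k \<phi>
  proof -
    have "(LINT x:{0<..}|lborel. f x * (deriv ^^ k) (deriv \<phi>) x) = (-1) ^ k * (LINT x:{0<..}|lborel. g k x * deriv \<phi> x)"
      using weak[of k] k test_fn_pos_deriv[OF \<phi>] by (simp add: weak_deriv_pos_def)
    moreover have "(LINT x:{0<..}|lborel. f x * (deriv ^^ Suc k) \<phi> x) = (-1) ^ Suc k * (LINT x:{0<..}|lborel. g (Suc k) x * \<phi> x)"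
      using weak[of "Suc k"] k \<phi> unfolding weak_deriv_pos_def by auto
    moreover have "(deriv ^^ Suc k) \<phi> = (deriv ^^ k) (deriv \<phi>)" by (simp add: funpow_Suc_right del: funpow.simps)
    ultimately have "(-1) ^ k * (LINT x:{0<..}|lborel. g k x * deriv \<phi> x) = (-1) ^ k * - (LINT x:{0<..}|lborel. g (Suc k) x * \<phi> x)"
      by simp
    then show ?thesis by (simp only: mult_cancel_left) simp
  qed
  have ex_G: "\<exists>G. continuous_on {0<..} G \<and> (AE x in lborel. x > 0 \<longrightarrow> g k x = G x) \<and>
      (\<forall>x y. 0 < x \<longrightarrow> x \<le> y \<longrightarrow> G y - G x = (LINT t:{x..y}|lborel. g (Suc k) t))" if k: "k < r" for k
  proof -
    obtain G where "continuous_on {0<..} G" "AE x in lborel. x > 0 \<longrightarrow> g k x = G x"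
      "\<And>x y. 0 < x \<Longrightarrow> x \<le> y \<Longrightarrow> G y - G x = (LINT t:{x..y}|lborel. g (Suc k) t)"
      using weak_deriv_imp_primitive[OF locg[OF less_imp_le[OF k]] locg[OF Suc_leI[OF k]] step[OF k]]
      by blast
    then show ?thesis by (intro exI[of _ G]) simp
  qed
  define G where "G = (\<lambda>k. SOME G. continuous_on {0<..} G \<and> (AE x in lborel. x > 0 \<longrightarrow> g k x = G x) \<and>
      (\<forall>x y. 0 < x \<longrightarrow> x \<le> y \<longrightarrow> G y - G x = (LINT t:{x..y}|lborel. g (Suc k) t)))"
  have G: "\<And>k. k < r \<Longrightarrow> continuous_on {0<..} (G k)"
    "\<And>k. k < r \<Longrightarrow> AE x in lborel. x > 0 \<longrightarrow> g k x = G k x"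
    "\<And>k x y. k < r \<Longrightarrow> 0 < x \<Longrightarrow> x \<le> y \<Longrightarrow> G k y - G k x = (LINT t:{x..y}|lborel. g (Suc k) t)"
    using someI_ex[OF ex_G] unfolding G_def by blast+
  \<comment> \<open>Index 0 keeps \<open>f\<close>, so that \<open>fk 0\<close> agrees with
    \<open>f\<close> at every point; on the open half line it coincides with the representative
    \<open>G 0\<close> by continuity.\<close>
  define fk where "fk = (\<lambda>k. if k = 0 then f else if k < r then G k else g k)"
  have r0: "0 < r" using r by simp
  have fG: "f x = G 0 x" if "x > 0" for x
  proof (rule continuous_AE_eq_imp_eq[OF contf G(1)[OF r0] _ that])
    have "AE x in lborel. x > 0 \<longrightarrow> f x - g 0 x = 0"
    proof (rule fundamental_lemma)
      show "loc_int_pos (\<lambda>x. f x - g 0 x)"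
        using loc_int_pos_continuous[OF contf] locg[of 0] by (simp add: loc_int_pos_def set_integral_diff(1))
      fix \<phi> assume \<phi>: "test_fn_pos \<phi>"
      have "(LINT x:{0<..}|lborel. (f x - g 0 x) * \<phi> x) = (LINT x:{0<..}|lborel. f x * \<phi> x - g 0 x * \<phi> x)"
        by (simp add: algebra_simps)
      also have "\<dots> = 0"
        using weak[of 0] \<phi> test_fn_integrable[OF loc_int_pos_continuous[OF contf] \<phi>] test_fn_integrable[OF locg[of 0] \<phi>]
        by (simp add: set_integral_diff(2) weak_deriv_pos_def)
      finally show "(LINT x:{0<..}|lborel. (f x - g 0 x) * \<phi> x) = 0" .
    qed
    with G(2)[OF r0] show "AE x in lborel. x > 0 \<longrightarrow> f x = G 0 x"
      by eventually_elim auto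
  qed
  have fkG: "fk k x = G k x" if "k < r" "x > 0" for k x using that fG by (simp add: fk_def)
  have fk_cont: "continuous_on {0<..} (fk k)" if "k < r" for k
    using G(1)[OF that] contf that by (simp add: fk_def)
  have fk_ae: "AE x in lborel. x > 0 \<longrightarrow> fk k x = g k x" if "k \<le> r" for k
  proof (cases "k < r")
    case True
    show ?thesis using G(2)[OF True] by eventually_elim (simp add: fkG True)
  qed (use that r in \<open>simp add: fk_def\<close>)
  have fk_loc: "loc_int_pos (fk k)" if "k \<le> r" for k
  proof (cases "k < r")
    case True
    then show ?thesis by (intro loc_int_pos_continuous fk_cont)
  qed (use that r locg[of r] in \<open>simp add: fk_def\<close>)
  have fk_meas: "(\<lambda>x. indicator {0<..} x *\<^sub>R (fk k x * lag_w \<alpha> r x)) \<in> borel_measurable lborel" if "k \<le> r" for k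
  proof (cases "k < r")
    case True
    have "(\<lambda>x. indicator {0<..} x *\<^sub>R fk k x) \<in> borel_measurable borel"
      by (rule borel_measurable_continuous_on_indicator) (use fk_cont[OF True] in auto)
    then have "(\<lambda>x. (indicator {0<..} x *\<^sub>R fk k x) * lag_w \<alpha> r x) \<in> borel_measurable lborel"
      by measurable
    then show ?thesis by (simp add: mult.assoc)
  next
    case False
    then show ?thesis using int[OF that] that r by (simp add: fk_def set_integrable_def)
  qed
  have ae: "AE x in lborel. indicator {0<..} x *\<^sub>R (fk k x * lag_w \<alpha> r x) = indicator {0<..} x *\<^sub>R (g k x * lag_w \<alpha> r x)" if "k \<le> r" for k
    using fk_ae[OF that] by eventually_elim (auto simp: indicator_def)
  have fk_int: "set_integrable lborel {0<..} (\<lambda>x. fk k x * lag_w \<alpha> r x)" if "k \<le> r" for k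
    using int[OF that] unfolding set_integrable_def
    by (subst integrable_cong_AE[OF fk_meas[OF that] _ ae[OF that]]) auto
  have fk_sum: "(\<Sum>k\<le>r. LINT x:{0<..}|lborel. \<bar>fk k x * lag_w \<alpha> r x\<bar>) \<le> 1"
  proof -
    have "(LINT x:{0<..}|lborel. \<bar>fk k x * lag_w \<alpha> r x\<bar>) = (LINT x:{0<..}|lborel. \<bar>g k x * lag_w \<alpha> r x\<bar>)" if "k \<le> r" for k
      unfolding set_lebesgue_integral_def
    proof (rule integral_cong_AE)
      have a: "(\<lambda>x. indicator {0<..} x *\<^sub>R \<bar>h x :: real\<bar>) = (\<lambda>x. \<bar>indicator {0<..} x *\<^sub>R h x\<bar>)" for h :: "real \<Rightarrow> real"
        by (auto simp: indicator_def)
      show "(\<lambda>x. indicator {0<..} x *\<^sub>R \<bar>fk k x * lag_w \<alpha> r x\<bar>) \<in> borel_measurable lborel"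
        unfolding a using fk_meas[OF that] by (rule borel_measurable_abs)
      show "(\<lambda>x. indicator {0<..} x *\<^sub>R \<bar>g k x * lag_w \<alpha> r x\<bar>) \<in> borel_measurable lborel"
        unfolding a using int[OF that] unfolding set_integrable_def by (intro borel_measurable_abs borel_measurable_integrable)
      show "AE x in lborel. indicator {0<..} x *\<^sub>R \<bar>fk k x * lag_w \<alpha> r x\<bar> = indicator {0<..} x *\<^sub>R \<bar>g k x * lag_w \<alpha> r x\<bar>"
        using fk_ae[OF that] by eventually_elim (auto simp: indicator_def)
    qed
    then show ?thesis using sum by simp
  qed
  have fk_diff: "fk k y - fk k x = (LINT t:{x..y}|lborel. fk (Suc k) t)" if "k < r" "0 < x" "x \<le> y" for k x y
  proof -
    have "fk k y - fk k x = (LINT t:{x..y}|lborel. g (Suc k) t)"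
      using G(3)[OF that] fkG[of k x] fkG[of k y] that by simp
    also have "\<dots> = (LINT t:{x..y}|lborel. fk (Suc k) t)"
      unfolding set_lebesgue_integral_def
    proof (rule integral_cong_AE)
      show "(\<lambda>t. indicator {x..y} t *\<^sub>R g (Suc k) t) \<in> borel_measurable lborel"
        "(\<lambda>t. indicator {x..y} t *\<^sub>R fk (Suc k) t) \<in> borel_measurable lborel"
        using loc_int_posD[OF locg[of "Suc k"], of x y] loc_int_posD[OF fk_loc[of "Suc k"], of x y] that
        unfolding set_integrable_def by (auto intro: borel_measurable_integrable)
      show "AE t in lborel. indicator {x..y} t *\<^sub>R g (Suc k) t = indicator {x..y} t *\<^sub>R fk (Suc k) t"
        using fk_ae[OF Suc_leI[OF that(1)]] by eventually_elim (use that in \<open>auto simp: indicator_def\<close>)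
    qed
    finally show ?thesis .
  qed
  have "derivative_chain r fk"
    by unfold_locales (use r fk_cont fk_loc fk_diff in auto)
  moreover have "fk 0 x = f x" for x by (simp add: fk_def)
  ultimately show ?thesis using that fk_int fk_sum by blast
qed

end

section \<open>Quadrature error for truncated powers\<close>

text \<open>The kernel of the Taylor remainder of order \<open>s\<close>. For s = 1 it is the
  indicator of x \<le> t, with value 1 also at x = t.\<close>

definition trunc_pow :: "nat \<Rightarrow> real \<Rightarrow> real \<Rightarrow> real" where
  "trunc_pow s t x = (if x \<le> t then (t - x) ^ (s - 1) else 0)"

lemma trunc_pow_measurable [measurable]: "trunc_pow s t \<in> borel_measurable borel"
  unfolding trunc_pow_def by measurable

lemma trunc_pow_bounds: "0 < x \<Longrightarrow> 0 < t \<Longrightarrow> 0 \<le> trunc_pow s t x \<and> trunc_pow s t x \<le> t ^ (s - 1)"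
  unfolding trunc_pow_def by (auto intro!: power_mono)

lemma powr_ge_min:
  fixes a l u x :: real
  assumes "0 < l" "l \<le> x" "x \<le> u"
  shows "min (l powr a) (u powr a) \<le> x powr a"
proof (cases "a \<ge> 0")
  case True
  then have "l powr a \<le> x powr a" using assms by (intro powr_mono2) auto
  then show ?thesis by simp
next
  case False
  then have "u powr a \<le> x powr a" using assms by (intro powr_mono2') auto
  then show ?thesis by simp
qed

context laguerre_weight
begin

lemma trunc_pow_integrable:
  assumes "t > 0"
  shows "set_integrable lborel {0<..} (\<lambda>x. trunc_pow s t x * lag_w \<alpha> 0 x)"
proof (rule set_integrable_bound)
  show "set_integrable lborel {0<..} (\<lambda>x. poly [:t ^ (s - 1):] x * lag_w \<alpha> 0 x)"
    by (rule set_integrable_poly_lag_w)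
  show "set_borel_measurable lborel {0<..} (\<lambda>x. trunc_pow s t x * lag_w \<alpha> 0 x)"
    unfolding set_borel_measurable_def by measurable
  show "AE x in lborel. x \<in> {0<..} \<longrightarrow> norm (trunc_pow s t x * lag_w \<alpha> 0 x) \<le> norm (poly [:t ^ (s - 1):] x * lag_w \<alpha> 0 x)"
    using trunc_pow_bounds[OF _ assms] lag_w_nonneg assms
    by (intro AE_I2) (auto simp: abs_mult intro!: mult_right_mono)
qed

lemma wint_trunc_pow_nonneg:
  assumes "t > 0"
  shows "0 \<le> wint \<alpha> (trunc_pow s t)"
  unfolding wint_def set_lebesgue_integral_def using trunc_pow_bounds[OF _ assms] lag_w_nonneg
  by (intro Bochner_Integration.integral_nonneg) (auto simp: indicator_def)

lemma wint_trunc_pow_le: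
  assumes "t > 0" "s \<ge> 1"
  shows "wint \<alpha> (trunc_pow s t) \<le> t powr (\<alpha> + s) / (\<alpha> + 1)"
proof -
  note I = powr_integral_Ioc[OF alpha, of t]
  have "wint \<alpha> (trunc_pow s t) \<le> (\<integral>x. t ^ (s - 1) * (indicator {0<..t} x * x powr \<alpha>) \<partial>lborel)"
    unfolding wint_def set_lebesgue_integral_def
  proof (rule integral_mono)
    show "integrable lborel (\<lambda>x. indicator {0<..} x *\<^sub>R (trunc_pow s t x * lag_w \<alpha> 0 x))"
      using trunc_pow_integrable[OF assms(1)] by (simp add: set_integrable_def)
    show "integrable lborel (\<lambda>x. t ^ (s - 1) * (indicator {0<..t} x * x powr \<alpha>))"
      using I(1) assms by simp
    fix x :: real
    show "indicator {0<..} x *\<^sub>R (trunc_pow s t x * lag_w \<alpha> 0 x) \<le> t ^ (s - 1) * (indicator {0<..t} x * x powr \<alpha>)"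
    proof (cases "0 < x \<and> x \<le> t")
      case True
      have "trunc_pow s t x * lag_w \<alpha> 0 x \<le> t ^ (s - 1) * x powr \<alpha>"
        using trunc_pow_bounds[of x t s] True assms
        by (intro mult_mono) (auto simp: lag_w_def)
      then show ?thesis using True by simp
    qed (auto simp: trunc_pow_def indicator_def)
  qed
  also have "\<dots> = t ^ (s - 1) * (t powr (\<alpha> + 1) / (\<alpha> + 1))" using I(2) assms by simp
  also have "\<dots> = t powr (\<alpha> + s) / (\<alpha> + 1)"
  proof -
    have "t ^ (s - 1) * t powr (\<alpha> + 1) = t powr (\<alpha> + s)"
      using assms by (simp add: of_nat_diff add.commute flip: powr_realpow powr_add)
    then show ?thesis by simp
  qed
  finally show ?thesis .
qed

text \<open>The exponential costs a factor e over a unit step, and the ratio y/z is at most 1 + 1/c,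
  which bounds the power part for either sign of \<alpha>.\<close>

lemma weight_compare:
  assumes "c > 0"
  shows "\<exists>C>0. \<forall>z y. c \<le> z \<longrightarrow> z \<le> y \<longrightarrow> y \<le> z + 1 \<longrightarrow> lag_w \<alpha> 0 z \<le> C * lag_w \<alpha> 0 y"
proof -
  define D where "D = (1 + 1 / c) powr \<bar>\<alpha>\<bar>"
  have D: "D \<ge> 1" unfolding D_def using assms by (intro ge_one_powr_ge_zero) auto
  have "lag_w \<alpha> 0 z \<le> D * exp 1 * lag_w \<alpha> 0 y" if z: "c \<le> z" "z \<le> y" "y \<le> z + 1" for z y
  proof -
    have zpos: "z > 0" "y > 0" using z assms by auto
    have "z powr \<alpha> \<le> D * y powr \<alpha>"
    proof (cases "\<alpha> \<ge> 0")
      case True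
      then have "z powr \<alpha> \<le> y powr \<alpha>" using zpos z by (intro powr_mono2) auto
      also have "\<dots> \<le> D * y powr \<alpha>" using D by (simp add: mult_le_cancel_right1)
      finally show ?thesis .
    next
      case False
      have "1 \<le> z / c" using z assms by simp
      then have "y \<le> z * (1 + 1 / c)" using z by (simp add: distrib_left)
      then have "(z * (1 + 1 / c)) powr \<alpha> \<le> y powr \<alpha>" using False zpos by (intro powr_mono2') auto
      then have "D * (z powr \<alpha> * (1 + 1 / c) powr \<alpha>) \<le> D * y powr \<alpha>"
        using D zpos assms by (intro mult_left_mono) (auto simp: powr_mult)
      moreover have "D * (1 + 1 / c) powr \<alpha> = 1"
      proof -
        have "1 + 1 / c > 0" using assms by (simp add: add_pos_pos)
        then show ?thesis using False unfolding D_def by (simp flip: powr_add)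
      qed
      then have "z powr \<alpha> = D * (z powr \<alpha> * (1 + 1 / c) powr \<alpha>)" by (simp only: mult.left_commute[of D])
      ultimately show ?thesis by simp
    qed
    moreover have "exp (- z) \<le> exp 1 * exp (- y)" using z by (simp flip: exp_add)
    ultimately have "z powr \<alpha> * exp (- z) \<le> (D * y powr \<alpha>) * (exp 1 * exp (- y))"
      using D by (intro mult_mono) auto
    then show ?thesis by (simp add: lag_w_def mult_ac)
  qed
  moreover have "D * exp 1 > 0" using D by simp
  ultimately show ?thesis by blast
qed

end

context gauss_laguerre
begin

definition gauss_error :: "nat \<Rightarrow> nat \<Rightarrow> real \<Rightarrow> real" where
  "gauss_error m s t = wint \<alpha> (trunc_pow s t) - (\<Sum>z\<in>zs m. lam m z * trunc_pow s t z)"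

lemma sum_lam: "m \<ge> 1 \<Longrightarrow> (\<Sum>z\<in>zs m. lam m z) = LI 1"
  using gauss_exact[of 1 m] by simp

lemma lam_le_total: "z \<in> zs m \<Longrightarrow> lam m z \<le> LI 1"
  using sum_lam[of m] zs_index_pos[of z m] member_le_sum[of z "zs m" "lam m"] lam_pos[of _ m] by (auto simp: less_imp_le)

text \<open>Both the integral and the Gauss sum are compared with \<open>LI P\<close>, the value on
  which they agree. The integral deviates from it by at most \<open>LI S\<close>; so does the sum,
  because the Cotes numbers are positive and the rule is exact for \<open>S\<close>.\<close>

lemma gauss_error_majorant:
  assumes "t > 0" "degree P < 2 * m" "degree S < 2 * m"
    and PS: "\<And>y. y > 0 \<Longrightarrow> \<bar>trunc_pow s t y - poly P y\<bar> \<le> poly S y"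
  shows "\<bar>gauss_error m s t\<bar> \<le> 2 * LI S"
proof -
  have "wint \<alpha> (trunc_pow s t) - LI P = (LINT x:{0<..}|lborel. trunc_pow s t x * lag_w \<alpha> 0 x - poly P x * lag_w \<alpha> 0 x)"
    unfolding wint_def LI_def
    using set_integral_diff(2)[OF trunc_pow_integrable[OF assms(1)] set_integrable_poly_lag_w] by simp
  also have "\<bar>\<dots>\<bar> \<le> (LINT x:{0<..}|lborel. poly S x * lag_w \<alpha> 0 x)"
  proof -
    have int: "set_integrable lborel {0<..} (\<lambda>x. trunc_pow s t x * lag_w \<alpha> 0 x - poly P x * lag_w \<alpha> 0 x)"
      by (intro set_integral_diff(1) trunc_pow_integrable set_integrable_poly_lag_w assms)
    have "\<bar>\<integral>x. indicator {0<..} x *\<^sub>R (trunc_pow s t x * lag_w \<alpha> 0 x - poly P x * lag_w \<alpha> 0 x) \<partial>lborel\<bar> \<le>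
        (\<integral>x. \<bar>indicator {0<..} x *\<^sub>R (trunc_pow s t x * lag_w \<alpha> 0 x - poly P x * lag_w \<alpha> 0 x)\<bar> \<partial>lborel)"
      by (rule integral_abs_bound)
    also have "\<dots> \<le> (\<integral>x. indicator {0<..} x *\<^sub>R (poly S x * lag_w \<alpha> 0 x) \<partial>lborel)"
    proof (rule integral_mono)
      show "integrable lborel (\<lambda>x. \<bar>indicator {0<..} x *\<^sub>R (trunc_pow s t x * lag_w \<alpha> 0 x - poly P x * lag_w \<alpha> 0 x)\<bar>)"
        using int unfolding set_integrable_def by (rule integrable_abs)
      show "integrable lborel (\<lambda>x. indicator {0<..} x *\<^sub>R (poly S x * lag_w \<alpha> 0 x))"
        using set_integrable_poly_lag_w unfolding set_integrable_def .
      show "\<bar>indicator {0<..} x *\<^sub>R (trunc_pow s t x * lag_w \<alpha> 0 x - poly P x * lag_w \<alpha> 0 x)\<bar> \<le>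
          indicator {0<..} x *\<^sub>R (poly S x * lag_w \<alpha> 0 x)" for x
        using PS[of x] lag_w_nonneg[of 0 x]
        by (auto simp: indicator_def abs_mult mult_right_mono simp flip: left_diff_distrib)
    qed
    finally show ?thesis by (simp add: set_lebesgue_integral_def)
  qed
  finally have 1: "\<bar>wint \<alpha> (trunc_pow s t) - LI P\<bar> \<le> LI S" by (simp add: LI_def wint_def)
  have "\<bar>LI P - (\<Sum>z\<in>zs m. lam m z * trunc_pow s t z)\<bar> = \<bar>\<Sum>z\<in>zs m. lam m z * (trunc_pow s t z - poly P z)\<bar>"
    unfolding gauss_exact[OF assms(2)] by (simp add: right_diff_distrib sum_subtractf abs_minus_commute)
  also have "\<dots> \<le> (\<Sum>z\<in>zs m. lam m z * poly S z)"
    using PS lam_pos zs_pos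
    by (intro order.trans[OF sum_abs] sum_mono) (auto simp: abs_mult less_imp_le intro!: mult_left_mono)
  also have "\<dots> = LI S" using gauss_exact[OF assms(3)] by simp
  finally show ?thesis using 1 unfolding gauss_error_def by linarith
qed

text \<open>Below a0 / m there is no node, so the error is the integral alone, at most t^(\<alpha> +
  s) / (\<alpha> + 1), and one factor t^(s/2) is at most m^(-s/2). For large m the polynomial
  majorant applies. For the finitely many remaining m, \<open>t\<close> stays in a compact part of
  the half line and both sides are bounded.\<close>

lemma gauss_error_bound_single:
  assumes s: "s \<ge> 1"
  shows "\<exists>C>0. \<exists>c>0. \<forall>m\<ge>1. \<forall>t. 0 < t \<longrightarrow> t \<le> c * real m \<longrightarrow>
    \<bar>gauss_error m s t\<bar> \<le> C * (t / m) powr (s / 2) * lag_w \<alpha> 0 t"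
proof -
  define a0 where "a0 = min (\<alpha> + 1) 1"
  have a0: "0 < a0" "a0 \<le> 1" "a0 \<le> \<alpha> + 1" using alpha by (auto simp: a0_def)
  obtain C1 c m0 where C1: "C1 > 0" "c > 0" and main:
    "\<And>m t. m \<ge> m0 \<Longrightarrow> a0 / real m \<le> t \<Longrightarrow> t \<le> c * real m \<Longrightarrow>
      (\<exists>P S. degree P < 2 * m \<and> degree S < 2 * m \<and>
      (\<forall>y>0. \<bar>(if y \<le> t then (t - y) ^ (s - 1) else 0) - poly P y\<bar> \<le> poly S y) \<and>
      LI S \<le> C1 * (t / m) powr (s / 2) * lag_w \<alpha> 0 t)"
    using truncated_power_approximation[OF s a0(1,2)] by blast
  define M where "M = real m0 + 1"
  have M: "M \<ge> 1" by (simp add: M_def)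
  \<comment> \<open>A positive lower bound for the right side without its constant, valid for m
    \<le> M and a0 / M \<le> t \<le> c M.\<close>
  define low where "low = (a0 / M\<^sup>2) powr (s / 2) * (min ((a0 / M) powr \<alpha>) ((c * M) powr \<alpha>) * exp (- (c * M)))"
  have low: "low > 0" unfolding low_def using a0 C1 M by (intro mult_pos_pos) auto
  define B where "B = 2 * (c * M) ^ (s - 1) * LI 1"
  have LI1: "LI 1 > 0" by (rule LI_pos) auto
  have B: "B > 0" unfolding B_def using C1 M LI1 by simp
  define C where "C = 2 * C1 + exp 1 / (\<alpha> + 1) + B / low"
  have parts: "exp 1 / (\<alpha> + 1) > 0" "B / low > 0" using alpha B low by auto
  have C: "C > 0" "2 * C1 \<le> C" "exp 1 / (\<alpha> + 1) \<le> C" "B / low \<le> C"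
    using C1 parts by (auto simp: C_def)
  have "\<bar>gauss_error m s t\<bar> \<le> C * (t / m) powr (s / 2) * lag_w \<alpha> 0 t"
    if m: "m \<ge> 1" and t: "0 < t" "t \<le> c * real m" for m t
  proof -
    have m1: "real m \<ge> 1" using m by simp
    define E where "E = (t / m) powr (s / 2) * lag_w \<alpha> 0 t"
    have E: "E > 0" unfolding E_def using t m1 by (simp add: lag_w_pos)
    consider "t < a0 / m" | "a0 / m \<le> t" "m \<ge> m0" | "a0 / m \<le> t" "m < m0" by linarith
    then have "\<bar>gauss_error m s t\<bar> \<le> C * E"
    proof cases
      case 1
      have "trunc_pow s t z = 0" if "z \<in> zs m" for z
      proof -
        have "a0 / m \<le> (\<alpha> + 1) / m" using a0 m1 by (intro divide_right_mono) auto
        then show ?thesis using zs_lower_bound[OF that] 1 by (simp add: trunc_pow_def)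
      qed
      then have "\<bar>gauss_error m s t\<bar> = wint \<alpha> (trunc_pow s t)"
        using wint_trunc_pow_nonneg[OF t(1)] by (simp add: gauss_error_def)
      also have "\<dots> \<le> t powr (\<alpha> + s) / (\<alpha> + 1)" by (rule wint_trunc_pow_le[OF t(1) s])
      also have "t powr (\<alpha> + s) = t powr (s / 2) * t powr (s / 2) * t powr \<alpha>"
        by (simp add: add.commute flip: powr_add)
      also have "\<dots> \<le> t powr (s / 2) * (1 / m) powr (s / 2) * t powr \<alpha>"
      proof (intro mult_right_mono mult_left_mono powr_mono2)
        have "a0 / m \<le> 1 / m" using a0 m1 by (intro divide_right_mono) auto
        then show "t \<le> 1 / m" using 1 by simp
      qed (use t in auto)
      also have "t powr (s / 2) * (1 / m) powr (s / 2) = (t / m) powr (s / 2)"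
        using t m1 by (simp add: powr_divide)
      also have "(t / m) powr (s / 2) * t powr \<alpha> \<le> (t / m) powr (s / 2) * (exp 1 * lag_w \<alpha> 0 t)"
      proof (intro mult_left_mono)
        have "t \<le> 1"
        proof -
          have "a0 / m \<le> 1 / 1" using a0 m1 by (intro frac_le) auto
          then show ?thesis using 1 by simp
        qed
        then have "1 \<le> exp 1 * exp (- t)" by (simp flip: exp_add)
        then have "t powr \<alpha> * 1 \<le> t powr \<alpha> * (exp 1 * exp (- t))" by (intro mult_left_mono) auto
        then show "t powr \<alpha> \<le> exp 1 * lag_w \<alpha> 0 t" by (simp add: lag_w_def mult_ac)
      qed auto
      also have "(t / m) powr (s / 2) * (exp 1 * lag_w \<alpha> 0 t) / (\<alpha> + 1) = exp 1 / (\<alpha> + 1) * E"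
        by (simp add: E_def)
      also have "\<dots> \<le> C * E" using C E by (intro mult_right_mono) auto
      finally show ?thesis using alpha by (simp add: divide_right_mono)
    next
      case 2
      from main[OF 2(2) 2(1) t(2)] obtain P S where PS: "degree P < 2 * m" "degree S < 2 * m"
        "\<And>y. y > 0 \<Longrightarrow> \<bar>trunc_pow s t y - poly P y\<bar> \<le> poly S y" "LI S \<le> C1 * (t / m) powr (s / 2) * lag_w \<alpha> 0 t"
        unfolding trunc_pow_def by blast
      have "\<bar>gauss_error m s t\<bar> \<le> 2 * LI S" by (rule gauss_error_majorant[OF t(1) PS(1,2,3)])
      also have "\<dots> \<le> 2 * C1 * E" using PS(4) by (simp add: E_def mult.assoc)
      also have "\<dots> \<le> C * E" using C E by (intro mult_right_mono) auto
      finally show ?thesis .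
    next
      case 3
      have mM: "real m \<le> M" using 3 by (simp add: M_def)
      have tM: "t \<le> c * M"
      using t(2) order.trans[OF _ mult_left_mono[OF mM less_imp_le[OF C1(2)]]] by blast
      have at: "a0 / M \<le> t"
      proof -
        have "a0 / M \<le> a0 / m" using a0 m1 mM by (intro divide_left_mono) auto
        then show ?thesis using 3 by simp
      qed
      have pw: "t ^ (s - 1) \<le> (c * M) ^ (s - 1)" using t tM by (intro power_mono) auto
      have "wint \<alpha> (trunc_pow s t) \<le> t ^ (s - 1) * LI 1"
      proof -
        have "wint \<alpha> (trunc_pow s t) \<le> LI [:t ^ (s - 1):]"
          unfolding wint_def LI_def using trunc_pow_bounds[OF _ t(1)] lag_w_nonneg
          by (intro set_integral_mono trunc_pow_integrable set_integrable_poly_lag_w t) (auto intro!: mult_right_mono)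
        also have "[:t ^ (s - 1):] = smult (t ^ (s - 1)) 1" by simp
        finally show ?thesis by (simp only: LI_smult)
      qed
      also have "\<dots> \<le> (c * M) ^ (s - 1) * LI 1" using pw LI1 by (intro mult_right_mono) auto
      finally have w: "wint \<alpha> (trunc_pow s t) \<le> (c * M) ^ (s - 1) * LI 1" .
      have "(\<Sum>z\<in>zs m. lam m z * trunc_pow s t z) \<le> (\<Sum>z\<in>zs m. lam m z * (c * M) ^ (s - 1))"
      proof (intro sum_mono mult_left_mono)
        fix z assume "z \<in> zs m"
        then show "trunc_pow s t z \<le> (c * M) ^ (s - 1)" "0 \<le> lam m z"
          using trunc_pow_bounds[OF zs_pos t(1), of z m s] pw lam_pos[of z m] by auto
      qed
      also have "\<dots> = (c * M) ^ (s - 1) * LI 1" using sum_lam[OF m] by (simp flip: sum_distrib_right)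
      finally have q: "(\<Sum>z\<in>zs m. lam m z * trunc_pow s t z) \<le> (c * M) ^ (s - 1) * LI 1" .
      have q0: "0 \<le> (\<Sum>z\<in>zs m. lam m z * trunc_pow s t z)"
        using trunc_pow_bounds[OF zs_pos t(1)] lam_pos by (intro sum_nonneg mult_nonneg_nonneg) (auto simp: less_imp_le)
      have "\<bar>gauss_error m s t\<bar> \<le> B"
        unfolding gauss_error_def B_def using w q q0 wint_trunc_pow_nonneg[OF t(1), of s] by linarith
      also have "B = B / low * low" using low by simp
      also have "\<dots> \<le> B / low * E"
      proof (rule mult_left_mono)
        show "low \<le> E"
          unfolding low_def E_def lag_w_def
        proof (intro mult_mono powr_mono2)
          show "a0 / M\<^sup>2 \<le> t / m"
          proof -
            have "a0 / M\<^sup>2 = (a0 / M) / M" by (simp add: power2_eq_square)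
            also have "\<dots> \<le> t / m" using at mM m1 a0 M t(1) by (intro frac_le) auto
            finally show ?thesis .
          qed
          show "min ((a0 / M) powr \<alpha>) ((c * M) powr \<alpha>) \<le> t powr (\<alpha> + real 0 / 2)"
            using powr_ge_min[of "a0 / M" t "c * M" \<alpha>] a0 M at tM by simp
          show "exp (- (c * M)) \<le> exp (- t)" using tM by simp
        qed (use a0 M C1 in auto)
        show "0 \<le> B / low" using parts by simp
      qed
      also have "\<dots> \<le> C * E" using C E by (intro mult_right_mono) auto
      finally show ?thesis .
    qed
    then show ?thesis by (simp add: E_def mult.assoc)
  qed
  with C(1) C1(2) show ?thesis by blast
qed

lemma gauss_error_bound:
  assumes "r \<ge> 1"
  obtains C c where "C > 0" "c > 0"
    "\<And>m s t. m \<ge> 1 \<Longrightarrow> 1 \<le> s \<Longrightarrow> s \<le> r \<Longrightarrow> 0 < t \<Longrightarrow> t \<le> c * real m \<Longrightarrow>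
      \<bar>gauss_error m s t\<bar> \<le> C * (t / m) powr (s / 2) * lag_w \<alpha> 0 t"
proof -
  have "\<exists>C>0. \<exists>c>0. \<forall>m\<ge>1. \<forall>s. 1 \<le> s \<longrightarrow> s \<le> n \<longrightarrow> (\<forall>t. 0 < t \<longrightarrow> t \<le> c * real m \<longrightarrow>
      \<bar>gauss_error m s t\<bar> \<le> C * (t / m) powr (s / 2) * lag_w \<alpha> 0 t)" for n
  proof (induction n)
    case 0
    then show ?case by (intro exI[of _ 1] conjI) auto
  next
    case (Suc n)
    then obtain C1 c1 where 1: "C1 > 0" "c1 > 0" "\<And>m s t. m \<ge> 1 \<Longrightarrow> 1 \<le> s \<Longrightarrow> s \<le> n \<Longrightarrow> 0 < t \<Longrightarrow> t \<le> c1 * real m \<Longrightarrow>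
      \<bar>gauss_error m s t\<bar> \<le> C1 * (t / m) powr (s / 2) * lag_w \<alpha> 0 t" by blast
    obtain C2 c2 where 2: "C2 > 0" "c2 > 0" "\<And>m t. m \<ge> 1 \<Longrightarrow> 0 < t \<Longrightarrow> t \<le> c2 * real m \<Longrightarrow>
      \<bar>gauss_error m (Suc n) t\<bar> \<le> C2 * (t / m) powr (Suc n / 2) * lag_w \<alpha> 0 t"
      using gauss_error_bound_single[of "Suc n"] by auto
    have "\<bar>gauss_error m s t\<bar> \<le> max C1 C2 * (t / m) powr (s / 2) * lag_w \<alpha> 0 t"
      if "m \<ge> 1" "1 \<le> s" "s \<le> Suc n" "0 < t" "t \<le> min c1 c2 * real m" for m s t
    proof -
      have t: "t \<le> c1 * real m" "t \<le> c2 * real m"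
        using that(5) mult_right_mono[of "min c1 c2" c1 "real m"] mult_right_mono[of "min c1 c2" c2 "real m"] by auto
      have le: "C' * ((t / m) powr (s / 2) * lag_w \<alpha> 0 t) \<le> max C1 C2 * ((t / m) powr (s / 2) * lag_w \<alpha> 0 t)"
        if "C' \<le> max C1 C2" for C' using that lag_w_nonneg by (intro mult_right_mono) auto
      show ?thesis
      proof (cases "s = Suc n")
        case True
        then have "\<bar>gauss_error m s t\<bar> \<le> C2 * ((t / m) powr (s / 2) * lag_w \<alpha> 0 t)"
          using 2(3)[OF that(1,4) t(2)] by (simp add: mult.assoc)
        also have "\<dots> \<le> max C1 C2 * ((t / m) powr (s / 2) * lag_w \<alpha> 0 t)" by (rule le) simp
        finally show ?thesis by (simp add: mult.assoc)
      next
        case False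
        then have "\<bar>gauss_error m s t\<bar> \<le> C1 * ((t / m) powr (s / 2) * lag_w \<alpha> 0 t)"
          using 1(3)[OF that(1,2) _ that(4) t(1)] that by (simp add: mult.assoc)
        also have "\<dots> \<le> max C1 C2 * ((t / m) powr (s / 2) * lag_w \<alpha> 0 t)" by (rule le) simp
        finally show ?thesis by (simp add: mult.assoc)
      qed
    qed
    then show ?case using 1(1,2) 2(1,2) by (intro exI[of _ "max C1 C2"] exI[of _ "min c1 c2"] conjI) auto
  qed
  from this[of r] show ?thesis using that by blast
qed

text \<open>Extends the bound to all m: for the finitely many small ones the nodes in question lie
  in a compact interval, where the weight is bounded below, and no Cotes number exceeds the total
  mass.\<close>

lemma lam_le_weight:
  assumes c: "c > 0" and \<theta>: "0 < \<theta>" "\<theta> < 1"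
  shows "\<exists>C>0. \<forall>m\<ge>1. \<forall>z\<in>zs m. c * real m \<le> z \<longrightarrow> z \<le> 4 * \<theta> * real m \<longrightarrow> lam m z \<le> C * lag_w \<alpha> 0 z"
proof -
  obtain C1 m0 where C1: "C1 > 0" and main: "\<And>m z. m \<ge> m0 \<Longrightarrow> z \<in> zs m \<Longrightarrow> 1 \<le> z \<Longrightarrow> z \<le> 4 * \<theta> * real m \<Longrightarrow> lam m z \<le> C1 * lag_w \<alpha> 0 z"
    using lam_upper_bound[OF \<theta>] by blast
  define m1 where "m1 = max m0 (nat \<lceil>1 / c\<rceil>)"
  define M where "M = real m1 + c + 1"
  have M: "M \<ge> 1" "c \<le> 4 * M" using c by (auto simp: M_def)
  define low where "low = min (c powr \<alpha>) ((4 * M) powr \<alpha>) * exp (- (4 * M))"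
  have low: "low > 0" unfolding low_def using c M by (intro mult_pos_pos) auto
  have LI1: "LI 1 > 0" by (rule LI_pos) auto
  have "lam m z \<le> max C1 (LI 1 / low) * lag_w \<alpha> 0 z"
    if m: "m \<ge> 1" and z: "z \<in> zs m" "c * real m \<le> z" "z \<le> 4 * \<theta> * real m" for m z
  proof (cases "m \<ge> m1")
    case True
    have "1 / c \<le> m" using True unfolding m1_def by linarith
    then have "1 \<le> c * m" using c by (simp add: field_simps)
    then have "lam m z \<le> C1 * lag_w \<alpha> 0 z" using z True by (intro main) (auto simp: m1_def)
    also have "\<dots> \<le> max C1 (LI 1 / low) * lag_w \<alpha> 0 z" by (intro mult_right_mono lag_w_nonneg) auto
    finally show ?thesis .
  next
    case False
    have mM: "real m \<le> M" using False c by (simp add: M_def)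
    have cz: "c \<le> z"
    proof -
      have "c * 1 \<le> c * real m" using m c by (intro mult_left_mono) auto
      then show ?thesis using z(2) by simp
    qed
    have zM: "z \<le> 4 * M"
    proof -
      have "4 * \<theta> * real m \<le> 4 * 1 * M" using \<theta> mM by (intro mult_mono) auto
      then show ?thesis using z by simp
    qed
    have "low \<le> lag_w \<alpha> 0 z"
      unfolding low_def lag_w_def using powr_ge_min[OF c cz zM, of \<alpha>] zM c M
      by (intro mult_mono) auto
    have "lam m z \<le> LI 1" by (rule lam_le_total[OF z(1)])
    also have "\<dots> = LI 1 / low * low" using low by simp
    also have "\<dots> \<le> LI 1 / low * lag_w \<alpha> 0 z" using \<open>low \<le> lag_w \<alpha> 0 z\<close> low LI1 by (intro mult_left_mono) auto
    also have "\<dots> \<le> max C1 (LI 1 / low) * lag_w \<alpha> 0 z" by (intro mult_right_mono lag_w_nonneg) auto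
    finally show ?thesis .
  qed
  then show ?thesis using C1 by (intro exI[of _ "max C1 (LI 1 / low)"]) auto
qed

text \<open>The value at a node is at most the mean of |f0| over an interval to its right plus the
  integral of |f1| there. The Cotes number is bounded by the weight, which is comparable on such an
  interval, and the spacing of the nodes makes the intervals disjoint, so the integrals add up to at
  most the one beyond \<open>b\<close>.\<close>

lemma node_sum_bound:
  assumes c: "c > 0" and \<theta>: "0 < \<theta>" "\<theta> < 1"
  shows "\<exists>C>0. \<forall>m\<ge>1. \<forall>b f0 f1. c * real m \<le> b \<longrightarrow> continuous_on {0<..} f0 \<longrightarrow> loc_int_pos f1 \<longrightarrow>
    (\<forall>x y. 0 < x \<longrightarrow> x \<le> y \<longrightarrow> f0 y - f0 x = (LINT t:{x..y}|lborel. f1 t)) \<longrightarrow>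
    set_integrable lborel {b<..} (\<lambda>x. (\<bar>f0 x\<bar> + \<bar>f1 x\<bar>) * lag_w \<alpha> 0 x) \<longrightarrow>
    (\<Sum>z\<in>{z \<in> zs m. b < z \<and> z \<le> 4 * \<theta> * real m}. lam m z * \<bar>f0 z\<bar>) \<le>
      C * (LINT x:{b<..}|lborel. (\<bar>f0 x\<bar> + \<bar>f1 x\<bar>) * lag_w \<alpha> 0 x)"
proof -
  obtain C1 where C1: "C1 > 0" "\<And>m z. m \<ge> 1 \<Longrightarrow> z \<in> zs m \<Longrightarrow> c * real m \<le> z \<Longrightarrow> z \<le> 4 * \<theta> * real m \<Longrightarrow> lam m z \<le> C1 * lag_w \<alpha> 0 z"
    using lam_le_weight[OF c \<theta>] by blast
  obtain C2 where C2: "C2 > 0" "\<And>z y. c \<le> z \<Longrightarrow> z \<le> y \<Longrightarrow> y \<le> z + 1 \<Longrightarrow> lag_w \<alpha> 0 z \<le> C2 * lag_w \<alpha> 0 y"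
    using weight_compare[OF c] by blast
  obtain \<delta>0 where \<delta>0: "\<delta>0 > 0" "\<And>m y z. m \<ge> 1 \<Longrightarrow> y \<in> zs m \<Longrightarrow> z \<in> zs m \<Longrightarrow> y < z \<Longrightarrow> c * real m \<le> y \<Longrightarrow> \<delta>0 \<le> z - y"
    using zs_spacing[OF c] by blast
  \<comment> \<open>Strictly below the spacing, so that the closed intervals are disjoint, and at
    most 1 for the comparison of weights.\<close>
  define \<delta> where "\<delta> = min (\<delta>0 / 2) 1"
  have \<delta>: "\<delta> > 0" "\<delta> \<le> 1" "\<delta> < \<delta>0" using \<delta>0 by (auto simp: \<delta>_def)
  have "(\<Sum>z\<in>{z \<in> zs m. b < z \<and> z \<le> 4 * \<theta> * real m}. lam m z * \<bar>f0 z\<bar>) \<le>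
      C1 * C2 / \<delta> * (LINT x:{b<..}|lborel. (\<bar>f0 x\<bar> + \<bar>f1 x\<bar>) * lag_w \<alpha> 0 x)"
    if m: "m \<ge> 1" and b: "c * real m \<le> b" and f0: "continuous_on {0<..} f0" and f1: "loc_int_pos f1"
      and diff: "\<And>x y. 0 < x \<Longrightarrow> x \<le> y \<Longrightarrow> f0 y - f0 x = (LINT t:{x..y}|lborel. f1 t)"
      and int: "set_integrable lborel {b<..} (\<lambda>x. (\<bar>f0 x\<bar> + \<bar>f1 x\<bar>) * lag_w \<alpha> 0 x)" for m b f0 f1
  proof -
    define A where "A = {z \<in> zs m. b < z \<and> z \<le> 4 * \<theta> * real m}"
    define k where "k = (\<lambda>x. (\<bar>f0 x\<bar> + \<bar>f1 x\<bar>) * lag_w \<alpha> 0 x)"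
    have k0: "k x \<ge> 0" for x by (simp add: k_def lag_w_nonneg)
    have finA: "finite A" by (simp add: A_def)
    have cb: "c \<le> b"
    proof -
      have "c * 1 \<le> c * real m" using m c by (intro mult_left_mono) auto
      then show ?thesis using b by simp
    qed
    have one: "lam m z * \<bar>f0 z\<bar> \<le> C1 * C2 / \<delta> * (LINT x:{z..z + \<delta>}|lborel. k x)" if z: "z \<in> A" for z
    proof -
      have zb: "z > b" "z > 0" "c \<le> z" using z cb c by (auto simp: A_def)
      have i1: "set_integrable lborel {z..z + \<delta>} (\<lambda>x. \<bar>f1 x\<bar>)"
        using loc_int_posD[OF f1 zb(2)] by (intro set_integrable_abs)
      have i0: "set_integrable lborel {z..z + \<delta>} (\<lambda>x. \<bar>f0 x\<bar>)"
        using f0 zb by (intro set_integrable_continuous_Icc continuous_intros) (auto elim!: continuous_on_subset)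
      define I1 where "I1 = (LINT t:{z..z + \<delta>}|lborel. \<bar>f1 t\<bar>)"
      have le: "\<bar>f0 z\<bar> \<le> \<bar>f0 y\<bar> + I1" if y: "y \<in> {z..z + \<delta>}" for y
      proof -
        have "\<bar>f0 y - f0 z\<bar> = \<bar>LINT t:{z..y}|lborel. f1 t\<bar>" using diff[OF zb(2), of y] y by simp
        also have "\<dots> \<le> (LINT t:{z..y}|lborel. \<bar>f1 t\<bar>)"
          using set_integral_norm_bound[OF loc_int_posD[OF f1 zb(2), of y]] by simp
        also have "\<dots> \<le> I1"
          unfolding I1_def set_lebesgue_integral_def
        proof (rule integral_mono)
          show "integrable lborel (\<lambda>x. indicator {z..y} x *\<^sub>R \<bar>f1 x\<bar>)"
            using set_integrable_abs[OF loc_int_posD[OF f1 zb(2), of y]] by (simp add: set_integrable_def)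
          show "integrable lborel (\<lambda>x. indicator {z..z + \<delta>} x *\<^sub>R \<bar>f1 x\<bar>)"
            using i1 by (simp add: set_integrable_def)
        qed (use y in \<open>auto simp: indicator_def\<close>)
        finally show ?thesis by linarith
      qed
      have "\<delta> * \<bar>f0 z\<bar> = (LINT y:{z..z + \<delta>}|lborel. \<bar>f0 z\<bar>)" using \<delta> by (simp add: set_lebesgue_integral_def)
      also have "\<dots> \<le> (LINT y:{z..z + \<delta>}|lborel. \<bar>f0 y\<bar> + I1)"
        using le by (intro set_integral_mono set_integral_add(1) i0 set_integrable_continuous_Icc continuous_on_const) auto
      also have "\<dots> = (LINT y:{z..z + \<delta>}|lborel. \<bar>f0 y\<bar>) + \<delta> * I1"
        using i0 \<delta> by (subst set_integral_add(2)) (auto simp: set_lebesgue_integral_def intro!: set_integrable_continuous_Icc)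
      also have "\<delta> * I1 \<le> I1"
        using \<delta> by (intro mult_left_le_one_le) (auto simp: I1_def set_lebesgue_integral_def intro!: Bochner_Integration.integral_nonneg)
      finally have le1: "\<delta> * \<bar>f0 z\<bar> \<le> (LINT y:{z..z + \<delta>}|lborel. \<bar>f0 y\<bar> + \<bar>f1 y\<bar>)"
        unfolding set_integral_add(2)[OF i0 i1] I1_def by simp
      have "lam m z * \<bar>f0 z\<bar> \<le> (C1 * lag_w \<alpha> 0 z) * \<bar>f0 z\<bar>"
        using z zb b by (intro mult_right_mono C1(2) m) (auto simp: A_def)
      also have "\<dots> = C1 / \<delta> * (lag_w \<alpha> 0 z * (\<delta> * \<bar>f0 z\<bar>))" using \<delta> by simp
      also have "\<dots> \<le> C1 / \<delta> * (lag_w \<alpha> 0 z * (LINT y:{z..z + \<delta>}|lborel. \<bar>f0 y\<bar> + \<bar>f1 y\<bar>))"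
        using le1 C1 \<delta> lag_w_nonneg by (intro mult_left_mono) auto
      also have "lag_w \<alpha> 0 z * (LINT y:{z..z + \<delta>}|lborel. \<bar>f0 y\<bar> + \<bar>f1 y\<bar>) =
          (LINT y:{z..z + \<delta>}|lborel. lag_w \<alpha> 0 z * (\<bar>f0 y\<bar> + \<bar>f1 y\<bar>))"
        by (rule set_integral_mult_right[symmetric])
      also have "\<dots> \<le> (LINT y:{z..z + \<delta>}|lborel. C2 * k y)"
      proof (rule set_integral_mono)
        show "set_integrable lborel {z..z + \<delta>} (\<lambda>y. lag_w \<alpha> 0 z * (\<bar>f0 y\<bar> + \<bar>f1 y\<bar>))"
          by (intro set_integrable_mult_right set_integral_add(1) i0 i1)
        show "set_integrable lborel {z..z + \<delta>} (\<lambda>y. C2 * k y)"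
          unfolding k_def using zb by (intro set_integrable_mult_right set_integrable_subset[OF int]) auto
        fix y assume y: "y \<in> {z..z + \<delta>}"
        have "lag_w \<alpha> 0 z * (\<bar>f0 y\<bar> + \<bar>f1 y\<bar>) \<le> (C2 * lag_w \<alpha> 0 y) * (\<bar>f0 y\<bar> + \<bar>f1 y\<bar>)"
          using y \<delta> zb by (intro mult_right_mono C2(2)) auto
        then show "lag_w \<alpha> 0 z * (\<bar>f0 y\<bar> + \<bar>f1 y\<bar>) \<le> C2 * k y" by (simp add: k_def mult_ac)
      qed
      also have "(LINT y:{z..z + \<delta>}|lborel. C2 * k y) = C2 * (LINT y:{z..z + \<delta>}|lborel. k y)"
        by (rule set_integral_mult_right)
      finally show ?thesis using C1 \<delta> by (simp add: mult_left_mono divide_right_mono)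
    qed
    have disj: "disjoint_family_on (\<lambda>z. {z..z + \<delta>}) A"
    proof -
      have "{y..y + \<delta>} \<inter> {z..z + \<delta>} = {}" if "y \<in> A" "z \<in> A" "y < z" for y z
        using \<delta>0(2)[OF m, of y z] that b \<delta> by (auto simp: A_def)
      note lt = this
      show ?thesis unfolding disjoint_family_on_def
      proof (intro ballI impI)
        fix y z assume yz: "y \<in> A" "z \<in> A" "y \<noteq> z"
        then consider "y < z" | "z < y" by linarith
        then show "{y..y + \<delta>} \<inter> {z..z + \<delta>} = {}"
          using lt[OF yz(1,2)] lt[OF yz(2,1)] by cases auto
      qed
    qed
    have "(\<Sum>z\<in>A. lam m z * \<bar>f0 z\<bar>) \<le> (\<Sum>z\<in>A. C1 * C2 / \<delta> * (LINT x:{z..z + \<delta>}|lborel. k x))"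
      by (rule sum_mono) (rule one)
    also have "\<dots> = C1 * C2 / \<delta> * (\<Sum>z\<in>A. LINT x:{z..z + \<delta>}|lborel. k x)" by (simp only: sum_distrib_left)
    also have "(\<Sum>z\<in>A. LINT x:{z..z + \<delta>}|lborel. k x) = (LINT x:(\<Union>z\<in>A. {z..z + \<delta>})|lborel. k x)"
    proof (rule set_integral_finite_Union[OF finA disj, symmetric])
      fix z assume "z \<in> A"
      then show "set_integrable lborel {z..z + \<delta>} k"
        unfolding k_def by (intro set_integrable_subset[OF int]) (auto simp: A_def)
    qed auto
    also have "\<dots> \<le> (LINT x:{b<..}|lborel. k x)"
      unfolding set_lebesgue_integral_def
    proof (rule integral_mono)
      have sub: "(\<Union>z\<in>A. {z..z + \<delta>}) \<subseteq> {b<..}" by (auto simp: A_def)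
      have "set_integrable lborel (\<Union>z\<in>A. {z..z + \<delta>}) k"
        unfolding k_def using finA by (intro set_integrable_subset[OF int] sub) (auto intro!: sets.finite_UN)
      then show "integrable lborel (\<lambda>x. indicator (\<Union>z\<in>A. {z..z + \<delta>}) x *\<^sub>R k x)" by (simp only: set_integrable_def)
      show "integrable lborel (\<lambda>x. indicator {b<..} x *\<^sub>R k x)" using int by (simp add: set_integrable_def k_def)
      show "indicator (\<Union>z\<in>A. {z..z + \<delta>}) x *\<^sub>R k x \<le> indicator {b<..} x *\<^sub>R k x" for x
        using subsetD[OF sub, of x] k0[of x] by (auto split: split_indicator)
    qed
    finally show ?thesis using C1 C2 \<delta> by (simp add: A_def k_def mult_left_mono divide_right_mono)
  qed
  then show ?thesis using C1 C2 \<delta> by (intro exI[of _ "C1 * C2 / \<delta>"] conjI) auto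
qed

section \<open>Error of the truncated rule on the Sobolev ball\<close>

text \<open>All truncated powers in the Taylor formula at \<open>b\<close> end at some t \<le> b and
  vanish at the nodes beyond \<open>b\<close>. The partial sum over the nodes up to \<open>b\<close>
  is therefore a full Gauss sum for each kernel, and every term becomes a complete
  \<open>gauss_error\<close>.\<close>

lemma left_part_error:
  assumes chain: "derivative_chain r fk" and b: "b > 0"
    and int_r: "set_integrable lborel {0<..} (\<lambda>x. fk r x * lag_w \<alpha> r x)"
  shows "set_integrable lborel {0<..b} (\<lambda>x. fk 0 x * lag_w \<alpha> 0 x)"
    and "set_integrable lborel {0<..b} (\<lambda>t. fk r t * gauss_error m r t)"
    and "(LINT x:{0<..b}|lborel. fk 0 x * lag_w \<alpha> 0 x) - (\<Sum>z\<in>{z \<in> zs m. z \<le> b}. lam m z * fk 0 z) =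
      (\<Sum>k<r. fk k b * (-1) ^ k / fact k * gauss_error m (Suc k) b) +
      (-1) ^ r / fact (r - 1) * (LINT t:{0<..b}|lborel. fk r t * gauss_error m r t)"
proof -
  interpret derivative_chain r fk by fact
  define W where "W = (\<lambda>x. indicator {0<..b} x * lag_w \<alpha> 0 x)"
  define g where "g = (\<lambda>t. indicator {0<..b} t * fk r t)"
  define inner where "inner = (\<lambda>t. \<integral>x. (if x \<le> t then W x * (t - x) ^ (r - 1) else 0) \<partial>lborel)"
  define ck where "ck = (\<lambda>k. fk k b * (-1) ^ k / fact k)"
  define cr :: real where "cr = (-1) ^ r / fact (r - 1)"
  have W0: "W x \<ge> 0" for x by (simp add: W_def lag_w_nonneg)
  have Wm [measurable]: "W \<in> borel_measurable borel" unfolding W_def by measurable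
  have gm [measurable]: "g \<in> borel_measurable borel"
  proof -
    have "(\<lambda>x. indicator {0<..} x *\<^sub>R (fk r x * lag_w \<alpha> r x)) \<in> borel_measurable lborel"
      using int_r unfolding set_integrable_def by (rule borel_measurable_integrable)
    then have [measurable]: "(\<lambda>x. indicator {0<..} x *\<^sub>R (fk r x * lag_w \<alpha> r x)) \<in> borel_measurable borel" by simp
    \<comment> \<open>The hypothesis gives measurability only for the product with the weight;
      dividing by the positive weight recovers it for \<open>g\<close>.\<close>
    have geq: "g = (\<lambda>x. indicator {0<..b} x * ((indicator {0<..} x *\<^sub>R (fk r x * lag_w \<alpha> r x)) / lag_w \<alpha> r x))"
    proof
      fix x
      show "g x = indicator {0<..b} x * ((indicator {0<..} x *\<^sub>R (fk r x * lag_w \<alpha> r x)) / lag_w \<alpha> r x)"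
        using lag_w_pos[of x r] by (cases "0 < x") (auto simp: g_def indicator_def)
    qed
    show ?thesis unfolding geq by measurable
  qed
  have trunc_eq: "(if x \<le> t then W x * (t - x) ^ (r - 1) else 0) = indicator {0<..} x *\<^sub>R (trunc_pow r t x * lag_w \<alpha> 0 x)"
    if "t \<le> b" for x t
    using that by (auto simp: W_def trunc_pow_def indicator_def)
  have inner_eq: "inner t = wint \<alpha> (trunc_pow r t)" if "t \<le> b" for t
    unfolding inner_def wint_def set_lebesgue_integral_def trunc_eq[OF that] ..
  have i1: "integrable lborel (\<lambda>x. if x \<le> t then W x * (t - x) ^ (r - 1) else 0)" for t
  proof (cases "t > 0")
    case True
    show ?thesis
    proof (rule Bochner_Integration.integrable_bound)
      show "integrable lborel (\<lambda>x. indicator {0<..} x *\<^sub>R (trunc_pow r t x * lag_w \<alpha> 0 x))"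
        using trunc_pow_integrable[OF True] by (simp add: set_integrable_def)
      show "(\<lambda>x. if x \<le> t then W x * (t - x) ^ (r - 1) else 0) \<in> borel_measurable lborel" by measurable
      show "AE x in lborel. norm (if x \<le> t then W x * (t - x) ^ (r - 1) else 0) \<le>
          norm (indicator {0<..} x *\<^sub>R (trunc_pow r t x * lag_w \<alpha> 0 x))"
        by (intro AE_I2) (auto simp: W_def trunc_pow_def indicator_def mult.commute)
    qed
  next
    case False
    then have "(\<lambda>x. if x \<le> t then W x * (t - x) ^ (r - 1) else 0) = (\<lambda>x. 0)"
      by (auto simp: W_def indicator_def)
    then show ?thesis by simp
  qed
  have abs_W: "(\<integral>x. (if x \<le> t then \<bar>W x\<bar> * (t - x) ^ (r - 1) else 0) \<partial>lborel) = inner t" for t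
    using W0 by (simp add: inner_def cong: if_cong)
  have inner_le: "inner t \<le> t powr (\<alpha> + r) / (\<alpha> + 1)" "0 \<le> inner t" if "0 < t" "t \<le> b" for t
    using wint_trunc_pow_le[OF that(1) r_pos] wint_trunc_pow_nonneg[OF that(1)] inner_eq[OF that(2)] by auto
  \<comment> \<open>Near 0 the top derivative is integrable only against t^(\<alpha> + r/2). The
    inner integral is of order t^(\<alpha> + r), which is smaller on bounded intervals, so Fubini
    applies.\<close>
  have weight_le: "t powr (\<alpha> + r) \<le> b powr (r / 2) * exp b * lag_w \<alpha> r t" if "0 < t" "t \<le> b" for t
  proof -
    have "t powr (\<alpha> + r) = t powr (r / 2) * t powr (\<alpha> + r / 2)" by (simp add: add.commute flip: powr_add)
    also have "\<dots> \<le> b powr (r / 2) * t powr (\<alpha> + r / 2)" using that by (intro mult_right_mono powr_mono2) auto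
    also have "\<dots> \<le> b powr (r / 2) * (exp b * (t powr (\<alpha> + r / 2) * exp (- t)))"
    proof (intro mult_left_mono)
      have "1 \<le> exp b * exp (- t)" using that by (simp flip: exp_add)
      then have "t powr (\<alpha> + r / 2) * 1 \<le> t powr (\<alpha> + r / 2) * (exp b * exp (- t))" by (intro mult_left_mono) auto
      then show "t powr (\<alpha> + r / 2) \<le> exp b * (t powr (\<alpha> + r / 2) * exp (- t))" by (simp add: mult_ac)
    qed auto
    finally show ?thesis by (simp add: lag_w_def mult_ac)
  qed
  define D where "D = b powr (r / 2) * exp b / (\<alpha> + 1)"
  have D: "D \<ge> 0" using alpha by (simp add: D_def)
  have inner_m [measurable]: "inner \<in> borel_measurable borel" unfolding inner_def by measurable
  have g_inner: "integrable lborel (\<lambda>t. g t * inner t)" "integrable lborel (\<lambda>t. \<bar>g t\<bar> * inner t)"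
  proof -
    have bound: "\<bar>g t\<bar> * \<bar>inner t\<bar> \<le> D * \<bar>indicator {0<..} t *\<^sub>R (fk r t * lag_w \<alpha> r t)\<bar>" for t
    proof (cases "0 < t \<and> t \<le> b")
      case True
      have "inner t \<le> t powr (\<alpha> + r) / (\<alpha> + 1)" using inner_le True by auto
      also have "\<dots> \<le> b powr (r / 2) * exp b * lag_w \<alpha> r t / (\<alpha> + 1)"
        using weight_le[of t] True alpha by (intro divide_right_mono) auto
      also have "\<dots> = D * lag_w \<alpha> r t" by (simp add: D_def)
      finally have "\<bar>fk r t\<bar> * inner t \<le> \<bar>fk r t\<bar> * (D * lag_w \<alpha> r t)" by (intro mult_left_mono) auto
      then show ?thesis using True inner_le(2)[of t] by (simp add: g_def abs_mult lag_w_nonneg mult_ac)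
    qed (auto simp: g_def D indicator_def)
    have maj: "integrable lborel (\<lambda>t. D * \<bar>indicator {0<..} t *\<^sub>R (fk r t * lag_w \<alpha> r t)\<bar>)"
      using int_r unfolding set_integrable_def by (intro integrable_mult_right integrable_abs)
    show "integrable lborel (\<lambda>t. g t * inner t)" "integrable lborel (\<lambda>t. \<bar>g t\<bar> * inner t)"
      by (rule Bochner_Integration.integrable_bound[OF maj]; use bound D in \<open>auto simp: abs_mult\<close>)+
  qed
  have fub1: "integrable lborel (\<lambda>x. W x * (\<integral>t. (if x \<le> t then (t - x) ^ (r - 1) * g t else 0) \<partial>lborel))"
    and fub2: "(\<integral>x. W x * (\<integral>t. (if x \<le> t then (t - x) ^ (r - 1) * g t else 0) \<partial>lborel) \<partial>lborel) = (\<integral>t. g t * inner t \<partial>lborel)"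
    using triangle_fubini[OF Wm gm i1] g_inner(2) unfolding abs_W by (auto simp: inner_def)
  define Rem where "Rem = (\<lambda>x. \<integral>t. (if x \<le> t then (t - x) ^ (r - 1) * g t else 0) \<partial>lborel)"
  have Rem: "Rem x = (LINT t:{x..b}|lborel. fk r t * (t - x) ^ (r - 1))" if "0 < x" for x
    unfolding Rem_def set_lebesgue_integral_def g_def
    by (rule Bochner_Integration.integral_cong) (use that in \<open>auto simp: indicator_def\<close>)
  have taylor_b: "fk 0 x = (\<Sum>k<r. ck k * trunc_pow (Suc k) b x) + cr * Rem x" if x: "0 < x" "x \<le> b" for x
  proof -
    have "fk k b * (x - b) ^ k / fact k = ck k * trunc_pow (Suc k) b x" for k
    proof -
      have "(x - b) ^ k = (-1) ^ k * (b - x) ^ k" by (simp flip: power_mult_distrib)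
      then show ?thesis using x by (simp add: ck_def trunc_pow_def)
    qed
    then show ?thesis using taylor[OF x r_pos order.refl] by (simp add: Rem[OF x(1)] cr_def)
  qed
  have tp_int: "integrable lborel (\<lambda>x. indicator {0<..} x *\<^sub>R (trunc_pow (Suc k) b x * lag_w \<alpha> 0 x))" for k
    using trunc_pow_integrable[OF b] by (simp add: set_integrable_def)
  have tp_restrict: "indicator {0<..} x *\<^sub>R (trunc_pow (Suc k) b x * lag_w \<alpha> 0 x) =
      indicator {0<..b} x * (trunc_pow (Suc k) b x * lag_w \<alpha> 0 x)" for k x
    by (auto simp: trunc_pow_def indicator_def)
  have decomp: "indicator {0<..b} x *\<^sub>R (fk 0 x * lag_w \<alpha> 0 x) =
      (\<Sum>k<r. ck k * (indicator {0<..} x *\<^sub>R (trunc_pow (Suc k) b x * lag_w \<alpha> 0 x))) + cr * (W x * Rem x)" for x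
  proof (cases "0 < x \<and> x \<le> b")
    case True
    then show ?thesis
      using taylor_b[of x] by (simp add: W_def distrib_left sum_distrib_left mult_ac)
  next
    case False
    then show ?thesis unfolding tp_restrict by (auto simp: W_def indicator_def)
  qed
  show int0: "set_integrable lborel {0<..b} (\<lambda>x. fk 0 x * lag_w \<alpha> 0 x)"
    unfolding set_integrable_def decomp using tp_int fub1
    by (intro Bochner_Integration.integrable_add Bochner_Integration.integrable_sum integrable_mult_right) (auto simp: Rem_def)
  have lhs: "(LINT x:{0<..b}|lborel. fk 0 x * lag_w \<alpha> 0 x) =
      (\<Sum>k<r. ck k * wint \<alpha> (trunc_pow (Suc k) b)) + cr * (\<integral>t. g t * inner t \<partial>lborel)"
  proof -
    have "(LINT x:{0<..b}|lborel. fk 0 x * lag_w \<alpha> 0 x) =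
        (\<integral>x. (\<Sum>k<r. ck k * (indicator {0<..} x *\<^sub>R (trunc_pow (Suc k) b x * lag_w \<alpha> 0 x))) + cr * (W x * Rem x) \<partial>lborel)"
      unfolding set_lebesgue_integral_def decomp ..
    also have "\<dots> = (\<integral>x. (\<Sum>k<r. ck k * (indicator {0<..} x *\<^sub>R (trunc_pow (Suc k) b x * lag_w \<alpha> 0 x))) \<partial>lborel) +
        (\<integral>x. cr * (W x * Rem x) \<partial>lborel)"
      using tp_int fub1
      by (intro Bochner_Integration.integral_add Bochner_Integration.integrable_sum integrable_mult_right) (auto simp: Rem_def)
    also have "(\<integral>x. (\<Sum>k<r. ck k * (indicator {0<..} x *\<^sub>R (trunc_pow (Suc k) b x * lag_w \<alpha> 0 x))) \<partial>lborel) =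
        (\<Sum>k<r. \<integral>x. ck k * (indicator {0<..} x *\<^sub>R (trunc_pow (Suc k) b x * lag_w \<alpha> 0 x)) \<partial>lborel)"
      using tp_int by (intro Bochner_Integration.integral_sum integrable_mult_right)
    also have "\<dots> = (\<Sum>k<r. ck k * wint \<alpha> (trunc_pow (Suc k) b))"
      by (simp only: integral_mult_right_zero wint_def set_lebesgue_integral_def)
    also have "(\<integral>x. cr * (W x * Rem x) \<partial>lborel) = cr * (\<integral>t. g t * inner t \<partial>lborel)"
      using fub2 by (simp only: integral_mult_right_zero Rem_def)
    finally show ?thesis .
  qed
  have node_int: "integrable lborel (\<lambda>t. g t * trunc_pow r t z)" and node_Rem: "z \<le> b \<Longrightarrow> Rem z = (\<integral>t. g t * trunc_pow r t z \<partial>lborel)"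
    and node_out: "z > b \<Longrightarrow> (\<integral>t. g t * trunc_pow r t z \<partial>lborel) = 0" if z: "z > 0" for z
  proof -
    have eq: "g t * trunc_pow r t z = indicator {z..b} t *\<^sub>R (fk r t * (t - z) ^ (r - 1))" for t
      using z by (auto simp: g_def trunc_pow_def indicator_def)
    show "integrable lborel (\<lambda>t. g t * trunc_pow r t z)"
      unfolding eq using remainder_integrable[OF order.refl z] by (simp add: set_integrable_def)
    show "Rem z = (\<integral>t. g t * trunc_pow r t z \<partial>lborel)" if "z \<le> b"
      unfolding Rem[OF z] eq set_lebesgue_integral_def ..
    show "(\<integral>t. g t * trunc_pow r t z \<partial>lborel) = 0" if "z > b"
      unfolding eq using that by simp
  qed
  have nodes: "(\<Sum>z\<in>{z \<in> zs m. z \<le> b}. lam m z * fk 0 z) =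
      (\<Sum>k<r. ck k * (\<Sum>z\<in>zs m. lam m z * trunc_pow (Suc k) b z)) +
      cr * (\<integral>t. g t * (\<Sum>z\<in>zs m. lam m z * trunc_pow r t z) \<partial>lborel)"
  proof -
    have "(\<Sum>z\<in>{z \<in> zs m. z \<le> b}. lam m z * fk 0 z) =
        (\<Sum>z\<in>zs m. (\<Sum>k<r. ck k * (lam m z * trunc_pow (Suc k) b z)) + cr * (lam m z * (\<integral>t. g t * trunc_pow r t z \<partial>lborel)))"
    proof (rule sum.mono_neutral_cong_left)
      fix z assume "z \<in> {z \<in> zs m. z \<le> b}"
      then have z: "0 < z" "z \<le> b" using zs_pos by auto
      show "lam m z * fk 0 z = (\<Sum>k<r. ck k * (lam m z * trunc_pow (Suc k) b z)) + cr * (lam m z * (\<integral>t. g t * trunc_pow r t z \<partial>lborel))"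
        unfolding taylor_b[OF z] node_Rem[OF z] by (simp add: distrib_left sum_distrib_left mult_ac)
    next
      show "\<forall>z\<in>zs m - {z \<in> zs m. z \<le> b}. (\<Sum>k<r. ck k * (lam m z * trunc_pow (Suc k) b z)) + cr * (lam m z * (\<integral>t. g t * trunc_pow r t z \<partial>lborel)) = 0"
      proof
        fix z assume "z \<in> zs m - {z \<in> zs m. z \<le> b}"
        then have z: "z > 0" "b < z" using zs_pos by auto
        have "trunc_pow (Suc k) b z = 0" for k using z by (simp add: trunc_pow_def)
        then show "(\<Sum>k<r. ck k * (lam m z * trunc_pow (Suc k) b z)) + cr * (lam m z * (\<integral>t. g t * trunc_pow r t z \<partial>lborel)) = 0"
          using node_out[OF z] by simp
      qed
    qed auto
    also have "\<dots> = (\<Sum>k<r. ck k * (\<Sum>z\<in>zs m. lam m z * trunc_pow (Suc k) b z)) +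
        cr * (\<Sum>z\<in>zs m. lam m z * (\<integral>t. g t * trunc_pow r t z \<partial>lborel))"
      unfolding sum.distrib sum_distrib_left by (subst sum.swap) simp
    also have "(\<Sum>z\<in>zs m. lam m z * (\<integral>t. g t * trunc_pow r t z \<partial>lborel)) = (\<integral>t. (\<Sum>z\<in>zs m. lam m z * (g t * trunc_pow r t z)) \<partial>lborel)"
      using node_int zs_pos
      by (subst Bochner_Integration.integral_sum) (auto intro!: integrable_mult_right)
    also have "\<dots> = (\<integral>t. g t * (\<Sum>z\<in>zs m. lam m z * trunc_pow r t z) \<partial>lborel)"
      by (rule Bochner_Integration.integral_cong) (simp_all add: sum_distrib_left mult_ac)
    finally show ?thesis .
  qed
  have sum_int: "integrable lborel (\<lambda>t. g t * (\<Sum>z\<in>zs m. lam m z * trunc_pow r t z))"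
  proof -
    have "integrable lborel (\<lambda>t. \<Sum>z\<in>zs m. lam m z * (g t * trunc_pow r t z))"
      using node_int zs_pos by (intro Bochner_Integration.integrable_sum integrable_mult_right) auto
    then show ?thesis by (simp add: sum_distrib_left mult.left_commute)
  qed
  have err: "g t * inner t - g t * (\<Sum>z\<in>zs m. lam m z * trunc_pow r t z) = indicator {0<..b} t *\<^sub>R (fk r t * gauss_error m r t)" for t
    by (cases "0 < t \<and> t \<le> b") (auto simp: g_def inner_eq gauss_error_def algebra_simps)
  show "set_integrable lborel {0<..b} (\<lambda>t. fk r t * gauss_error m r t)"
    unfolding set_integrable_def err[symmetric] by (intro Bochner_Integration.integrable_diff g_inner sum_int)
  have "(\<integral>t. g t * inner t \<partial>lborel) - (\<integral>t. g t * (\<Sum>z\<in>zs m. lam m z * trunc_pow r t z) \<partial>lborel) =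
      (LINT t:{0<..b}|lborel. fk r t * gauss_error m r t)"
    unfolding set_lebesgue_integral_def err[symmetric]
    by (rule Bochner_Integration.integral_diff[symmetric, OF g_inner(1) sum_int])
  then have diff_int: "cr * (\<integral>t. g t * inner t \<partial>lborel) - cr * (\<integral>t. g t * (\<Sum>z\<in>zs m. lam m z * trunc_pow r t z) \<partial>lborel) =
      cr * (LINT t:{0<..b}|lborel. fk r t * gauss_error m r t)"
    by (simp only: right_diff_distrib[symmetric])
  have diff_sum: "(\<Sum>k<r. ck k * wint \<alpha> (trunc_pow (Suc k) b)) - (\<Sum>k<r. ck k * (\<Sum>z\<in>zs m. lam m z * trunc_pow (Suc k) b z)) =
      (\<Sum>k<r. ck k * gauss_error m (Suc k) b)"
    by (simp only: gauss_error_def right_diff_distrib sum_subtractf)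
  show "(LINT x:{0<..b}|lborel. fk 0 x * lag_w \<alpha> 0 x) - (\<Sum>z\<in>{z \<in> zs m. z \<le> b}. lam m z * fk 0 z) =
      (\<Sum>k<r. fk k b * (-1) ^ k / fact k * gauss_error m (Suc k) b) +
      (-1) ^ r / fact (r - 1) * (LINT t:{0<..b}|lborel. fk r t * gauss_error m r t)"
    unfolding lhs nodes using diff_int diff_sum by (simp only: ck_def cr_def)
qed

lemma lag_w_le_tail:
  assumes "0 < b" "b \<le> x"
  shows "lag_w \<alpha> 0 x \<le> b powr - (r / 2) * lag_w \<alpha> r x"
proof -
  have "lag_w \<alpha> 0 x = x powr - (r / 2) * lag_w \<alpha> r x"
    using assms by (simp add: lag_w_def flip: powr_add mult.assoc)
  also have "\<dots> \<le> b powr - (r / 2) * lag_w \<alpha> r x"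
    using assms by (intro mult_right_mono powr_mono2' lag_w_nonneg) auto
  finally show ?thesis .
qed

lemma quadrature_error:
  assumes r: "r \<ge> 1" and \<theta>: "0 < \<theta>" "\<theta> < 1"
  shows "\<exists>C>0. \<forall>m\<ge>1. \<forall>f\<in>sob_ball \<alpha> r.
    \<bar>wint \<alpha> f - (\<Sum>z\<in>{z \<in> zs m. z \<le> 4 * \<theta> * real m}. lam m z * f z)\<bar> \<le> C * real m powr - (r / 2)"
proof -
  obtain C1 c1 where C1: "C1 > 0" "c1 > 0" and ge: "\<And>m s t. m \<ge> 1 \<Longrightarrow> 1 \<le> s \<Longrightarrow> s \<le> r \<Longrightarrow> 0 < t \<Longrightarrow> t \<le> c1 * real m \<Longrightarrow>
      \<bar>gauss_error m s t\<bar> \<le> C1 * (t / m) powr (s / 2) * lag_w \<alpha> 0 t"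
    using gauss_error_bound[OF r] by metis
  \<comment> \<open>Below \<open>c1\<close> for the kernel estimates up to \<open>b\<close>, below
    \<theta> so that \<open>b\<close> lies under the cut-off 4 \<theta> m, and at most 1 so that b /
    m is at most 1.\<close>
  define c where "c = min (min c1 \<theta>) 1"
  have c: "c > 0" "c \<le> c1" "c \<le> \<theta>" "c \<le> 1" using C1 \<theta> by (auto simp: c_def)
  have "c / 2 > 0" using c by simp
  from node_sum_bound[OF this \<theta>] obtain C2 where C2: "C2 > 0"
    and nodes: "\<And>m b f0 f1. m \<ge> 1 \<Longrightarrow> c / 2 * real m \<le> b \<Longrightarrow> continuous_on {0<..} f0 \<Longrightarrow> loc_int_pos f1 \<Longrightarrow>
      (\<And>x y. 0 < x \<Longrightarrow> x \<le> y \<Longrightarrow> f0 y - f0 x = (LINT t:{x..y}|lborel. f1 t)) \<Longrightarrow>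
      set_integrable lborel {b<..} (\<lambda>x. (\<bar>f0 x\<bar> + \<bar>f1 x\<bar>) * lag_w \<alpha> 0 x) \<Longrightarrow>
      (\<Sum>z\<in>{z \<in> zs m. b < z \<and> z \<le> 4 * \<theta> * real m}. lam m z * \<bar>f0 z\<bar>) \<le>
        C2 * (LINT x:{b<..}|lborel. (\<bar>f0 x\<bar> + \<bar>f1 x\<bar>) * lag_w \<alpha> 0 x)"
    by blast
  define D where "D = (2 / c) powr (r / 2)"
  have D: "D > 0" using c by (simp add: D_def)
  define C where "C = C1 * D * (4 / c) + C1 + (1 + C2) * D"
  have C: "C > 0" unfolding C_def using C1 C2 D c by (intro add_pos_pos mult_pos_pos) auto
  have "\<bar>wint \<alpha> f - (\<Sum>z\<in>{z \<in> zs m. z \<le> 4 * \<theta> * real m}. lam m z * f z)\<bar> \<le> C * real m powr - (r / 2)"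
    if m: "m \<ge> 1" and f: "f \<in> sob_ball \<alpha> r" for m f
  proof -
    have m1: "real m \<ge> 1" using m by simp
    have cm: "c * real m > 0" using c m1 by simp
    define E where "E = real m powr - (r / 2)"
    have E: "E > 0" using m1 by (simp add: E_def)
    obtain fk where chain: "derivative_chain r fk" and fk0: "\<And>x. fk 0 x = f x"
      and int: "\<And>k. k \<le> r \<Longrightarrow> set_integrable lborel {0<..} (\<lambda>x. fk k x * lag_w \<alpha> r x)"
      and sum: "(\<Sum>k\<le>r. LINT x:{0<..}|lborel. \<bar>fk k x * lag_w \<alpha> r x\<bar>) \<le> 1"
      using sob_ball_derivatives[OF f r] by blast
    interpret derivative_chain r fk by (rule chain)
    define T where "T = (\<lambda>x. \<Sum>k\<le>r. \<bar>fk k x * lag_w \<alpha> r x\<bar>)"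
    have T0: "T x \<ge> 0" for x by (simp add: T_def sum_nonneg)
    have iabs: "integrable lborel (\<lambda>x. indicator {0<..} x *\<^sub>R \<bar>fk k x * lag_w \<alpha> r x\<bar>)" if "k \<le> r" for k
      using set_integrable_abs[OF int[OF that]] by (simp only: set_integrable_def)
    have T_eq: "indicator {0<..} x *\<^sub>R T x = (\<Sum>k\<le>r. indicator {0<..} x *\<^sub>R \<bar>fk k x * lag_w \<alpha> r x\<bar>)" for x
      by (simp add: T_def scaleR_sum_right sum_distrib_left)
    have Tint: "integrable lborel (\<lambda>x. indicator {0<..} x *\<^sub>R T x)"
      unfolding T_eq by (intro Bochner_Integration.integrable_sum iabs) auto
    have Tle: "(\<integral>x. indicator {0<..} x *\<^sub>R T x \<partial>lborel) \<le> 1"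
    proof -
      have "(\<integral>x. indicator {0<..} x *\<^sub>R T x \<partial>lborel) = (\<Sum>k\<le>r. LINT x:{0<..}|lborel. \<bar>fk k x * lag_w \<alpha> r x\<bar>)"
        unfolding T_eq set_lebesgue_integral_def by (intro Bochner_Integration.integral_sum iabs) auto
      then show ?thesis using sum by (simp only:)
    qed
    \<comment> \<open>The interval has length c m / 2. If \<open>T\<close> exceeded 4 / (c m) on all
      of it, its integral would be at least 2, but it is at most 1.\<close>
    have "\<exists>b\<in>{c * m / 2..c * m}. T b \<le> 4 / (c * m)"
    proof (rule ccontr)
      assume "\<not> ?thesis"
      then have big: "4 / (c * m) \<le> T b" if "b \<in> {c * m / 2..c * m}" for b using that by force
      have "2 = (\<integral>x. indicator {c * m / 2..c * m} x * (4 / (c * m)) \<partial>lborel)"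
        using c m by simp
      also have "\<dots> \<le> (\<integral>x. indicator {0<..} x *\<^sub>R T x \<partial>lborel)"
      proof (rule integral_mono[OF _ Tint])
        show "integrable lborel (\<lambda>x. indicator {c * m / 2..c * m} x * (4 / (c * m)))"
          by (intro integrable_mult_left integrable_real_indicator) (auto simp: emeasure_lborel_Icc_eq)
        show "indicator {c * m / 2..c * m} x * (4 / (c * m)) \<le> indicator {0<..} x *\<^sub>R T x" for x
          using big[of x] T0[of x] cm by (auto simp: indicator_def)
      qed
      also have "\<dots> \<le> 1" by (rule Tle)
      finally show False by simp
    qed
    then obtain b where b: "c * m / 2 \<le> b" "b \<le> c * m" "T b \<le> 4 / (c * m)" by auto
    have b0: "b > 0" using b cm by linarith
    have bE: "b powr - (r / 2) \<le> D * E"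
    proof -
      have "b powr - (r / 2) \<le> (c * m / 2) powr - (r / 2)" using b cm by (intro powr_mono2') auto
      also have "c * m / 2 = (c / 2) * m" by simp
      also have "((c / 2) * m) powr - (r / 2) = (c / 2) powr - (r / 2) * E" unfolding E_def by (rule powr_mult)
      also have "(c / 2) powr - (r / 2) = D" using c by (simp add: D_def powr_minus powr_divide)
      finally show ?thesis .
    qed
    have bm: "b \<le> c1 * real m" using b(2) mult_right_mono[OF c(2) of_nat_0_le_iff[of m]] by linarith
    have b\<theta>: "b \<le> 4 * \<theta> * real m"
    proof -
      have "c * m \<le> (4 * \<theta>) * m" using c \<theta> by (intro mult_right_mono) auto
      then show ?thesis using b by simp
    qed
    note left_int = left_part_error(1)[OF chain b0 int[OF order.refl]]
    note left = left_part_error(2,3)[OF chain b0 int[OF order.refl], where m = m]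
    have wb: "lag_w \<alpha> 0 b \<le> D * E * lag_w \<alpha> r b"
      using lag_w_le_tail[OF b0 order.refl, of r] mult_right_mono[OF bE lag_w_nonneg[of r b]] by linarith
    \<comment> \<open>In the boundary terms the powers of b / m are only bounded by 1. The rate
      comes from \<open>b\<close> being of order m: w(b) is at most D * E times the Sobolev weight
      at b.\<close>
    have first: "\<bar>\<Sum>k<r. fk k b * (-1) ^ k / fact k * gauss_error m (Suc k) b\<bar> \<le> C1 * D * (4 / c) * E"
    proof -
      have "\<bar>\<Sum>k<r. fk k b * (-1) ^ k / fact k * gauss_error m (Suc k) b\<bar> \<le> (\<Sum>k<r. \<bar>fk k b\<bar> * (C1 * lag_w \<alpha> 0 b))"
      proof (intro order.trans[OF sum_abs] sum_mono)
        fix k assume "k \<in> {..<r}"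
        then have k: "k < r" by simp
        have "(b / m) powr (Suc k / 2) \<le> 1"
        proof -
          have "b \<le> 1 * real m" using b(2) mult_right_mono[OF c(4) of_nat_0_le_iff[of m]] by linarith
          then have "b / m \<le> 1" using m1 by (simp add: divide_le_eq)
          then have "(b / m) powr (Suc k / 2) \<le> 1 powr (Suc k / 2)" using b0 m1 by (intro powr_mono2) auto
          then show ?thesis by simp
        qed
        then have "C1 * (b / m) powr (Suc k / 2) * lag_w \<alpha> 0 b \<le> C1 * 1 * lag_w \<alpha> 0 b"
          using C1 lag_w_nonneg by (intro mult_right_mono mult_left_mono) auto
        then have g: "\<bar>gauss_error m (Suc k) b\<bar> \<le> C1 * lag_w \<alpha> 0 b"
          using ge[OF m _ _ b0 bm, of "Suc k"] k by simp
        have "\<bar>fk k b * (-1) ^ k / fact k * gauss_error m (Suc k) b\<bar> = (\<bar>fk k b\<bar> / fact k) * \<bar>gauss_error m (Suc k) b\<bar>"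
          by (simp add: abs_mult power_abs)
        also have "\<dots> \<le> (\<bar>fk k b\<bar> / 1) * (C1 * lag_w \<alpha> 0 b)"
          by (intro mult_mono divide_left_mono fact_ge_1 g) auto
        finally show "\<bar>fk k b * (-1) ^ k / fact k * gauss_error m (Suc k) b\<bar> \<le> \<bar>fk k b\<bar> * (C1 * lag_w \<alpha> 0 b)" by simp
      qed
      also have "\<dots> = C1 * ((\<Sum>k<r. \<bar>fk k b\<bar>) * lag_w \<alpha> 0 b)" by (simp add: mult_ac sum_distrib_left)
      also have "\<dots> \<le> C1 * ((\<Sum>k<r. \<bar>fk k b\<bar>) * (D * E * lag_w \<alpha> r b))"
        using wb C1 by (intro mult_left_mono) (auto intro: sum_nonneg)
      also have "\<dots> = C1 * D * E * (\<Sum>k<r. \<bar>fk k b * lag_w \<alpha> r b\<bar>)"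
        using lag_w_nonneg[of r b] by (simp add: abs_mult mult_ac sum_distrib_left)
      also have "\<dots> \<le> C1 * D * E * (4 / c)"
      proof (intro mult_left_mono)
        have "(\<Sum>k<r. \<bar>fk k b * lag_w \<alpha> r b\<bar>) \<le> T b" unfolding T_def by (rule sum_mono2) auto
        also have "\<dots> \<le> 4 / (c * m)" by (rule b)
        also have "\<dots> \<le> 4 / (c * 1)" using c m1 by (intro divide_left_mono mult_left_mono) auto
        finally show "(\<Sum>k<r. \<bar>fk k b * lag_w \<alpha> r b\<bar>) \<le> 4 / c" by simp
      qed (use C1 D E in auto)
      finally show ?thesis by (simp add: mult_ac)
    qed
    have second: "\<bar>LINT t:{0<..b}|lborel. fk r t * gauss_error m r t\<bar> \<le> C1 * E"
    proof -
      have "\<bar>LINT t:{0<..b}|lborel. fk r t * gauss_error m r t\<bar> \<le> (\<integral>t. \<bar>indicator {0<..b} t *\<^sub>R (fk r t * gauss_error m r t)\<bar> \<partial>lborel)"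
        unfolding set_lebesgue_integral_def by (rule integral_abs_bound)
      also have "\<dots> \<le> (\<integral>t. (C1 * E) * (indicator {0<..} t *\<^sub>R T t) \<partial>lborel)"
      proof (rule integral_mono)
        show "integrable lborel (\<lambda>t. \<bar>indicator {0<..b} t *\<^sub>R (fk r t * gauss_error m r t)\<bar>)"
          using left(1) unfolding set_integrable_def by (rule integrable_abs)
        show "integrable lborel (\<lambda>t. (C1 * E) * (indicator {0<..} t *\<^sub>R T t))" using Tint by (rule integrable_mult_right)
        fix t
        show "\<bar>indicator {0<..b} t *\<^sub>R (fk r t * gauss_error m r t)\<bar> \<le> (C1 * E) * (indicator {0<..} t *\<^sub>R T t)"
        proof (cases "0 < t \<and> t \<le> b")
          case True
          have "t \<le> c1 * real m" using True bm by linarith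
          then have "\<bar>gauss_error m r t\<bar> \<le> C1 * (t / m) powr (r / 2) * lag_w \<alpha> 0 t"
            using True by (intro ge m r order.refl) auto
          \<comment> \<open>This is where the two weights fit together: t^(r/2) w(t) is the Sobolev
            weight, so the kernel estimate at \<open>t\<close> is exactly m^(-r/2) times the density
            of the norm, uniformly down to t = 0.\<close>
          also have "(t / m) powr (r / 2) = E * t powr (r / 2)" by (simp add: powr_divide E_def powr_minus_divide)
          also have "C1 * (E * t powr (r / 2)) * lag_w \<alpha> 0 t = C1 * E * lag_w \<alpha> r t"
            by (simp add: lag_w_def powr_add)
          finally have "\<bar>fk r t\<bar> * \<bar>gauss_error m r t\<bar> \<le> \<bar>fk r t\<bar> * (C1 * E * lag_w \<alpha> r t)"
            by (intro mult_left_mono) auto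
          also have "\<dots> = (C1 * E) * \<bar>fk r t * lag_w \<alpha> r t\<bar>" using lag_w_nonneg[of r t] by (simp add: abs_mult)
          also have "\<dots> \<le> (C1 * E) * T t"
            unfolding T_def using C1 E by (intro mult_left_mono member_le_sum) auto
          finally show ?thesis using True by (simp add: abs_mult)
        next
          case False
          then show ?thesis using C1 E T0[of t] by (auto simp: indicator_def)
        qed
      qed
      also have "\<dots> = (C1 * E) * (\<integral>t. indicator {0<..} t *\<^sub>R T t \<partial>lborel)" by (rule integral_mult_right_zero)
      also have "\<dots> \<le> (C1 * E) * 1" using Tle C1 E by (intro mult_left_mono) auto
      finally show ?thesis by simp
    qed
    have left_bound: "\<bar>(LINT x:{0<..b}|lborel. f x * lag_w \<alpha> 0 x) - (\<Sum>z\<in>{z \<in> zs m. z \<le> b}. lam m z * f z)\<bar> \<le> C1 * D * (4 / c) * E + C1 * E"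
    proof -
      have "\<bar>(-1) ^ r / fact (r - 1) * (LINT t:{0<..b}|lborel. fk r t * gauss_error m r t)\<bar> =
          1 / fact (r - 1) * \<bar>LINT t:{0<..b}|lborel. fk r t * gauss_error m r t\<bar>"
        by (simp add: abs_mult power_abs)
      also have "\<dots> \<le> 1 * (C1 * E)"
        using second fact_ge_1[of "r - 1"] by (intro mult_mono) (auto simp: divide_le_eq)
      finally show ?thesis using left(2) first unfolding fk0 by linarith
    qed
    have tail_dom: "(\<bar>fk 0 x\<bar> + \<bar>fk 1 x\<bar>) * lag_w \<alpha> 0 x \<le> D * E * T x" if "x > b" for x
    proof -
      have "lag_w \<alpha> 0 x \<le> D * E * lag_w \<alpha> r x"
        using lag_w_le_tail[OF b0 less_imp_le[OF that], of r] mult_right_mono[OF bE lag_w_nonneg[of r x]] by linarith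
      then have "(\<bar>fk 0 x\<bar> + \<bar>fk 1 x\<bar>) * lag_w \<alpha> 0 x \<le> (\<bar>fk 0 x\<bar> + \<bar>fk 1 x\<bar>) * (D * E * lag_w \<alpha> r x)"
        by (intro mult_left_mono) auto
      also have "\<dots> = D * E * (\<Sum>k\<in>{0, 1}. \<bar>fk k x * lag_w \<alpha> r x\<bar>)"
        using lag_w_nonneg[of r x] by (simp add: abs_mult algebra_simps)
      also have "\<dots> \<le> D * E * T x"
        unfolding T_def using r D E by (intro mult_left_mono sum_mono2) auto
      finally show ?thesis .
    qed
    have meas: "(\<lambda>x. indicator {b<..} x *\<^sub>R (fk k x * lag_w \<alpha> 0 x)) \<in> borel_measurable lborel" if "k \<le> r" for k
    proof -
      have "(\<lambda>x. indicator {0<..} x *\<^sub>R (fk k x * lag_w \<alpha> r x)) \<in> borel_measurable lborel"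
        using int[OF that] unfolding set_integrable_def by (rule borel_measurable_integrable)
      then have [measurable]: "(\<lambda>x. indicator {0<..} x *\<^sub>R (fk k x * lag_w \<alpha> r x)) \<in> borel_measurable borel" by simp
      have "(\<lambda>x. indicator {b<..} x *\<^sub>R (fk k x * lag_w \<alpha> 0 x)) =
          (\<lambda>x. indicator {b<..} x *\<^sub>R ((indicator {0<..} x *\<^sub>R (fk k x * lag_w \<alpha> r x)) / lag_w \<alpha> r x * lag_w \<alpha> 0 x))"
      proof
        fix x
        show "indicator {b<..} x *\<^sub>R (fk k x * lag_w \<alpha> 0 x) =
          indicator {b<..} x *\<^sub>R ((indicator {0<..} x *\<^sub>R (fk k x * lag_w \<alpha> r x)) / lag_w \<alpha> r x * lag_w \<alpha> 0 x)"
          using lag_w_pos[of x r] b0 by (cases "b < x") (auto simp: indicator_def)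
      qed
      then show ?thesis by (simp only: measurable_lborel1) measurable
    qed
    have DT: "integrable lborel (\<lambda>x. D * E * (indicator {0<..} x *\<^sub>R T x))" using Tint by (rule integrable_mult_right)
    have int_abs: "integrable lborel (\<lambda>x. indicator {b<..} x *\<^sub>R ((\<bar>fk 0 x\<bar> + \<bar>fk 1 x\<bar>) * lag_w \<alpha> 0 x))"
    proof (rule Bochner_Integration.integrable_bound[OF DT])
      have "(\<lambda>x. \<bar>indicator {b<..} x *\<^sub>R (fk 0 x * lag_w \<alpha> 0 x)\<bar> + \<bar>indicator {b<..} x *\<^sub>R (fk 1 x * lag_w \<alpha> 0 x)\<bar>) \<in> borel_measurable lborel"
        using r by (intro borel_measurable_add borel_measurable_abs meas) auto
      also have "(\<lambda>x. \<bar>indicator {b<..} x *\<^sub>R (fk 0 x * lag_w \<alpha> 0 x)\<bar> + \<bar>indicator {b<..} x *\<^sub>R (fk 1 x * lag_w \<alpha> 0 x)\<bar>) =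
          (\<lambda>x. indicator {b<..} x *\<^sub>R ((\<bar>fk 0 x\<bar> + \<bar>fk 1 x\<bar>) * lag_w \<alpha> 0 x))"
        using lag_w_nonneg by (auto simp: indicator_def abs_mult algebra_simps)
      finally show "(\<lambda>x. indicator {b<..} x *\<^sub>R ((\<bar>fk 0 x\<bar> + \<bar>fk 1 x\<bar>) * lag_w \<alpha> 0 x)) \<in> borel_measurable lborel" .
      show "AE x in lborel. norm (indicator {b<..} x *\<^sub>R ((\<bar>fk 0 x\<bar> + \<bar>fk 1 x\<bar>) * lag_w \<alpha> 0 x)) \<le> norm (D * E * (indicator {0<..} x *\<^sub>R T x))"
        using tail_dom b0 lag_w_nonneg D E T0 by (intro AE_I2) (auto simp: indicator_def abs_mult)
    qed
    have tail_le: "(LINT x:{b<..}|lborel. (\<bar>fk 0 x\<bar> + \<bar>fk 1 x\<bar>) * lag_w \<alpha> 0 x) \<le> D * E"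
    proof -
      have "(LINT x:{b<..}|lborel. (\<bar>fk 0 x\<bar> + \<bar>fk 1 x\<bar>) * lag_w \<alpha> 0 x) \<le> (\<integral>x. D * E * (indicator {0<..} x *\<^sub>R T x) \<partial>lborel)"
        unfolding set_lebesgue_integral_def
      proof (rule integral_mono[OF int_abs DT])
        show "indicator {b<..} x *\<^sub>R ((\<bar>fk 0 x\<bar> + \<bar>fk 1 x\<bar>) * lag_w \<alpha> 0 x) \<le> D * E * (indicator {0<..} x *\<^sub>R T x)" for x
          using tail_dom[of x] b0 D E T0[of x] by (auto simp: indicator_def)
      qed
      also have "\<dots> = D * E * (\<integral>x. indicator {0<..} x *\<^sub>R T x \<partial>lborel)" by (rule integral_mult_right_zero)
      also have "\<dots> \<le> D * E * 1" using Tle D E by (intro mult_left_mono) auto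
      finally show ?thesis by simp
    qed
    have int_f: "integrable lborel (\<lambda>x. indicator {b<..} x *\<^sub>R (f x * lag_w \<alpha> 0 x))"
    proof (rule Bochner_Integration.integrable_bound[OF int_abs])
      show "(\<lambda>x. indicator {b<..} x *\<^sub>R (f x * lag_w \<alpha> 0 x)) \<in> borel_measurable lborel"
        using meas[of 0] unfolding fk0 by simp
      show "AE x in lborel. norm (indicator {b<..} x *\<^sub>R (f x * lag_w \<alpha> 0 x)) \<le> norm (indicator {b<..} x *\<^sub>R ((\<bar>fk 0 x\<bar> + \<bar>fk 1 x\<bar>) * lag_w \<alpha> 0 x))"
        using lag_w_nonneg by (intro AE_I2) (auto simp: indicator_def abs_mult fk0 intro!: mult_right_mono)
    qed
    have right_int: "\<bar>LINT x:{b<..}|lborel. f x * lag_w \<alpha> 0 x\<bar> \<le> D * E"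
    proof -
      have "\<bar>LINT x:{b<..}|lborel. f x * lag_w \<alpha> 0 x\<bar> \<le> (\<integral>x. \<bar>indicator {b<..} x *\<^sub>R (f x * lag_w \<alpha> 0 x)\<bar> \<partial>lborel)"
        unfolding set_lebesgue_integral_def by (rule integral_abs_bound)
      also have "\<dots> \<le> (LINT x:{b<..}|lborel. (\<bar>fk 0 x\<bar> + \<bar>fk 1 x\<bar>) * lag_w \<alpha> 0 x)"
        unfolding set_lebesgue_integral_def
      proof (rule integral_mono[OF _ int_abs])
        show "integrable lborel (\<lambda>x. \<bar>indicator {b<..} x *\<^sub>R (f x * lag_w \<alpha> 0 x)\<bar>)" using int_f by (rule integrable_abs)
        show "\<bar>indicator {b<..} x *\<^sub>R (f x * lag_w \<alpha> 0 x)\<bar> \<le> indicator {b<..} x *\<^sub>R ((\<bar>fk 0 x\<bar> + \<bar>fk 1 x\<bar>) * lag_w \<alpha> 0 x)" for x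
          using lag_w_nonneg[of 0 x] by (auto simp: indicator_def abs_mult fk0 intro!: mult_right_mono)
      qed
      finally show ?thesis using tail_le by simp
    qed
    have right_nodes: "\<bar>\<Sum>z\<in>{z \<in> zs m. b < z \<and> z \<le> 4 * \<theta> * real m}. lam m z * f z\<bar> \<le> C2 * (D * E)"
    proof -
      have "\<bar>\<Sum>z\<in>{z \<in> zs m. b < z \<and> z \<le> 4 * \<theta> * real m}. lam m z * f z\<bar> \<le> (\<Sum>z\<in>{z \<in> zs m. b < z \<and> z \<le> 4 * \<theta> * real m}. lam m z * \<bar>fk 0 z\<bar>)"
        using lam_pos by (intro order.trans[OF sum_abs] sum_mono) (auto simp: abs_mult fk0 less_imp_le)
      also have "\<dots> \<le> C2 * (LINT x:{b<..}|lborel. (\<bar>fk 0 x\<bar> + \<bar>fk 1 x\<bar>) * lag_w \<alpha> 0 x)"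
      proof (rule nodes[OF m])
        show "c / 2 * real m \<le> b" using b by simp
        show "continuous_on {0<..} (fk 0)" using cont[of 0] r by simp
        show "loc_int_pos (fk 1)" using loc r by simp
        show "fk 0 y - fk 0 x = (LINT t:{x..y}|lborel. fk 1 t)" if "0 < x" "x \<le> y" for x y
          using diff[of 0 x y] r that by simp
        show "set_integrable lborel {b<..} (\<lambda>x. (\<bar>fk 0 x\<bar> + \<bar>fk 1 x\<bar>) * lag_w \<alpha> 0 x)"
          using int_abs by (simp only: set_integrable_def)
      qed
      also have "\<dots> \<le> C2 * (D * E)" using tail_le C2 by (intro mult_left_mono) auto
      finally show ?thesis .
    qed
    have split_int: "wint \<alpha> f = (LINT x:{0<..b}|lborel. f x * lag_w \<alpha> 0 x) + (LINT x:{b<..}|lborel. f x * lag_w \<alpha> 0 x)"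
    proof -
      have "{0<..} = {0<..b} \<union> {b<..}" using b0 by auto
      moreover have "set_integrable lborel {0<..b} (\<lambda>x. f x * lag_w \<alpha> 0 x)" using left_int unfolding fk0 .
      moreover have "set_integrable lborel {b<..} (\<lambda>x. f x * lag_w \<alpha> 0 x)" using int_f by (simp only: set_integrable_def)
      ultimately show ?thesis unfolding wint_def by (simp add: set_integral_Un disjoint_iff)
    qed
    have split_sum: "(\<Sum>z\<in>{z \<in> zs m. z \<le> 4 * \<theta> * real m}. lam m z * f z) =
        (\<Sum>z\<in>{z \<in> zs m. z \<le> b}. lam m z * f z) + (\<Sum>z\<in>{z \<in> zs m. b < z \<and> z \<le> 4 * \<theta> * real m}. lam m z * f z)"
    proof -
      have "{z \<in> zs m. z \<le> 4 * \<theta> * real m} = {z \<in> zs m. z \<le> b} \<union> {z \<in> zs m. b < z \<and> z \<le> 4 * \<theta> * real m}"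
        using b\<theta> by auto
      then show ?thesis by (simp only:) (rule sum.union_disjoint, auto)
    qed
    have "\<bar>wint \<alpha> f - (\<Sum>z\<in>{z \<in> zs m. z \<le> 4 * \<theta> * real m}. lam m z * f z)\<bar> \<le>
        (C1 * D * (4 / c) * E + C1 * E) + (D * E + C2 * (D * E))"
      unfolding split_int split_sum using left_bound right_int right_nodes by linarith
    also have "\<dots> = C * E" by (simp add: C_def algebra_simps)
    finally show ?thesis by (simp add: E_def)
  qed
  with C show ?thesis by blast
qed

end

section \<open>The lower bound\<close>

lemma integrable_indicator_Icc: "integrable lborel (\<lambda>x. indicator {a..b::real} x * c)" for c :: real
  by (intro integrable_mult_left integrable_real_indicator) (auto simp: emeasure_lborel_Icc_eq)

lemma smooth_real_by_parts:
  assumes g: "smooth_real g" and \<phi>: "test_fn_pos \<phi>"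
  shows "(LINT x:{0<..}|lborel. g x * deriv \<phi> x) = - (LINT x:{0<..}|lborel. deriv g x * \<phi> x)"
proof -
  obtain a0 b0 where ab0: "0 < a0" "a0 \<le> b0" "\<And>x. x \<notin> {a0..b0} \<Longrightarrow> \<phi> x = 0" and s: "smooth_real \<phi>"
    using \<phi> unfolding test_fn_pos_def by blast
  define a b where "a = a0 / 2" and "b = b0 + 1"
  have ab: "0 < a" "a \<le> b" "\<phi> a = 0" "\<phi> b = 0" and out: "\<And>x. x \<notin> {a..b} \<Longrightarrow> \<phi> x = 0"
    using ab0 by (auto simp: a_def b_def)
  have out': "deriv \<phi> x = 0" if "x \<notin> {a..b}" for x
  proof -
    have "((\<lambda>_. 0) has_real_derivative deriv \<phi> x) (at x)"
      by (rule has_field_derivative_transform_within_open[OF smooth_real_DERIV[OF s], of "- {a..b}"])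
         (use that out in auto)
    then show ?thesis using DERIV_unique[OF _ DERIV_const] by blast
  qed
  have cont: "continuous_on {a..b} (\<lambda>x. g x * deriv \<phi> x)" "continuous_on {a..b} (\<lambda>x. deriv g x * \<phi> x)"
    by (intro continuous_on_mult smooth_real_continuous smooth_real_deriv g s)+
  note si = cont[THEN set_integrable_continuous_Icc]
  have "((\<lambda>x. g x * deriv \<phi> x + deriv g x * \<phi> x) has_integral g b * \<phi> b - g a * \<phi> a) {a..b}"
  proof (rule fundamental_theorem_of_calculus[OF ab(2)])
    fix x
    have "((\<lambda>x. g x * \<phi> x) has_real_derivative g x * deriv \<phi> x + deriv g x * \<phi> x) (at x)"
      using DERIV_mult[OF smooth_real_DERIV[OF g] smooth_real_DERIV[OF s]] by (simp add: mult.commute add.commute)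
    then show "((\<lambda>x. g x * \<phi> x) has_vector_derivative g x * deriv \<phi> x + deriv g x * \<phi> x) (at x within {a..b})"
      by (simp add: has_real_derivative_iff_has_vector_derivative has_vector_derivative_at_within)
  qed
  then have "integral {a..b} (\<lambda>x. g x * deriv \<phi> x + deriv g x * \<phi> x) = 0"
    using ab by (simp add: integral_unique)
  moreover have "(LINT x:{a..b}|lborel. g x * deriv \<phi> x + deriv g x * \<phi> x) =
      integral {a..b} (\<lambda>x. g x * deriv \<phi> x + deriv g x * \<phi> x)"
    by (intro set_borel_integral_eq_integral(2) set_integral_add(1) si)
  ultimately have "(LINT x:{a..b}|lborel. g x * deriv \<phi> x) + (LINT x:{a..b}|lborel. deriv g x * \<phi> x) = 0"
    using set_integral_add(2)[OF si] by simp
  moreover have "(LINT x:{0<..}|lborel. g x * deriv \<phi> x) = (LINT x:{a..b}|lborel. g x * deriv \<phi> x)"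
    by (rule test_fn_integral_cong) (use ab out' in auto)
  moreover have "(LINT x:{0<..}|lborel. deriv g x * \<phi> x) = (LINT x:{a..b}|lborel. deriv g x * \<phi> x)"
    by (rule test_fn_integral_cong) (use ab out in auto)
  ultimately show ?thesis by simp
qed

lemma smooth_real_funpow: "smooth_real g \<Longrightarrow> smooth_real ((deriv ^^ k) g)"
  by (induction k) (auto intro: smooth_real_deriv)

lemma smooth_real_weak_deriv:
  assumes "smooth_real g"
  shows "weak_deriv_pos k g ((deriv ^^ k) g)"
proof -
  have loc: "loc_int_pos f" if "smooth_real f" for f
    by (intro loc_int_pos_continuous smooth_real_continuous that)
  have "(LINT x:{0<..}|lborel. g x * (deriv ^^ k) \<phi> x) = (-1) ^ k * (LINT x:{0<..}|lborel. (deriv ^^ k) g x * \<phi> x)"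
    if "test_fn_pos \<phi>" for \<phi>
    using that
  proof (induction k arbitrary: \<phi>)
    case (Suc k)
    have "(LINT x:{0<..}|lborel. g x * (deriv ^^ Suc k) \<phi> x) =
        (-1) ^ k * (LINT x:{0<..}|lborel. (deriv ^^ k) g x * deriv \<phi> x)"
      using Suc.IH[OF test_fn_pos_deriv[OF Suc.prems]] by (simp add: funpow_swap1)
    also have "(LINT x:{0<..}|lborel. (deriv ^^ k) g x * deriv \<phi> x) =
        - (LINT x:{0<..}|lborel. (deriv ^^ Suc k) g x * \<phi> x)"
      using smooth_real_by_parts[OF smooth_real_funpow[OF assms] Suc.prems] by simp
    finally show ?case by simp
  qed simp
  then show ?thesis unfolding weak_deriv_pos_def
    by (intro conjI loc smooth_real_funpow assms allI impI)
qed

lemma weak_deriv_pos_cmult: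
  assumes "weak_deriv_pos k f g"
  shows "weak_deriv_pos k (\<lambda>x. c * f x) (\<lambda>x. c * g x)"
  using assms unfolding weak_deriv_pos_def loc_int_pos_def
  by (simp add: mult.assoc mult.left_commute)

lemma powr_compare_double:
  fixes a x \<beta> :: real
  assumes "a > 0" "a \<le> x" "x \<le> 2 * a"
  shows "x powr \<beta> \<le> 2 powr \<bar>\<beta>\<bar> * a powr \<beta>" and "a powr \<beta> \<le> 2 powr \<bar>\<beta>\<bar> * x powr \<beta>"
proof -
  have q: "y powr \<beta> \<le> 2 powr \<bar>\<beta>\<bar>" if "1 / 2 \<le> y" "y \<le> 2" for y :: real
  proof -
    have "\<beta> * ln y \<le> \<bar>\<beta>\<bar> * ln 2"
    proof -
      have "ln y \<le> ln 2" using that by simp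
      moreover have "- ln 2 \<le> ln y"
        using ln_mono[of "1 / 2" y] that by (simp add: ln_div)
      ultimately have "\<bar>ln y\<bar> \<le> ln 2" by linarith
      then have "\<bar>\<beta>\<bar> * \<bar>ln y\<bar> \<le> \<bar>\<beta>\<bar> * ln 2" by (rule mult_left_mono) simp
      then show ?thesis using abs_ge_self[of "\<beta> * ln y"] by (simp add: abs_mult)
    qed
    then show ?thesis using that by (simp add: powr_def)
  qed
  have "(x / a) powr \<beta> \<le> 2 powr \<bar>\<beta>\<bar>" "(a / x) powr \<beta> \<le> 2 powr \<bar>\<beta>\<bar>"
    using assms by (auto intro!: q simp: field_simps)
  then show "x powr \<beta> \<le> 2 powr \<bar>\<beta>\<bar> * a powr \<beta>" "a powr \<beta> \<le> 2 powr \<bar>\<beta>\<bar> * x powr \<beta>"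
    using assms by (auto simp: powr_divide field_simps)
qed

lemma deriv_funpow_translate:
  assumes "smooth_real g"
  shows "(deriv ^^ k) (\<lambda>x. g (x - a)) = (\<lambda>x. (deriv ^^ k) g (x - a))"
proof (induction k)
  case (Suc k)
  have "deriv (\<lambda>x. (deriv ^^ k) g (x - a)) x = (deriv ^^ Suc k) g (x - a)" for x
  proof (rule DERIV_imp_deriv)
    have "((\<lambda>x. (deriv ^^ k) g (x + - a)) has_real_derivative (deriv ^^ Suc k) g (x + - a)) (at x)"
      using smooth_real_DERIV[OF smooth_real_funpow[OF assms], of k "x + - a"] unfolding DERIV_shift by simp
    then show "((\<lambda>x. (deriv ^^ k) g (x - a)) has_real_derivative (deriv ^^ Suc k) g (x - a)) (at x)" by simp
  qed
  then show ?case using Suc by auto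
qed simp

lemma bump_translate: "bump a (a + b) c x = bump 0 b c (x - a)"
  by (simp add: bump_eq algebra_simps)

lemma smooth_deriv_support:
  fixes g :: "real \<Rightarrow> real"
  assumes "\<And>x. x \<notin> {a..b} \<Longrightarrow> g x = 0" "x \<notin> {a..b}"
  shows "(deriv ^^ k) g x = 0"
  using assms(2)
proof (induction k arbitrary: x)
  case (Suc k)
  have "((\<lambda>_. 0) has_real_derivative 0) (at x)" by simp
  then have "((deriv ^^ k) g has_real_derivative 0) (at x)"
    by (rule has_field_derivative_transform_within_open[of _ _ _ "- {a..b}"]) (use Suc in auto)
  then show ?case by (simp add: DERIV_imp_deriv)
qed (use assms in simp)

context laguerre_weight
begin

text \<open>One fixed bump is translated to [a, a + 1]. There the Sobolev weight is comparable to
  a^(\<alpha> + r/2) exp (- a), and dividing by this normalises the norm. In the integral against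
  \<open>w\<close> the exponential cancels and a^(-r/2) is left.\<close>

lemma bump_in_sob_ball:
  "\<exists>c>0. \<forall>a\<ge>1. \<exists>f\<in>sob_ball \<alpha> r. (\<forall>x. x \<notin> {a<..<a + 1} \<longrightarrow> f x = 0) \<and> c * a powr - (r / 2) \<le> wint \<alpha> f"
proof -
  define h where "h = bump 0 1 1"
  have h: "smooth_real h" unfolding h_def by (rule bump_smooth) simp
  have h0: "h x = 0" if "x \<notin> {0..1}" for x using that by (auto simp: h_def bump_eq)
  define D where "D = (\<lambda>k. (deriv ^^ k) h)"
  have D: "smooth_real (D k)" for k unfolding D_def by (rule smooth_real_funpow[OF h])
  have D0: "D k x = 0" if "x \<notin> {0..1}" for k x unfolding D_def by (rule smooth_deriv_support[OF h0 that])
  have "\<exists>B. \<forall>x. \<bar>D k x\<bar> \<le> B" for k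
  proof -
    have "compact (D k ` {0..1})" by (intro compact_continuous_image smooth_real_continuous D) auto
    then have "bounded (D k ` {0..1})" by (rule compact_imp_bounded)
    then obtain B where "\<forall>y\<in>D k ` {0..1}. \<bar>y\<bar> \<le> B" by (auto simp: bounded_iff)
    then have "\<bar>D k x\<bar> \<le> max B 0" for x by (cases "x \<in> {0..1}") (force simp: D0)+
    then show ?thesis by blast
  qed
  then obtain B where B: "\<And>k x. \<bar>D k x\<bar> \<le> B k" by metis
  have B0: "B k \<ge> 0" for k using B[of k 0] by linarith
  define \<beta> where "\<beta> = \<alpha> + r / 2"
  define K where "K = (1 + (\<Sum>k\<le>r. B k)) * 2 powr \<bar>\<beta>\<bar>"
  have K: "K > 0" unfolding K_def using B0 by (intro mult_pos_pos add_pos_nonneg sum_nonneg) auto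
  \<comment> \<open>exp (- 8) bounds the bump from below on its middle half, exp (- 1) is the loss
    of exp (- x) over a unit step, 2 in the denominator comes from the length of the middle half,
    and the power of 2 compares powers of x and a.\<close>
  define c where "c = exp (- 8) * exp (- 1) / (2 * 2 powr \<bar>\<alpha>\<bar> * K)"
  have c: "c > 0" unfolding c_def using K by simp
  have "\<exists>f\<in>sob_ball \<alpha> r. (\<forall>x. x \<notin> {a<..<a + 1} \<longrightarrow> f x = 0) \<and> c * a powr - (r / 2) \<le> wint \<alpha> f"
    if a: "a \<ge> 1" for a
  proof -
    define N where "N = K * a powr \<beta> * exp (- a)"
    have N: "N > 0" unfolding N_def using K a by simp
    define G where "G = (\<lambda>k x. (1 / N) * D k (x - a))"
    have G_out: "G k x = 0" if "x \<notin> {a..a + 1}" for k x proof -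
      have "x - a \<notin> {0..1}" using that by auto
      then show ?thesis by (simp add: G_def D0 del: atLeastAtMost_iff)
    qed
    have Gc: "continuous_on A (G k)" for A k
    proof -
      have "continuous_on A (\<lambda>x. D k (x - a))"
        by (rule continuous_on_compose2[OF smooth_real_continuous[OF D, of UNIV]]) (auto intro!: continuous_intros)
      then show ?thesis unfolding G_def by (intro continuous_on_mult continuous_on_const)
    qed
    have ha: "smooth_real (\<lambda>x. h (x - a))"
    proof -
      have "(\<lambda>x. h (x - a)) = bump a (a + 1) 1" by (auto simp: h_def bump_translate)
      then show ?thesis by (simp add: bump_smooth)
    qed
    have weak: "weak_deriv_pos k (G 0) (G k)" for k
      using weak_deriv_pos_cmult[OF smooth_real_weak_deriv[OF ha, of k], of "1 / N"]
      unfolding deriv_funpow_translate[OF h] by (simp add: G_def D_def)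
    have Gint: "set_integrable lborel {0<..} (\<lambda>x. G k x * lag_w \<alpha> s x)" for k s
    proof -
      have "set_integrable lborel {a..a + 1} (\<lambda>x. G k x * lag_w \<alpha> s x)"
        unfolding lag_w_def using a
        by (intro set_integrable_continuous_Icc continuous_on_mult Gc continuous_intros) auto
      moreover have "indicator {0<..} x *\<^sub>R (G k x * lag_w \<alpha> s x) = indicator {a..a + 1} x *\<^sub>R (G k x * lag_w \<alpha> s x)" for x
        using a by (cases "x \<in> {a..a + 1}") (auto simp: G_out indicator_def)
      ultimately show ?thesis unfolding set_integrable_def by (simp only:)
    qed
    have w_le: "lag_w \<alpha> r x \<le> N / (1 + (\<Sum>k\<le>r. B k))" if "x \<in> {a..a + 1}" for x
    proof -
      have s: "1 + (\<Sum>k\<le>r. B k) > 0" using B0 by (intro add_pos_nonneg sum_nonneg) auto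
      have "lag_w \<alpha> r x = x powr \<beta> * exp (- x)" by (simp add: lag_w_def \<beta>_def)
      also have "\<dots> \<le> (2 powr \<bar>\<beta>\<bar> * a powr \<beta>) * exp (- a)"
        using that a by (intro mult_mono powr_compare_double) auto
      also have "\<dots> = N / (1 + (\<Sum>k\<le>r. B k))" using s by (simp add: N_def K_def)
      finally show ?thesis .
    qed
    have norm: "(LINT x:{0<..}|lborel. \<bar>G k x * lag_w \<alpha> r x\<bar>) \<le> B k / (1 + (\<Sum>k\<le>r. B k))" for k
    proof -
      have "(LINT x:{0<..}|lborel. \<bar>G k x * lag_w \<alpha> r x\<bar>) \<le>
          (\<integral>x. indicator {a..a + 1} x * (B k / (1 + (\<Sum>k\<le>r. B k))) \<partial>lborel)"
        unfolding set_lebesgue_integral_def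
      proof (rule integral_mono)
        show "integrable lborel (\<lambda>x. indicator {0<..} x *\<^sub>R \<bar>G k x * lag_w \<alpha> r x\<bar>)"
          using set_integrable_abs[OF Gint] unfolding set_integrable_def .
        show "integrable lborel (\<lambda>x. indicator {a..a + 1} x * (B k / (1 + (\<Sum>k\<le>r. B k))))"
          by (rule integrable_indicator_Icc)
        fix x
        show "indicator {0<..} x *\<^sub>R \<bar>G k x * lag_w \<alpha> r x\<bar> \<le> indicator {a..a + 1} x * (B k / (1 + (\<Sum>k\<le>r. B k)))"
        proof (cases "x \<in> {a..a + 1}")
          case True
          have "\<bar>G k x * lag_w \<alpha> r x\<bar> = \<bar>D k (x - a)\<bar> / N * lag_w \<alpha> r x"
            using N lag_w_nonneg by (simp add: G_def abs_mult)
          also have "\<dots> \<le> B k / N * (N / (1 + (\<Sum>k\<le>r. B k)))"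
            using B[of k] B0[of k] N by (intro mult_mono divide_right_mono w_le True lag_w_nonneg) auto
          finally show ?thesis using True a N by simp
        qed (simp add: G_out)
      qed
      also have "\<dots> = B k / (1 + (\<Sum>k\<le>r. B k))" by simp
      finally show ?thesis .
    qed
    have "(\<Sum>k\<le>r. LINT x:{0<..}|lborel. \<bar>G k x * lag_w \<alpha> r x\<bar>) \<le> (\<Sum>k\<le>r. B k / (1 + (\<Sum>k\<le>r. B k)))"
      by (intro sum_mono norm)
    also have "\<dots> = (\<Sum>k\<le>r. B k) / (1 + (\<Sum>k\<le>r. B k))" by (rule sum_divide_distrib[symmetric])
    also have "\<dots> \<le> 1" using sum_nonneg[of "{..r}" B] B0 by simp
    finally have "G 0 \<in> sob_ball \<alpha> r"
      unfolding sob_ball_def using Gc weak Gint by blast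
    moreover have "G 0 x = 0" if "x \<notin> {a<..<a + 1}" for x
      using that by (auto simp: G_def D_def h_def bump_eq)
    moreover have "c * a powr - (r / 2) \<le> wint \<alpha> (G 0)"
    proof -
      define V where "V = exp (- 8) / N * (a powr \<alpha> / 2 powr \<bar>\<alpha>\<bar> * (exp (- 1) * exp (- a)))"
      have "V / 2 = (\<integral>x. indicator {a + 1 / 4..a + 3 / 4} x * V \<partial>lborel)" by simp
      also have "\<dots> \<le> (\<integral>x. indicator {0<..} x *\<^sub>R (G 0 x * lag_w \<alpha> 0 x) \<partial>lborel)"
      proof (rule integral_mono)
        show "integrable lborel (\<lambda>x. indicator {a + 1 / 4..a + 3 / 4} x * V)"
          by (rule integrable_indicator_Icc)
        show "integrable lborel (\<lambda>x. indicator {0<..} x *\<^sub>R (G 0 x * lag_w \<alpha> 0 x))"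
          using Gint unfolding set_integrable_def .
        fix x
        have G0: "G 0 x \<ge> 0" using N bump_nonneg by (simp add: G_def D_def h_def)
        show "indicator {a + 1 / 4..a + 3 / 4} x * V \<le> indicator {0<..} x *\<^sub>R (G 0 x * lag_w \<alpha> 0 x)"
        proof (cases "x \<in> {a + 1 / 4..a + 3 / 4}")
          case True
          have "exp (- 4) \<le> exp (- 1 / (x - a))" "exp (- 4) \<le> exp (- 1 / (1 - (x - a)))"
            using True by (auto simp: field_simps)
          then have "exp (- 4) * exp (- 4) \<le> h (x - a)"
            using True by (auto simp: h_def bump_eq intro: mult_mono)
          then have "exp (- 8) \<le> h (x - a)" by (simp flip: exp_add)
          then have "exp (- 8) / N \<le> G 0 x" using N by (simp add: G_def D_def divide_right_mono)
          moreover have "a powr \<alpha> / 2 powr \<bar>\<alpha>\<bar> * (exp (- 1) * exp (- a)) \<le> lag_w \<alpha> 0 x"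
            unfolding lag_w_def
          proof (intro mult_mono)
            show "a powr \<alpha> / 2 powr \<bar>\<alpha>\<bar> \<le> x powr (\<alpha> + real 0 / 2)"
              using powr_compare_double(2)[of a x \<alpha>] True a by (simp add: field_simps)
            show "exp (- 1) * exp (- a) \<le> exp (- x)" using True by (simp flip: exp_add)
          qed auto
          ultimately have "V \<le> G 0 x * lag_w \<alpha> 0 x" unfolding V_def using N G0 by (intro mult_mono) auto
          then show ?thesis using True a by simp
        next
          case False
          then show ?thesis using lag_w_nonneg G0 by (auto simp: indicator_def)
        qed
      qed
      finally have "V / 2 \<le> wint \<alpha> (G 0)" by (simp only: wint_def set_lebesgue_integral_def)
      moreover have "V / 2 = c * a powr - (r / 2)"
      proof -
        have "a powr \<alpha> = a powr \<beta> * a powr - (r / 2)" unfolding powr_add[symmetric] by (simp add: \<beta>_def)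
        then show ?thesis using a K by (simp add: V_def c_def N_def field_simps)
      qed
      ultimately show ?thesis by simp
    qed
    ultimately show ?thesis by blast
  qed
  with c show ?thesis by blast
qed

lemma Int_n_lower_bound:
  "\<exists>c>0. \<forall>n\<ge>1. ereal (c * real n powr - (r / 2)) \<le> Int_n \<alpha> n (sob_ball \<alpha> r)"
proof -
  obtain c where c: "c > 0" and bumps: "\<And>a. a \<ge> 1 \<Longrightarrow>
      \<exists>f\<in>sob_ball \<alpha> r. (\<forall>x. x \<notin> {a<..<a + 1} \<longrightarrow> f x = 0) \<and> c * a powr - (r / 2) \<le> wint \<alpha> f"
    using bump_in_sob_ball[of r] by blast
  \<comment> \<open>The power of 2 pays for j \<le> 2 n.\<close>
  define c' where "c' = c * 2 powr - (r / 2)"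
  have "ereal (c' * real n powr - (r / 2)) \<le> Int_n \<alpha> n (sob_ball \<alpha> r)" if n: "n \<ge> 1" for n
    unfolding Int_n_def
  proof (intro INF_greatest)
    fix k and xs ls :: "nat \<Rightarrow> real"
    assume k: "k \<in> {..n}"
    have "card ((\<lambda>i. nat \<lfloor>xs i\<rfloor>) ` {..<k}) \<le> n"
      using card_image_le[of "{..<k}" "\<lambda>i. nat \<lfloor>xs i\<rfloor>"] k by simp
    then have "\<not> {n..2 * n} \<subseteq> (\<lambda>i. nat \<lfloor>xs i\<rfloor>) ` {..<k}"
      using card_mono[of "(\<lambda>i. nat \<lfloor>xs i\<rfloor>) ` {..<k}" "{n..2 * n}"] by auto
    then obtain j where "j \<in> {n..2 * n}" and free: "j \<notin> (\<lambda>i. nat \<lfloor>xs i\<rfloor>) ` {..<k}" by blast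
    then have j: "n \<le> j" "j \<le> 2 * n" by auto
    obtain f where f: "f \<in> sob_ball \<alpha> r" "\<And>x. x \<notin> {real j<..<real j + 1} \<Longrightarrow> f x = 0"
      "c * real j powr - (r / 2) \<le> wint \<alpha> f"
      using bumps[of "real j"] j n by auto
    have "f (xs i) = 0" if "i < k" for i
    proof (rule f(2), rule notI)
      assume "xs i \<in> {real j<..<real j + 1}"
      then have "\<lfloor>xs i\<rfloor> = int j" by (intro floor_unique) auto
      then show False using free that by force
    qed
    then have "(\<Sum>i<k. ls i * f (xs i)) = 0" by simp
    moreover have "c' * real n powr - (r / 2) \<le> c * real j powr - (r / 2)"
    proof -
      have "c' * real n powr - (r / 2) = c * (2 * real n) powr - (r / 2)" by (simp add: c'_def powr_mult)
      also have "\<dots> \<le> c * real j powr - (r / 2)" using c j n by (intro mult_left_mono powr_mono2') auto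
      finally show ?thesis .
    qed
    ultimately have "ereal (c' * real n powr - (r / 2)) \<le> ereal \<bar>wint \<alpha> f - (\<Sum>i<k. ls i * f (xs i))\<bar>"
      using f(3) by simp
    then show "ereal (c' * real n powr - (r / 2)) \<le> (SUP f\<in>sob_ball \<alpha> r. ereal \<bar>wint \<alpha> f - (\<Sum>i<k. ls i * f (xs i))\<bar>)"
      by (rule SUP_upper2[OF f(1)])
  qed
  moreover have "c' > 0" using c by (simp add: c'_def)
  ultimately show ?thesis by blast
qed

end

section \<open>The truncated Gauss-Laguerre quadrature\<close>

context gauss_laguerre
begin

lemma zero_pm_bij: "bij_betw (zero_pm p m) {1..m} (zs m)"
proof -
  have "bij_betw ((!) (sorted_list_of_set (zs m))) {..<m} (zs m)"
    by (rule bij_betw_nth) auto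
  moreover have "bij_betw (\<lambda>k. k - 1) {1..m} {..<m}"
    by (rule bij_betwI[of _ _ _ Suc]) auto
  ultimately have "bij_betw ((!) (sorted_list_of_set (zs m)) \<circ> (\<lambda>k. k - 1)) {1..m} (zs m)"
    by (rule bij_betw_trans[rotated])
  moreover have "(!) (sorted_list_of_set (zs m)) \<circ> (\<lambda>k. k - 1) = zero_pm p m"
    by (auto simp: zero_pm_def zs_def)
  ultimately show ?thesis by simp
qed

lemma zero_pm_mem: "k \<in> {1..m} \<Longrightarrow> zero_pm p m k \<in> zs m"
  using zero_pm_bij by (rule bij_betwE[THEN bspec])

lemma zero_pm_mono:
  assumes "1 \<le> i" "i \<le> j" "j \<le> m"
  shows "zero_pm p m i \<le> zero_pm p m j"
proof -
  have "sorted_list_of_set (zs m) ! (i - 1) \<le> sorted_list_of_set (zs m) ! (j - 1)"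
    by (rule sorted_nth_mono) (use assms in auto)
  then show ?thesis by (simp add: zero_pm_def zs_def)
qed

lemma jm_le: "jm \<theta> p m \<le> m"
  unfolding jm_def by (subst Max_le_iff) auto

text \<open>The zeros are sorted, so the indices of zeros below the cut-off form an initial segment;
  if there is none, the added 0 makes \<open>jm\<close> vanish and both sets are empty.\<close>

lemma atMost_jm: "{1..jm \<theta> p m} = {k \<in> {1..m}. zero_pm p m k \<le> 4 * \<theta> * real m}"
proof -
  define S where "S = {k \<in> {1..m}. zero_pm p m k \<le> 4 * \<theta> * real m}"
  have fin: "finite ({0} \<union> S)" unfolding S_def by simp
  have J: "jm \<theta> p m = Max ({0} \<union> S)" by (simp add: jm_def S_def)
  have "k \<in> S" if "1 \<le> k" "k \<le> jm \<theta> p m" for k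
  proof -
    have "jm \<theta> p m \<in> {0} \<union> S" unfolding J by (rule Max_in[OF fin]) auto
    then have "jm \<theta> p m \<in> S" using that by auto
    then show ?thesis using zero_pm_mono[of k "jm \<theta> p m" m] that by (auto simp: S_def)
  qed
  moreover have "k \<le> jm \<theta> p m" if "k \<in> S" for k
    unfolding J using that fin by (intro Max_ge) auto
  moreover have "1 \<le> k" if "k \<in> S" for k
    using that by (simp add: S_def)
  ultimately have "k \<in> {1..jm \<theta> p m} \<longleftrightarrow> k \<in> S" for k
    unfolding atLeastAtMost_iff by blast
  then show ?thesis unfolding S_def[symmetric] by (rule set_eqI)
qed

lemma cotes_eq_lam:
  assumes k: "k \<in> {1..m}"
  shows "cotes \<alpha> p m k = lam m (zero_pm p m k)"
proof -
  have bij: "bij_betw (zero_pm p m) ({1..m} - {k}) (zs m - {zero_pm p m k})"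
    using bij_betw_DiffI[OF zero_pm_bij] k by (simp add: zero_pm_mem)
  have "(\<Prod>i\<in>{1..m} - {k}. (x - zero_pm p m i) / (zero_pm p m k - zero_pm p m i)) = poly (ell m (zero_pm p m k)) x" for x
    using prod.reindex_bij_betw[OF bij, of "\<lambda>y. (x - y) / (zero_pm p m k - y)"]
    by (simp add: ell_def poly_prod diff_divide_distrib)
  then show ?thesis by (simp add: cotes_def lam_def LI_def wint_def)
qed

lemma QTL_eq: "QTL \<alpha> \<theta> p m f = (\<Sum>z\<in>{z \<in> zs m. z \<le> 4 * \<theta> * real m}. lam m z * f z)"
proof -
  have bij: "bij_betw (zero_pm p m) {k \<in> {1..m}. zero_pm p m k \<le> 4 * \<theta> * real m} {z \<in> zs m. z \<le> 4 * \<theta> * real m}"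
  proof (rule bij_betw_subset[OF zero_pm_bij])
    show "zero_pm p m ` {k \<in> {1..m}. zero_pm p m k \<le> 4 * \<theta> * real m} = {z \<in> zs m. z \<le> 4 * \<theta> * real m}"
      unfolding bij_betw_imp_surj_on[OF zero_pm_bij, symmetric] by blast
  qed blast
  have "QTL \<alpha> \<theta> p m f = (\<Sum>k\<in>{k \<in> {1..m}. zero_pm p m k \<le> 4 * \<theta> * real m}. lam m (zero_pm p m k) * f (zero_pm p m k))"
    unfolding QTL_def atMost_jm by (rule sum.cong) (auto simp: cotes_eq_lam)
  also have "\<dots> = (\<Sum>z\<in>{z \<in> zs m. z \<le> 4 * \<theta> * real m}. lam m z * f z)"
    by (rule sum.reindex_bij_betw[OF bij])
  finally show ?thesis .
qed

lemma Int_n_le_QTL_error: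
  assumes "jm \<theta> p m \<le> n"
  shows "Int_n \<alpha> n F \<le> (SUP f \<in> F. ereal \<bar>wint \<alpha> f - QTL \<alpha> \<theta> p m f\<bar>)"
proof -
  define xs where "xs = (\<lambda>i. zero_pm p m (Suc i))"
  define ls where "ls = (\<lambda>i. cotes \<alpha> p m (Suc i))"
  have "xs i > 0" if "i < jm \<theta> p m" for i
    using that jm_le[of \<theta> m] unfolding xs_def by (intro zs_pos[of _ m] zero_pm_mem) auto
  then have xs: "xs \<in> {xs. \<forall>i<jm \<theta> p m. 0 < xs i}" by simp
  have "Int_n \<alpha> n F \<le> (SUP f \<in> F. ereal \<bar>wint \<alpha> f - (\<Sum>i<jm \<theta> p m. ls i * f (xs i))\<bar>)"
    unfolding Int_n_def
    by (rule INF_lower2[of "jm \<theta> p m"], use assms in simp, rule INF_lower2[OF xs], rule INF_lower) simp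
  then show ?thesis by (simp add: QTL_def sum.atLeast1_atMost_eq xs_def ls_def)
qed

lemma QTL_error:
  fixes r :: nat
  assumes "r \<ge> 1" "0 < \<theta>" "\<theta> < 1"
  shows "\<exists>C>0. \<forall>m\<ge>1. (SUP f \<in> sob_ball \<alpha> r. ereal \<bar>wint \<alpha> f - QTL \<alpha> \<theta> p m f\<bar>) \<le> ereal (C * real m powr - (r / 2))"
proof -
  obtain C where C: "C > 0" "\<forall>m\<ge>1. \<forall>f\<in>sob_ball \<alpha> r.
      \<bar>wint \<alpha> f - QTL \<alpha> \<theta> p m f\<bar> \<le> C * real m powr - (r / 2)"
    using quadrature_error[OF assms] unfolding QTL_eq by (elim exE conjE)
  have "(SUP f \<in> sob_ball \<alpha> r. ereal \<bar>wint \<alpha> f - QTL \<alpha> \<theta> p m f\<bar>) \<le> ereal (C * real m powr - (r / 2))"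
    if "m \<ge> 1" for m
    by (rule SUP_least) (use C(2) that in simp)
  with C(1) show ?thesis by (intro exI[of _ C] conjI allI impI)
qed

text \<open>The lower bound for the optimal error shows that \<open>jm\<close> is unbounded, so the \<open>GREATEST\<close>
  in the definition of \<open>mn\<close> exists.\<close>

lemma jm_mn:
  fixes r :: nat
  assumes "r \<ge> 1" "0 < \<theta>" "\<theta> < 1" "n \<ge> 1"
  shows "jm \<theta> p (mn \<theta> p n) \<le> n" and "n \<le> mn \<theta> p n"
proof -
  obtain c where c: "c > 0" "\<And>n. n \<ge> 1 \<Longrightarrow> ereal (c * real n powr - (r / 2)) \<le> Int_n \<alpha> n (sob_ball \<alpha> r)"
    using Int_n_lower_bound[of r] by blast
  obtain C where C: "C > 0" "\<And>m. m \<ge> 1 \<Longrightarrow>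
      (SUP f \<in> sob_ball \<alpha> r. ereal \<bar>wint \<alpha> f - QTL \<alpha> \<theta> p m f\<bar>) \<le> ereal (C * real m powr - (r / 2))"
    using QTL_error[OF assms(1-3)] by blast
  \<comment> \<open>\<open>X\<close> solves c n^(-r/2) = C X^(-r/2). For a larger m with at most n
    retained nodes, the lower bound for n nodes would exceed the upper bound for the error of that
    rule.\<close>
  define X where "X = (C / c) powr (2 / r) * real n"
  have X: "X > 0" using assms(4) c(1) C(1) by (simp add: X_def)
  have bound: "m \<le> nat \<lceil>X\<rceil>" if m: "jm \<theta> p m \<le> n" for m
  proof (rule ccontr)
    assume "\<not> ?thesis"
    then have big: "real m > X" "m \<ge> 1" using X by linarith+
    have "ereal (c * real n powr - (r / 2)) \<le> ereal (C * real m powr - (r / 2))"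
      by (rule order.trans[OF c(2)[OF assms(4)] order.trans[OF Int_n_le_QTL_error[OF m] C(2)[OF big(2)]]])
    then have "c * real n powr - (r / 2) \<le> C * real m powr - (r / 2)" by simp
    also have "\<dots> < C * X powr - (r / 2)"
      using C(1) big X assms(1) by (intro mult_strict_left_mono powr_less_mono2_neg) auto
    also have "X powr - (r / 2) = ((C / c) powr (2 / r)) powr - (r / 2) * real n powr - (r / 2)"
      unfolding X_def by (rule powr_mult)
    also have "((C / c) powr (2 / r)) powr - (r / 2) = c / C"
      using c(1) C(1) assms(1) by (simp add: powr_powr powr_minus_divide)
    finally show False using C(1) by simp
  qed
  show "jm \<theta> p (mn \<theta> p n) \<le> n"
    unfolding mn_def by (rule GreatestI_nat[of "\<lambda>m. jm \<theta> p m \<le> n", OF jm_le bound])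
  \<comment> \<open>By \<open>jm_le\<close> the number \<open>n\<close> itself is a candidate in the
    \<open>GREATEST\<close>.\<close>
  show "n \<le> mn \<theta> p n"
    unfolding mn_def by (rule Greatest_le_nat[of "\<lambda>m. jm \<theta> p m \<le> n", OF jm_le bound])
qed

end

theorem theorem2p1:
  fixes \<alpha> \<theta> :: real and r :: nat and p :: "nat \<Rightarrow> real poly"
  assumes "\<alpha> > -1" and "r \<ge> 1" and "0 < \<theta>" and "\<theta> < 1"
    and "\<forall>m. degree (p m) = m"
    and "\<forall>m k. (LINT x:{0<..}|lborel. poly (p m) x * poly (p k) x * lag_w \<alpha> 0 x)
                = (if m = k then 1 else 0)"
  shows "\<exists>C1 C2. C1 > 0 \<and> C2 > 0 \<and> (\<forall>n \<ge> 1.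
     ereal (C1 * real n powr (- (3 * real r / 4))) \<le> Int_n \<alpha> n (sob_ball \<alpha> r) \<and>
     Int_n \<alpha> n (sob_ball \<alpha> r)
       \<le> (SUP f \<in> sob_ball \<alpha> r. ereal \<bar>wint \<alpha> f - QTL \<alpha> \<theta> p (mn \<theta> p n) f\<bar>) \<and>
     (SUP f \<in> sob_ball \<alpha> r. ereal \<bar>wint \<alpha> f - QTL \<alpha> \<theta> p (mn \<theta> p n) f\<bar>)
       \<le> ereal (C2 * real n powr (- (real r / 2))))"
proof -
  interpret laguerre_weight \<alpha> by standard (rule assms)
  interpret gauss_laguerre \<alpha> p
    by standard (use assms(5,6) in \<open>auto simp: LI_def wint_def\<close>)
  obtain C1 where C1: "C1 > 0" "\<And>n. n \<ge> 1 \<Longrightarrow> ereal (C1 * real n powr - (r / 2)) \<le> Int_n \<alpha> n (sob_ball \<alpha> r)"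
    using Int_n_lower_bound[of r] by blast
  obtain C2 where C2: "C2 > 0" "\<And>m. m \<ge> 1 \<Longrightarrow>
      (SUP f \<in> sob_ball \<alpha> r. ereal \<bar>wint \<alpha> f - QTL \<alpha> \<theta> p m f\<bar>) \<le> ereal (C2 * real m powr - (r / 2))"
    using QTL_error[OF assms(2-4)] by blast
  show ?thesis
  proof (intro exI conjI allI impI)
    show "C1 > 0" "C2 > 0" by fact+
    fix n :: nat assume n: "n \<ge> 1"
    note mn = jm_mn[OF assms(2-4) n]
    have "C1 * real n powr - (3 * real r / 4) \<le> C1 * real n powr - (r / 2)"
      using C1(1) n by (intro mult_left_mono powr_mono) auto
    then show "ereal (C1 * real n powr - (3 * real r / 4)) \<le> Int_n \<alpha> n (sob_ball \<alpha> r)"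
      by (intro order.trans[OF _ C1(2)[OF n]]) simp
    show "Int_n \<alpha> n (sob_ball \<alpha> r) \<le> (SUP f \<in> sob_ball \<alpha> r. ereal \<bar>wint \<alpha> f - QTL \<alpha> \<theta> p (mn \<theta> p n) f\<bar>)"
      by (rule Int_n_le_QTL_error[OF mn(1)])
    have "C2 * real (mn \<theta> p n) powr - (r / 2) \<le> C2 * real n powr - (r / 2)"
      using C2(1) n mn(2) by (intro mult_left_mono powr_mono2') auto
    then show "(SUP f \<in> sob_ball \<alpha> r. ereal \<bar>wint \<alpha> f - QTL \<alpha> \<theta> p (mn \<theta> p n) f\<bar>) \<le> ereal (C2 * real n powr - (real r / 2))"
      using n mn(2) by (intro order.trans[OF C2(2)]) auto
  qed
qed

end
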